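(* There exists a constant $C>0$ such that for all $z>0$ and all positive integers $n$, $$|V(z)-V_n^{B,\theta}(z)|\le C\,(F_0(z)+\Delta_0(z)+z+1)\,n^{-1/4},$$ where $$V(z)=\inf_{\sigma\in\mathcal T^B_{0T}}\ \sup_{\tau\in\mathcal T^B_{0T}}E^BQ^B_z(\sigma,\tau),\qquad V_n^{B,\theta}(z)=\inf_{\zeta\in\mathcal T^{B,n}_{0,n}}\ \sup_{\eta\in\mathcal T^{B,n}_{0,n}}E^BQ^B_z\big(\theta^{(n)}_\zeta,\theta^{(n)}_\eta\big).$$ The constant $C$ does not depend on $z$ or $n$.
   Context: Fix $T>0$ (horizon), $r>0$ (interest rate), $\kappa>0$ (volatility). Payoff functionals. For $t\ge 0$ let $M[0,t]$ be the space of Borel measurable real functions on $[0,t]$ with the uniform distance $d_{0t}(\upsilon,\tilde\upsilon)=\sup_{0\le s\le t}|\upsilon_s-\tilde\upsilon_s|$. For each $t\ge0$ let $F_t$ and $\Delta_t$ be nonnegative functions on $M[0,t]$ (a function defined on a longer interval is evaluated through its restriction to $[0,t]$) such that for some constant $L\ge1$ and all $t\ge s\ge0$, $\upsilon,\tilde\upsilon\in M[0,t]$, $$|F_s(\upsilon)-F_s(\tilde\upsilon)|+|\Delta_s(\upsilon)-\Delta_s(\tilde\upsilon)|\le L(s+1)\,d_{0s}(\upsilon,\tilde\upsilon),$$ $$|F_t(\upsilon)-F_s(\upsilon)|+|\Delta_t(\upsilon)-\Delta_s(\upsilon)|\le L\Big(|t-s|\big(1+\sup_{u\in[0,t]}|\upsilon_u|\big)+\sup_{u\in[s,t]}|\upsilon_u-\upsilon_s|\Big).$$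 $F_0(\upsilon)$ and $\Delta_0(\upsilon)$ depend only on $\upsilon_0$ and are written $F_0(z),\Delta_0(z)$ when $\upsilon_0=z$. Put $G_t=F_t+\Delta_t$. Black–Scholes market. Let $(B_t)_{t\ge0}$ be a standard Brownian motion on a complete probability space with probability $P^B$ (the martingale measure) and expectation $E^B$, and let $(\mathcal F^B_t)_{t\ge0}$ be its completed (hence right-continuous) natural filtration. Set $B^*_t=B_t-\frac{\kappa}{2}t$ and, for $z>0$, let the stock price be $S^B_t(z)=z\exp(rt+\kappa B^*_t)$, $t\ge0$. For $s,t\ge0$ the payoff and discounted payoff are $$R^B_z(s,t)=G_s(S^B(z))\mathbb I_{s<t}+F_t(S^B(z))\mathbb I_{t\le s},\qquad Q^B_z(s,t)=e^{-r(s\wedge t)}R^B_z(s,t).$$ $\mathcal T^B_{0T}$ is the set of stopping times with respect to $(\mathcal F^B_t)$ with values in $[0,T]$. Embedding times. For each positive integer $n$ put $\theta^{(n)}_0=0$ and $\theta^{(n)}_{k}=\inf\{t>\theta^{(n)}_{k-1}:\ |B^*_t-B^*_{\theta^{(n)}_{k-1}}|=\sqrt{T/n}\}$ for $k\ge1$. $\mathcal T^{B,n}_{0,n}$ is the set of stopping times with respect to the discrete filtration $(\mathcal F^B_{\theta^{(n)}_k})_{k=0,1,\dots,n}$ with values in $\{0,1,\dots,n\}$. *)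

theory Defs
  imports "HOL-Probability.Probability"
begin

section \<open>Payoff functionals\<close>

text \<open>
  The space \<open>M[0,t]\<close>. A path is a total function of which only the values on \<open>[0,t]\<close> matter,
  so that \<open>path_space t \<subseteq> path_space s\<close> for \<open>s \<le> t\<close> plays the role of restricting paths.
\<close>

definition path_space :: "real \<Rightarrow> (real \<Rightarrow> real) set" where
  "path_space t = borel_measurable (restrict_space borel {0..t})"

text \<open>
  Paths may be unbounded, so the suprema are taken in \<^typ>\<open>ereal\<close>; a bound whose right-hand
  side is infinite is no restriction.
\<close>

definition path_dist :: "real \<Rightarrow> (real \<Rightarrow> real) \<Rightarrow> (real \<Rightarrow> real) \<Rightarrow> ereal" where
  "path_dist t \<upsilon> \<upsilon>' = (SUP u\<in>{0..t}. ereal \<bar>\<upsilon> u - \<upsilon>' u\<bar>)"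

text \<open>
  That \<open>F s \<upsilon>\<close> and \<open>\<Delta> s \<upsilon>\<close> only depend on the restriction of \<open>\<upsilon>\<close> to \<open>[0,s]\<close> is a consequence of
  \<open>path_lipschitz\<close> (see \<open>payoff_cong\<close> below) and is therefore not assumed separately.
\<close>

locale payoff_functionals =
  fixes F \<Delta> :: "real \<Rightarrow> (real \<Rightarrow> real) \<Rightarrow> real" and L :: real
  assumes L_ge_1: "1 \<le> L"
    and F_nonneg: "\<And>t \<upsilon>. 0 \<le> t \<Longrightarrow> \<upsilon> \<in> path_space t \<Longrightarrow> 0 \<le> F t \<upsilon>"
    and Delta_nonneg: "\<And>t \<upsilon>. 0 \<le> t \<Longrightarrow> \<upsilon> \<in> path_space t \<Longrightarrow> 0 \<le> \<Delta> t \<upsilon>"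
    and path_lipschitz:
      "\<And>s t \<upsilon> \<upsilon>'. 0 \<le> s \<Longrightarrow> s \<le> t \<Longrightarrow> \<upsilon> \<in> path_space t \<Longrightarrow> \<upsilon>' \<in> path_space t \<Longrightarrow>
        ereal (\<bar>F s \<upsilon> - F s \<upsilon>'\<bar> + \<bar>\<Delta> s \<upsilon> - \<Delta> s \<upsilon>'\<bar>) \<le> ereal (L * (s + 1)) * path_dist s \<upsilon> \<upsilon>'"
    and time_regular:
      "\<And>s t \<upsilon>. 0 \<le> s \<Longrightarrow> s \<le> t \<Longrightarrow> \<upsilon> \<in> path_space t \<Longrightarrow>
        ereal (\<bar>F t \<upsilon> - F s \<upsilon>\<bar> + \<bar>\<Delta> t \<upsilon> - \<Delta> s \<upsilon>\<bar>) \<le>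
          ereal L * (ereal \<bar>t - s\<bar> * (1 + (SUP u\<in>{0..t}. ereal \<bar>\<upsilon> u\<bar>))
                     + (SUP u\<in>{s..t}. ereal \<bar>\<upsilon> u - \<upsilon> s\<bar>))"

lemma (in payoff_functionals) payoff_cong:
  assumes s: "0 \<le> s" and path: "\<upsilon> \<in> path_space s" "\<upsilon>' \<in> path_space s"
    and eq: "\<And>u. 0 \<le> u \<Longrightarrow> u \<le> s \<Longrightarrow> \<upsilon> u = \<upsilon>' u"
  shows "F s \<upsilon> = F s \<upsilon>'" "\<Delta> s \<upsilon> = \<Delta> s \<upsilon>'"
proof -
  have "path_dist s \<upsilon> \<upsilon>' = (SUP u\<in>{0..s}. (0::ereal))"
    unfolding path_dist_def by (intro SUP_cong) (auto simp: eq)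
  also have "\<dots> = 0"
    using s by simp
  finally have "\<bar>F s \<upsilon> - F s \<upsilon>'\<bar> + \<bar>\<Delta> s \<upsilon> - \<Delta> s \<upsilon>'\<bar> \<le> 0"
    using path_lipschitz[OF s order_refl path] by simp
  then show "F s \<upsilon> = F s \<upsilon>'" "\<Delta> s \<upsilon> = \<Delta> s \<upsilon>'"
    by linarith+
qed

section \<open>Brownian motion and its completed natural filtration\<close>

locale standard_brownian_motion = prob_space +
  fixes B :: "real \<Rightarrow> 'a \<Rightarrow> real"
  assumes measurable_B: "\<And>t. 0 \<le> t \<Longrightarrow> random_variable borel (B t)"
    and start_zero: "AE \<omega> in M. B 0 \<omega> = 0"
    and normal_increments:
      "\<And>s t. 0 \<le> s \<Longrightarrow> s < t \<Longrightarrow>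
        distributed M lborel (\<lambda>\<omega>. B t \<omega> - B s \<omega>) (\<lambda>x. ennreal (normal_density 0 (sqrt (t - s)) x))"
    and indep_increments:
      "\<And>(\<tau> :: nat \<Rightarrow> real) m. 0 \<le> \<tau> 0 \<Longrightarrow> mono \<tau> \<Longrightarrow>
        indep_vars (\<lambda>_. borel) (\<lambda>i \<omega>. B (\<tau> (Suc i)) \<omega> - B (\<tau> i) \<omega>) {..<m}"
    and continuous_paths: "AE \<omega> in M. continuous_on {0..} (\<lambda>t. B t \<omega>)"

text \<open>
  For negative times the \<open>\<sigma>\<close>-algebra consists of events of probability 0 or 1; these times only occur
  because the library's filtrations are indexed by a whole type.
\<close>

definition bm_filtration :: "'a measure \<Rightarrow> (real \<Rightarrow> 'a \<Rightarrow> real) \<Rightarrow> real \<Rightarrow> 'a measure" where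
  "bm_filtration M B t =
     sigma (space M) ({B s -` A \<inter> space M | s A. 0 \<le> s \<and> s \<le> t \<and> A \<in> sets borel} \<union> null_sets M)"

lemma filtration_bm_filtration: "filtration (space M) (bm_filtration M B)"
proof
  have sub: "{B s -` A \<inter> space M | s A. 0 \<le> s \<and> s \<le> t \<and> A \<in> sets borel} \<union> null_sets M
      \<subseteq> Pow (space M)" for t
    using sets.sets_into_space by auto
  show "space (bm_filtration M B t) = space M" for t
    unfolding bm_filtration_def by (rule space_measure_of[OF sub])
  show "sets (bm_filtration M B s) \<subseteq> sets (bm_filtration M B t)" if "s \<le> t" for s t
    unfolding bm_filtration_def sets_measure_of[OF sub] using that
    by (intro sigma_sets_subseteq Un_mono order_refl) (blast intro: order_trans)
qed

definition stopping_times_upto :: "'a measure \<Rightarrow> (real \<Rightarrow> 'a \<Rightarrow> real) \<Rightarrow> real \<Rightarrow> ('a \<Rightarrow> real) set" where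
  "stopping_times_upto M B T =
     {\<tau>. stopping_time (bm_filtration M B) \<tau> \<and> (\<forall>\<omega>\<in>space M. \<tau> \<omega> \<in> {0..T})}"

section \<open>The Black--Scholes market\<close>

definition drifted :: "real \<Rightarrow> (real \<Rightarrow> 'a \<Rightarrow> real) \<Rightarrow> real \<Rightarrow> 'a \<Rightarrow> real" where
  "drifted \<kappa> B t \<omega> = B t \<omega> - \<kappa> / 2 * t"

definition stock ::
    "real \<Rightarrow> real \<Rightarrow> (real \<Rightarrow> 'a \<Rightarrow> real) \<Rightarrow> real \<Rightarrow> 'a \<Rightarrow> real \<Rightarrow> real" where
  "stock r \<kappa> B z \<omega> t = z * exp (r * t + \<kappa> * drifted \<kappa> B t \<omega>)"

definition payoff ::
    "(real \<Rightarrow> (real \<Rightarrow> real) \<Rightarrow> real) \<Rightarrow> (real \<Rightarrow> (real \<Rightarrow> real) \<Rightarrow> real) \<Rightarrow> (real \<Rightarrow> real)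
      \<Rightarrow> real \<Rightarrow> real \<Rightarrow> real" where
  "payoff F \<Delta> S s t =
     (F s S + \<Delta> s S) * of_bool (s < t) + F t S * of_bool (t \<le> s)"

definition discounted_payoff ::
    "(real \<Rightarrow> (real \<Rightarrow> real) \<Rightarrow> real) \<Rightarrow> (real \<Rightarrow> (real \<Rightarrow> real) \<Rightarrow> real) \<Rightarrow> real \<Rightarrow> real
      \<Rightarrow> (real \<Rightarrow> 'a \<Rightarrow> real) \<Rightarrow> real \<Rightarrow> 'a \<Rightarrow> real \<Rightarrow> real \<Rightarrow> real" where
  "discounted_payoff F \<Delta> r \<kappa> B z \<omega> s t =
     exp (- r * min s t) * payoff F \<Delta> (stock r \<kappa> B z \<omega>) s t"

text \<open>
  The suprema and infima in the two game values are those of the reals. They range over nonempty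
  bounded families: the discounted payoffs are nonnegative and, by \<open>time_regular\<close>, dominated by an
  integrable random variable that does not depend on the stopping times.
\<close>

definition game_value ::
    "'a measure \<Rightarrow> (real \<Rightarrow> 'a \<Rightarrow> real) \<Rightarrow> (real \<Rightarrow> (real \<Rightarrow> real) \<Rightarrow> real)
      \<Rightarrow> (real \<Rightarrow> (real \<Rightarrow> real) \<Rightarrow> real) \<Rightarrow> real \<Rightarrow> real \<Rightarrow> real \<Rightarrow> real \<Rightarrow> real" where
  "game_value M B F \<Delta> r \<kappa> T z =
     (INF \<sigma>\<in>stopping_times_upto M B T. SUP \<tau>\<in>stopping_times_upto M B T.
        \<integral>\<omega>. discounted_payoff F \<Delta> r \<kappa> B z \<omega> (\<sigma> \<omega>) (\<tau> \<omega>) \<partial>M)"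

section \<open>Embedding times and the discretized game\<close>

text \<open>
  \<open>embedding_time \<kappa> B h k\<close> is the \<open>k\<close>-th time at which the drifted motion has moved by \<open>h\<close>. The set
  is almost surely nonempty, so the value of the infimum of the empty set affects a null set only,
  all of whose subsets belong to every member of the completed filtration.
\<close>

primrec embedding_time ::
    "real \<Rightarrow> (real \<Rightarrow> 'a \<Rightarrow> real) \<Rightarrow> real \<Rightarrow> nat \<Rightarrow> 'a \<Rightarrow> real" where
  "embedding_time \<kappa> B h 0 = (\<lambda>\<omega>. 0)"
| "embedding_time \<kappa> B h (Suc k) = (\<lambda>\<omega>.
     Inf {t. t > embedding_time \<kappa> B h k \<omega> \<and>
             \<bar>drifted \<kappa> B t \<omega> - drifted \<kappa> B (embedding_time \<kappa> B h k \<omega>) \<omega>\<bar> = h})"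

definition embedded_filtration ::
    "'a measure \<Rightarrow> (real \<Rightarrow> 'a \<Rightarrow> real) \<Rightarrow> real \<Rightarrow> real \<Rightarrow> nat \<Rightarrow> 'a measure" where
  "embedded_filtration M B \<kappa> h k =
     filtration.pre_sigma (space M) (bm_filtration M B) (embedding_time \<kappa> B h k)"

definition embedded_stopping_times ::
    "'a measure \<Rightarrow> (real \<Rightarrow> 'a \<Rightarrow> real) \<Rightarrow> real \<Rightarrow> real \<Rightarrow> nat \<Rightarrow> ('a \<Rightarrow> nat) set" where
  "embedded_stopping_times M B \<kappa> h n =
     {\<zeta>. stopping_time (embedded_filtration M B \<kappa> h) \<zeta> \<and> (\<forall>\<omega>\<in>space M. \<zeta> \<omega> \<in> {0..n})}"

definition embedded_game_value ::
    "'a measure \<Rightarrow> (real \<Rightarrow> 'a \<Rightarrow> real) \<Rightarrow> (real \<Rightarrow> (real \<Rightarrow> real) \<Rightarrow> real)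
      \<Rightarrow> (real \<Rightarrow> (real \<Rightarrow> real) \<Rightarrow> real) \<Rightarrow> real \<Rightarrow> real \<Rightarrow> real \<Rightarrow> nat \<Rightarrow> real \<Rightarrow> real" where
  "embedded_game_value M B F \<Delta> r \<kappa> T n z =
     (let h = sqrt (T / real n); \<theta> = embedding_time \<kappa> B h;
          \<T> = embedded_stopping_times M B \<kappa> h n
      in INF \<zeta>\<in>\<T>. SUP \<eta>\<in>\<T>.
           \<integral>\<omega>. discounted_payoff F \<Delta> r \<kappa> B z \<omega> (\<theta> (\<zeta> \<omega>) \<omega>) (\<theta> (\<eta> \<omega>) \<omega>) \<partial>M)"

end

theory Submission
  imports Defs
begin

text \<open>
  Write \<open>X\<close> for the drifted motion and \<open>h = sqrt (T / n)\<close>. Seen at the embedding times, \<open>X\<close> is a walk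
  with steps \<open>\<plusminus>h\<close>. The two game values are compared by translating strategies path by path: a stopping
  time of the market is rounded up to the next embedding time, and a stopping time of the walk is
  read as a real time and truncated at \<open>T\<close>. The translations are arranged so that the player who
  acts first in one game also acts first in the other, except where a change of the order favours the
  inequality to be shown (\<open>seller_comparison\<close>, \<open>buyer_comparison\<close>). What is lost is then the change of a single
  discounted payoff between two nearby times, which lie either in one excursion of the walk or both
  between the last embedding time and \<open>T\<close> (\<open>short_interval\<close>).

  The regularity of the payoffs bounds such a change by a constant times the size of the initial data,
  times \<open>1 + w\<close> with \<open>w\<close> a bound for \<open>exp (\<kappa> X)\<close>, times the elapsed time plus the oscillation of \<open>X\<close>
  (\<open>discounted_payoff_increment\<close>). Within an excursion \<open>X\<close> oscillates by at most \<open>2h\<close>. The last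
  embedding time differs from \<open>T\<close> by order \<open>n powr (-1/2)\<close> in mean square, and Brownian motion moves
  by the square root of the elapsed time. This square root produces the rate \<open>n powr (-1/4)\<close>.

  Everything about the embedding times comes from two martingales, \<open>B\<close> and \<open>exp (\<kappa> X)\<close>. Eliminating
  the linear term between them shows that the duration of an excursion is compensated by
  \<open>2 / \<kappa>\<^sup>2 * (exp (\<kappa> \<xi>) - 1 - \<kappa> \<xi>)\<close>, where \<open>\<xi> = \<plusminus>h\<close> is the step; this is \<open>h\<^sup>2\<close> up to order \<open>h\<^sup>3\<close>.
  Summing the orthogonal compensated durations gives the mean square deviation of the last embedding
  time (\<open>final_time_deviation\<close>). Moments of \<open>w\<close> follow from Doob's inequality for the walk
  (\<open>exp_walk_maximal\<close>), and the oscillation near \<open>T\<close> is controlled simultaneously at all distances from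
  \<open>T\<close>, so that the random time can be substituted (\<open>weighted_increment_bound\<close>).

  The argument is carried out for a motion all of whose paths are good, so that no exceptional sets
  appear. Since the probability space and the filtration are complete, changing the given motion on a null set
  alters neither the stopping times nor the expected payoffs.
\<close>

section \<open>Square integrability, Gaussian moments and a discrete maximal inequality\<close>

lemma integrable_mult_of_squares:
  fixes f g :: "'a \<Rightarrow> real"
  assumes [measurable]: "f \<in> borel_measurable M" "g \<in> borel_measurable M"
    and "integrable M (\<lambda>\<omega>. (f \<omega>)\<^sup>2)" "integrable M (\<lambda>\<omega>. (g \<omega>)\<^sup>2)"
  shows "integrable M (\<lambda>\<omega>. f \<omega> * g \<omega>)"
proof (rule Bochner_Integration.integrable_bound)
  show "integrable M (\<lambda>\<omega>. (f \<omega>)\<^sup>2 + (g \<omega>)\<^sup>2)" using assms by simp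
  have "\<bar>x * y\<bar> \<le> x\<^sup>2 + y\<^sup>2" for x y :: real
  proof -
    have "2 * (\<bar>x\<bar> * \<bar>y\<bar>) \<le> \<bar>x\<bar>\<^sup>2 + \<bar>y\<bar>\<^sup>2"
      using sum_squares_bound[of "\<bar>x\<bar>" "\<bar>y\<bar>"] by (simp add: mult.assoc)
    moreover have "0 \<le> \<bar>x\<bar> * \<bar>y\<bar>" by simp
    ultimately have "\<bar>x\<bar> * \<bar>y\<bar> \<le> \<bar>x\<bar>\<^sup>2 + \<bar>y\<bar>\<^sup>2" by linarith
    then show ?thesis by (simp add: abs_mult)
  qed
  then show "AE \<omega> in M. norm (f \<omega> * g \<omega>) \<le> norm ((f \<omega>)\<^sup>2 + (g \<omega>)\<^sup>2)" by simp
qed simp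

lemma (in finite_measure) integrable_of_square:
  fixes f :: "'a \<Rightarrow> real"
  assumes [measurable]: "f \<in> borel_measurable M" and "integrable M (\<lambda>\<omega>. (f \<omega>)\<^sup>2)"
  shows "integrable M f"
  using integrable_mult_of_squares[OF assms(1), of "\<lambda>_. 1"] assms(2) by simp

text \<open>
  Completing the square turns the exponentially tilted density into a shifted normal density.
\<close>

lemma normal_exponential_moment:
  assumes "0 < \<sigma>"
  shows "has_bochner_integral lborel (\<lambda>x. normal_density 0 \<sigma> x * exp (p * x)) (exp (p\<^sup>2 * \<sigma>\<^sup>2 / 2))"
proof -
  have "normal_density 0 \<sigma> x * exp (p * x) = exp (p\<^sup>2 * \<sigma>\<^sup>2 / 2) * normal_density (p * \<sigma>\<^sup>2) \<sigma> x" for x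
  proof -
    have "- (x\<^sup>2) / (2 * \<sigma>\<^sup>2) + p * x = p\<^sup>2 * \<sigma>\<^sup>2 / 2 + - ((x - p * \<sigma>\<^sup>2)\<^sup>2) / (2 * \<sigma>\<^sup>2)"
      using assms by (simp add: field_simps power2_eq_square)
    then have "exp (- (x\<^sup>2) / (2 * \<sigma>\<^sup>2)) * exp (p * x)
        = exp (p\<^sup>2 * \<sigma>\<^sup>2 / 2) * exp (- ((x - p * \<sigma>\<^sup>2)\<^sup>2) / (2 * \<sigma>\<^sup>2))"
      by (simp only: flip: exp_add)
    then show ?thesis by (simp add: normal_density_def)
  qed
  moreover have "has_bochner_integral lborel (\<lambda>x. exp (p\<^sup>2 * \<sigma>\<^sup>2 / 2) * normal_density (p * \<sigma>\<^sup>2) \<sigma> x)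
      (exp (p\<^sup>2 * \<sigma>\<^sup>2 / 2) * 1)"
    by (intro has_bochner_integral_mult_right)
      (use assms in \<open>simp add: has_bochner_integral_iff\<close>)
  ultimately show ?thesis by simp
qed

primrec running_max :: "(nat \<Rightarrow> 'a \<Rightarrow> real) \<Rightarrow> nat \<Rightarrow> 'a \<Rightarrow> real" where
  "running_max Z 0 \<omega> = Z 0 \<omega>"
| "running_max Z (Suc k) \<omega> = max (running_max Z k \<omega>) (Z (Suc k) \<omega>)"

lemma running_max_ge: "j \<le> k \<Longrightarrow> Z j \<omega> \<le> running_max Z k \<omega>"
  by (induction k) (auto simp: le_Suc_eq)

lemma running_max_attained: "\<exists>j\<le>k. running_max Z k \<omega> = Z j \<omega>"
  by (induction k) (auto simp: max_def le_Suc_eq)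

lemma measurable_running_max:
  "(\<And>j. j \<le> k \<Longrightarrow> Z j \<in> borel_measurable N) \<Longrightarrow> running_max Z k \<in> borel_measurable N"
proof (induction k)
  case 0
  moreover have "running_max Z 0 = Z 0" by (rule ext) simp
  ultimately show ?case by simp
next
  case (Suc k)
  have [measurable]: "running_max Z k \<in> borel_measurable N" "Z (Suc k) \<in> borel_measurable N"
    by (rule Suc.IH, rule Suc.prems, simp) (rule Suc.prems, simp)
  have "running_max Z (Suc k) = (\<lambda>\<omega>. max (running_max Z k \<omega>) (Z (Suc k) \<omega>))"
    by (rule ext) simp
  moreover have "(\<lambda>\<omega>. max (running_max Z k \<omega>) (Z (Suc k) \<omega>)) \<in> borel_measurable N"
    by measurable
  ultimately show ?case by (simp only:)
qed

lemma integrable_running_max_square: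
  assumes "\<And>j. j \<le> k \<Longrightarrow> Z j \<in> borel_measurable M"
    and i: "\<And>j. j \<le> k \<Longrightarrow> integrable M (\<lambda>\<omega>. (Z j \<omega>)\<^sup>2)"
  shows "integrable M (\<lambda>\<omega>. (running_max Z k \<omega>)\<^sup>2)"
proof (rule Bochner_Integration.integrable_bound)
  show "integrable M (\<lambda>\<omega>. \<Sum>j\<le>k. (Z j \<omega>)\<^sup>2)"
    by (intro Bochner_Integration.integrable_sum i) simp
  have [measurable]: "running_max Z k \<in> borel_measurable M"
    by (rule measurable_running_max) (use assms in auto)
  show "(\<lambda>\<omega>. (running_max Z k \<omega>)\<^sup>2) \<in> borel_measurable M" by simp
  show "AE \<omega> in M. norm ((running_max Z k \<omega>)\<^sup>2) \<le> norm (\<Sum>j\<le>k. (Z j \<omega>)\<^sup>2)"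
  proof (rule AE_I2)
    fix \<omega>
    obtain j where j: "j \<le> k" "running_max Z k \<omega> = Z j \<omega>" using running_max_attained[of k Z \<omega>] by blast
    have "(Z j \<omega>)\<^sup>2 \<le> (\<Sum>i\<le>k. (Z i \<omega>)\<^sup>2)"
      by (rule member_le_sum[of j]) (simp_all add: j(1))
    then show "norm ((running_max Z k \<omega>)\<^sup>2) \<le> norm (\<Sum>j\<le>k. (Z j \<omega>)\<^sup>2)"
      unfolding j(2) by (simp add: sum_nonneg)
  qed
qed

text \<open>
  Doob's maximal inequality in mean square. With \<open>R\<close> the running maximum, the potential
  \<open>R\<^sup>2 / 2 - R Z\<close> grows in one step by at most \<open>- R (Z' - Z)\<close>, because \<open>R\<close> can only increase to the new value \<open>Z'\<close>.
  Its mean therefore stays nonpositive, and completing the square does the rest. The submartingale property enters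
  through the correlation of the increments with the running maximum, a form that suits both Brownian motion on a
  grid and the embedded walk.
\<close>

lemma discrete_doob_inequality:
  fixes Z :: "nat \<Rightarrow> 'a \<Rightarrow> real"
  assumes meas: "\<And>k. k \<le> n \<Longrightarrow> Z k \<in> borel_measurable M"
    and int2: "\<And>k. k \<le> n \<Longrightarrow> integrable M (\<lambda>\<omega>. (Z k \<omega>)\<^sup>2)"
    and sub: "\<And>k. k < n \<Longrightarrow> 0 \<le> (\<integral>\<omega>. running_max Z k \<omega> * (Z (Suc k) \<omega> - Z k \<omega>) \<partial>M)"
  shows "(\<integral>\<omega>. (running_max Z n \<omega>)\<^sup>2 \<partial>M) \<le> 4 * (\<integral>\<omega>. (Z n \<omega>)\<^sup>2 \<partial>M)"
proof -
  define P where "P k \<omega> = (running_max Z k \<omega>)\<^sup>2 / 2 - running_max Z k \<omega> * Z k \<omega>" for k \<omega>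
  have mr: "running_max Z k \<in> borel_measurable M" if "k \<le> n" for k
    by (rule measurable_running_max) (use that meas in auto)
  have ir: "integrable M (\<lambda>\<omega>. (running_max Z k \<omega>)\<^sup>2)" if "k \<le> n" for k
    by (rule integrable_running_max_square) (use that meas int2 in auto)
  have irz: "integrable M (\<lambda>\<omega>. running_max Z k \<omega> * Z j \<omega>)" if "k \<le> n" "j \<le> n" for k j
    using meas[OF that(2)] int2[OF that(2)] mr[OF that(1)] ir[OF that(1)]
    by (intro integrable_mult_of_squares)
  have iP: "integrable M (P k)" if "k \<le> n" for k
    unfolding P_def[abs_def] using ir[OF that] irz[OF that that] by simp
  have step: "P (Suc k) \<omega> \<le> P k \<omega> - running_max Z k \<omega> * (Z (Suc k) \<omega> - Z k \<omega>)" for k \<omega>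
  proof (cases "running_max Z k \<omega> \<le> Z (Suc k) \<omega>")
    case True
    have "0 \<le> (Z (Suc k) \<omega> - running_max Z k \<omega>)\<^sup>2" by simp
    with True show ?thesis by (simp add: P_def max_absorb2 algebra_simps power2_eq_square)
  next
    case False
    then show ?thesis by (simp add: P_def max_absorb1 algebra_simps)
  qed
  have "integral\<^sup>L M (P k) \<le> 0" if "k \<le> n" for k
    using that
  proof (induction k)
    case 0
    have "0 \<le> (\<integral>\<omega>. (Z 0 \<omega>)\<^sup>2 / 2 \<partial>M)" by simp
    moreover have "integral\<^sup>L M (P 0) = (\<integral>\<omega>. - ((Z 0 \<omega>)\<^sup>2 / 2) \<partial>M)"
      by (intro Bochner_Integration.integral_cong) (auto simp: P_def power2_eq_square)
    ultimately show ?case by simp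
  next
    case (Suc k)
    have i1: "integrable M (\<lambda>\<omega>. running_max Z k \<omega> * (Z (Suc k) \<omega> - Z k \<omega>))"
      using irz[of k "Suc k"] irz[of k k] Suc.prems by (simp add: right_diff_distrib del: running_max.simps)
    have "integral\<^sup>L M (P (Suc k)) \<le> (\<integral>\<omega>. P k \<omega> - running_max Z k \<omega> * (Z (Suc k) \<omega> - Z k \<omega>) \<partial>M)"
      by (rule integral_mono[OF _ _ step]) (use iP[of k] iP[of "Suc k"] Suc.prems i1 in simp_all)
    also have "\<dots> = integral\<^sup>L M (P k) - (\<integral>\<omega>. running_max Z k \<omega> * (Z (Suc k) \<omega> - Z k \<omega>) \<partial>M)"
      using iP[of k] Suc.prems i1 by simp
    also have "\<dots> \<le> 0" using Suc.IH Suc.prems sub[of k] by simp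
    finally show ?case .
  qed
  from this[of n] have P0: "integral\<^sup>L M (P n) \<le> 0" by simp
  have "(running_max Z n \<omega>)\<^sup>2 \<le> 4 * P n \<omega> + 4 * (Z n \<omega>)\<^sup>2" for \<omega>
  proof -
    have "0 \<le> (running_max Z n \<omega> - 2 * Z n \<omega>)\<^sup>2" by simp
    then show ?thesis by (simp add: P_def power2_eq_square algebra_simps)
  qed
  then have "(\<integral>\<omega>. (running_max Z n \<omega>)\<^sup>2 \<partial>M) \<le> (\<integral>\<omega>. 4 * P n \<omega> + 4 * (Z n \<omega>)\<^sup>2 \<partial>M)"
    by (intro integral_mono) (use ir[of n] iP[of n] int2[of n] in simp_all)
  also have "\<dots> = 4 * integral\<^sup>L M (P n) + 4 * (\<integral>\<omega>. (Z n \<omega>)\<^sup>2 \<partial>M)"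
    using iP[of n] int2[of n] by simp
  finally show ?thesis using P0 by simp
qed

text \<open>
  Random bounds arise as Fatou limits and as infinite series, hence with extended values.
\<close>

lemma (in prob_space) real_valued_version:
  assumes [measurable]: "V \<in> borel_measurable M" and le: "(\<integral>\<^sup>+\<omega>. V \<omega> \<partial>M) \<le> ennreal c" and c: "0 \<le> c"
  shows "\<exists>W. integrable M W \<and> (\<forall>\<omega>. 0 \<le> W \<omega>) \<and> (\<integral>\<omega>. W \<omega> \<partial>M) \<le> c \<and> (AE \<omega> in M. V \<omega> = ennreal (W \<omega>))"
proof -
  have "(\<integral>\<^sup>+\<omega>. V \<omega> \<partial>M) \<noteq> \<infinity>" using le by (auto simp: top_unique)
  then have finAE: "AE \<omega> in M. V \<omega> \<noteq> \<infinity>" by (rule nn_integral_noteq_infinite[rotated]) simp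
  define W where "W \<omega> = enn2real (V \<omega>)" for \<omega>
  have [measurable]: "W \<in> borel_measurable M" unfolding W_def[abs_def] by measurable
  have eq: "AE \<omega> in M. V \<omega> = ennreal (W \<omega>)"
    using finAE by eventually_elim (simp add: W_def ennreal_enn2real_if)
  have "(\<integral>\<^sup>+\<omega>. ennreal (W \<omega>) \<partial>M) = (\<integral>\<^sup>+\<omega>. V \<omega> \<partial>M)"
    by (rule nn_integral_cong_AE) (use eq in \<open>eventually_elim, simp\<close>)
  then have nW: "(\<integral>\<^sup>+\<omega>. ennreal (W \<omega>) \<partial>M) \<le> ennreal c" using le by simp
  have W0: "0 \<le> W \<omega>" for \<omega> by (simp add: W_def)
  have iW: "integrable M W"
    by (rule integrableI_nonneg) (use nW W0 in \<open>auto simp: less_top[symmetric] top_unique\<close>)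
  have "ennreal (\<integral>\<omega>. W \<omega> \<partial>M) \<le> ennreal c"
    using nW nn_integral_eq_integral[OF iW] W0 by simp
  then have "(\<integral>\<omega>. W \<omega> \<partial>M) \<le> c" using c by (simp add: ennreal_le_iff)
  then show ?thesis using iW W0 eq by (intro exI[of _ W] conjI) simp_all
qed

section \<open>Brownian motion relative to a filtration\<close>

text \<open>
  All path properties are required at every sample point. The filtration is a parameter, since it need not be
  generated by this version of the motion: in the application it is the completed filtration of another version.
  Unboundedness of the drifted path makes every embedding time finite.
\<close>

locale filtered_bm = prob_space M + filtration "space M" F
  for M :: "'a measure" and F :: "real \<Rightarrow> 'a measure" +
  fixes B :: "real \<Rightarrow> 'a \<Rightarrow> real" and \<kappa> :: real
  assumes sets_F: "\<And>t. sets (F t) \<subseteq> sets M"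
    and kappa_pos: "0 < \<kappa>"
    and adapted_B: "\<And>t. 0 \<le> t \<Longrightarrow> B t \<in> borel_measurable (F t)"
    and B_zero: "\<And>\<omega>. \<omega> \<in> space M \<Longrightarrow> B 0 \<omega> = 0"
    and continuous_B: "\<And>\<omega>. \<omega> \<in> space M \<Longrightarrow> continuous_on {0..} (\<lambda>t. B t \<omega>)"
    and normal_B: "\<And>s t. 0 \<le> s \<Longrightarrow> s < t \<Longrightarrow>
        distributed M lborel (\<lambda>\<omega>. B t \<omega> - B s \<omega>) (\<lambda>x. ennreal (normal_density 0 (sqrt (t - s)) x))"
    and indep_B: "\<And>s t A D. 0 \<le> s \<Longrightarrow> s < t \<Longrightarrow> A \<in> sets (F s) \<Longrightarrow> D \<in> sets borel \<Longrightarrow>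
        prob (A \<inter> ((\<lambda>\<omega>. B t \<omega> - B s \<omega>) -` D \<inter> space M))
          = prob A * prob ((\<lambda>\<omega>. B t \<omega> - B s \<omega>) -` D \<inter> space M)"
    and unbounded_B: "\<And>\<omega> a. \<omega> \<in> space M \<Longrightarrow> \<exists>t\<ge>0. a < \<bar>drifted \<kappa> B t \<omega>\<bar>"
begin

lemma measurable_F_M: "f \<in> borel_measurable (F t) \<Longrightarrow> f \<in> borel_measurable M"
  by (rule measurable_from_subalg[of M "F t"]) (auto simp: subalgebra_def sets_F space_F)

lemma measurable_F_mono: "f \<in> borel_measurable (F s) \<Longrightarrow> s \<le> t \<Longrightarrow> f \<in> borel_measurable (F t)"
  by (rule measurable_from_subalg[of "F t" "F s"]) (auto simp: subalgebra_def sets_F_mono space_F)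

lemma B_measurable: "0 \<le> t \<Longrightarrow> B t \<in> borel_measurable M"
  by (rule measurable_F_M[OF adapted_B])

lemma increment_moment:
  assumes "0 \<le> s" "s \<le> t"
  shows "integrable M (\<lambda>\<omega>. (B t \<omega> - B s \<omega>) ^ k)"
    and "(\<integral>\<omega>. (B t \<omega> - B s \<omega>) \<partial>M) = 0"
    and "(\<integral>\<omega>. (B t \<omega> - B s \<omega>) ^ 4 \<partial>M) = 3 * (t - s)\<^sup>2"
    and "integrable M (\<lambda>\<omega>. exp (p * (B t \<omega> - B s \<omega>)))"
    and "(\<integral>\<omega>. exp (p * (B t \<omega> - B s \<omega>)) \<partial>M) = exp (p\<^sup>2 * (t - s) / 2)"
proof -
  let ?c = "integrable M (\<lambda>\<omega>. (B t \<omega> - B s \<omega>) ^ k)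
    \<and> (\<integral>\<omega>. (B t \<omega> - B s \<omega>) \<partial>M) = 0
    \<and> (\<integral>\<omega>. (B t \<omega> - B s \<omega>) ^ 4 \<partial>M) = 3 * (t - s)\<^sup>2
    \<and> integrable M (\<lambda>\<omega>. exp (p * (B t \<omega> - B s \<omega>)))
    \<and> (\<integral>\<omega>. exp (p * (B t \<omega> - B s \<omega>)) \<partial>M) = exp (p\<^sup>2 * (t - s) / 2)"
  have ?c
  proof (cases "s = t")
    case True
    then show ?thesis by (simp add: power_0_left prob_space)
  next
    case ne: False
    define \<sigma> where "\<sigma> = sqrt (t - s)"
    have \<sigma>: "0 < \<sigma>" "\<sigma>\<^sup>2 = t - s" using assms ne by (auto simp: \<sigma>_def)
    have D: "distributed M lborel (\<lambda>\<omega>. B t \<omega> - B s \<omega>) (\<lambda>x. ennreal (normal_density 0 \<sigma> x))"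
      using normal_B[of s t] assms ne by (simp add: \<sigma>_def)
    note I = distributed_integrable[OF D] and J = distributed_integral[OF D]
    show ?thesis
    proof (intro conjI)
    show "integrable M (\<lambda>\<omega>. (B t \<omega> - B s \<omega>) ^ k)"
      using I[of "\<lambda>x. x ^ k"] integrable_normal_moment[OF \<sigma>(1), of 0 k] by simp
    show "(\<integral>\<omega>. (B t \<omega> - B s \<omega>) \<partial>M) = 0"
      using J[of "\<lambda>x. x"] integral_normal_moment_nz_1[OF \<sigma>(1), of 0] by simp
    show "(\<integral>\<omega>. (B t \<omega> - B s \<omega>) ^ 4 \<partial>M) = 3 * (t - s)\<^sup>2"
      using J[of "\<lambda>x. x ^ 4"] integral_normal_moment_even[OF \<sigma>(1), of 0 2] \<sigma>
      by (simp add: fact_numeral field_simps)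
    show "integrable M (\<lambda>\<omega>. exp (p * (B t \<omega> - B s \<omega>)))"
      "(\<integral>\<omega>. exp (p * (B t \<omega> - B s \<omega>)) \<partial>M) = exp (p\<^sup>2 * (t - s) / 2)"
      using I[of "\<lambda>x. exp (p * x)"] J[of "\<lambda>x. exp (p * x)"] normal_exponential_moment[OF \<sigma>(1), of p] \<sigma>
      by (simp_all add: has_bochner_integral_iff)
    qed
  qed
  then show "integrable M (\<lambda>\<omega>. (B t \<omega> - B s \<omega>) ^ k)"
    and "(\<integral>\<omega>. (B t \<omega> - B s \<omega>) \<partial>M) = 0"
    and "(\<integral>\<omega>. (B t \<omega> - B s \<omega>) ^ 4 \<partial>M) = 3 * (t - s)\<^sup>2"
    and "integrable M (\<lambda>\<omega>. exp (p * (B t \<omega> - B s \<omega>)))"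
    and "(\<integral>\<omega>. exp (p * (B t \<omega> - B s \<omega>)) \<partial>M) = exp (p\<^sup>2 * (t - s) / 2)"
    by auto
qed

lemma sigma_sets_vimage_real:
  "sigma_sets (space M) {f -` A \<inter> space M |A. A \<in> sets borel}
    = {f -` A \<inter> space M |A. A \<in> sets (borel :: real measure)}"
proof -
  have "sets (vimage_algebra (space M) f (borel :: real measure)) = {f -` A \<inter> space M |A. A \<in> sets borel}"
    by (rule sets_vimage_algebra2) auto
  then show ?thesis by (simp add: sets_vimage_algebra)
qed

lemma indep_increment:
  assumes "0 \<le> s" "s < t" and g: "g \<in> borel_measurable (F s)" and \<phi>: "\<phi> \<in> borel_measurable borel"
  shows "indep_var borel g borel (\<lambda>\<omega>. \<phi> (B t \<omega> - B s \<omega>) :: real)"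
proof -
  have [measurable]: "B t \<in> borel_measurable M" "B s \<in> borel_measurable M"
    using assms B_measurable by auto
  note \<phi>[measurable]
  let ?X = "\<lambda>\<omega>. B t \<omega> - B s \<omega>"
  show ?thesis
    unfolding indep_var_eq sigma_sets_vimage_real
  proof (intro conjI indep_setI)
    show gm: "random_variable borel g" using measurable_F_M[OF g] .
    show fm: "random_variable borel (\<lambda>\<omega>. \<phi> (?X \<omega>))" by simp
    show "{g -` A \<inter> space M |A. A \<in> sets borel} \<subseteq> events"
      using measurable_sets[OF gm] by auto
    show "{(\<lambda>\<omega>. \<phi> (?X \<omega>)) -` A \<inter> space M |A. A \<in> sets borel} \<subseteq> events"
      using measurable_sets[OF fm] by auto
    fix a b assume "a \<in> {g -` A \<inter> space M |A. A \<in> sets borel}"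
      and "b \<in> {(\<lambda>\<omega>. \<phi> (?X \<omega>)) -` A \<inter> space M |A. A \<in> sets borel}"
    then obtain C D where a: "a = g -` C \<inter> space M" "C \<in> sets borel"
      and b: "b = (\<lambda>\<omega>. \<phi> (?X \<omega>)) -` D \<inter> space M" "D \<in> sets borel" by auto
    have "a \<in> sets (F s)" using measurable_sets[OF g a(2)] by (simp add: a space_F)
    moreover have "\<phi> -` D \<in> sets borel" using measurable_sets[OF \<phi> b(2)] by simp
    moreover have "b = ?X -` (\<phi> -` D) \<inter> space M" by (auto simp: b)
    ultimately show "prob (a \<inter> b) = prob a * prob b"
      using indep_B[of s t a "\<phi> -` D"] assms by simp
  qed
qed

lemma expectation_mult_increment:
  assumes "0 \<le> s" "s \<le> t" and g: "g \<in> borel_measurable (F s)" "integrable M g"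
    and \<phi>: "\<phi> \<in> borel_measurable borel" "integrable M (\<lambda>\<omega>. \<phi> (B t \<omega> - B s \<omega>) :: real)"
  shows "integrable M (\<lambda>\<omega>. g \<omega> * \<phi> (B t \<omega> - B s \<omega>))"
    and "(\<integral>\<omega>. g \<omega> * \<phi> (B t \<omega> - B s \<omega>) \<partial>M) = (\<integral>\<omega>. g \<omega> \<partial>M) * (\<integral>\<omega>. \<phi> (B t \<omega> - B s \<omega>) \<partial>M)"
proof -
  have "integrable M (\<lambda>\<omega>. g \<omega> * \<phi> (B t \<omega> - B s \<omega>)) \<and>
    (\<integral>\<omega>. g \<omega> * \<phi> (B t \<omega> - B s \<omega>) \<partial>M) = (\<integral>\<omega>. g \<omega> \<partial>M) * (\<integral>\<omega>. \<phi> (B t \<omega> - B s \<omega>) \<partial>M)"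
  proof (cases "s = t")
    case True
    then show ?thesis using g by (simp add: prob_space)
  next
    case False
    then have "indep_var borel g borel (\<lambda>\<omega>. \<phi> (B t \<omega> - B s \<omega>))"
      using assms by (intro indep_increment) auto
    from indep_var_lebesgue_integral[OF this g(2) \<phi>(2)] indep_var_integrable[OF this g(2) \<phi>(2)]
    show ?thesis by simp
  qed
  then show "integrable M (\<lambda>\<omega>. g \<omega> * \<phi> (B t \<omega> - B s \<omega>))"
    and "(\<integral>\<omega>. g \<omega> * \<phi> (B t \<omega> - B s \<omega>) \<partial>M) = (\<integral>\<omega>. g \<omega> \<partial>M) * (\<integral>\<omega>. \<phi> (B t \<omega> - B s \<omega>) \<partial>M)"
    by auto
qed

text \<open>
  Doob's inequality is applied on equidistant grids and passed to the limit by Fatou's lemma: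
  by continuity each value of \<open>Z\<close> is a limit of values on the grids. The conclusion
  provides an integrable majorant, which avoids suprema over uncountable index sets.
\<close>

lemma continuous_maximal_inequality:
  fixes Z :: "real \<Rightarrow> 'a \<Rightarrow> real"
  assumes st: "0 \<le> s" "s < t"
    and adapted: "\<And>u. s \<le> u \<Longrightarrow> u \<le> t \<Longrightarrow> Z u \<in> borel_measurable (F u)"
    and cont: "\<And>\<omega>. \<omega> \<in> space M \<Longrightarrow> continuous_on {s..t} (\<lambda>u. Z u \<omega>)"
    and nonneg: "\<And>u \<omega>. \<omega> \<in> space M \<Longrightarrow> 0 \<le> Z u \<omega>"
    and int2: "\<And>u. s \<le> u \<Longrightarrow> u \<le> t \<Longrightarrow> integrable M (\<lambda>\<omega>. (Z u \<omega>)\<^sup>2)"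
    and sub: "\<And>u v g. s \<le> u \<Longrightarrow> u \<le> v \<Longrightarrow> v \<le> t \<Longrightarrow> g \<in> borel_measurable (F u) \<Longrightarrow>
       integrable M (\<lambda>\<omega>. (g \<omega>)\<^sup>2) \<Longrightarrow> (\<And>\<omega>. \<omega> \<in> space M \<Longrightarrow> 0 \<le> g \<omega>) \<Longrightarrow>
       0 \<le> (\<integral>\<omega>. g \<omega> * (Z v \<omega> - Z u \<omega>) \<partial>M)"
  shows "\<exists>W. integrable M W \<and> (\<forall>\<omega>. 0 \<le> W \<omega>) \<and> (\<integral>\<omega>. W \<omega> \<partial>M) \<le> 4 * (\<integral>\<omega>. (Z t \<omega>)\<^sup>2 \<partial>M)
    \<and> (AE \<omega> in M. \<forall>u\<in>{s..t}. (Z u \<omega>)\<^sup>2 \<le> W \<omega>)"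
proof -
  define \<tau> where "\<tau> m j = s + (t - s) * real j / real (Suc m)" for m j
  define V where "V m = running_max (\<lambda>j. Z (\<tau> m j)) (Suc m)" for m
  define c where "c = 4 * (\<integral>\<omega>. (Z t \<omega>)\<^sup>2 \<partial>M)"
  have \<tau>b: "s \<le> \<tau> m j" "\<tau> m j \<le> t" if "j \<le> Suc m" for m j
  proof -
    show "s \<le> \<tau> m j" using st by (simp add: \<tau>_def)
    have "(t - s) * (real j / real (Suc m)) \<le> (t - s) * 1"
      using that st by (intro mult_left_mono) auto
    then show "\<tau> m j \<le> t" by (simp add: \<tau>_def)
  qed
  have \<tau>mono: "\<tau> m i \<le> \<tau> m j" if "i \<le> j" for m i j
    using that st by (auto simp: \<tau>_def intro!: divide_right_mono mult_left_mono)
  have ZM: "Z u \<in> borel_measurable M" if "s \<le> u" "u \<le> t" for u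
    using adapted[OF that] by (rule measurable_F_M)
  have VM[measurable]: "V m \<in> borel_measurable M" for m
    unfolding V_def by (intro measurable_running_max ZM \<tau>b)
  have iV: "integrable M (\<lambda>\<omega>. (V m \<omega>)\<^sup>2)" for m
    unfolding V_def by (intro integrable_running_max_square ZM int2 \<tau>b)
  have EV: "(\<integral>\<omega>. (V m \<omega>)\<^sup>2 \<partial>M) \<le> c" for m
  proof -
    have "(\<integral>\<omega>. (V m \<omega>)\<^sup>2 \<partial>M) \<le> 4 * (\<integral>\<omega>. (Z (\<tau> m (Suc m)) \<omega>)\<^sup>2 \<partial>M)"
      unfolding V_def
    proof (rule discrete_doob_inequality)
      fix k assume k: "k < Suc m"
      show "0 \<le> (\<integral>\<omega>. running_max (\<lambda>j. Z (\<tau> m j)) k \<omega> * (Z (\<tau> m (Suc k)) \<omega> - Z (\<tau> m k) \<omega>) \<partial>M)"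
      proof (rule sub)
        show "running_max (\<lambda>j. Z (\<tau> m j)) k \<in> borel_measurable (F (\<tau> m k))"
          by (rule measurable_running_max, rule measurable_F_mono[OF adapted])
            (use k \<tau>b \<tau>mono in auto)
        show "integrable M (\<lambda>\<omega>. (running_max (\<lambda>j. Z (\<tau> m j)) k \<omega>)\<^sup>2)"
          by (intro integrable_running_max_square ZM int2 \<tau>b) (use k in auto)
        fix \<omega> assume "\<omega> \<in> space M"
        then show "0 \<le> running_max (\<lambda>j. Z (\<tau> m j)) k \<omega>"
          using running_max_ge[of 0 k "\<lambda>j. Z (\<tau> m j)" \<omega>] nonneg[of \<omega> "\<tau> m 0"] by simp
      qed (use k \<tau>b \<tau>mono in auto)
    qed (auto intro!: ZM int2 \<tau>b)
    also have "\<tau> m (Suc m) = t" by (simp add: \<tau>_def)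
    finally show ?thesis by (simp add: c_def)
  qed
  define W0 where "W0 \<omega> = liminf (\<lambda>m. ennreal ((V m \<omega>)\<^sup>2))" for \<omega>
  have [measurable]: "W0 \<in> borel_measurable M" unfolding W0_def[abs_def] by measurable
  have "(\<integral>\<^sup>+\<omega>. W0 \<omega> \<partial>M) \<le> liminf (\<lambda>m. (\<integral>\<^sup>+\<omega>. ennreal ((V m \<omega>)\<^sup>2) \<partial>M))"
    unfolding W0_def by (rule nn_integral_liminf) simp
  also have "\<dots> \<le> liminf (\<lambda>m. ennreal c)"
    by (intro Liminf_mono always_eventually allI)
      (use EV iV in \<open>simp add: nn_integral_eq_integral ennreal_leI\<close>)
  also have "\<dots> = ennreal c" by (simp add: Liminf_const)
  finally have nW0: "(\<integral>\<^sup>+\<omega>. W0 \<omega> \<partial>M) \<le> ennreal c" .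
  have c0: "0 \<le> c" by (simp add: c_def)
  obtain W where W: "integrable M W" "\<forall>\<omega>. 0 \<le> W \<omega>" "(\<integral>\<omega>. W \<omega> \<partial>M) \<le> c"
    and eq: "AE \<omega> in M. W0 \<omega> = ennreal (W \<omega>)"
    using real_valued_version[OF _ nW0 c0] by auto
  have bound: "ennreal ((Z u \<omega>)\<^sup>2) \<le> W0 \<omega>" if \<omega>: "\<omega> \<in> space M" and u: "u \<in> {s..t}" for \<omega> u
  proof -
    define j where "j m = nat \<lfloor>(u - s) / (t - s) * real (Suc m)\<rfloor>" for m
    have q: "0 \<le> (u - s) / (t - s)" "(u - s) / (t - s) \<le> 1" using u st by auto
    have jle: "j m \<le> Suc m" for m
    proof -
      have "(u - s) / (t - s) * real (Suc m) \<le> 1 * real (Suc m)"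
        by (rule mult_right_mono) (use q in auto)
      from floor_mono[OF this] have "\<lfloor>(u - s) / (t - s) * real (Suc m)\<rfloor> \<le> int (Suc m)"
        by simp
      then show ?thesis unfolding j_def by linarith
    qed
    have near: "\<bar>\<tau> m (j m) - u\<bar> \<le> (t - s) / real (Suc m)" for m
    proof -
      define x where "x = (u - s) / (t - s) * real (Suc m)"
      have "0 \<le> x" unfolding x_def by (intro mult_nonneg_nonneg q) simp
      then have "\<bar>real (j m) - x\<bar> \<le> 1" unfolding j_def x_def[symmetric] by linarith
      then have "\<bar>real (j m) - x\<bar> * ((t - s) / real (Suc m)) \<le> 1 * ((t - s) / real (Suc m))"
        by (rule mult_right_mono) (use st in simp)
      also have "\<bar>real (j m) - x\<bar> * ((t - s) / real (Suc m)) = \<bar>(real (j m) - x) * ((t - s) / real (Suc m))\<bar>"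
        using st by (simp add: abs_mult)
      also have "(real (j m) - x) * ((t - s) / real (Suc m)) = \<tau> m (j m) - u"
      proof -
        have "x * ((t - s) / real (Suc m)) = u - s"
          using st by (simp add: x_def del: of_nat_Suc)
        then show ?thesis
          unfolding left_diff_distrib[of "real (j m)" x] by (simp add: \<tau>_def mult.commute del: of_nat_Suc)
      qed
      finally show ?thesis by simp
    qed
    have lim0: "(\<lambda>m. (t - s) / real (Suc m)) \<longlonglongrightarrow> 0"
      by (rule LIMSEQ_Suc[OF lim_const_over_n])
    have "(\<lambda>m. \<tau> m (j m) - u) \<longlonglongrightarrow> 0"
      by (rule Lim_null_comparison[OF _ lim0]) (use near in auto)
    then have "(\<lambda>m. \<tau> m (j m)) \<longlonglongrightarrow> u" by (simp add: LIM_zero_iff)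
    then have "(\<lambda>m. Z (\<tau> m (j m)) \<omega>) \<longlonglongrightarrow> Z u \<omega>"
      by (rule continuous_on_tendsto_compose[OF cont[OF \<omega>]])
        (use u \<tau>b[OF jle] in auto)
    then have "(\<lambda>m. ennreal ((Z (\<tau> m (j m)) \<omega>)\<^sup>2)) \<longlonglongrightarrow> ennreal ((Z u \<omega>)\<^sup>2)"
      by (intro tendsto_ennrealI tendsto_power)
    then have "ennreal ((Z u \<omega>)\<^sup>2) = liminf (\<lambda>m. ennreal ((Z (\<tau> m (j m)) \<omega>)\<^sup>2))"
      by (rule lim_imp_Liminf[OF sequentially_bot, symmetric])
    also have "\<dots> \<le> W0 \<omega>"
      unfolding W0_def
    proof (intro Liminf_mono always_eventually allI ennreal_leI power_mono)
      show "Z (\<tau> m (j m)) \<omega> \<le> V m \<omega>" for m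
        unfolding V_def using running_max_ge[OF jle, of "\<lambda>j. Z (\<tau> m j)" for m] by simp
    qed (use nonneg \<omega> in auto)
    finally show ?thesis .
  qed
  have "AE \<omega> in M. \<forall>u\<in>{s..t}. (Z u \<omega>)\<^sup>2 \<le> W \<omega>"
    using eq AE_space
  proof eventually_elim
    case (elim \<omega>)
    show ?case
    proof
      fix u assume "u \<in> {s..t}"
      from bound[OF elim(2) this] show "(Z u \<omega>)\<^sup>2 \<le> W \<omega>"
        using W(2) by (simp add: elim(1) ennreal_le_iff)
    qed
  qed
  then show ?thesis using W unfolding c_def by blast
qed

end

context filtered_bm begin

abbreviation X :: "real \<Rightarrow> 'a \<Rightarrow> real" where "X \<equiv> drifted \<kappa> B"

lemma X_zero: "\<omega> \<in> space M \<Longrightarrow> X 0 \<omega> = 0"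
  by (simp add: drifted_def B_zero)

lemma continuous_X: "\<omega> \<in> space M \<Longrightarrow> continuous_on {0..} (\<lambda>t. X t \<omega>)"
  unfolding drifted_def by (intro continuous_intros continuous_B)

lemma adapted_X: "0 \<le> t \<Longrightarrow> X t \<in> borel_measurable (F t)"
  using adapted_B[of t] unfolding drifted_def[abs_def] by simp

text \<open>
  The maximal inequality for the submartingale \<open>(B u - B s)\<^sup>2\<close>; the fourth moment of a normal variable supplies the constant.
\<close>

lemma increment_maximal_fourth_moment:
  assumes "0 \<le> s" "s < t"
  shows "\<exists>W. integrable M W \<and> (\<forall>\<omega>. 0 \<le> W \<omega>) \<and> (\<integral>\<omega>. W \<omega> \<partial>M) \<le> 12 * (t - s)\<^sup>2
    \<and> (AE \<omega> in M. \<forall>u\<in>{s..t}. (B u \<omega> - B s \<omega>) ^ 4 \<le> W \<omega>)"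
proof -
  have p4: "(x\<^sup>2)\<^sup>2 = x ^ 4" for x :: real by (simp flip: power_mult)
  have "\<exists>W. integrable M W \<and> (\<forall>\<omega>. 0 \<le> W \<omega>)
    \<and> (\<integral>\<omega>. W \<omega> \<partial>M) \<le> 4 * (\<integral>\<omega>. ((B t \<omega> - B s \<omega>)\<^sup>2)\<^sup>2 \<partial>M)
    \<and> (AE \<omega> in M. \<forall>u\<in>{s..t}. ((B u \<omega> - B s \<omega>)\<^sup>2)\<^sup>2 \<le> W \<omega>)"
  proof (rule continuous_maximal_inequality[where Z = "\<lambda>u \<omega>. (B u \<omega> - B s \<omega>)\<^sup>2", OF assms])
    fix u assume u: "s \<le> u" "u \<le> t"
    have [measurable]: "B u \<in> borel_measurable (F u)" "B s \<in> borel_measurable (F u)"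
      using adapted_B[of u] measurable_F_mono[OF adapted_B[of s], of u] u assms by auto
    show "(\<lambda>\<omega>. (B u \<omega> - B s \<omega>)\<^sup>2) \<in> borel_measurable (F u)" by measurable
    show "integrable M (\<lambda>\<omega>. ((B u \<omega> - B s \<omega>)\<^sup>2)\<^sup>2)"
      unfolding p4 using increment_moment(1)[of s u 4] u assms by simp
  next
    fix \<omega> assume "\<omega> \<in> space M"
    then have "continuous_on {s..t} (\<lambda>u. B u \<omega>)"
      using continuous_B continuous_on_subset[of "{0..}" _ "{s..t}"] assms by auto
    then show "continuous_on {s..t} (\<lambda>u. (B u \<omega> - B s \<omega>)\<^sup>2)" by (intro continuous_intros)
  next
    fix u v :: real and g :: "'a \<Rightarrow> real" assume uv: "s \<le> u" "u \<le> v" "v \<le> t" and g: "g \<in> borel_measurable (F u)"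
      "integrable M (\<lambda>\<omega>. (g \<omega>)\<^sup>2)" and g0: "\<And>\<omega>. \<omega> \<in> space M \<Longrightarrow> 0 \<le> g \<omega>"
    have u0: "0 \<le> u" using uv assms by simp
    have gM[measurable]: "g \<in> borel_measurable M" using measurable_F_M[OF g(1)] .
    have [measurable]: "B u \<in> borel_measurable M" "B s \<in> borel_measurable M" "B v \<in> borel_measurable M"
      using B_measurable uv assms by auto
    let ?k = "\<lambda>\<omega>. g \<omega> * (2 * (B u \<omega> - B s \<omega>))"
    have km: "?k \<in> borel_measurable (F u)"
    proof -
      have [measurable]: "B u \<in> borel_measurable (F u)" "B s \<in> borel_measurable (F u)"
        using adapted_B[of u] measurable_F_mono[OF adapted_B[of s], of u] uv assms by auto
      note g(1)[measurable]
      show ?thesis by measurable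
    qed
    have ki: "integrable M ?k"
    proof (rule integrable_mult_of_squares[OF gM _ g(2)])
      show "integrable M (\<lambda>\<omega>. (2 * (B u \<omega> - B s \<omega>))\<^sup>2)"
        unfolding power_mult_distrib using increment_moment(1)[of s u 2] uv assms
        by (intro integrable_mult_right) simp
    qed measurable
    have gi: "integrable M g" by (rule integrable_of_square[OF gM g(2)])
    have i: "integrable M (\<lambda>\<omega>. B v \<omega> - B u \<omega>)"
      using increment_moment(1)[of u v 1] u0 uv by simp
    have i2: "integrable M (\<lambda>\<omega>. (B v \<omega> - B u \<omega>)\<^sup>2)"
      using increment_moment(1)[of u v 2] u0 uv by simp
    note 1 = expectation_mult_increment[OF u0 uv(2) km ki, of "\<lambda>x. x", OF _ i]
    have i3: "integrable M (\<lambda>\<omega>. g \<omega> * (B v \<omega> - B u \<omega>)\<^sup>2)"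
      using expectation_mult_increment(1)[OF u0 uv(2) g(1) gi, of "\<lambda>x. x\<^sup>2", OF _ i2] by simp
    have "(\<integral>\<omega>. g \<omega> * ((B v \<omega> - B s \<omega>)\<^sup>2 - (B u \<omega> - B s \<omega>)\<^sup>2) \<partial>M)
        = (\<integral>\<omega>. ?k \<omega> * (B v \<omega> - B u \<omega>) + g \<omega> * (B v \<omega> - B u \<omega>)\<^sup>2 \<partial>M)"
      by (rule Bochner_Integration.integral_cong) (simp_all add: power2_eq_square algebra_simps)
    also have "\<dots> = (\<integral>\<omega>. ?k \<omega> * (B v \<omega> - B u \<omega>) \<partial>M) + (\<integral>\<omega>. g \<omega> * (B v \<omega> - B u \<omega>)\<^sup>2 \<partial>M)"
      using 1(1) i3 by (intro Bochner_Integration.integral_add) simp_all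
    also have "(\<integral>\<omega>. ?k \<omega> * (B v \<omega> - B u \<omega>) \<partial>M) = 0"
      using 1(2) increment_moment(2)[of u v] u0 uv by simp
    also have "0 \<le> 0 + (\<integral>\<omega>. g \<omega> * (B v \<omega> - B u \<omega>)\<^sup>2 \<partial>M)"
      using g0 by (auto intro!: integral_nonneg_AE)
    finally show "0 \<le> (\<integral>\<omega>. g \<omega> * ((B v \<omega> - B s \<omega>)\<^sup>2 - (B u \<omega> - B s \<omega>)\<^sup>2) \<partial>M)" .
  qed simp
  moreover have "4 * (\<integral>\<omega>. ((B t \<omega> - B s \<omega>)\<^sup>2)\<^sup>2 \<partial>M) = 12 * (t - s)\<^sup>2"
    unfolding p4 using increment_moment(3)[of s t] assms by simp
  ultimately show ?thesis unfolding p4 by simp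
qed

lemma exponential_maximal_moment:
  assumes "0 < t"
  shows "\<exists>W. integrable M W \<and> (\<forall>\<omega>. 0 \<le> W \<omega>) \<and> (\<integral>\<omega>. W \<omega> \<partial>M) \<le> 4 * exp (2 * p\<^sup>2 * t)
    \<and> (AE \<omega> in M. \<forall>u\<in>{0..t}. exp (2 * p * B u \<omega>) \<le> W \<omega>)"
proof -
  have p2: "(exp (p * x))\<^sup>2 = exp (2 * p * x)" for x :: real by (simp flip: exp_double)
  have B0: "B 0 \<omega> = 0" if "\<omega> \<in> space M" for \<omega> using B_zero[OF that] .
  have i2: "integrable M (\<lambda>\<omega>. exp (2 * p * B u \<omega>))" if "0 \<le> u" for u
    using increment_moment(4)[of 0 u "2 * p"] that
    by (subst Bochner_Integration.integrable_cong[OF refl, of _ _ "\<lambda>\<omega>. exp (2 * p * (B u \<omega> - B 0 \<omega>))"])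
      (simp_all add: B0)
  have "\<exists>W. integrable M W \<and> (\<forall>\<omega>. 0 \<le> W \<omega>)
    \<and> (\<integral>\<omega>. W \<omega> \<partial>M) \<le> 4 * (\<integral>\<omega>. (exp (p * B t \<omega>))\<^sup>2 \<partial>M)
    \<and> (AE \<omega> in M. \<forall>u\<in>{0..t}. (exp (p * B u \<omega>))\<^sup>2 \<le> W \<omega>)"
  proof (rule continuous_maximal_inequality[where Z = "\<lambda>u \<omega>. exp (p * B u \<omega>)", OF order_refl assms])
    fix u assume u: "0 \<le> u" "u \<le> t"
    note adapted_B[OF u(1), measurable]
    show "(\<lambda>\<omega>. exp (p * B u \<omega>)) \<in> borel_measurable (F u)" by measurable
    show "integrable M (\<lambda>\<omega>. (exp (p * B u \<omega>))\<^sup>2)" unfolding p2 using i2[OF u(1)] .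
  next
    fix \<omega> assume "\<omega> \<in> space M"
    then have "continuous_on {0..t} (\<lambda>u. B u \<omega>)"
      using continuous_B continuous_on_subset[of "{0..}" _ "{0..t}"] by auto
    then show "continuous_on {0..t} (\<lambda>u. exp (p * B u \<omega>))" by (intro continuous_intros)
  next
    fix u v :: real and g :: "'a \<Rightarrow> real" assume u0: "0 \<le> u" and uv: "u \<le> v" "v \<le> t" and g: "g \<in> borel_measurable (F u)"
      "integrable M (\<lambda>\<omega>. (g \<omega>)\<^sup>2)" and g0: "\<And>\<omega>. \<omega> \<in> space M \<Longrightarrow> 0 \<le> g \<omega>"
    let ?k = "\<lambda>\<omega>. g \<omega> * exp (p * B u \<omega>)"
    have km: "?k \<in> borel_measurable (F u)"
    proof -
      note adapted_B[OF u0, measurable] g(1)[measurable]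
      show ?thesis by measurable
    qed
    have ki: "integrable M ?k"
    proof (rule integrable_mult_of_squares)
      show "g \<in> borel_measurable M" using measurable_F_M[OF g(1)] .
      show "(\<lambda>\<omega>. exp (p * B u \<omega>)) \<in> borel_measurable M" using B_measurable[OF u0] by simp
      show "integrable M (\<lambda>\<omega>. (exp (p * B u \<omega>))\<^sup>2)" unfolding p2 using i2[OF u0] .
    qed (rule g(2))
    have e1: "integrable M (\<lambda>\<omega>. exp (p * (B v \<omega> - B u \<omega>)))"
      using increment_moment(4)[of u v p] u0 uv by simp
    then have i: "integrable M (\<lambda>\<omega>. exp (p * (B v \<omega> - B u \<omega>)) - 1)" by simp
    have "(\<integral>\<omega>. g \<omega> * (exp (p * B v \<omega>) - exp (p * B u \<omega>)) \<partial>M)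
        = (\<integral>\<omega>. ?k \<omega> * (exp (p * (B v \<omega> - B u \<omega>)) - 1) \<partial>M)"
      by (rule Bochner_Integration.integral_cong) (simp_all add: algebra_simps flip: exp_add)
    also have "\<dots> = (\<integral>\<omega>. ?k \<omega> \<partial>M) * (\<integral>\<omega>. exp (p * (B v \<omega> - B u \<omega>)) - 1 \<partial>M)"
      using expectation_mult_increment(2)[OF u0 uv(1) km ki, of "\<lambda>x. exp (p * x) - 1", OF _ i] by simp
    also have "(\<integral>\<omega>. exp (p * (B v \<omega> - B u \<omega>)) - 1 \<partial>M) = exp (p\<^sup>2 * (v - u) / 2) - 1"
      using e1 increment_moment(5)[of u v p] u0 uv by (simp add: prob_space)
    finally have "(\<integral>\<omega>. g \<omega> * (exp (p * B v \<omega>) - exp (p * B u \<omega>)) \<partial>M)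
        = (\<integral>\<omega>. ?k \<omega> \<partial>M) * (exp (p\<^sup>2 * (v - u) / 2) - 1)" .
    moreover have "0 \<le> (\<integral>\<omega>. ?k \<omega> \<partial>M)" using g0 by (auto intro!: integral_nonneg_AE)
    ultimately show "0 \<le> (\<integral>\<omega>. g \<omega> * (exp (p * B v \<omega>) - exp (p * B u \<omega>)) \<partial>M)" using uv by simp
  qed simp
  moreover have "(\<integral>\<omega>. exp (2 * p * B t \<omega>) \<partial>M) = exp (2 * p\<^sup>2 * t)"
  proof -
    have "(\<integral>\<omega>. exp (2 * p * B t \<omega>) \<partial>M) = (\<integral>\<omega>. exp (2 * p * (B t \<omega> - B 0 \<omega>)) \<partial>M)"
      by (rule Bochner_Integration.integral_cong) (simp_all add: B0)
    then show ?thesis using increment_moment(5)[of 0 t "2 * p"] assms by (simp add: power_mult_distrib)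
  qed
  ultimately show ?thesis unfolding p2 by simp
qed

text \<open>
  Local domination by an integrable variable is part of the notion, so that optional stopping reduces to dominated convergence.
\<close>

definition dominated_martingale :: "(real \<Rightarrow> 'a \<Rightarrow> real) \<Rightarrow> bool" where
  "dominated_martingale N \<longleftrightarrow>
     (\<forall>t\<ge>0. N t \<in> borel_measurable (F t)) \<and>
     (\<forall>\<omega>\<in>space M. continuous_on {0..} (\<lambda>t. N t \<omega>)) \<and>
     (\<forall>K>0. \<exists>W. integrable M W \<and> (AE \<omega> in M. \<forall>u\<in>{0..K}. \<bar>N u \<omega>\<bar> \<le> W \<omega>)) \<and>
     (\<forall>s t A. 0 \<le> s \<longrightarrow> s \<le> t \<longrightarrow> A \<in> sets (F s) \<longrightarrow>
        (\<integral>\<omega>. indicator A \<omega> * N t \<omega> \<partial>M) = (\<integral>\<omega>. indicator A \<omega> * N s \<omega> \<partial>M))"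

lemma dominated_martingaleD:
  assumes "dominated_martingale N"
  shows "0 \<le> t \<Longrightarrow> N t \<in> borel_measurable (F t)"
    and "\<omega> \<in> space M \<Longrightarrow> continuous_on {0..} (\<lambda>t. N t \<omega>)"
    and "0 < K \<Longrightarrow> \<exists>W. integrable M W \<and> (AE \<omega> in M. \<forall>u\<in>{0..K}. \<bar>N u \<omega>\<bar> \<le> W \<omega>)"
    and "0 \<le> s \<Longrightarrow> s \<le> t \<Longrightarrow> A \<in> sets (F s) \<Longrightarrow>
      (\<integral>\<omega>. indicator A \<omega> * N t \<omega> \<partial>M) = (\<integral>\<omega>. indicator A \<omega> * N s \<omega> \<partial>M)"
proof -
  note D = assms[unfolded dominated_martingale_def]
  note D1 = D[THEN conjunct1] and D2 = D[THEN conjunct2]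
  note D3 = D2[THEN conjunct2]
  show "0 \<le> t \<Longrightarrow> N t \<in> borel_measurable (F t)" by (rule D1[rule_format])
  show "\<omega> \<in> space M \<Longrightarrow> continuous_on {0..} (\<lambda>t. N t \<omega>)"
    by (rule D2[THEN conjunct1, rule_format])
  show "0 < K \<Longrightarrow> \<exists>W. integrable M W \<and> (AE \<omega> in M. \<forall>u\<in>{0..K}. \<bar>N u \<omega>\<bar> \<le> W \<omega>)"
    by (rule D3[THEN conjunct1, rule_format])
  show "0 \<le> s \<Longrightarrow> s \<le> t \<Longrightarrow> A \<in> sets (F s) \<Longrightarrow>
      (\<integral>\<omega>. indicator A \<omega> * N t \<omega> \<partial>M) = (\<integral>\<omega>. indicator A \<omega> * N s \<omega> \<partial>M)"
    by (rule D3[THEN conjunct2, rule_format])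
qed

lemma indicator_F: "A \<in> sets (F s) \<Longrightarrow> (indicator A :: 'a \<Rightarrow> real) \<in> borel_measurable (F s)"
  by simp

lemma indicator_integrable: "A \<in> sets (F s) \<Longrightarrow> integrable M (indicator A :: 'a \<Rightarrow> real)"
  using sets_F[of s] by (simp add: less_top[symmetric] subset_iff)

lemma indicator_square: "(indicator A \<omega> :: real)\<^sup>2 = indicator A \<omega>"
  by (simp add: indicator_def)

lemma dominated_martingale_B: "dominated_martingale B"
  unfolding dominated_martingale_def
proof (intro conjI allI impI ballI)
  fix K :: real assume K: "0 < K"
  obtain W where W: "integrable M W" "AE \<omega> in M. \<forall>u\<in>{0..K}. (B u \<omega> - B 0 \<omega>) ^ 4 \<le> W \<omega>"
    using increment_maximal_fourth_moment[of 0 K] K by auto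
  have "AE \<omega> in M. \<forall>u\<in>{0..K}. \<bar>B u \<omega>\<bar> \<le> 1 + W \<omega>"
    using W(2) AE_space
  proof eventually_elim
    case (elim \<omega>)
    show ?case
    proof
      fix u assume "u \<in> {0..K}"
      then have "(B u \<omega>) ^ 4 \<le> W \<omega>" using elim B_zero[of \<omega>] by auto
      moreover have "\<bar>B u \<omega>\<bar> \<le> 1 + (B u \<omega>) ^ 4"
      proof (cases "\<bar>B u \<omega>\<bar> \<le> 1")
        case False
        then have "\<bar>B u \<omega>\<bar> ^ 1 \<le> \<bar>B u \<omega>\<bar> ^ 4" by (intro power_increasing) auto
        then show ?thesis by simp
      qed (simp add: add_increasing2)
      ultimately show "\<bar>B u \<omega>\<bar> \<le> 1 + W \<omega>" by simp
    qed
  qed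
  then show "\<exists>W. integrable M W \<and> (AE \<omega> in M. \<forall>u\<in>{0..K}. \<bar>B u \<omega>\<bar> \<le> W \<omega>)"
    using W(1) by (intro exI[of _ "\<lambda>\<omega>. 1 + W \<omega>"]) simp
next
  fix s t A assume st: "(0::real) \<le> s" "s \<le> t" and A: "A \<in> sets (F s)"
  have iB: "integrable M (\<lambda>\<omega>. indicator A \<omega> * B u \<omega>)" if "0 \<le> u" for u
  proof (rule integrable_mult_of_squares)
    show "(indicator A :: 'a \<Rightarrow> real) \<in> borel_measurable M" using measurable_F_M[OF indicator_F[OF A]] .
    show "B u \<in> borel_measurable M" using B_measurable[OF that] .
    show "integrable M (\<lambda>\<omega>. (indicator A \<omega> :: real)\<^sup>2)"
      using indicator_integrable[OF A] by (simp add: indicator_square)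
    show "integrable M (\<lambda>\<omega>. (B u \<omega>)\<^sup>2)"
      using increment_moment(1)[of 0 u 2] that
      by (subst Bochner_Integration.integrable_cong[OF refl, of _ _ "\<lambda>\<omega>. (B u \<omega> - B 0 \<omega>)\<^sup>2"])
        (simp_all add: B_zero)
  qed
  have "(\<integral>\<omega>. indicator A \<omega> * (B t \<omega> - B s \<omega>) \<partial>M) = 0"
    using expectation_mult_increment(2)[OF st indicator_F[OF A] indicator_integrable[OF A], of "\<lambda>x. x"]
      increment_moment(1)[OF st, of 1] increment_moment(2)[OF st] by simp
  then show "(\<integral>\<omega>. indicator A \<omega> * B t \<omega> \<partial>M) = (\<integral>\<omega>. indicator A \<omega> * B s \<omega> \<partial>M)"
    using iB[of t] iB[of s] st by (simp add: right_diff_distrib)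
qed (simp_all add: adapted_B continuous_B)

lemma dominated_martingale_exp_X: "dominated_martingale (\<lambda>t \<omega>. exp (\<kappa> * X t \<omega>))"
  unfolding dominated_martingale_def
proof (intro conjI allI impI ballI)
  fix t :: real assume t: "0 \<le> t"
  note adapted_X[OF t, measurable]
  show "(\<lambda>\<omega>. exp (\<kappa> * X t \<omega>)) \<in> borel_measurable (F t)" by measurable
next
  fix \<omega> assume "\<omega> \<in> space M"
  then show "continuous_on {0..} (\<lambda>t. exp (\<kappa> * X t \<omega>))"
    by (intro continuous_intros continuous_X)
next
  fix K :: real assume K: "0 < K"
  obtain W where W: "integrable M W" "AE \<omega> in M. \<forall>u\<in>{0..K}. exp (2 * (\<kappa> / 2) * B u \<omega>) \<le> W \<omega>"
    using exponential_maximal_moment[OF K, of "\<kappa> / 2"] by auto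
  have "AE \<omega> in M. \<forall>u\<in>{0..K}. \<bar>exp (\<kappa> * X u \<omega>)\<bar> \<le> W \<omega>"
    using W(2)
  proof eventually_elim
    case (elim \<omega>)
    show ?case
    proof
      fix u assume u: "u \<in> {0..K}"
      have "\<kappa> * X u \<omega> \<le> \<kappa> * B u \<omega>"
        using u kappa_pos by (intro mult_left_mono) (auto simp: drifted_def)
      then have "exp (\<kappa> * X u \<omega>) \<le> exp (2 * (\<kappa> / 2) * B u \<omega>)" by simp
      also have "\<dots> \<le> W \<omega>" using elim u by (rule bspec)
      finally show "\<bar>exp (\<kappa> * X u \<omega>)\<bar> \<le> W \<omega>" by simp
    qed
  qed
  then show "\<exists>W. integrable M W \<and> (AE \<omega> in M. \<forall>u\<in>{0..K}. \<bar>exp (\<kappa> * X u \<omega>)\<bar> \<le> W \<omega>)"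
    using W(1) by blast
next
  fix s t A assume st: "(0::real) \<le> s" "s \<le> t" and A: "A \<in> sets (F s)"
  let ?g = "\<lambda>\<omega>. indicator A \<omega> * exp (\<kappa> * X s \<omega>) :: real"
  have gm: "?g \<in> borel_measurable (F s)"
  proof -
    note adapted_X[OF st(1), measurable] indicator_F[OF A, measurable]
    show ?thesis by measurable
  qed
  have gi: "integrable M ?g"
  proof (rule Bochner_Integration.integrable_bound)
    have "integrable M (\<lambda>\<omega>. exp (\<kappa> * (B s \<omega> - B 0 \<omega>)))"
      using increment_moment(4)[of 0 s \<kappa>] st by simp
    then show "integrable M (\<lambda>\<omega>. exp (\<kappa> * (B s \<omega> - B 0 \<omega>)))" .
    show "?g \<in> borel_measurable M" using measurable_F_M[OF gm] .
    show "AE \<omega> in M. norm (?g \<omega>) \<le> norm (exp (\<kappa> * (B s \<omega> - B 0 \<omega>)))"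
      using AE_space
    proof eventually_elim
      case (elim \<omega>)
      have "\<kappa> * X s \<omega> \<le> \<kappa> * (B s \<omega> - B 0 \<omega>)"
        using st kappa_pos elim by (intro mult_left_mono) (auto simp: drifted_def B_zero)
      then show ?case by (simp add: indicator_def)
    qed
  qed
  have "(\<integral>\<omega>. indicator A \<omega> * exp (\<kappa> * X t \<omega>) \<partial>M)
      = (\<integral>\<omega>. exp (- (\<kappa>\<^sup>2 * (t - s) / 2)) * (?g \<omega> * exp (\<kappa> * (B t \<omega> - B s \<omega>))) \<partial>M)"
  proof (rule Bochner_Integration.integral_cong[OF refl])
    fix \<omega>
    have "\<kappa> * X t \<omega> = - (\<kappa>\<^sup>2 * (t - s) / 2) + (\<kappa> * X s \<omega> + \<kappa> * (B t \<omega> - B s \<omega>))"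
      by (simp add: drifted_def power2_eq_square field_simps)
    then show "indicator A \<omega> * exp (\<kappa> * X t \<omega>) = exp (- (\<kappa>\<^sup>2 * (t - s) / 2)) * (?g \<omega> * exp (\<kappa> * (B t \<omega> - B s \<omega>)))"
      by (simp only: exp_add mult_ac)
  qed
  also have "\<dots> = exp (- (\<kappa>\<^sup>2 * (t - s) / 2)) * ((\<integral>\<omega>. ?g \<omega> \<partial>M) * exp (\<kappa>\<^sup>2 * (t - s) / 2))"
    using expectation_mult_increment(2)[OF st gm gi, of "\<lambda>x. exp (\<kappa> * x)"]
      increment_moment(4,5)[OF st, of \<kappa>] by simp
  also have "\<dots> = (\<integral>\<omega>. ?g \<omega> \<partial>M)" by (simp add: exp_minus)
  finally show "(\<integral>\<omega>. indicator A \<omega> * exp (\<kappa> * X t \<omega>) \<partial>M) = (\<integral>\<omega>. indicator A \<omega> * exp (\<kappa> * X s \<omega>) \<partial>M)" .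
qed

end

section \<open>Optional stopping\<close>

lemma grid_ceiling:
  fixes x d :: real
  assumes "0 < d" "0 \<le> x"
  shows "x \<le> d * real (nat \<lceil>x / d\<rceil>)" "d * real (nat \<lceil>x / d\<rceil>) \<le> x + d"
proof -
  have "0 \<le> x / d" using assms by simp
  then have r: "x / d \<le> real (nat \<lceil>x / d\<rceil>)" "real (nat \<lceil>x / d\<rceil>) \<le> x / d + 1"
    by linarith+
  from mult_left_mono[OF r(1), of d] show "x \<le> d * real (nat \<lceil>x / d\<rceil>)" using assms by simp
  from mult_left_mono[OF r(2), of d] show "d * real (nat \<lceil>x / d\<rceil>) \<le> x + d"
    using assms by (simp add: distrib_left)
qed

lemma grid_ceiling_tendsto:
  fixes x :: real
  assumes "0 \<le> x"
  shows "(\<lambda>m. 1 / real (Suc m) * real (nat \<lceil>x / (1 / real (Suc m))\<rceil>)) \<longlonglongrightarrow> x"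
proof (rule tendsto_sandwich)
  show "(\<lambda>_. x) \<longlonglongrightarrow> x" by simp
  have "(\<lambda>m. x + 1 / real (Suc m)) \<longlonglongrightarrow> x + 0"
    by (intro tendsto_add tendsto_const LIMSEQ_Suc[OF lim_const_over_n])
  then show "(\<lambda>m. x + 1 / real (Suc m)) \<longlonglongrightarrow> x" by simp
qed (intro always_eventually allI grid_ceiling; use assms in simp)+

context filtered_bm begin

lemma stopping_time_measurable_min:
  assumes "stopping_time F \<sigma>"
  shows "(\<lambda>\<omega>. min (\<sigma> \<omega>) t) \<in> borel_measurable (F t)"
proof (rule borel_measurableI_le)
  fix a
  show "{\<omega> \<in> space (F t). min (\<sigma> \<omega>) t \<le> a} \<in> sets (F t)"
  proof (cases "t \<le> a")
    case True
    then have "{\<omega> \<in> space (F t). min (\<sigma> \<omega>) t \<le> a} = space (F t)" by (auto simp: min_le_iff_disj)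
    then show ?thesis by simp
  next
    case False
    then have "{\<omega> \<in> space (F t). min (\<sigma> \<omega>) t \<le> a} = {\<omega> \<in> space (F t). \<sigma> \<omega> \<le> a}"
      by (auto simp: min_le_iff_disj)
    moreover have "{\<omega> \<in> space (F t). \<sigma> \<omega> \<le> a} \<in> sets (F t)"
      using stopping_time_le_const[OF assms, of a t] False by (simp add: pred_def)
    ultimately show ?thesis by simp
  qed
qed

text \<open>
  The stopped time is approximated from above on a grid. Capping the grid times at \<open>t\<close> keeps the approximations
  measurable at time \<open>t\<close>.
\<close>

lemma measurable_stopped:
  fixes N :: "real \<Rightarrow> 'a \<Rightarrow> real"
  assumes \<sigma>: "stopping_time F \<sigma>" and \<sigma>0: "\<And>\<omega>. \<omega> \<in> space M \<Longrightarrow> 0 \<le> \<sigma> \<omega>"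
    and N: "\<And>t. 0 \<le> t \<Longrightarrow> N t \<in> borel_measurable (F t)"
    and cont: "\<And>\<omega>. \<omega> \<in> space M \<Longrightarrow> continuous_on {0..} (\<lambda>t. N t \<omega>)"
    and t: "0 \<le> t"
  shows "(\<lambda>\<omega>. N (min (\<sigma> \<omega>) t) \<omega>) \<in> borel_measurable (F t)"
proof -
  define c where "c \<omega> = min (\<sigma> \<omega>) t" for \<omega>
  have c[measurable]: "c \<in> borel_measurable (F t)"
    unfolding c_def[abs_def] by (rule stopping_time_measurable_min[OF \<sigma>])
  define j where "j m \<omega> = nat \<lceil>c \<omega> / (1 / real (Suc m))\<rceil>" for m \<omega>
  have jm: "j m \<in> measurable (F t) (count_space UNIV)" for m
    unfolding j_def[abs_def] by measurable
  define u where "u m i = min (1 / real (Suc m) * real i) t" for m and i :: nat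
  have um: "(\<lambda>\<omega>. N (u m (j m \<omega>)) \<omega>) \<in> borel_measurable (F t)" for m
  proof (rule measurable_compose_countable[OF _ jm])
    fix i
    have "0 \<le> u m i" "u m i \<le> t" using t by (auto simp: u_def)
    then show "(\<lambda>\<omega>. N (u m i) \<omega>) \<in> borel_measurable (F t)"
      using measurable_F_mono[OF N[of "u m i"], of t] by simp
  qed
  have "(\<lambda>\<omega>. N (c \<omega>) \<omega>) \<in> borel_measurable (F t)"
  proof (rule borel_measurable_LIMSEQ_real[OF _ um])
    fix \<omega> assume "\<omega> \<in> space (F t)"
    then have \<omega>: "\<omega> \<in> space M" by (simp add: space_F)
    have c0: "0 \<le> c \<omega>" using \<sigma>0[OF \<omega>] t by (simp add: c_def)
    have "(\<lambda>m. u m (j m \<omega>)) \<longlonglongrightarrow> min (c \<omega>) t"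
      unfolding u_def j_def by (intro tendsto_min tendsto_const grid_ceiling_tendsto c0)
    then have "(\<lambda>m. u m (j m \<omega>)) \<longlonglongrightarrow> c \<omega>" by (simp add: c_def)
    then show "(\<lambda>m. N (u m (j m \<omega>)) \<omega>) \<longlonglongrightarrow> N (c \<omega>) \<omega>"
      by (rule continuous_on_tendsto_compose[OF cont[OF \<omega>]])
        (use c0 t in \<open>auto simp: u_def\<close>)
  qed
  then show ?thesis by (simp add: c_def)
qed

lemma measurable_at_stopping_time:
  fixes N :: "real \<Rightarrow> 'a \<Rightarrow> real"
  assumes \<sigma>: "stopping_time F \<sigma>" and \<sigma>0: "\<And>\<omega>. \<omega> \<in> space M \<Longrightarrow> 0 \<le> \<sigma> \<omega>"
    and N: "\<And>t. 0 \<le> t \<Longrightarrow> N t \<in> borel_measurable (F t)"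
    and cont: "\<And>\<omega>. \<omega> \<in> space M \<Longrightarrow> continuous_on {0..} (\<lambda>t. N t \<omega>)"
  shows "(\<lambda>\<omega>. N (\<sigma> \<omega>) \<omega>) \<in> borel_measurable (pre_sigma \<sigma>)"
proof (rule borel_measurableI_le, rule sets_pre_sigmaI[OF \<sigma>])
  fix a t
  show "{\<omega> \<in> {\<omega> \<in> space (pre_sigma \<sigma>). N (\<sigma> \<omega>) \<omega> \<le> a}. \<sigma> \<omega> \<le> t} \<in> sets (F t)"
  proof (cases "0 \<le> t")
    case True
    note measurable_stopped[OF \<sigma> \<sigma>0 N cont True, measurable] stopping_timeD[OF \<sigma>, measurable]
    have "{\<omega> \<in> {\<omega> \<in> space (pre_sigma \<sigma>). N (\<sigma> \<omega>) \<omega> \<le> a}. \<sigma> \<omega> \<le> t}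
      = {\<omega> \<in> space (F t). N (min (\<sigma> \<omega>) t) \<omega> \<le> a \<and> \<sigma> \<omega> \<le> t}"
      by (auto simp: space_pre_sigma space_F min_def)
    also have "\<dots> \<in> sets (F t)" by measurable
    finally show ?thesis .
  next
    case False
    then have "{\<omega> \<in> {\<omega> \<in> space (pre_sigma \<sigma>). N (\<sigma> \<omega>) \<omega> \<le> a}. \<sigma> \<omega> \<le> t} = {}"
      using \<sigma>0 by (force simp: space_pre_sigma)
    then show ?thesis by (simp only: sets.empty_sets)
  qed
qed

lemma pre_sigma_subset_M:
  assumes "stopping_time F \<sigma>"
  shows "sets (pre_sigma \<sigma>) \<subseteq> sets M"
proof
  fix A assume A: "A \<in> sets (pre_sigma \<sigma>)"
  have "A \<subseteq> space M" using sets.sets_into_space[OF A] by (simp add: space_pre_sigma)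
  have "{\<omega> \<in> A. \<sigma> \<omega> \<le> real n} \<in> sets M" for n
    using sets_pre_sigmaD[OF assms A, of "real n"] sets_F[of "real n"] by (rule rev_subsetD)
  then have "(\<Union>n. {\<omega> \<in> A. \<sigma> \<omega> \<le> real n}) \<in> sets M" by (intro sets.countable_UN) auto
  moreover have "(\<Union>n. {\<omega> \<in> A. \<sigma> \<omega> \<le> real n}) = A" using real_arch_simple by auto
  ultimately show "A \<in> sets M" by simp
qed

lemma subalgebra_pre_sigma: "stopping_time F \<sigma> \<Longrightarrow> subalgebra M (pre_sigma \<sigma>)"
  unfolding subalgebra_def by (simp add: pre_sigma_subset_M space_pre_sigma)

lemma measurable_pre_sigma_M:
  "stopping_time F \<sigma> \<Longrightarrow> f \<in> borel_measurable (pre_sigma \<sigma>) \<Longrightarrow> f \<in> borel_measurable M"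
  by (rule measurable_from_subalg[OF subalgebra_pre_sigma])

text \<open>
  Rounding \<open>\<rho>\<close> up to a grid gives a stopping time with finitely many values, for which the claim is a finite sum over the
  events \<open>C j\<close> on which the \<open>j\<close>-th grid time is taken. The comparison takes place at \<open>K + 1\<close>, which still bounds the rounded
  times as the mesh is at most \<open>1\<close>.
\<close>

lemma optional_stopping_terminal:
  assumes N: "dominated_martingale N"
    and \<rho>: "stopping_time F \<rho>" "\<And>\<omega>. \<omega> \<in> space M \<Longrightarrow> 0 \<le> \<rho> \<omega> \<and> \<rho> \<omega> \<le> K"
    and A: "A \<in> sets (pre_sigma \<rho>)" and K: "0 \<le> K"
  shows "integrable M (\<lambda>\<omega>. N (\<rho> \<omega>) \<omega>)"
    and "(\<integral>\<omega>. indicator A \<omega> * N (\<rho> \<omega>) \<omega> \<partial>M) = (\<integral>\<omega>. indicator A \<omega> * N (K + 1) \<omega> \<partial>M)"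
proof -
  note ND = dominated_martingaleD[OF N]
  have NM: "N t \<in> borel_measurable M" if "0 \<le> t" for t
    using measurable_F_M[OF ND(1)[OF that]] .
  obtain W where W: "integrable M W" "AE \<omega> in M. \<forall>u\<in>{0..K + 1}. \<bar>N u \<omega>\<bar> \<le> W \<omega>"
    using ND(3)[of "K + 1"] K by auto
  have AM: "A \<in> sets M" using A pre_sigma_subset_M[OF \<rho>(1)] by (rule rev_subsetD)
  have iN: "integrable M (N t)" if "0 \<le> t" "t \<le> K + 1" for t
  proof (rule Bochner_Integration.integrable_bound[OF W(1) NM[OF that(1)]])
    show "AE \<omega> in M. norm (N t \<omega>) \<le> norm (W \<omega>)"
      using W(2)
    proof eventually_elim
      case (elim \<omega>)
      have "\<bar>N t \<omega>\<bar> \<le> W \<omega>" using elim that by simp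
      then show ?case by simp
    qed
  qed
  define d where "d m = 1 / real (Suc m)" for m
  define \<rho>' where "\<rho>' m \<omega> = d m * real (nat \<lceil>\<rho> \<omega> / d m\<rceil>)" for m \<omega>
  have d: "0 < d m" "d m \<le> 1" for m by (simp_all add: d_def field_simps)
  have \<rho>'b: "0 \<le> \<rho>' m \<omega>" "\<rho>' m \<omega> \<le> K + 1" if "\<omega> \<in> space M" for m \<omega>
  proof -
    show "0 \<le> \<rho>' m \<omega>" using d(1)[of m] by (simp add: \<rho>'_def)
    have "\<rho>' m \<omega> \<le> \<rho> \<omega> + d m" unfolding \<rho>'_def using \<rho>(2)[OF that] d by (intro grid_ceiling) auto
    then show "\<rho>' m \<omega> \<le> K + 1" using \<rho>(2)[OF that] d(2)[of m] by linarith
  qed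
  have \<rho>M: "\<rho> \<in> borel_measurable M"
    by (rule measurable_stopping_time[OF \<rho>(1) sets_F space_F])
  have jm: "(\<lambda>\<omega>. nat \<lceil>\<rho> \<omega> / d m\<rceil>) \<in> measurable M (count_space UNIV)" for m
    using \<rho>M by measurable
  have N'm: "(\<lambda>\<omega>. N (\<rho>' m \<omega>) \<omega>) \<in> borel_measurable M" for m
    unfolding \<rho>'_def
    by (rule measurable_compose_countable[OF _ jm]) (use NM d(1)[of m] in \<open>simp add: less_imp_le\<close>)
  have lim: "(\<lambda>m. N (\<rho>' m \<omega>) \<omega>) \<longlonglongrightarrow> N (\<rho> \<omega>) \<omega>" if \<omega>: "\<omega> \<in> space M" for \<omega>
  proof (rule continuous_on_tendsto_compose[OF ND(2)[OF \<omega>]])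
    show "(\<lambda>m. \<rho>' m \<omega>) \<longlonglongrightarrow> \<rho> \<omega>"
      unfolding \<rho>'_def d_def using \<rho>(2)[OF \<omega>] by (intro grid_ceiling_tendsto) simp
  qed (use \<rho>(2)[OF \<omega>] \<rho>'b[OF \<omega>] in auto)
  have N\<rho>m: "(\<lambda>\<omega>. N (\<rho> \<omega>) \<omega>) \<in> borel_measurable M"
    by (rule borel_measurable_LIMSEQ_real[OF lim N'm])
  show "integrable M (\<lambda>\<omega>. N (\<rho> \<omega>) \<omega>)"
  proof (rule Bochner_Integration.integrable_bound[OF W(1) N\<rho>m])
    show "AE \<omega> in M. norm (N (\<rho> \<omega>) \<omega>) \<le> norm (W \<omega>)"
      using W(2) AE_space
    proof eventually_elim
      case (elim \<omega>)
      have "\<bar>N (\<rho> \<omega>) \<omega>\<bar> \<le> W \<omega>" using elim(1) \<rho>(2)[OF elim(2)] by simp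
      then show ?case by simp
    qed
  qed
  have eq: "(\<integral>\<omega>. indicator A \<omega> * N (\<rho>' m \<omega>) \<omega> \<partial>M) = (\<integral>\<omega>. indicator A \<omega> * N (K + 1) \<omega> \<partial>M)" for m
  proof -
    define J where "J = nat \<lfloor>(K + 1) / d m\<rfloor>"
    have Jb: "d m * real j \<le> K + 1" if "j \<le> J" for j
    proof -
      have "0 \<le> (K + 1) / d m" using K d(1)[of m] by simp
      then have "real j \<le> (K + 1) / d m" using that unfolding J_def by linarith
      from mult_left_mono[OF this, of "d m"] show ?thesis using d(1)[of m] by simp
    qed
    define C where "C j = {\<omega> \<in> A. nat \<lceil>\<rho> \<omega> / d m\<rceil> = j}" for j
    have Cset: "C j \<in> sets (F (d m * real j))" for j
    proof -
      have 1: "{\<omega> \<in> A. \<rho> \<omega> \<le> d m * real j} \<in> sets (F (d m * real j))"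
        by (rule sets_pre_sigmaD[OF \<rho>(1) A])
      have le_iff: "nat \<lceil>x / d m\<rceil> \<le> i \<longleftrightarrow> x \<le> d m * real i" for x i
        using d(1)[of m] by (simp add: ceiling_le_iff pos_divide_le_eq mult.commute)
      show ?thesis
      proof (cases j)
        case 0
        have "C j = {\<omega> \<in> A. \<rho> \<omega> \<le> d m * real j}"
          unfolding C_def using le_iff[of _ 0] by (simp add: 0)
        then show ?thesis using 1 by simp
      next
        case (Suc i)
        have 2: "{\<omega> \<in> A. \<rho> \<omega> \<le> d m * real i} \<in> sets (F (d m * real j))"
          using sets_pre_sigmaD[OF \<rho>(1) A, of "d m * real i"] sets_F_mono[of "d m * real i" "d m * real j"] d(1)[of m]
          by (auto simp: Suc)
        have "(nat \<lceil>x / d m\<rceil> = j) = (x \<le> d m * real j \<and> \<not> x \<le> d m * real i)" for x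
          unfolding le_iff[symmetric] Suc by linarith
        then have "C j = {\<omega> \<in> A. \<rho> \<omega> \<le> d m * real j} - {\<omega> \<in> A. \<rho> \<omega> \<le> d m * real i}"
          unfolding C_def by auto
        then show ?thesis using 1 2 by simp
      qed
    qed
    have CM: "C j \<in> sets M" for j using Cset sets_F by (rule rev_subsetD)
    have sumC: "indicator A \<omega> * y (nat \<lceil>\<rho> \<omega> / d m\<rceil>) = (\<Sum>j\<le>J. indicator (C j) \<omega> * (y j :: real))"
      if \<omega>: "\<omega> \<in> space M" for \<omega> y
    proof -
      have "\<rho>' m \<omega> \<le> K + 1" using \<rho>'b[OF \<omega>] by simp
      then have "real (nat \<lceil>\<rho> \<omega> / d m\<rceil>) \<le> (K + 1) / d m"
        using d(1)[of m] by (simp add: \<rho>'_def pos_le_divide_eq mult.commute)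
      then have le: "nat \<lceil>\<rho> \<omega> / d m\<rceil> \<le> J" unfolding J_def by linarith
      have "(\<Sum>j\<le>J. indicator (C j) \<omega> * y j) = (\<Sum>j\<in>{nat \<lceil>\<rho> \<omega> / d m\<rceil>}. indicator (C j) \<omega> * y j)"
        by (rule sum.mono_neutral_right) (use le in \<open>auto simp: C_def indicator_def\<close>)
      then show ?thesis by (simp add: C_def indicator_def)
    qed
    have icN: "integrable M (\<lambda>\<omega>. indicator (C j) \<omega> * N t \<omega>)" if "0 \<le> t" "t \<le> K + 1" for j t
      using integrable_mult_indicator[OF CM iN[OF that]] by simp
    have "(\<integral>\<omega>. indicator A \<omega> * N (\<rho>' m \<omega>) \<omega> \<partial>M) = (\<integral>\<omega>. (\<Sum>j\<le>J. indicator (C j) \<omega> * N (d m * real j) \<omega>) \<partial>M)"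
      unfolding \<rho>'_def
      by (rule Bochner_Integration.integral_cong[OF refl]) (rule sumC)
    also have "\<dots> = (\<Sum>j\<le>J. (\<integral>\<omega>. indicator (C j) \<omega> * N (d m * real j) \<omega> \<partial>M))"
      using Jb d(1)[of m] by (intro Bochner_Integration.integral_sum icN) auto
    also have "\<dots> = (\<Sum>j\<le>J. (\<integral>\<omega>. indicator (C j) \<omega> * N (K + 1) \<omega> \<partial>M))"
    proof (rule sum.cong[OF refl])
      fix j assume "j \<in> {..J}"
      then show "(\<integral>\<omega>. indicator (C j) \<omega> * N (d m * real j) \<omega> \<partial>M) = (\<integral>\<omega>. indicator (C j) \<omega> * N (K + 1) \<omega> \<partial>M)"
        using Jb[of j] d(1)[of m] by (intro ND(4)[symmetric] Cset) auto
    qed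
    also have "\<dots> = (\<integral>\<omega>. (\<Sum>j\<le>J. indicator (C j) \<omega> * N (K + 1) \<omega>) \<partial>M)"
      using K by (intro Bochner_Integration.integral_sum[symmetric] icN) auto
    also have "\<dots> = (\<integral>\<omega>. indicator A \<omega> * N (K + 1) \<omega> \<partial>M)"
      by (rule Bochner_Integration.integral_cong[OF refl]) (rule sumC[symmetric])
    finally show ?thesis .
  qed
  have "(\<lambda>m. \<integral>\<omega>. indicator A \<omega> * N (\<rho>' m \<omega>) \<omega> \<partial>M) \<longlonglongrightarrow> (\<integral>\<omega>. indicator A \<omega> * N (\<rho> \<omega>) \<omega> \<partial>M)"
  proof (rule integral_dominated_convergence[OF _ _ W(1)])
    show "(\<lambda>\<omega>. indicator A \<omega> * N (\<rho> \<omega>) \<omega>) \<in> borel_measurable M"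
      using AM N\<rho>m by measurable
    show "(\<lambda>\<omega>. indicator A \<omega> * N (\<rho>' m \<omega>) \<omega>) \<in> borel_measurable M" for m
      using AM N'm[of m] by measurable
    show "AE \<omega> in M. (\<lambda>m. indicator A \<omega> * N (\<rho>' m \<omega>) \<omega>) \<longlonglongrightarrow> indicator A \<omega> * N (\<rho> \<omega>) \<omega>"
      by (rule AE_I2) (intro tendsto_mult tendsto_const lim)
    show "AE \<omega> in M. norm (indicator A \<omega> * N (\<rho>' m \<omega>) \<omega>) \<le> W \<omega>" for m
      using W(2) AE_space
    proof eventually_elim
      case (elim \<omega>)
      have "\<bar>N (\<rho>' m \<omega>) \<omega>\<bar> \<le> W \<omega>" using elim(1) \<rho>'b[OF elim(2), of m] by simp
      then show ?case by (auto simp: indicator_def)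
    qed
  qed
  then show "(\<integral>\<omega>. indicator A \<omega> * N (\<rho> \<omega>) \<omega> \<partial>M) = (\<integral>\<omega>. indicator A \<omega> * N (K + 1) \<omega> \<partial>M)"
    unfolding eq by (simp add: LIMSEQ_const_iff)
qed

text \<open>
  Both times are truncated at \<open>k\<close>, on the part of \<open>A\<close> where \<open>\<sigma> \<le> k\<close>, so that \<open>\<sigma>\<close> itself is unchanged there; then \<open>k\<close> tends to infinity.
\<close>

lemma optional_stopping:
  assumes N: "dominated_martingale N"
    and \<sigma>: "stopping_time F \<sigma>" and \<rho>: "stopping_time F \<rho>"
    and order: "\<And>\<omega>. \<omega> \<in> space M \<Longrightarrow> 0 \<le> \<sigma> \<omega> \<and> \<sigma> \<omega> \<le> \<rho> \<omega>"
    and A: "A \<in> sets (pre_sigma \<sigma>)"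
    and Z: "integrable M Z"
      "\<And>\<omega> u. \<omega> \<in> space M \<Longrightarrow> \<sigma> \<omega> \<le> u \<Longrightarrow> u \<le> \<rho> \<omega> \<Longrightarrow> \<bar>N u \<omega> - N (\<sigma> \<omega>) \<omega>\<bar> \<le> Z \<omega>"
  shows "integrable M (\<lambda>\<omega>. N (\<rho> \<omega>) \<omega> - N (\<sigma> \<omega>) \<omega>)"
    and "(\<integral>\<omega>. indicator A \<omega> * (N (\<rho> \<omega>) \<omega> - N (\<sigma> \<omega>) \<omega>) \<partial>M) = 0"
proof -
  note ND = dominated_martingaleD[OF N]
  have AM: "A \<in> sets M" using A pre_sigma_subset_M[OF \<sigma>] by (rule rev_subsetD)
  have N\<rho>: "(\<lambda>\<omega>. N (\<rho> \<omega>) \<omega>) \<in> borel_measurable M"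
    by (rule measurable_pre_sigma_M[OF \<rho> measurable_at_stopping_time[OF \<rho> _ ND(1) ND(2)]])
      (use order in force)+
  have N\<sigma>: "(\<lambda>\<omega>. N (\<sigma> \<omega>) \<omega>) \<in> borel_measurable M"
    by (rule measurable_pre_sigma_M[OF \<sigma> measurable_at_stopping_time[OF \<sigma> _ ND(1) ND(2)]])
      (use order in force)+
  show "integrable M (\<lambda>\<omega>. N (\<rho> \<omega>) \<omega> - N (\<sigma> \<omega>) \<omega>)"
  proof (rule Bochner_Integration.integrable_bound[OF Z(1)])
    show "(\<lambda>\<omega>. N (\<rho> \<omega>) \<omega> - N (\<sigma> \<omega>) \<omega>) \<in> borel_measurable M" using N\<rho> N\<sigma> by measurable
    show "AE \<omega> in M. norm (N (\<rho> \<omega>) \<omega> - N (\<sigma> \<omega>) \<omega>) \<le> norm (Z \<omega>)"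
    proof (rule AE_I2)
      fix \<omega> assume "\<omega> \<in> space M"
      then show "norm (N (\<rho> \<omega>) \<omega> - N (\<sigma> \<omega>) \<omega>) \<le> norm (Z \<omega>)"
        using Z(2)[of \<omega> "\<rho> \<omega>"] order[of \<omega>] by simp
    qed
  qed
  define \<sigma>' where "\<sigma>' k \<omega> = min (\<sigma> \<omega>) (real k)" for k \<omega>
  define \<rho>' where "\<rho>' k \<omega> = min (\<rho> \<omega>) (real k)" for k \<omega>
  define A' where "A' k = {\<omega> \<in> A. \<sigma> \<omega> \<le> real k}" for k
  have st: "stopping_time F (\<sigma>' k)" "stopping_time F (\<rho>' k)" for k
    unfolding \<sigma>'_def[abs_def] \<rho>'_def[abs_def]
    by (intro stopping_time_min \<sigma> \<rho> stopping_time_const)+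
  have b: "0 \<le> \<sigma>' k \<omega> \<and> \<sigma>' k \<omega> \<le> real k" "0 \<le> \<rho>' k \<omega> \<and> \<rho>' k \<omega> \<le> real k" "\<sigma>' k \<omega> \<le> \<rho>' k \<omega>"
    if "\<omega> \<in> space M" for k \<omega>
    using order[OF that] by (auto simp: \<sigma>'_def \<rho>'_def)
  have A's: "A' k \<in> sets (pre_sigma (\<sigma>' k))" for k
  proof (rule sets_pre_sigmaI[OF st(1)])
    fix t
    have "{\<omega> \<in> A' k. \<sigma>' k \<omega> \<le> t} = {\<omega> \<in> A. \<sigma> \<omega> \<le> min t (real k)}"
      by (auto simp: A'_def \<sigma>'_def min_le_iff_disj)
    moreover have "{\<omega> \<in> A. \<sigma> \<omega> \<le> min t (real k)} \<in> sets (F (min t (real k)))"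
      by (rule sets_pre_sigmaD[OF \<sigma> A])
    moreover have "sets (F (min t (real k))) \<subseteq> sets (F t)" by (rule sets_F_mono) simp
    ultimately show "{\<omega> \<in> A' k. \<sigma>' k \<omega> \<le> t} \<in> sets (F t)" by auto
  qed
  have A's2: "A' k \<in> sets (pre_sigma (\<rho>' k))" for k
    using mono_pre_sigma[OF st b(3)] A's[of k] by auto
  have A'M: "A' k \<in> sets M" for k using A's[of k] pre_sigma_subset_M[OF st(1)] by (rule rev_subsetD)
  have z: "(\<integral>\<omega>. indicator (A' k) \<omega> * (N (\<rho>' k \<omega>) \<omega> - N (\<sigma>' k \<omega>) \<omega>) \<partial>M) = 0" for k
  proof -
    note 1 = optional_stopping_terminal[OF N st(1) b(1) A's]
      and 2 = optional_stopping_terminal[OF N st(2) b(2) A's2]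
    have "integrable M (\<lambda>\<omega>. indicator (A' k) \<omega> * N (\<rho>' k \<omega>) \<omega>)"
      "integrable M (\<lambda>\<omega>. indicator (A' k) \<omega> * N (\<sigma>' k \<omega>) \<omega>)"
      using integrable_mult_indicator[OF A'M 1(1)] integrable_mult_indicator[OF A'M 2(1)] by simp_all
    then show ?thesis using 1(2)[of k] 2(2)[of k] by (simp add: right_diff_distrib)
  qed
  have "(\<lambda>k. \<integral>\<omega>. indicator (A' k) \<omega> * (N (\<rho>' k \<omega>) \<omega> - N (\<sigma>' k \<omega>) \<omega>) \<partial>M)
      \<longlonglongrightarrow> (\<integral>\<omega>. indicator A \<omega> * (N (\<rho> \<omega>) \<omega> - N (\<sigma> \<omega>) \<omega>) \<partial>M)"
  proof (rule integral_dominated_convergence[OF _ _ Z(1)])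
    show "(\<lambda>\<omega>. indicator A \<omega> * (N (\<rho> \<omega>) \<omega> - N (\<sigma> \<omega>) \<omega>)) \<in> borel_measurable M"
      using AM N\<rho> N\<sigma> by measurable
    show "(\<lambda>\<omega>. indicator (A' k) \<omega> * (N (\<rho>' k \<omega>) \<omega> - N (\<sigma>' k \<omega>) \<omega>)) \<in> borel_measurable M" for k
    proof -
      have "(\<lambda>\<omega>. N (\<rho>' k \<omega>) \<omega>) \<in> borel_measurable M" "(\<lambda>\<omega>. N (\<sigma>' k \<omega>) \<omega>) \<in> borel_measurable M"
        using optional_stopping_terminal(1)[OF N st(1) b(1) A's] optional_stopping_terminal(1)[OF N st(2) b(2) A's2]
        by simp_all
      then show ?thesis using A'M[of k] by measurable
    qed
    show "AE \<omega> in M. (\<lambda>k. indicator (A' k) \<omega> * (N (\<rho>' k \<omega>) \<omega> - N (\<sigma>' k \<omega>) \<omega>))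
        \<longlonglongrightarrow> indicator A \<omega> * (N (\<rho> \<omega>) \<omega> - N (\<sigma> \<omega>) \<omega>)"
    proof (rule AE_I2)
      fix \<omega> assume \<omega>: "\<omega> \<in> space M"
      obtain k0 where k0: "\<rho> \<omega> \<le> real k0" using real_arch_simple by blast
      have "eventually (\<lambda>k. indicator (A' k) \<omega> * (N (\<rho>' k \<omega>) \<omega> - N (\<sigma>' k \<omega>) \<omega>)
          = indicator A \<omega> * (N (\<rho> \<omega>) \<omega> - N (\<sigma> \<omega>) \<omega>)) sequentially"
        using eventually_ge_at_top[of k0]
      proof eventually_elim
        case (elim k)
        then have "\<rho> \<omega> \<le> real k" "\<sigma> \<omega> \<le> real k" using k0 order[OF \<omega>] by auto
        then show ?case by (simp add: A'_def \<rho>'_def \<sigma>'_def indicator_def)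
      qed
      then show "(\<lambda>k. indicator (A' k) \<omega> * (N (\<rho>' k \<omega>) \<omega> - N (\<sigma>' k \<omega>) \<omega>))
          \<longlonglongrightarrow> indicator A \<omega> * (N (\<rho> \<omega>) \<omega> - N (\<sigma> \<omega>) \<omega>)"
        by (rule tendsto_eventually)
    qed
    show "AE \<omega> in M. norm (indicator (A' k) \<omega> * (N (\<rho>' k \<omega>) \<omega> - N (\<sigma>' k \<omega>) \<omega>)) \<le> Z \<omega>" for k
    proof (rule AE_I2)
      fix \<omega> assume \<omega>: "\<omega> \<in> space M"
      show "norm (indicator (A' k) \<omega> * (N (\<rho>' k \<omega>) \<omega> - N (\<sigma>' k \<omega>) \<omega>)) \<le> Z \<omega>"
      proof (cases "\<omega> \<in> A' k")
        case True
        then have "\<sigma> \<omega> \<le> real k" by (simp add: A'_def)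
        then show ?thesis
          using Z(2)[OF \<omega>, of "\<rho>' k \<omega>"] order[OF \<omega>] True by (simp add: \<sigma>'_def \<rho>'_def)
      next
        case False
        then show ?thesis using Z(2)[OF \<omega>, of "\<sigma> \<omega>"] order[OF \<omega>] by simp
      qed
    qed
  qed
  then show "(\<integral>\<omega>. indicator A \<omega> * (N (\<rho> \<omega>) \<omega> - N (\<sigma> \<omega>) \<omega>) \<partial>M) = 0"
    unfolding z by (simp add: LIMSEQ_const_iff)
qed

text \<open>
  Conditional expectation passes from indicators to arbitrary factors that are known at time \<open>\<sigma>\<close>.
\<close>

lemma integral_mult_eq_zero:
  assumes \<sigma>: "stopping_time F \<sigma>" and D: "integrable M D"
    and z: "\<And>A. A \<in> sets (pre_sigma \<sigma>) \<Longrightarrow> (\<integral>\<omega>. indicator A \<omega> * D \<omega> \<partial>M) = 0"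
    and g: "g \<in> borel_measurable (pre_sigma \<sigma>)" and i: "integrable M (\<lambda>\<omega>. g \<omega> * D \<omega> :: real)"
  shows "(\<integral>\<omega>. g \<omega> * D \<omega> \<partial>M) = 0"
proof -
  interpret S: finite_measure_subalgebra M "pre_sigma \<sigma>"
    by unfold_locales (rule subalgebra_pre_sigma[OF \<sigma>])
  interpret S: sigma_finite_subalgebra M "pre_sigma \<sigma>"
    by (rule finite_measure_subalgebra_is_sigma_finite) unfold_locales
  have "AE \<omega> in M. real_cond_exp M (pre_sigma \<sigma>) D \<omega> = 0"
    by (rule S.real_cond_exp_charact) (use z D in \<open>simp_all add: set_lebesgue_integral_def\<close>)
  then have "(\<integral>\<omega>. g \<omega> * real_cond_exp M (pre_sigma \<sigma>) D \<omega> \<partial>M) = (\<integral>\<omega>. 0 \<partial>M)"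
    by (intro integral_cong_AE) (use measurable_pre_sigma_M[OF \<sigma> g] in auto)
  then show ?thesis using S.real_cond_exp_intg(2)[OF i g] D by simp
qed

end

text \<open>
  As \<open>h > 0\<close>, the set of times after \<open>s\<close> at distance \<open>h\<close> stays away from \<open>s\<close> and is closed, so its infimum is attained;
  the intermediate value theorem shows that it is nonempty and that the path stays closer than \<open>h\<close> before.
\<close>

lemma first_exit_time:
  fixes f :: "real \<Rightarrow> real"
  assumes cont: "continuous_on {0..} f" and s: "0 \<le> s" and h: "0 < h"
    and unb: "\<And>a. \<exists>t\<ge>0. a < \<bar>f t\<bar>"
  defines "\<tau> \<equiv> Inf {t. t > s \<and> \<bar>f t - f s\<bar> = h}"
  shows "s < \<tau>" and "\<bar>f \<tau> - f s\<bar> = h" and "\<And>u. s \<le> u \<Longrightarrow> u < \<tau> \<Longrightarrow> \<bar>f u - f s\<bar> < h"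
proof -
  define D where "D = {t. t > s \<and> \<bar>f t - f s\<bar> = h}"
  have D_eq: "D = {t \<in> {s..}. \<bar>f t - f s\<bar> = h}"
    using h by (auto simp: D_def order.order_iff_strict)
  have cs: "continuous_on {s..} (\<lambda>t. \<bar>f t - f s\<bar>)"
    using s by (intro continuous_intros continuous_on_subset[OF cont]) auto
  have cl: "closed D"
    unfolding D_eq by (rule continuous_closed_preimage_constant[OF cs]) simp
  have ivt: "\<exists>t\<in>D. t \<le> u" if u: "s \<le> u" "h \<le> \<bar>f u - f s\<bar>" for u
  proof -
    have "\<exists>x\<ge>s. x \<le> u \<and> \<bar>f x - f s\<bar> = h"
      by (rule IVT'[of "\<lambda>t. \<bar>f t - f s\<bar>"])
        (use u h in \<open>auto intro!: continuous_on_subset[OF cs]\<close>)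
    then show ?thesis by (auto simp: D_eq)
  qed
  have ne: "D \<noteq> {}"
  proof -
    have "compact {0..s}" by simp
    have "continuous_on {0..s} (\<lambda>t. \<bar>f t\<bar>)"
      by (intro continuous_intros continuous_on_subset[OF cont]) auto
    then have "\<exists>x\<in>{0..s}. \<forall>t\<in>{0..s}. \<bar>f t\<bar> \<le> \<bar>f x\<bar>"
      by (intro continuous_attains_sup) (use s in auto)
    then obtain x where x: "\<forall>t\<in>{0..s}. \<bar>f t\<bar> \<le> \<bar>f x\<bar>" ..
    obtain t where t: "0 \<le> t" "\<bar>f x\<bar> + \<bar>f s\<bar> + h < \<bar>f t\<bar>" using unb by blast
    have "\<not> t \<le> s"
    proof
      assume "t \<le> s"
      then have "\<bar>f t\<bar> \<le> \<bar>f x\<bar>" using x t by simp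
      then show False using t(2) h by linarith
    qed
    then have "s \<le> t" "h \<le> \<bar>f t - f s\<bar>" using t by linarith+
    from ivt[OF this] show ?thesis by auto
  qed
  have bdd: "bdd_below D" by (rule bdd_belowI[of _ s]) (auto simp: D_def)
  have "\<tau> \<in> D" unfolding \<tau>_def D_def[symmetric] by (rule closed_contains_Inf[OF ne bdd cl])
  then show "s < \<tau>" "\<bar>f \<tau> - f s\<bar> = h" by (auto simp: D_def)
  show "\<bar>f u - f s\<bar> < h" if su: "s \<le> u" "u < \<tau>" for u
  proof (rule ccontr)
    assume "\<not> \<bar>f u - f s\<bar> < h"
    then have "h \<le> \<bar>f u - f s\<bar>" by simp
    then obtain t where "t \<in> D" "t \<le> u" using ivt[OF su(1)] by blast
    then have "\<tau> \<le> u" unfolding \<tau>_def D_def[symmetric] using cInf_lower[OF _ bdd, of t] by simp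
    then show False using su by simp
  qed
qed

context filtered_bm begin

section \<open>The embedding times\<close>

abbreviation \<theta> :: "real \<Rightarrow> nat \<Rightarrow> 'a \<Rightarrow> real" where "\<theta> h \<equiv> embedding_time \<kappa> B h"

lemma embedding_time_nonneg:
  assumes "0 < h" "\<omega> \<in> space M"
  shows "0 \<le> \<theta> h k \<omega>"
proof (induction k)
  case (Suc k)
  have "\<theta> h k \<omega> < \<theta> h (Suc k) \<omega>"
    unfolding embedding_time.simps
    by (rule first_exit_time(1)[OF continuous_X[OF assms(2)] Suc assms(1) unbounded_B[OF assms(2)]])
  with Suc show ?case by simp
qed simp

context
  fixes h :: real and \<omega> :: 'a
  assumes h: "0 < h" and \<omega>: "\<omega> \<in> space M"
begin

lemma embedding_time_less_Suc: "\<theta> h k \<omega> < \<theta> h (Suc k) \<omega>"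
  unfolding embedding_time.simps
  by (rule first_exit_time(1)[OF continuous_X[OF \<omega>] embedding_time_nonneg[OF h \<omega>] h unbounded_B[OF \<omega>]])

lemma embedding_step: "\<bar>X (\<theta> h (Suc k) \<omega>) \<omega> - X (\<theta> h k \<omega>) \<omega>\<bar> = h"
  unfolding embedding_time.simps
  by (rule first_exit_time(2)[OF continuous_X[OF \<omega>] embedding_time_nonneg[OF h \<omega>] h unbounded_B[OF \<omega>]])

lemma embedding_excursion:
  assumes "\<theta> h k \<omega> \<le> u" "u \<le> \<theta> h (Suc k) \<omega>"
  shows "\<bar>X u \<omega> - X (\<theta> h k \<omega>) \<omega>\<bar> \<le> h"
proof (cases "u = \<theta> h (Suc k) \<omega>")
  case True
  then show ?thesis using embedding_step[of k] by simp
next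
  case False
  then have "u < \<theta> h (Suc k) \<omega>" using assms by simp
  then have "\<bar>X u \<omega> - X (\<theta> h k \<omega>) \<omega>\<bar> < h"
    using first_exit_time(3)[OF continuous_X[OF \<omega>] embedding_time_nonneg[OF h \<omega>] h unbounded_B[OF \<omega>] assms(1)]
    unfolding embedding_time.simps by blast
  then show ?thesis by simp
qed

lemma embedding_time_less: "i < j \<Longrightarrow> \<theta> h i \<omega> < \<theta> h j \<omega>"
  by (rule lift_Suc_mono_less[where f = "\<lambda>k. \<theta> h k \<omega>", OF embedding_time_less_Suc])

lemma embedding_time_le: "i \<le> j \<Longrightarrow> \<theta> h i \<omega> \<le> \<theta> h j \<omega>"
  using embedding_time_less[of i j] by (auto simp: le_less)

lemma embedding_time_less_iff: "\<theta> h i \<omega> < \<theta> h j \<omega> \<longleftrightarrow> i < j"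
  using embedding_time_less[of i j] embedding_time_le[of j i] by (auto simp: not_less[symmetric])

lemma embedded_walk_bounded: "\<bar>X (\<theta> h k \<omega>) \<omega>\<bar> \<le> real k * h"
proof (induction k)
  case 0
  then show ?case using X_zero[OF \<omega>] by simp
next
  case (Suc k)
  then show ?case using embedding_step[of k] by (simp add: algebra_simps)
qed

end

text \<open>
  Reaching distance \<open>h\<close> before \<open>t\<close> is detected by nearly reaching it at rational times, which makes the event observable at
  time \<open>t\<close>. The converse direction uses that the largest distance on a compact interval is attained.
\<close>

lemma embedding_time_Suc_le_iff:
  assumes h: "0 < h" and \<omega>: "\<omega> \<in> space M" and t: "0 \<le> t"
    and \<sigma>_def: "\<sigma> = min (\<theta> h k \<omega>) t"
  shows "\<theta> h (Suc k) \<omega> \<le> t \<longleftrightarrow>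
    (\<forall>i::nat. \<exists>q\<in>\<rat> \<inter> {0..t}. \<sigma> \<le> q \<and> h - 1 / real (Suc i) < \<bar>X q \<omega> - X \<sigma> \<omega>\<bar>)"
proof
  assume le: "\<theta> h (Suc k) \<omega> \<le> t"
  then have lt: "\<theta> h k \<omega> < t" using embedding_time_less_Suc[OF h \<omega>, of k] by simp
  then have \<sigma>: "\<sigma> = \<theta> h k \<omega>" by (simp add: \<sigma>_def)
  let ?u = "\<theta> h (Suc k) \<omega>"
  have 0: "0 \<le> \<sigma>" unfolding \<sigma> by (rule embedding_time_nonneg[OF h \<omega>])
  have \<sigma>u: "\<sigma> < ?u" unfolding \<sigma> by (rule embedding_time_less_Suc[OF h \<omega>])
  show "\<forall>i::nat. \<exists>q\<in>\<rat> \<inter> {0..t}. \<sigma> \<le> q \<and> h - 1 / real (Suc i) < \<bar>X q \<omega> - X \<sigma> \<omega>\<bar>"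
  proof
    fix i
    have "continuous_on {0..} (\<lambda>v. \<bar>X v \<omega> - X \<sigma> \<omega>\<bar>)"
      by (intro continuous_intros continuous_X[OF \<omega>])
    moreover have "?u \<in> {0..}" "0 < 1 / real (Suc i)" using 0 \<sigma>u by simp_all
    ultimately have "\<exists>d>0. \<forall>v\<in>{0..}. dist v ?u < d \<longrightarrow>
        dist \<bar>X v \<omega> - X \<sigma> \<omega>\<bar> \<bar>X ?u \<omega> - X \<sigma> \<omega>\<bar> < 1 / real (Suc i)"
      unfolding continuous_on_iff by blast
    then obtain d where d: "0 < d" "\<forall>v\<in>{0..}. dist v ?u < d \<longrightarrow>
        dist \<bar>X v \<omega> - X \<sigma> \<omega>\<bar> \<bar>X ?u \<omega> - X \<sigma> \<omega>\<bar> < 1 / real (Suc i)" by blast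
    obtain q where q: "q \<in> \<rat>" "max \<sigma> (?u - d) < q" "q < ?u"
      using Rats_dense_in_real[of "max \<sigma> (?u - d)" ?u] \<sigma>u d(1) by auto
    have "\<bar>X ?u \<omega> - X \<sigma> \<omega>\<bar> = h" unfolding \<sigma> by (rule embedding_step[OF h \<omega>])
    moreover have "\<bar>\<bar>X q \<omega> - X \<sigma> \<omega>\<bar> - \<bar>X ?u \<omega> - X \<sigma> \<omega>\<bar>\<bar> < 1 / real (Suc i)"
      using d(2)[rule_format, of q] q 0 unfolding dist_real_def by auto
    ultimately have "h - 1 / real (Suc i) < \<bar>X q \<omega> - X \<sigma> \<omega>\<bar>" by linarith
    then show "\<exists>q\<in>\<rat> \<inter> {0..t}. \<sigma> \<le> q \<and> h - 1 / real (Suc i) < \<bar>X q \<omega> - X \<sigma> \<omega>\<bar>"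
      using q 0 le by (intro bexI[of _ q]) auto
  qed
next
  assume R: "\<forall>i::nat. \<exists>q\<in>\<rat> \<inter> {0..t}. \<sigma> \<le> q \<and> h - 1 / real (Suc i) < \<bar>X q \<omega> - X \<sigma> \<omega>\<bar>"
  have 0: "0 \<le> \<sigma>" unfolding \<sigma>_def using embedding_time_nonneg[OF h \<omega>] t by simp
  have "continuous_on {\<sigma>..t} (\<lambda>v. \<bar>X v \<omega> - X \<sigma> \<omega>\<bar>)"
    using 0 by (intro continuous_intros continuous_on_subset[OF continuous_X[OF \<omega>]]) auto
  then have "\<exists>x\<in>{\<sigma>..t}. \<forall>v\<in>{\<sigma>..t}. \<bar>X v \<omega> - X \<sigma> \<omega>\<bar> \<le> \<bar>X x \<omega> - X \<sigma> \<omega>\<bar>"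
    by (intro continuous_attains_sup) (auto simp: \<sigma>_def)
  then obtain x where x: "x \<in> {\<sigma>..t}" "\<forall>v\<in>{\<sigma>..t}. \<bar>X v \<omega> - X \<sigma> \<omega>\<bar> \<le> \<bar>X x \<omega> - X \<sigma> \<omega>\<bar>" ..
  have lt: "h - 1 / real (Suc i) < \<bar>X x \<omega> - X \<sigma> \<omega>\<bar>" for i
  proof -
    obtain q where q: "q \<in> \<rat> \<inter> {0..t}" "\<sigma> \<le> q \<and> h - 1 / real (Suc i) < \<bar>X q \<omega> - X \<sigma> \<omega>\<bar>"
      using R[rule_format, of i] ..
    then have "\<bar>X q \<omega> - X \<sigma> \<omega>\<bar> \<le> \<bar>X x \<omega> - X \<sigma> \<omega>\<bar>" using x(2)[rule_format, of q] by simp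
    then show ?thesis using q(2) by linarith
  qed
  have "(\<lambda>i. h - 1 / real (Suc i)) \<longlonglongrightarrow> h - 0"
    by (intro tendsto_diff tendsto_const LIMSEQ_Suc[OF lim_const_over_n])
  then have ge: "h \<le> \<bar>X x \<omega> - X \<sigma> \<omega>\<bar>"
    by (intro LIMSEQ_le_const2[of "\<lambda>i. h - 1 / real (Suc i)"]) (use lt in \<open>auto intro: less_imp_le\<close>)
  then have "x \<noteq> \<sigma>" using h by auto
  then have "\<sigma> < t" using x(1) by auto
  then have \<sigma>: "\<sigma> = \<theta> h k \<omega>" by (auto simp: \<sigma>_def min_def split: if_splits)
  show "\<theta> h (Suc k) \<omega> \<le> t"
  proof (rule ccontr)
    assume n: "\<not> \<theta> h (Suc k) \<omega> \<le> t"
    have "\<bar>X x \<omega> - X (\<theta> h k \<omega>) \<omega>\<bar> < h"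
      using first_exit_time(3)[OF continuous_X[OF \<omega>] embedding_time_nonneg[OF h \<omega>] h unbounded_B[OF \<omega>], of k x]
        n x(1) unfolding embedding_time.simps \<sigma> by auto
    then show False using ge \<sigma> by simp
  qed
qed

lemma stopping_time_embedding:
  assumes h: "0 < h"
  shows "stopping_time F (\<theta> h k)"
proof (induction k)
  case 0
  show ?case by (simp add: stopping_time_const)
next
  case (Suc k)
  show ?case
  proof (rule stopping_timeI)
    fix t
    show "Measurable.pred (F t) (\<lambda>\<omega>. \<theta> h (Suc k) \<omega> \<le> t)"
    proof (cases "0 \<le> t")
      case False
      have "\<not> \<theta> h (Suc k) \<omega> \<le> t" if "\<omega> \<in> space (F t)" for \<omega>
        using embedding_time_nonneg[OF h, of \<omega> "Suc k"] that False by (simp add: space_F del: embedding_time.simps)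
      then have "{\<omega> \<in> space (F t). \<theta> h (Suc k) \<omega> \<le> t} = {}" by blast
      then show ?thesis unfolding pred_def by (simp only: sets.empty_sets)
    next
      case True
      define Y where "Y \<omega> = X (min (\<theta> h k \<omega>) t) \<omega>" for \<omega>
      have Y[measurable]: "Y \<in> borel_measurable (F t)"
        unfolding Y_def[abs_def]
        by (rule measurable_stopped[OF Suc embedding_time_nonneg[OF h] adapted_X continuous_X True])
      note stopping_time_measurable_min[OF Suc, of t, measurable]
      have "Measurable.pred (F t) (\<lambda>\<omega>. \<forall>i::nat. \<exists>q\<in>\<rat> \<inter> {0..t}. min (\<theta> h k \<omega>) t \<le> q \<and>
          h - 1 / real (Suc i) < \<bar>X q \<omega> - Y \<omega>\<bar>)"
      proof (intro pred_intros_countable(1) measurable_pred_countable(2))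
        show "countable (\<rat> \<inter> {0..t})" by (intro countable_Int1 countable_rat)
        fix i :: nat and q assume "q \<in> \<rat> \<inter> {0..t}"
        then have [measurable]: "X q \<in> borel_measurable (F t)"
          by (intro measurable_F_mono[OF adapted_X, of q t]) auto
        show "Measurable.pred (F t) (\<lambda>\<omega>. min (\<theta> h k \<omega>) t \<le> q \<and> h - 1 / real (Suc i) < \<bar>X q \<omega> - Y \<omega>\<bar>)"
          by measurable
      qed
      then show ?thesis
        by (subst measurable_cong[OF embedding_time_Suc_le_iff[OF h _ True refl]])
          (simp_all add: space_F Y_def)
    qed
  qed
qed

end

lemma exp_minus_linear_nonneg: "0 \<le> exp x - 1 - x" for x :: real
  using exp_ge_add_one_self[of x] by linarith

lemma exp_minus_linear_le: "exp x - 1 - x \<le> x\<^sup>2 * exp \<bar>x\<bar> / 2" for x :: real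
proof -
  obtain t where t: "\<bar>t\<bar> \<le> \<bar>x\<bar>" "exp x = (\<Sum>m<2. (x ^ m) / fact m) + (exp t / fact 2) * x ^ 2"
    using Maclaurin_exp_le by blast
  have "exp t * x\<^sup>2 \<le> exp \<bar>x\<bar> * x\<^sup>2" using t(1) by (intro mult_right_mono) auto
  then show ?thesis using t(2) by (simp add: numeral_2_eq_2 field_simps)
qed

lemma exp_minus_quadratic_le: "\<bar>exp x - 1 - x - x\<^sup>2 / 2\<bar> \<le> \<bar>x\<bar> ^ 3 * exp \<bar>x\<bar> / 6" for x :: real
proof -
  obtain t where t: "\<bar>t\<bar> \<le> \<bar>x\<bar>" "exp x = (\<Sum>m<3. (x ^ m) / fact m) + (exp t / fact 3) * x ^ 3"
    using Maclaurin_exp_le by blast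
  have "exp t * \<bar>x\<bar> ^ 3 \<le> exp \<bar>x\<bar> * \<bar>x\<bar> ^ 3" using t(1) by (intro mult_right_mono) auto
  moreover have "exp x - 1 - x - x\<^sup>2 / 2 = exp t * x ^ 3 / 6"
    using t(2) by (simp add: eval_nat_numeral)
  ultimately have "\<bar>exp x - 1 - x - x\<^sup>2 / 2\<bar> = exp t * \<bar>x\<bar> ^ 3 / 6"
    "exp t * \<bar>x\<bar> ^ 3 \<le> \<bar>x\<bar> ^ 3 * exp \<bar>x\<bar>"
    by (simp_all only: abs_mult abs_divide power_abs abs_exp_cancel abs_numeral mult.commute[of _ "exp \<bar>x\<bar>"])
  then show ?thesis by (simp only: divide_right_mono)
qed

lemma nn_integral_limit_le:
  assumes "\<And>k. f k \<in> borel_measurable M" "\<And>\<omega>. \<omega> \<in> space M \<Longrightarrow> (\<lambda>k. f k \<omega>) \<longlonglongrightarrow> g \<omega>"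
    and "\<And>k. (\<integral>\<^sup>+\<omega>. f k \<omega> \<partial>M) \<le> c"
  shows "(\<integral>\<^sup>+\<omega>. g \<omega> \<partial>M) \<le> (c :: ennreal)"
proof -
  have "(\<integral>\<^sup>+\<omega>. g \<omega> \<partial>M) = (\<integral>\<^sup>+\<omega>. liminf (\<lambda>k. f k \<omega>) \<partial>M)"
    by (intro nn_integral_cong lim_imp_Liminf[symmetric] assms(2)) simp_all
  also have "\<dots> \<le> liminf (\<lambda>k. \<integral>\<^sup>+\<omega>. f k \<omega> \<partial>M)" by (rule nn_integral_liminf[OF assms(1)])
  also have "\<dots> \<le> liminf (\<lambda>k. c)" by (intro Liminf_mono always_eventually allI assms(3))
  finally show ?thesis by (simp add: Liminf_const)
qed

section \<open>Martingale identities for the duration of an interval\<close>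

context filtered_bm begin

lemma space_in_pre_sigma: "space M \<in> sets (pre_sigma \<sigma>)"
  using sets.top[of "pre_sigma \<sigma>"] by (simp add: space_pre_sigma)

lemma stopping_time_plus:
  assumes "stopping_time F \<sigma>" "0 \<le> c"
  shows "stopping_time F (\<lambda>\<omega>. \<sigma> \<omega> + c)"
proof (rule stopping_timeI)
  fix t
  have "Measurable.pred (F t) (\<lambda>\<omega>. \<sigma> \<omega> \<le> t - c)"
    using assms by (intro stopping_time_le_const) auto
  then show "Measurable.pred (F t) (\<lambda>\<omega>. \<sigma> \<omega> + c \<le> t)" by (simp add: le_diff_eq)
qed

lemma stopping_time_M: "stopping_time F \<sigma> \<Longrightarrow> \<sigma> \<in> borel_measurable M"
  by (rule measurable_stopping_time[OF _ sets_F space_F])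

lemma X_at_stopping_time:
  assumes "stopping_time F \<sigma>" "\<And>\<omega>. \<omega> \<in> space M \<Longrightarrow> 0 \<le> \<sigma> \<omega>"
  shows "(\<lambda>\<omega>. X (\<sigma> \<omega>) \<omega>) \<in> borel_measurable (pre_sigma \<sigma>)"
  by (rule measurable_at_stopping_time[OF assms adapted_X continuous_X])

text \<open>
  The duration \<open>\<rho> - \<sigma>\<close> of a random interval on which \<open>X\<close> oscillates by at most \<open>c\<close>.
\<close>

context
  fixes \<sigma> \<rho> :: "'a \<Rightarrow> real" and c :: real
  assumes \<sigma>: "stopping_time F \<sigma>" and \<rho>: "stopping_time F \<rho>"
    and order: "\<And>\<omega>. \<omega> \<in> space M \<Longrightarrow> 0 \<le> \<sigma> \<omega> \<and> \<sigma> \<omega> \<le> \<rho> \<omega>"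
    and osc: "\<And>\<omega> u. \<omega> \<in> space M \<Longrightarrow> \<sigma> \<omega> \<le> u \<Longrightarrow> u \<le> \<rho> \<omega> \<Longrightarrow> \<bar>X u \<omega> - X (\<sigma> \<omega>) \<omega>\<bar> \<le> c"
begin

lemma increment_B_X: "B u \<omega> - B v \<omega> = (X u \<omega> - X v \<omega>) + \<kappa> / 2 * (u - v)"
  by (simp add: drifted_def field_simps)

lemma X_\<sigma>_M: "(\<lambda>\<omega>. X (\<sigma> \<omega>) \<omega>) \<in> borel_measurable M"
  by (rule measurable_pre_sigma_M[OF \<sigma> X_at_stopping_time[OF \<sigma>]]) (use order in simp)

lemma X_\<rho>_M: "(\<lambda>\<omega>. X (\<rho> \<omega>) \<omega>) \<in> borel_measurable M"
  by (rule measurable_pre_sigma_M[OF \<rho> X_at_stopping_time[OF \<rho>]]) (use order in force)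

text \<open>
  \<open>B\<close> is a martingale that gains \<open>\<kappa> / 2\<close> per unit of time over \<open>X\<close>, and \<open>X\<close> moves by at most \<open>c\<close>. So the mean duration,
  truncated at any level, is at most \<open>2 c / \<kappa>\<close>.
\<close>

lemma integrable_duration: "integrable M (\<lambda>\<omega>. \<rho> \<omega> - \<sigma> \<omega>)"
proof -
  define \<rho>' where "\<rho>' k \<omega> = min (\<rho> \<omega>) (\<sigma> \<omega> + real k)" for k \<omega>
  have st: "stopping_time F (\<rho>' k)" for k
    unfolding \<rho>'_def[abs_def] by (intro stopping_time_min \<rho> stopping_time_plus \<sigma>) simp
  note [measurable] = stopping_time_M[OF \<sigma>] stopping_time_M[OF \<rho>] stopping_time_M[OF st]
  have b: "0 \<le> \<sigma> \<omega> \<and> \<sigma> \<omega> \<le> \<rho>' k \<omega>" "\<rho>' k \<omega> \<le> \<rho> \<omega>" "\<rho>' k \<omega> - \<sigma> \<omega> \<le> real k" if "\<omega> \<in> space M" for k \<omega>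
    using order[OF that] by (auto simp: \<rho>'_def)
  have i: "integrable M (\<lambda>\<omega>. \<rho>' k \<omega> - \<sigma> \<omega>)" for k
    by (rule integrable_const_bound[of _ "real k"]) (use b in \<open>auto intro!: AE_I2\<close>)
  have E: "(\<integral>\<omega>. \<rho>' k \<omega> - \<sigma> \<omega> \<partial>M) \<le> 2 * c / \<kappa>" for k
  proof -
    have Z: "\<bar>B u \<omega> - B (\<sigma> \<omega>) \<omega>\<bar> \<le> c + \<kappa> / 2 * real k"
      if \<omega>: "\<omega> \<in> space M" and u: "\<sigma> \<omega> \<le> u" "u \<le> \<rho>' k \<omega>" for \<omega> u
    proof -
      have "\<bar>X u \<omega> - X (\<sigma> \<omega>) \<omega>\<bar> \<le> c" using osc[OF \<omega> u(1)] b(2)[OF \<omega>, of k] u(2) by simp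
      moreover have "\<kappa> / 2 * (u - \<sigma> \<omega>) \<le> \<kappa> / 2 * real k" "0 \<le> \<kappa> / 2 * (u - \<sigma> \<omega>)"
        using b(3)[OF \<omega>, of k] u kappa_pos by (auto intro!: mult_left_mono)
      ultimately show ?thesis unfolding increment_B_X by linarith
    qed
    note OS = optional_stopping[OF dominated_martingale_B \<sigma> st b(1) space_in_pre_sigma
        integrable_const Z]
    have iB: "integrable M (\<lambda>\<omega>. B (\<rho>' k \<omega>) \<omega> - B (\<sigma> \<omega>) \<omega>)" using OS(1) by simp
    have "(\<integral>\<omega>. B (\<rho>' k \<omega>) \<omega> - B (\<sigma> \<omega>) \<omega> \<partial>M)
        = (\<integral>\<omega>. indicator (space M) \<omega> * (B (\<rho>' k \<omega>) \<omega> - B (\<sigma> \<omega>) \<omega>) \<partial>M)"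
      by (rule Bochner_Integration.integral_cong) auto
    then have "(\<integral>\<omega>. B (\<rho>' k \<omega>) \<omega> - B (\<sigma> \<omega>) \<omega> \<partial>M) = 0" using OS(2) by simp
    moreover have "(\<integral>\<omega>. \<kappa> / 2 * (\<rho>' k \<omega> - \<sigma> \<omega>) \<partial>M) \<le> (\<integral>\<omega>. c + (B (\<rho>' k \<omega>) \<omega> - B (\<sigma> \<omega>) \<omega>) \<partial>M)"
    proof (rule integral_mono)
      fix \<omega> assume \<omega>: "\<omega> \<in> space M"
      have "\<bar>X (\<rho>' k \<omega>) \<omega> - X (\<sigma> \<omega>) \<omega>\<bar> \<le> c" using osc[OF \<omega>, of "\<rho>' k \<omega>"] b[OF \<omega>, of k] by simp
      then show "\<kappa> / 2 * (\<rho>' k \<omega> - \<sigma> \<omega>) \<le> c + (B (\<rho>' k \<omega>) \<omega> - B (\<sigma> \<omega>) \<omega>)"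
        unfolding increment_B_X by linarith
    qed (use i OS(1) in simp_all)
    moreover have "(\<integral>\<omega>. c + (B (\<rho>' k \<omega>) \<omega> - B (\<sigma> \<omega>) \<omega>) \<partial>M) = c + (\<integral>\<omega>. B (\<rho>' k \<omega>) \<omega> - B (\<sigma> \<omega>) \<omega> \<partial>M)"
    proof -
      have "(\<integral>\<omega>. c \<partial>M) = c" by (simp add: prob_space)
      then show ?thesis using Bochner_Integration.integral_add[OF integrable_const[of c] iB] by simp
    qed
    moreover have "(\<integral>\<omega>. \<kappa> / 2 * (\<rho>' k \<omega> - \<sigma> \<omega>) \<partial>M) = \<kappa> / 2 * (\<integral>\<omega>. \<rho>' k \<omega> - \<sigma> \<omega> \<partial>M)"
      by (rule integral_mult_right_zero)
    ultimately show ?thesis using kappa_pos by (simp add: field_simps)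
  qed
  have "(\<integral>\<^sup>+\<omega>. ennreal (\<rho> \<omega> - \<sigma> \<omega>) \<partial>M) \<le> ennreal (2 * c / \<kappa>)"
  proof (rule nn_integral_limit_le[where f = "\<lambda>k \<omega>. ennreal (\<rho>' k \<omega> - \<sigma> \<omega>)"])
    show "(\<integral>\<^sup>+\<omega>. ennreal (\<rho>' k \<omega> - \<sigma> \<omega>) \<partial>M) \<le> ennreal (2 * c / \<kappa>)" for k
      using i[of k] E[of k] b(1)
      by (subst nn_integral_eq_integral) (auto intro!: ennreal_leI AE_I2)
    fix \<omega> assume \<omega>: "\<omega> \<in> space M"
    obtain k0 where k0: "\<rho> \<omega> - \<sigma> \<omega> \<le> real k0" using real_arch_simple by blast
    have "eventually (\<lambda>k. ennreal (\<rho>' k \<omega> - \<sigma> \<omega>) = ennreal (\<rho> \<omega> - \<sigma> \<omega>)) sequentially"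
      using eventually_ge_at_top[of k0]
    proof eventually_elim
      case (elim k)
      then have "\<rho> \<omega> \<le> \<sigma> \<omega> + real k" using k0 by simp
      then show ?case by (simp add: \<rho>'_def)
    qed
    then show "(\<lambda>k. ennreal (\<rho>' k \<omega> - \<sigma> \<omega>)) \<longlonglongrightarrow> ennreal (\<rho> \<omega> - \<sigma> \<omega>)" by (rule tendsto_eventually)
  qed measurable
  then show ?thesis
    by (intro integrableI_nonneg) (use order in \<open>auto intro!: AE_I2 simp: less_top[symmetric] top_unique\<close>)
qed

lemma integrable_exp_increment: "integrable M (\<lambda>\<omega>. exp (\<kappa> * (X (\<rho> \<omega>) \<omega> - X (\<sigma> \<omega>) \<omega>)))"
proof (rule integrable_const_bound[of _ "exp (\<kappa> * c)"])
  note [measurable] = X_\<sigma>_M X_\<rho>_M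
  show "(\<lambda>\<omega>. exp (\<kappa> * (X (\<rho> \<omega>) \<omega> - X (\<sigma> \<omega>) \<omega>))) \<in> borel_measurable M" by measurable
  show "AE \<omega> in M. norm (exp (\<kappa> * (X (\<rho> \<omega>) \<omega> - X (\<sigma> \<omega>) \<omega>))) \<le> exp (\<kappa> * c)"
  proof (rule AE_I2)
    fix \<omega> assume \<omega>: "\<omega> \<in> space M"
    then show "norm (exp (\<kappa> * (X (\<rho> \<omega>) \<omega> - X (\<sigma> \<omega>) \<omega>))) \<le> exp (\<kappa> * c)"
      using osc[OF \<omega>, of "\<rho> \<omega>"] order[OF \<omega>] kappa_pos by simp
  qed
qed

text \<open>
  The martingale \<open>exp (\<kappa> X)\<close> is divided by its value at \<open>\<sigma>\<close>, a factor that is known at that time.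
\<close>

lemma martingale_exp_increment:
  assumes i: "integrable M (\<lambda>\<omega>. exp (\<kappa> * X (\<sigma> \<omega>) \<omega>))" and A: "A \<in> sets (pre_sigma \<sigma>)"
  shows "(\<integral>\<omega>. indicator A \<omega> * (exp (\<kappa> * (X (\<rho> \<omega>) \<omega> - X (\<sigma> \<omega>) \<omega>)) - 1) \<partial>M) = 0"
proof -
  note [measurable] = X_\<sigma>_M X_\<rho>_M
  let ?N = "\<lambda>t \<omega>. exp (\<kappa> * X t \<omega>)"
  have Z: "\<bar>?N u \<omega> - ?N (\<sigma> \<omega>) \<omega>\<bar> \<le> (exp (\<kappa> * c) + 1) * exp (\<kappa> * X (\<sigma> \<omega>) \<omega>)"
    if \<omega>: "\<omega> \<in> space M" and u: "\<sigma> \<omega> \<le> u" "u \<le> \<rho> \<omega>" for \<omega> u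
  proof -
    have "X u \<omega> \<le> X (\<sigma> \<omega>) \<omega> + c" using osc[OF \<omega> u] by linarith
    then have "\<kappa> * X u \<omega> \<le> \<kappa> * c + \<kappa> * X (\<sigma> \<omega>) \<omega>"
      using mult_left_mono[of "X u \<omega>" "X (\<sigma> \<omega>) \<omega> + c" \<kappa>] kappa_pos by (simp add: algebra_simps)
    then have "?N u \<omega> \<le> exp (\<kappa> * c) * exp (\<kappa> * X (\<sigma> \<omega>) \<omega>)" by (simp flip: exp_add)
    then show ?thesis using exp_gt_zero[of "\<kappa> * X u \<omega>"] exp_gt_zero[of "\<kappa> * X (\<sigma> \<omega>) \<omega>"]
      unfolding distrib_right by linarith
  qed
  have iZ: "integrable M (\<lambda>\<omega>. (exp (\<kappa> * c) + 1) * exp (\<kappa> * X (\<sigma> \<omega>) \<omega>))" using i by simp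
  have OS1: "integrable M (\<lambda>\<omega>. ?N (\<rho> \<omega>) \<omega> - ?N (\<sigma> \<omega>) \<omega>)"
    by (rule optional_stopping(1)[OF dominated_martingale_exp_X \<sigma> \<rho> order A iZ Z])
  have OS2: "(\<integral>\<omega>. indicator A' \<omega> * (?N (\<rho> \<omega>) \<omega> - ?N (\<sigma> \<omega>) \<omega>) \<partial>M) = 0"
    if "A' \<in> sets (pre_sigma \<sigma>)" for A'
    by (rule optional_stopping(2)[OF dominated_martingale_exp_X \<sigma> \<rho> order that iZ Z])
  have eq: "exp (- (\<kappa> * X (\<sigma> \<omega>) \<omega>)) * (?N (\<rho> \<omega>) \<omega> - ?N (\<sigma> \<omega>) \<omega>)
      = exp (\<kappa> * (X (\<rho> \<omega>) \<omega> - X (\<sigma> \<omega>) \<omega>)) - 1" for \<omega>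
    by (simp add: right_diff_distrib exp_diff exp_minus field_simps)
  have AM: "A \<in> sets M" using A pre_sigma_subset_M[OF \<sigma>] by (rule rev_subsetD)
  let ?g = "\<lambda>\<omega>. indicator A \<omega> * exp (- (\<kappa> * X (\<sigma> \<omega>) \<omega>)) :: real"
  have g: "?g \<in> borel_measurable (pre_sigma \<sigma>)"
  proof -
    have 1: "(\<lambda>\<omega>. X (\<sigma> \<omega>) \<omega>) \<in> borel_measurable (pre_sigma \<sigma>)"
      by (rule X_at_stopping_time[OF \<sigma>]) (use order in simp)
    note 1[measurable] A[measurable]
    show ?thesis by measurable
  qed
  have "integrable M (\<lambda>\<omega>. indicator A \<omega> * (exp (\<kappa> * (X (\<rho> \<omega>) \<omega> - X (\<sigma> \<omega>) \<omega>)) - 1))"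
    using integrable_mult_indicator[OF AM, of "\<lambda>\<omega>. exp (\<kappa> * (X (\<rho> \<omega>) \<omega> - X (\<sigma> \<omega>) \<omega>)) - 1"]
      integrable_exp_increment by simp
  then have gi: "integrable M (\<lambda>\<omega>. ?g \<omega> * (?N (\<rho> \<omega>) \<omega> - ?N (\<sigma> \<omega>) \<omega>))"
    unfolding mult.assoc eq .
  have "(\<integral>\<omega>. ?g \<omega> * (?N (\<rho> \<omega>) \<omega> - ?N (\<sigma> \<omega>) \<omega>) \<partial>M) = 0"
    by (rule integral_mult_eq_zero[OF \<sigma> OS1 OS2 g gi])
  then show ?thesis unfolding mult.assoc eq .
qed

text \<open>
  The bound of order \<open>c\<close> from \<open>B\<close> alone is too weak. Subtracting a multiple of the martingale identity for \<open>B\<close> from the one for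
  \<open>exp (\<kappa> X)\<close> cancels the linear term of the exponential, so the duration is compensated by a quantity that is
  quadratic in the displacement.
\<close>

lemma martingale_compensated_duration:
  assumes i: "integrable M (\<lambda>\<omega>. exp (\<kappa> * X (\<sigma> \<omega>) \<omega>))" and A: "A \<in> sets (pre_sigma \<sigma>)"
  shows "(\<integral>\<omega>. indicator A \<omega> *
      (2 / \<kappa>\<^sup>2 * (exp (\<kappa> * (X (\<rho> \<omega>) \<omega> - X (\<sigma> \<omega>) \<omega>)) - 1 - \<kappa> * (X (\<rho> \<omega>) \<omega> - X (\<sigma> \<omega>) \<omega>))
        - (\<rho> \<omega> - \<sigma> \<omega>)) \<partial>M) = 0"
proof -
  have Z: "\<bar>B u \<omega> - B (\<sigma> \<omega>) \<omega>\<bar> \<le> c + \<kappa> / 2 * (\<rho> \<omega> - \<sigma> \<omega>)"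
    if \<omega>: "\<omega> \<in> space M" and u: "\<sigma> \<omega> \<le> u" "u \<le> \<rho> \<omega>" for \<omega> u
  proof -
    have "\<bar>X u \<omega> - X (\<sigma> \<omega>) \<omega>\<bar> \<le> c" using osc[OF \<omega> u] .
    moreover have "\<kappa> / 2 * (u - \<sigma> \<omega>) \<le> \<kappa> / 2 * (\<rho> \<omega> - \<sigma> \<omega>)" "0 \<le> \<kappa> / 2 * (u - \<sigma> \<omega>)"
      using u kappa_pos by (auto intro!: mult_left_mono)
    ultimately show ?thesis unfolding increment_B_X by linarith
  qed
  have iZ: "integrable M (\<lambda>\<omega>. c + \<kappa> / 2 * (\<rho> \<omega> - \<sigma> \<omega>))" using integrable_duration by simp
  note OS = optional_stopping[OF dominated_martingale_B \<sigma> \<rho> order A iZ Z]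
  have AM: "A \<in> sets M" using A pre_sigma_subset_M[OF \<sigma>] by (rule rev_subsetD)
  let ?e = "\<lambda>\<omega>. exp (\<kappa> * (X (\<rho> \<omega>) \<omega> - X (\<sigma> \<omega>) \<omega>)) - 1" and ?b = "\<lambda>\<omega>. B (\<rho> \<omega>) \<omega> - B (\<sigma> \<omega>) \<omega>"
  have i1: "integrable M (\<lambda>\<omega>. indicator A \<omega> * ?e \<omega>)"
    using integrable_mult_indicator[OF AM, of ?e] integrable_exp_increment by simp
  have i2: "integrable M (\<lambda>\<omega>. indicator A \<omega> * ?b \<omega>)"
    using integrable_mult_indicator[OF AM OS(1)] by simp
  have "indicator A \<omega> * (2 / \<kappa>\<^sup>2 * (exp (\<kappa> * (X (\<rho> \<omega>) \<omega> - X (\<sigma> \<omega>) \<omega>)) - 1 - \<kappa> * (X (\<rho> \<omega>) \<omega> - X (\<sigma> \<omega>) \<omega>))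
        - (\<rho> \<omega> - \<sigma> \<omega>)) = 2 / \<kappa>\<^sup>2 * (indicator A \<omega> * ?e \<omega>) - 2 / \<kappa> * (indicator A \<omega> * ?b \<omega>)" for \<omega>
  proof -
    have "2 / \<kappa>\<^sup>2 * (e - \<kappa> * x) - d = 2 / \<kappa>\<^sup>2 * e - 2 / \<kappa> * (x + \<kappa> / 2 * d)" for e x d
      using kappa_pos by (simp add: field_simps power2_eq_square)
    from this[of "?e \<omega>"] show ?thesis unfolding increment_B_X
      by (cases "\<omega> \<in> A") (simp_all only: indicator_simps not_False_eq_True mult_1 mult_zero_left mult_zero_right diff_self)
  qed
  then have "(\<integral>\<omega>. indicator A \<omega> *
      (2 / \<kappa>\<^sup>2 * (exp (\<kappa> * (X (\<rho> \<omega>) \<omega> - X (\<sigma> \<omega>) \<omega>)) - 1 - \<kappa> * (X (\<rho> \<omega>) \<omega> - X (\<sigma> \<omega>) \<omega>))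
        - (\<rho> \<omega> - \<sigma> \<omega>)) \<partial>M) = (\<integral>\<omega>. 2 / \<kappa>\<^sup>2 * (indicator A \<omega> * ?e \<omega>) - 2 / \<kappa> * (indicator A \<omega> * ?b \<omega>) \<partial>M)"
    by (simp only:)
  also have "\<dots> = 2 / \<kappa>\<^sup>2 * (\<integral>\<omega>. indicator A \<omega> * ?e \<omega> \<partial>M) - 2 / \<kappa> * (\<integral>\<omega>. indicator A \<omega> * ?b \<omega> \<partial>M)"
    using i1 i2 by (subst Bochner_Integration.integral_diff) (simp_all only: integrable_mult_right integral_mult_right_zero)
  finally show ?thesis using martingale_exp_increment[OF i A] OS(2) by simp
qed

lemma expected_duration_le:
  assumes i: "integrable M (\<lambda>\<omega>. exp (\<kappa> * X (\<sigma> \<omega>) \<omega>))" and A: "A \<in> sets (pre_sigma \<sigma>)"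
  shows "(\<integral>\<omega>. indicator A \<omega> * (\<rho> \<omega> - \<sigma> \<omega>) \<partial>M) \<le> c\<^sup>2 * exp (\<kappa> * c) * prob A"
proof -
  have AM: "A \<in> sets M" using A pre_sigma_subset_M[OF \<sigma>] by (rule rev_subsetD)
  let ?x = "\<lambda>\<omega>. X (\<rho> \<omega>) \<omega> - X (\<sigma> \<omega>) \<omega>"
  let ?p = "\<lambda>\<omega>. 2 / \<kappa>\<^sup>2 * (exp (\<kappa> * ?x \<omega>) - 1 - \<kappa> * ?x \<omega>)"
  note [measurable] = X_\<sigma>_M X_\<rho>_M AM
  have pb: "0 \<le> ?p \<omega> \<and> ?p \<omega> \<le> c\<^sup>2 * exp (\<kappa> * c)" if \<omega>: "\<omega> \<in> space M" for \<omega>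
  proof
    show "0 \<le> ?p \<omega>" using exp_minus_linear_nonneg[of "\<kappa> * ?x \<omega>"] by simp
    have x: "\<bar>?x \<omega>\<bar> \<le> c" using osc[OF \<omega>, of "\<rho> \<omega>"] order[OF \<omega>] by simp
    have "exp (\<kappa> * ?x \<omega>) - 1 - \<kappa> * ?x \<omega> \<le> (\<kappa> * ?x \<omega>)\<^sup>2 * exp \<bar>\<kappa> * ?x \<omega>\<bar> / 2"
      by (rule exp_minus_linear_le)
    also have "\<dots> \<le> (\<kappa>\<^sup>2 * c\<^sup>2) * exp (\<kappa> * c) / 2"
    proof (intro divide_right_mono mult_mono)
      have "(?x \<omega>)\<^sup>2 \<le> c\<^sup>2" using x by (rule abs_le_square_iff[THEN iffD1, OF order_trans]) simp
      then show "(\<kappa> * ?x \<omega>)\<^sup>2 \<le> \<kappa>\<^sup>2 * c\<^sup>2" unfolding power_mult_distrib by (rule mult_left_mono) simp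
      show "exp \<bar>\<kappa> * ?x \<omega>\<bar> \<le> exp (\<kappa> * c)" using x kappa_pos by (simp add: abs_mult)
    qed auto
    finally have "2 / \<kappa>\<^sup>2 * (exp (\<kappa> * ?x \<omega>) - 1 - \<kappa> * ?x \<omega>) \<le> 2 / \<kappa>\<^sup>2 * ((\<kappa>\<^sup>2 * c\<^sup>2) * exp (\<kappa> * c) / 2)"
      by (rule mult_left_mono) simp
    then show "?p \<omega> \<le> c\<^sup>2 * exp (\<kappa> * c)" using kappa_pos by simp
  qed
  have ip: "integrable M (\<lambda>\<omega>. indicator A \<omega> * ?p \<omega>)"
  proof (rule integrable_const_bound[of _ "c\<^sup>2 * exp (\<kappa> * c)"])
    show "AE \<omega> in M. norm (indicator A \<omega> * ?p \<omega>) \<le> c\<^sup>2 * exp (\<kappa> * c)"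
    proof (rule AE_I2)
      fix \<omega> assume "\<omega> \<in> space M"
      from pb[OF this] show "norm (indicator A \<omega> * ?p \<omega>) \<le> c\<^sup>2 * exp (\<kappa> * c)"
        by (cases "\<omega> \<in> A") (simp_all del: times_divide_eq_left)
    qed
  qed measurable
  have id: "integrable M (\<lambda>\<omega>. indicator A \<omega> * (\<rho> \<omega> - \<sigma> \<omega>))"
    using integrable_mult_indicator[OF AM integrable_duration] by simp
  have "(\<integral>\<omega>. indicator A \<omega> * ?p \<omega> \<partial>M) - (\<integral>\<omega>. indicator A \<omega> * (\<rho> \<omega> - \<sigma> \<omega>) \<partial>M) = 0"
    using martingale_compensated_duration[OF i A]
    unfolding right_diff_distrib[of "indicator A _" "?p _"] Bochner_Integration.integral_diff[OF ip id] .
  then have "(\<integral>\<omega>. indicator A \<omega> * (\<rho> \<omega> - \<sigma> \<omega>) \<partial>M) = (\<integral>\<omega>. indicator A \<omega> * ?p \<omega> \<partial>M)" by simp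
  also have "\<dots> \<le> (\<integral>\<omega>. (c\<^sup>2 * exp (\<kappa> * c)) * indicator A \<omega> \<partial>M)"
  proof (rule integral_mono[OF ip])
    show "integrable M (\<lambda>\<omega>. (c\<^sup>2 * exp (\<kappa> * c)) * indicator A \<omega>)"
      using AM by (intro integrable_mult_right) (simp add: less_top[symmetric])
    fix \<omega> assume "\<omega> \<in> space M"
    from pb[OF this] show "indicator A \<omega> * ?p \<omega> \<le> (c\<^sup>2 * exp (\<kappa> * c)) * indicator A \<omega>"
      by (cases "\<omega> \<in> A") (simp_all del: times_divide_eq_left)
  qed
  also have "\<dots> = c\<^sup>2 * exp (\<kappa> * c) * prob A"
    using AM by (simp add: Int_absorb2 sets.sets_into_space)
  finally show ?thesis .
qed

end

end

lemma exp_minus_one_abs_le: "\<bar>exp x - 1\<bar> \<le> \<bar>x\<bar> * exp \<bar>x\<bar>" for x :: real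
proof (cases "0 \<le> x")
  case True
  have "1 - x \<le> exp (- x)" using exp_ge_add_one_self[of "- x"] by simp
  then have "exp x * (1 - x) \<le> exp x * exp (- x)" by (rule mult_left_mono) simp
  then show ?thesis using True by (simp add: exp_minus algebra_simps)
next
  case False
  have "1 + x \<le> exp x" by (rule exp_ge_add_one_self)
  moreover have "- x * 1 \<le> - x * exp (- x)" using False by (intro mult_left_mono) auto
  ultimately have "1 - exp x \<le> - x * exp (- x)" by linarith
  then show ?thesis using False by (simp add: abs_of_nonpos)
qed

section \<open>The embedded walk and the durations of its excursions\<close>

declare embedding_time.simps(2)[simp del]

context filtered_bm begin

lemma integrable_exp_X:
  assumes "0 \<le> u" shows "integrable M (\<lambda>\<omega>. exp (\<kappa> * X u \<omega>))"
  using optional_stopping_terminal(1)[OF dominated_martingale_exp_X stopping_time_const[of F u], of u "{}"] assms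
  by simp

definition step :: "real \<Rightarrow> nat \<Rightarrow> 'a \<Rightarrow> real" where
  "step h k \<omega> = X (\<theta> h (Suc k) \<omega>) \<omega> - X (\<theta> h k \<omega>) \<omega>"

definition holding :: "real \<Rightarrow> nat \<Rightarrow> 'a \<Rightarrow> real" where
  "holding h k \<omega> = \<theta> h (Suc k) \<omega> - \<theta> h k \<omega>"

text \<open>
  By \<open>martingale_compensated_duration\<close> these variables are orthogonal to everything that is known when the excursion starts.
\<close>

definition compensated :: "real \<Rightarrow> nat \<Rightarrow> 'a \<Rightarrow> real" where
  "compensated h k \<omega> = 2 / \<kappa>\<^sup>2 * (exp (\<kappa> * step h k \<omega>) - 1 - \<kappa> * step h k \<omega>) - holding h k \<omega>"

context
  fixes h :: real
  assumes h: "0 < h"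
begin

lemma theta_stopping: "stopping_time F (\<theta> h k)"
  by (rule stopping_time_embedding[OF h])

lemma theta_order: "\<omega> \<in> space M \<Longrightarrow> 0 \<le> \<theta> h k \<omega> \<and> \<theta> h k \<omega> \<le> \<theta> h (Suc k) \<omega>"
  using embedding_time_nonneg[OF h] embedding_time_less_Suc[OF h, of \<omega> k] by (simp add: less_imp_le)

lemma theta_osc: "\<omega> \<in> space M \<Longrightarrow> \<theta> h k \<omega> \<le> u \<Longrightarrow> u \<le> \<theta> h (Suc k) \<omega> \<Longrightarrow> \<bar>X u \<omega> - X (\<theta> h k \<omega>) \<omega>\<bar> \<le> h"
  by (rule embedding_excursion[OF h])

lemma walk_measurable: "(\<lambda>\<omega>. X (\<theta> h k \<omega>) \<omega>) \<in> borel_measurable (pre_sigma (\<theta> h k))"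
  by (rule X_at_stopping_time[OF theta_stopping embedding_time_nonneg[OF h]])

lemma pre_sigma_theta_mono:
  assumes "i \<le> j" and f: "f \<in> borel_measurable (pre_sigma (\<theta> h i))"
  shows "f \<in> borel_measurable (pre_sigma (\<theta> h j))"
proof (rule measurable_from_subalg[OF _ f])
  show "subalgebra (pre_sigma (\<theta> h j)) (pre_sigma (\<theta> h i))"
    unfolding subalgebra_def
    using mono_pre_sigma[OF theta_stopping[of i] theta_stopping[of j] embedding_time_le[OF h _ assms(1)]]
    by (simp add: space_pre_sigma)
qed

lemma theta_M[measurable]: "\<theta> h k \<in> borel_measurable M"
  by (rule stopping_time_M[OF theta_stopping])

lemma walk_M[measurable]: "(\<lambda>\<omega>. X (\<theta> h k \<omega>) \<omega>) \<in> borel_measurable M"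
  by (rule measurable_pre_sigma_M[OF theta_stopping walk_measurable])

lemma step_M[measurable]: "step h k \<in> borel_measurable M"
  unfolding step_def[abs_def] by measurable

lemma holding_M[measurable]: "holding h k \<in> borel_measurable M"
  unfolding holding_def[abs_def] by measurable

lemma compensated_M[measurable]: "compensated h k \<in> borel_measurable M"
  unfolding compensated_def[abs_def] by measurable

lemma step_abs: "\<omega> \<in> space M \<Longrightarrow> \<bar>step h k \<omega>\<bar> = h"
  unfolding step_def by (rule embedding_step[OF h])

lemma exp_walk_bounded:
  assumes "0 \<le> p" "\<omega> \<in> space M"
  shows "exp (p * X (\<theta> h k \<omega>) \<omega>) \<le> exp (p * (real k * h))"
  using embedded_walk_bounded[OF h assms(2), of k] assms(1) by (simp add: mult_left_mono abs_le_iff)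

lemma integrable_exp_walk: "0 \<le> p \<Longrightarrow> integrable M (\<lambda>\<omega>. exp (p * X (\<theta> h k \<omega>) \<omega>))"
  by (rule integrable_const_bound[of _ "exp (p * (real k * h))"])
    (auto intro!: AE_I2 exp_walk_bounded[unfolded exp_le_cancel_iff])

lemmas walk_context = theta_stopping theta_stopping theta_order theta_osc

lemma integrable_holding: "integrable M (holding h k)"
  using integrable_duration[OF walk_context] by (simp add: holding_def[abs_def])

lemma holding_nonneg: "\<omega> \<in> space M \<Longrightarrow> 0 \<le> holding h k \<omega>"
  using theta_order by (simp add: holding_def)

context
  fixes H :: real
  assumes hH: "h \<le> H"
begin

lemma expectation_holding_le: "(\<integral>\<omega>. holding h k \<omega> \<partial>M) \<le> h\<^sup>2 * exp (\<kappa> * H)"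
proof -
  have "(\<integral>\<omega>. holding h k \<omega> \<partial>M) = (\<integral>\<omega>. indicator (space M) \<omega> * (\<theta> h (Suc k) \<omega> - \<theta> h k \<omega>) \<partial>M)"
    by (rule Bochner_Integration.integral_cong) (auto simp: holding_def)
  also have "\<dots> \<le> h\<^sup>2 * exp (\<kappa> * h) * prob (space M)"
    by (rule expected_duration_le[OF walk_context integrable_exp_walk space_in_pre_sigma])
      (use kappa_pos in auto)
  also have "\<dots> \<le> h\<^sup>2 * exp (\<kappa> * H)" using kappa_pos hH by (simp add: prob_space mult_left_mono)
  finally show ?thesis .
qed

text \<open>
  On the event \<open>A\<close>, which is known at time \<open>u\<close>, the remaining duration of the excursion starts at the fixed time \<open>u\<close>. Two positions
  within one excursion differ by at most \<open>2h\<close>, so the mean remaining duration is of order \<open>h\<^sup>2\<close>, uniformly in \<open>u\<close>.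
\<close>

lemma expectation_remaining_le:
  assumes u: "0 \<le> u" and A_def: "A = {\<omega> \<in> space M. \<theta> h k \<omega> \<le> u \<and> u \<le> \<theta> h (Suc k) \<omega>}"
  shows "A \<in> sets M"
    and "integrable M (\<lambda>\<omega>. indicator A \<omega> * (\<theta> h (Suc k) \<omega> - u))"
    and "(\<integral>\<omega>. indicator A \<omega> * (\<theta> h (Suc k) \<omega> - u) \<partial>M) \<le> 4 * h\<^sup>2 * exp (2 * \<kappa> * H) * prob A"
proof -
  have A: "A \<in> sets (F u)"
  proof -
    note stopping_timeD[OF theta_stopping[of k], of u, measurable]
      stopping_time_less_const[OF theta_stopping[of "Suc k"], of u, measurable]
    have "{\<omega> \<in> space (F u). \<theta> h k \<omega> \<le> u \<and> \<not> \<theta> h (Suc k) \<omega> < u} \<in> sets (F u)" by measurable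
    then show ?thesis by (simp add: A_def space_F not_less)
  qed
  then show "A \<in> sets M" using sets_F by (rule rev_subsetD)
  \<comment> \<open>Off \<open>A\<close> the interval is empty, so that the oscillation bound holds at every sample point.\<close>
  define \<rho> where "\<rho> \<omega> = (if \<omega> \<in> A then \<theta> h (Suc k) \<omega> else u)" for \<omega>
  have \<rho>st: "stopping_time F \<rho>"
  proof (rule stopping_timeI)
    fix t
    show "Measurable.pred (F t) (\<lambda>\<omega>. \<rho> \<omega> \<le> t)"
    proof (cases "u \<le> t")
      case True
      have [measurable]: "A \<in> sets (F t)" using A sets_F_mono[OF True] by auto
      note stopping_timeD[OF theta_stopping[of "Suc k"], of t, measurable]
      have "Measurable.pred (F t) (\<lambda>\<omega>. \<omega> \<in> A \<longrightarrow> \<theta> h (Suc k) \<omega> \<le> t)" by measurable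
      then show ?thesis
        by (rule measurable_cong[THEN iffD2, rotated]) (use True in \<open>auto simp: \<rho>_def\<close>)
    next
      case False
      have "Measurable.pred (F t) (\<lambda>\<omega>. False)" by simp
      then show ?thesis
        by (rule measurable_cong[THEN iffD2, rotated]) (use False in \<open>auto simp: \<rho>_def A_def\<close>)
    qed
  qed
  have order: "0 \<le> u \<and> u \<le> \<rho> \<omega>" for \<omega> using u by (simp add: \<rho>_def A_def)
  have osc: "\<bar>X v \<omega> - X u \<omega>\<bar> \<le> 2 * h" if "\<omega> \<in> space M" "u \<le> v" "v \<le> \<rho> \<omega>" for \<omega> v
  proof (cases "\<omega> \<in> A")
    case True
    then have "\<bar>X v \<omega> - X (\<theta> h k \<omega>) \<omega>\<bar> \<le> h" "\<bar>X u \<omega> - X (\<theta> h k \<omega>) \<omega>\<bar> \<le> h"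
      using that by (auto intro!: theta_osc simp: \<rho>_def A_def)
    then show ?thesis by linarith
  next
    case False
    then have "v = u" using that by (simp add: \<rho>_def)
    then show ?thesis using h by simp
  qed
  have eq: "indicator A \<omega> * (\<rho> \<omega> - u) = indicator A \<omega> * (\<theta> h (Suc k) \<omega> - u)" for \<omega>
    by (simp add: \<rho>_def indicator_def)
  have Au: "A \<in> sets (pre_sigma (\<lambda>_. u))"
  proof (rule sets_pre_sigmaI[OF stopping_time_const])
    fix t
    show "{\<omega> \<in> A. u \<le> t} \<in> sets (F t)"
      using A sets_F_mono[of u t] by (cases "u \<le> t") auto
  qed
  have "(\<integral>\<omega>. indicator A \<omega> * (\<rho> \<omega> - u) \<partial>M) \<le> (2 * h)\<^sup>2 * exp (\<kappa> * (2 * h)) * prob A"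
    by (rule expected_duration_le[OF stopping_time_const \<rho>st order osc integrable_exp_X[OF u] Au])
  also have "\<dots> \<le> 4 * h\<^sup>2 * exp (2 * \<kappa> * H) * prob A"
    using kappa_pos hH by (auto intro!: mult_right_mono mult_left_mono simp: power_mult_distrib)
  finally show "(\<integral>\<omega>. indicator A \<omega> * (\<theta> h (Suc k) \<omega> - u) \<partial>M) \<le> 4 * h\<^sup>2 * exp (2 * \<kappa> * H) * prob A"
    unfolding eq .
  have "integrable M (\<lambda>\<omega>. indicator A \<omega> * (\<rho> \<omega> - u))"
    using integrable_mult_indicator[OF \<open>A \<in> sets M\<close> integrable_duration[OF stopping_time_const \<rho>st order osc]]
    by simp
  then show "integrable M (\<lambda>\<omega>. indicator A \<omega> * (\<theta> h (Suc k) \<omega> - u))" unfolding eq .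
qed

text \<open>
  The square of a duration is twice the integral over \<open>u\<close> of the remaining duration at \<open>u\<close>. By Fubini's theorem and the
  uniform bound on the mean remaining duration, the second moment is of order \<open>h\<^sup>2\<close> times the mean.
\<close>

lemma holding_square:
  shows "integrable M (\<lambda>\<omega>. (holding h k \<omega>)\<^sup>2)"
    and "(\<integral>\<omega>. (holding h k \<omega>)\<^sup>2 \<partial>M) \<le> 8 * exp (3 * \<kappa> * H) * h ^ 4"
proof -
  interpret P: pair_sigma_finite M lborel
    by (intro pair_sigma_finite.intro sigma_finite_measure_axioms lborel.sigma_finite_measure_axioms)
  let ?a = "\<theta> h k" and ?b = "\<theta> h (Suc k)"
  define c where "c = 8 * h\<^sup>2 * exp (2 * \<kappa> * H)"
  have c0: "0 \<le> c" by (simp add: c_def)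
  define f where "f \<omega> u = (if ?a \<omega> \<le> u \<and> u \<le> ?b \<omega> then ennreal (2 * (?b \<omega> - u)) else 0)" for \<omega> u
  define g :: "'a \<Rightarrow> real \<Rightarrow> ennreal" where "g \<omega> u = (if ?a \<omega> \<le> u \<and> u \<le> ?b \<omega> then 1 else 0)" for \<omega> u
  have fm: "case_prod f \<in> borel_measurable (M \<Otimes>\<^sub>M lborel)"
    unfolding f_def by measurable
  have gm: "case_prod g \<in> borel_measurable (M \<Otimes>\<^sub>M lborel)"
    unfolding g_def by measurable
  have gm': "case_prod (\<lambda>u \<omega>. g \<omega> u) \<in> borel_measurable (lborel \<Otimes>\<^sub>M M)"
    unfolding g_def by measurable
  have inner: "(\<integral>\<^sup>+u. f \<omega> u \<partial>lborel) = ennreal ((holding h k \<omega>)\<^sup>2)" if \<omega>: "\<omega> \<in> space M" for \<omega>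
  proof -
    have "(\<integral>\<^sup>+u. f \<omega> u \<partial>lborel) = (\<integral>\<^sup>+u. ennreal (2 * (?b \<omega> - u)) * indicator {?a \<omega>..?b \<omega>} u \<partial>lborel)"
      by (rule nn_integral_cong) (auto simp: f_def indicator_def)
    also have "\<dots> = ennreal (- ((?b \<omega> - ?b \<omega>)\<^sup>2) - - ((?b \<omega> - ?a \<omega>)\<^sup>2))"
    proof (rule nn_integral_FTC_Icc)
      show "((\<lambda>u. - ((?b \<omega> - u)\<^sup>2)) has_real_derivative 2 * (?b \<omega> - x)) (at x)" for x
        by (auto intro!: derivative_eq_intros)
      show "?a \<omega> \<le> ?b \<omega>" using theta_order[OF \<omega>] by simp
    qed auto
    finally show ?thesis by (simp add: holding_def)
  qed
  have inner2: "(\<integral>\<^sup>+u. g \<omega> u \<partial>lborel) = ennreal (holding h k \<omega>)" if \<omega>: "\<omega> \<in> space M" for \<omega>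
  proof -
    have "(\<integral>\<^sup>+u. g \<omega> u \<partial>lborel) = (\<integral>\<^sup>+u. indicator {?a \<omega>..?b \<omega>} u \<partial>lborel)"
      by (rule nn_integral_cong) (auto simp: g_def indicator_def)
    then show ?thesis using theta_order[OF \<omega>] by (simp add: holding_def)
  qed
  have outer: "(\<integral>\<^sup>+\<omega>. f \<omega> u \<partial>M) \<le> ennreal c * (\<integral>\<^sup>+\<omega>. g \<omega> u \<partial>M)" for u
  proof (cases "0 \<le> u")
    case False
    then have "(\<integral>\<^sup>+\<omega>. f \<omega> u \<partial>M) = (\<integral>\<^sup>+\<omega>. 0 \<partial>M)"
      by (intro nn_integral_cong) (use embedding_time_nonneg[OF h, of _ k] in \<open>force simp: f_def\<close>)
    then show ?thesis by simp
  next
    case True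
    define A where "A = {\<omega> \<in> space M. ?a \<omega> \<le> u \<and> u \<le> ?b \<omega>}"
    note R = expectation_remaining_le[OF True A_def]
    have "(\<integral>\<^sup>+\<omega>. f \<omega> u \<partial>M) = (\<integral>\<^sup>+\<omega>. ennreal (2 * (indicator A \<omega> * (?b \<omega> - u))) \<partial>M)"
      by (intro nn_integral_cong) (auto simp: f_def A_def indicator_def)
    also have "\<dots> = ennreal (\<integral>\<omega>. 2 * (indicator A \<omega> * (?b \<omega> - u)) \<partial>M)"
      by (rule nn_integral_eq_integral) (use R(2) in \<open>auto simp: A_def indicator_def\<close>)
    also have "\<dots> \<le> ennreal (c * prob A)"
      using R(3) unfolding integral_mult_right_zero
      by (intro ennreal_leI) (simp add: c_def mult_ac)
    also have "\<dots> = ennreal c * emeasure M A"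
      using c0 by (simp add: ennreal_mult' emeasure_eq_measure)
    also have "emeasure M A = (\<integral>\<^sup>+\<omega>. indicator A \<omega> \<partial>M)" using R(1) by simp
    also have "\<dots> = (\<integral>\<^sup>+\<omega>. g \<omega> u \<partial>M)"
      by (intro nn_integral_cong) (auto simp: g_def A_def indicator_def)
    finally show ?thesis .
  qed
  have "(\<integral>\<^sup>+\<omega>. ennreal ((holding h k \<omega>)\<^sup>2) \<partial>M) = (\<integral>\<^sup>+\<omega>. (\<integral>\<^sup>+u. f \<omega> u \<partial>lborel) \<partial>M)"
    by (intro nn_integral_cong) (simp add: inner)
  also have "\<dots> = (\<integral>\<^sup>+u. (\<integral>\<^sup>+\<omega>. f \<omega> u \<partial>M) \<partial>lborel)" by (rule P.Fubini'[OF fm, symmetric])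
  also have "\<dots> \<le> (\<integral>\<^sup>+u. ennreal c * (\<integral>\<^sup>+\<omega>. g \<omega> u \<partial>M) \<partial>lborel)"
    by (intro nn_integral_mono outer)
  also have "\<dots> = ennreal c * (\<integral>\<^sup>+u. (\<integral>\<^sup>+\<omega>. g \<omega> u \<partial>M) \<partial>lborel)"
    by (rule nn_integral_cmult) (use borel_measurable_nn_integral[OF gm'] in simp)
  also have "(\<integral>\<^sup>+u. (\<integral>\<^sup>+\<omega>. g \<omega> u \<partial>M) \<partial>lborel) = (\<integral>\<^sup>+\<omega>. (\<integral>\<^sup>+u. g \<omega> u \<partial>lborel) \<partial>M)"
    by (rule P.Fubini'[OF gm])
  also have "\<dots> = (\<integral>\<^sup>+\<omega>. ennreal (holding h k \<omega>) \<partial>M)" by (intro nn_integral_cong) (simp add: inner2)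
  also have "\<dots> = ennreal (\<integral>\<omega>. holding h k \<omega> \<partial>M)"
    by (rule nn_integral_eq_integral[OF integrable_holding]) (auto intro!: AE_I2 holding_nonneg)
  also have "ennreal c * ennreal (\<integral>\<omega>. holding h k \<omega> \<partial>M) \<le> ennreal c * ennreal (h\<^sup>2 * exp (\<kappa> * H))"
    by (intro mult_left_mono ennreal_leI expectation_holding_le) simp
  also have "\<dots> = ennreal (8 * exp (3 * \<kappa> * H) * h ^ 4)"
  proof -
    have "c * (h\<^sup>2 * exp (\<kappa> * H)) = 8 * (exp (2 * \<kappa> * H) * exp (\<kappa> * H)) * (h\<^sup>2 * h\<^sup>2)"
      by (simp add: c_def)
    also have "\<dots> = 8 * exp (3 * \<kappa> * H) * h ^ 4"
      by (simp flip: exp_add power_add)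
    finally show ?thesis using c0 by (simp flip: ennreal_mult')
  qed
  finally have *: "(\<integral>\<^sup>+\<omega>. ennreal ((holding h k \<omega>)\<^sup>2) \<partial>M) \<le> ennreal (8 * exp (3 * \<kappa> * H) * h ^ 4)" .
  then show i: "integrable M (\<lambda>\<omega>. (holding h k \<omega>)\<^sup>2)"
    by (intro integrableI_nonneg) (auto simp: less_top[symmetric] top_unique)
  from * show "(\<integral>\<omega>. (holding h k \<omega>)\<^sup>2 \<partial>M) \<le> 8 * exp (3 * \<kappa> * H) * h ^ 4"
    by (subst (asm) nn_integral_eq_integral[OF i]) (simp_all add: ennreal_le_iff)
qed

end
end
end

text \<open>
  A second order expansion at \<open>1\<close>. For \<open>x = exp (\<kappa> \<xi>)\<close> with a step \<open>\<xi>\<close> of the walk the linear term has conditional mean zero, and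
  the quadratic one is of order \<open>h\<^sup>2\<close>.
\<close>

lemma power_four_le:
  fixes x a :: real
  assumes "0 \<le> x" "x \<le> a" "1 \<le> a"
  shows "x ^ 4 \<le> 1 + 4 * (x - 1) + 6 * a\<^sup>2 * (x - 1)\<^sup>2"
proof -
  have x2: "x\<^sup>2 \<le> a\<^sup>2" using assms by (intro power_mono) auto
  have a2: "a * 1 \<le> a * a" "1 * 1 \<le> a * a" using assms by (intro mult_mono; simp)+
  have "x\<^sup>2 + 2 * x + 3 \<le> 6 * a\<^sup>2" using x2 a2 assms unfolding power2_eq_square by linarith
  then have "(x\<^sup>2 + 2 * x + 3) * (x - 1)\<^sup>2 \<le> 6 * a\<^sup>2 * (x - 1)\<^sup>2" by (rule mult_right_mono) simp
  moreover have "x ^ 4 = 1 + 4 * (x - 1) + (x\<^sup>2 + 2 * x + 3) * (x - 1)\<^sup>2" by algebra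
  ultimately show ?thesis by linarith
qed

context filtered_bm begin

context
  fixes h H :: real
  assumes h: "0 < h" and hH: "h \<le> H"
begin

lemma exp_step_integrable: "integrable M (\<lambda>\<omega>. exp (\<kappa> * step h k \<omega>))"
  using integrable_exp_increment[OF walk_context[OF h]] by (simp add: step_def)

lemma step_integrable: "integrable M (step h k)"
  by (rule integrable_const_bound[of _ h]) (auto intro!: AE_I2 step_M[OF h] simp: step_abs[OF h])

lemma compensated_integrable: "integrable M (compensated h k)"
  unfolding compensated_def[abs_def]
  by (intro Bochner_Integration.integrable_diff integrable_mult_right integrable_const
      exp_step_integrable step_integrable integrable_holding[OF h])

lemma expectation_mult_exp_step:
  assumes g: "g \<in> borel_measurable (pre_sigma (\<theta> h k))"
    and i: "integrable M (\<lambda>\<omega>. g \<omega> * (exp (\<kappa> * step h k \<omega>) - 1) :: real)"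
  shows "(\<integral>\<omega>. g \<omega> * (exp (\<kappa> * step h k \<omega>) - 1) \<partial>M) = 0"
proof (rule integral_mult_eq_zero[OF theta_stopping[OF h] _ _ g i])
  show "integrable M (\<lambda>\<omega>. exp (\<kappa> * step h k \<omega>) - 1)" using exp_step_integrable by simp
  show "(\<integral>\<omega>. indicator A \<omega> * (exp (\<kappa> * step h k \<omega>) - 1) \<partial>M) = 0"
    if "A \<in> sets (pre_sigma (\<theta> h k))" for A
    unfolding step_def
    by (rule martingale_exp_increment[OF walk_context[OF h] integrable_exp_walk[OF h] that])
      (use kappa_pos in auto)
qed

lemma expectation_mult_compensated:
  assumes g: "g \<in> borel_measurable (pre_sigma (\<theta> h k))"
    and i: "integrable M (\<lambda>\<omega>. g \<omega> * compensated h k \<omega> :: real)"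
  shows "(\<integral>\<omega>. g \<omega> * compensated h k \<omega> \<partial>M) = 0"
proof (rule integral_mult_eq_zero[OF theta_stopping[OF h] compensated_integrable _ g i])
  show "(\<integral>\<omega>. indicator A \<omega> * compensated h k \<omega> \<partial>M) = 0"
    if "A \<in> sets (pre_sigma (\<theta> h k))" for A
    unfolding compensated_def step_def holding_def
    by (rule martingale_compensated_duration[OF walk_context[OF h] integrable_exp_walk[OF h] that])
      (use kappa_pos in auto)
qed

text \<open>
  Since \<open>\<bar>step\<bar> = h\<close> exactly, the quadratic part of the exponential is deterministic up to order \<open>h\<^sup>3\<close>.
\<close>

lemma quadratic_part:
  assumes \<omega>: "\<omega> \<in> space M"
  shows "0 \<le> 2 / \<kappa>\<^sup>2 * (exp (\<kappa> * step h k \<omega>) - 1 - \<kappa> * step h k \<omega>)"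
    and "2 / \<kappa>\<^sup>2 * (exp (\<kappa> * step h k \<omega>) - 1 - \<kappa> * step h k \<omega>) \<le> h\<^sup>2 * exp (\<kappa> * H)"
    and "\<bar>2 / \<kappa>\<^sup>2 * (exp (\<kappa> * step h k \<omega>) - 1 - \<kappa> * step h k \<omega>) - h\<^sup>2\<bar> \<le> \<kappa> * h ^ 3 * exp (\<kappa> * H)"
proof -
  let ?y = "\<kappa> * step h k \<omega>"
  have y: "\<bar>?y\<bar> = \<kappa> * h" using step_abs[OF h \<omega>, of k] kappa_pos by (simp add: abs_mult)
  have y2: "?y\<^sup>2 = \<kappa>\<^sup>2 * h\<^sup>2"
  proof -
    have "?y\<^sup>2 = \<bar>?y\<bar>\<^sup>2" by simp
    then show ?thesis unfolding y by (simp add: power_mult_distrib)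
  qed
  have e: "exp (\<kappa> * h) \<le> exp (\<kappa> * H)" using hH kappa_pos by simp
  show "0 \<le> 2 / \<kappa>\<^sup>2 * (exp ?y - 1 - ?y)" using exp_minus_linear_nonneg[of ?y] by simp
  have "2 / \<kappa>\<^sup>2 * (exp ?y - 1 - ?y) \<le> 2 / \<kappa>\<^sup>2 * (?y\<^sup>2 * exp \<bar>?y\<bar> / 2)"
    by (rule mult_left_mono[OF exp_minus_linear_le]) simp
  also have "\<dots> = h\<^sup>2 * exp (\<kappa> * h)" unfolding y y2 using kappa_pos by simp
  also have "\<dots> \<le> h\<^sup>2 * exp (\<kappa> * H)" using e by (intro mult_left_mono) auto
  finally show "2 / \<kappa>\<^sup>2 * (exp ?y - 1 - ?y) \<le> h\<^sup>2 * exp (\<kappa> * H)" .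
  have "\<bar>2 / \<kappa>\<^sup>2 * (exp ?y - 1 - ?y) - h\<^sup>2\<bar> = \<bar>2 / \<kappa>\<^sup>2 * (exp ?y - 1 - ?y - ?y\<^sup>2 / 2)\<bar>"
    unfolding y2 using kappa_pos by (simp add: right_diff_distrib)
  also have "\<dots> = 2 / \<kappa>\<^sup>2 * \<bar>exp ?y - 1 - ?y - ?y\<^sup>2 / 2\<bar>"
    unfolding abs_mult by simp
  also have "\<dots> \<le> 2 / \<kappa>\<^sup>2 * (\<bar>?y\<bar> ^ 3 * exp \<bar>?y\<bar> / 6)"
    by (rule mult_left_mono[OF exp_minus_quadratic_le]) simp
  also have "\<dots> = \<kappa> * h ^ 3 * exp (\<kappa> * h) / 3"
    unfolding y using kappa_pos by (simp add: power_mult_distrib power2_eq_square power3_eq_cube)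
  also have "\<dots> \<le> \<kappa> * h ^ 3 * exp (\<kappa> * H)"
  proof -
    have "\<kappa> * h ^ 3 * exp (\<kappa> * h) \<le> \<kappa> * h ^ 3 * exp (\<kappa> * H)"
      using e h kappa_pos by (intro mult_left_mono) auto
    moreover have "0 \<le> \<kappa> * h ^ 3 * exp (\<kappa> * h)" using h kappa_pos by simp
    ultimately show ?thesis by linarith
  qed
  finally show "\<bar>2 / \<kappa>\<^sup>2 * (exp ?y - 1 - ?y) - h\<^sup>2\<bar> \<le> \<kappa> * h ^ 3 * exp (\<kappa> * H)" .
qed

lemma compensated_square:
  shows "integrable M (\<lambda>\<omega>. (compensated h k \<omega>)\<^sup>2)"
    and "(\<integral>\<omega>. (compensated h k \<omega>)\<^sup>2 \<partial>M) \<le> 18 * exp (3 * \<kappa> * H) * h ^ 4"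
proof -
  let ?c = "(h\<^sup>2 * exp (\<kappa> * H))\<^sup>2"
  have b: "(compensated h k \<omega>)\<^sup>2 \<le> 2 * ?c + 2 * (holding h k \<omega>)\<^sup>2" if \<omega>: "\<omega> \<in> space M" for \<omega>
  proof -
    define p where "p = 2 / \<kappa>\<^sup>2 * (exp (\<kappa> * step h k \<omega>) - 1 - \<kappa> * step h k \<omega>)"
    have "p\<^sup>2 \<le> ?c" unfolding p_def using quadratic_part[OF \<omega>, of k] by (intro power_mono) auto
    moreover have "(p - d)\<^sup>2 \<le> 2 * p\<^sup>2 + 2 * d\<^sup>2" for d
    proof -
      have "0 \<le> (p + d)\<^sup>2" by simp
      then show ?thesis by (simp add: power2_eq_square algebra_simps)
    qed
    ultimately show ?thesis unfolding compensated_def p_def[symmetric]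
      by (smt (verit))
  qed
  have i2: "integrable M (\<lambda>\<omega>. 2 * ?c + 2 * (holding h k \<omega>)\<^sup>2)"
    using holding_square(1)[OF h hH, of k] by simp
  show i: "integrable M (\<lambda>\<omega>. (compensated h k \<omega>)\<^sup>2)"
  proof (rule Bochner_Integration.integrable_bound[OF i2])
    show "(\<lambda>\<omega>. (compensated h k \<omega>)\<^sup>2) \<in> borel_measurable M" using compensated_M[OF h, of k] by measurable
    show "AE \<omega> in M. norm ((compensated h k \<omega>)\<^sup>2) \<le> norm (2 * ?c + 2 * (holding h k \<omega>)\<^sup>2)"
      using b by (intro AE_I2) (simp add: abs_of_nonneg)
  qed
  have "(\<integral>\<omega>. (compensated h k \<omega>)\<^sup>2 \<partial>M) \<le> (\<integral>\<omega>. 2 * ?c + 2 * (holding h k \<omega>)\<^sup>2 \<partial>M)"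
    by (rule integral_mono[OF i i2 b])
  also have "\<dots> = 2 * ?c + 2 * (\<integral>\<omega>. (holding h k \<omega>)\<^sup>2 \<partial>M)"
    using holding_square(1)[OF h hH, of k] by (simp add: prob_space)
  also have "\<dots> \<le> 2 * ?c + 2 * (8 * exp (3 * \<kappa> * H) * h ^ 4)"
    using holding_square(2)[OF h hH, of k] by linarith
  also have "?c = exp (2 * \<kappa> * H) * h ^ 4"
    by (simp add: power_mult_distrib flip: exp_double power_mult)
  also have "2 * (exp (2 * \<kappa> * H) * h ^ 4) + 2 * (8 * exp (3 * \<kappa> * H) * h ^ 4) \<le> 18 * exp (3 * \<kappa> * H) * h ^ 4"
  proof -
    have "exp (2 * \<kappa> * H) * h ^ 4 \<le> exp (3 * \<kappa> * H) * h ^ 4"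
      using kappa_pos h hH by (intro mult_right_mono) auto
    then show ?thesis by linarith
  qed
  finally show "(\<integral>\<omega>. (compensated h k \<omega>)\<^sup>2 \<partial>M) \<le> 18 * exp (3 * \<kappa> * H) * h ^ 4" .
qed

lemma compensated_pre_sigma: "compensated h k \<in> borel_measurable (pre_sigma (\<theta> h (Suc k)))"
proof -
  note [measurable] = walk_measurable[OF h, of "Suc k"]
    measurable_stopping_time_pre_sigma[OF theta_stopping[OF h], of "Suc k"]
    pre_sigma_theta_mono[OF h _ walk_measurable[OF h, of k], of "Suc k", simplified]
    pre_sigma_theta_mono[OF h _ measurable_stopping_time_pre_sigma[OF theta_stopping[OF h]], of k "Suc k", simplified]
  show ?thesis unfolding compensated_def[abs_def] step_def holding_def by measurable
qed

text \<open>
  The compensated durations are orthogonal, so their second moments add up.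
\<close>

lemma compensated_sum_square:
  shows "integrable M (\<lambda>\<omega>. (\<Sum>k<n. compensated h k \<omega>)\<^sup>2)
    \<and> (\<integral>\<omega>. (\<Sum>k<n. compensated h k \<omega>)\<^sup>2 \<partial>M) \<le> real n * (18 * exp (3 * \<kappa> * H) * h ^ 4)"
proof (induction n)
  case (Suc n)
  let ?S = "\<lambda>\<omega>. \<Sum>k<n. compensated h k \<omega>"
  have Sp: "?S \<in> borel_measurable (pre_sigma (\<theta> h n))"
  proof (rule borel_measurable_sum)
    fix k assume "k \<in> {..<n}"
    then show "compensated h k \<in> borel_measurable (pre_sigma (\<theta> h n))"
      by (intro pre_sigma_theta_mono[OF h _ compensated_pre_sigma, of _ n]) auto
  qed
  have SM: "?S \<in> borel_measurable M" using measurable_pre_sigma_M[OF theta_stopping[OF h] Sp] .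
  have iS: "integrable M (\<lambda>\<omega>. (?S \<omega>)\<^sup>2)" using Suc.IH by blast
  have ix: "integrable M (\<lambda>\<omega>. ?S \<omega> * compensated h n \<omega>)"
    by (rule integrable_mult_of_squares[OF SM compensated_M[OF h] iS compensated_square(1)])
  have z: "(\<integral>\<omega>. ?S \<omega> * compensated h n \<omega> \<partial>M) = 0"
    by (rule expectation_mult_compensated[OF Sp ix])
  have eq: "(\<Sum>k<Suc n. compensated h k \<omega>)\<^sup>2
      = (?S \<omega>)\<^sup>2 + (2 * (?S \<omega> * compensated h n \<omega>) + (compensated h n \<omega>)\<^sup>2)" for \<omega>
    by (simp add: power2_eq_square algebra_simps)
  have i2: "integrable M (\<lambda>\<omega>. 2 * (?S \<omega> * compensated h n \<omega>) + (compensated h n \<omega>)\<^sup>2)"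
    using ix compensated_square(1) by (intro Bochner_Integration.integrable_add integrable_mult_right)
  have "(\<integral>\<omega>. (?S \<omega>)\<^sup>2 + (2 * (?S \<omega> * compensated h n \<omega>) + (compensated h n \<omega>)\<^sup>2) \<partial>M)
     = (\<integral>\<omega>. (?S \<omega>)\<^sup>2 \<partial>M) + (2 * (\<integral>\<omega>. ?S \<omega> * compensated h n \<omega> \<partial>M) + (\<integral>\<omega>. (compensated h n \<omega>)\<^sup>2 \<partial>M))"
    unfolding Bochner_Integration.integral_add[OF iS i2]
      Bochner_Integration.integral_add[OF integrable_mult_right[OF ix] compensated_square(1)]
    by simp
  also have "\<dots> \<le> real (Suc n) * (18 * exp (3 * \<kappa> * H) * h ^ 4)"
    using Suc.IH compensated_square(2)[of n] z by (simp add: distrib_right)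
  finally show ?case unfolding eq using iS i2 by simp
qed simp

text \<open>
  The compensated durations sum up to a quantity within order \<open>n h\<^sup>3\<close> of \<open>T\<close>, minus the last embedding time.
\<close>

lemma final_time_deviation:
  assumes n: "real n * h\<^sup>2 = T" and T: "0 < T"
  shows "integrable M (\<lambda>\<omega>. (\<theta> h n \<omega> - T)\<^sup>2)"
    and "(\<integral>\<omega>. (\<theta> h n \<omega> - T)\<^sup>2 \<partial>M)
      \<le> (36 * T * exp (3 * \<kappa> * H) + 2 * T\<^sup>2 * \<kappa>\<^sup>2 * exp (2 * \<kappa> * H)) * h\<^sup>2"
proof -
  let ?S = "\<lambda>\<omega>. \<Sum>k<n. compensated h k \<omega>"
  define d where "d = real n * (\<kappa> * h ^ 3 * exp (\<kappa> * H))"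
  have d: "d\<^sup>2 = T\<^sup>2 * \<kappa>\<^sup>2 * exp (2 * \<kappa> * H) * h\<^sup>2"
  proof -
    have "d = T * (\<kappa> * h * exp (\<kappa> * H))"
      unfolding d_def n[symmetric] by (simp add: power2_eq_square power3_eq_cube)
    then show ?thesis by (simp add: power_mult_distrib mult_ac flip: exp_double)
  qed
  have b: "(\<theta> h n \<omega> - T)\<^sup>2 \<le> 2 * (?S \<omega>)\<^sup>2 + 2 * d\<^sup>2" if \<omega>: "\<omega> \<in> space M" for \<omega>
  proof -
    let ?p = "\<lambda>k. 2 / \<kappa>\<^sup>2 * (exp (\<kappa> * step h k \<omega>) - 1 - \<kappa> * step h k \<omega>)"
    have "(\<Sum>k<n. holding h k \<omega>) = \<theta> h n \<omega>"
      unfolding holding_def by (induction n) simp_all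
    then have S: "?S \<omega> = (\<Sum>k<n. ?p k) - \<theta> h n \<omega>"
      by (simp add: compensated_def sum_subtractf)
    have "\<bar>(\<Sum>k<n. ?p k) - T\<bar> = \<bar>\<Sum>k<n. ?p k - h\<^sup>2\<bar>"
      by (simp add: sum_subtractf n)
    also have "\<dots> \<le> (\<Sum>k<n. \<bar>?p k - h\<^sup>2\<bar>)" by (rule sum_abs)
    also have "\<dots> \<le> (\<Sum>k<n. \<kappa> * h ^ 3 * exp (\<kappa> * H))"
      by (intro sum_mono quadratic_part(3) \<omega>)
    also have "\<dots> = d" by (simp add: d_def)
    finally have D: "\<bar>(\<Sum>k<n. ?p k) - T\<bar> \<le> d" .
    have "\<theta> h n \<omega> - T = ((\<Sum>k<n. ?p k) - T) - ?S \<omega>" using S by simp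
    moreover have "(x - y)\<^sup>2 \<le> 2 * y\<^sup>2 + 2 * d\<^sup>2" if "\<bar>x\<bar> \<le> d" for x y :: real
    proof -
      have "0 \<le> (x + y)\<^sup>2" by simp
      then have "(x - y)\<^sup>2 \<le> 2 * y\<^sup>2 + 2 * x\<^sup>2" by (simp add: power2_eq_square algebra_simps)
      moreover have "x\<^sup>2 \<le> d\<^sup>2" using power_mono[OF that, of 2] by simp
      ultimately show ?thesis by linarith
    qed
    ultimately show ?thesis using D by (simp only:)
  qed
  have i2: "integrable M (\<lambda>\<omega>. 2 * (?S \<omega>)\<^sup>2 + 2 * d\<^sup>2)"
    using compensated_sum_square[of n] by simp
  have i0: "(\<lambda>\<omega>. (\<theta> h n \<omega> - T)\<^sup>2) \<in> borel_measurable M" using theta_M[OF h, of n] by measurable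
  show i: "integrable M (\<lambda>\<omega>. (\<theta> h n \<omega> - T)\<^sup>2)"
    by (rule Bochner_Integration.integrable_bound[OF i2 i0]) (use b in \<open>intro AE_I2, simp add: abs_of_nonneg\<close>)
  have "(\<integral>\<omega>. (\<theta> h n \<omega> - T)\<^sup>2 \<partial>M) \<le> (\<integral>\<omega>. 2 * (?S \<omega>)\<^sup>2 + 2 * d\<^sup>2 \<partial>M)"
    by (rule integral_mono[OF i i2 b])
  also have "\<dots> = 2 * (\<integral>\<omega>. (?S \<omega>)\<^sup>2 \<partial>M) + 2 * d\<^sup>2"
    using compensated_sum_square[of n] by (simp add: prob_space)
  also have "\<dots> \<le> 2 * (real n * (18 * exp (3 * \<kappa> * H) * h ^ 4)) + 2 * d\<^sup>2"
    using conjunct2[OF compensated_sum_square[of n]] by linarith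
  also have "real n * (18 * exp (3 * \<kappa> * H) * h ^ 4) = 18 * T * exp (3 * \<kappa> * H) * h\<^sup>2"
    unfolding n[symmetric] by (simp add: power2_eq_square power4_eq_xxxx)
  finally show "(\<integral>\<omega>. (\<theta> h n \<omega> - T)\<^sup>2 \<partial>M)
      \<le> (36 * T * exp (3 * \<kappa> * H) + 2 * T\<^sup>2 * \<kappa>\<^sup>2 * exp (2 * \<kappa> * H)) * h\<^sup>2"
    unfolding d by (simp add: algebra_simps)
qed

lemma walk_Suc: "X (\<theta> h (Suc k) \<omega>) \<omega> = X (\<theta> h k \<omega>) \<omega> + step h k \<omega>"
  by (simp add: step_def)

lemma exp_walk_moment:
  "(\<integral>\<omega>. exp (4 * \<kappa> * X (\<theta> h n \<omega>) \<omega>) \<partial>M) \<le> (1 + 6 * \<kappa>\<^sup>2 * exp (4 * \<kappa> * H) * h\<^sup>2) ^ n"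
proof (induction n)
  case 0
  have "(\<integral>\<omega>. exp (4 * \<kappa> * X (\<theta> h 0 \<omega>) \<omega>) \<partial>M) = (\<integral>\<omega>. 1 \<partial>M)"
    by (rule Bochner_Integration.integral_cong) (simp_all add: X_zero)
  then show ?case by (simp add: prob_space)
next
  case (Suc n)
  define q where "q = 6 * \<kappa>\<^sup>2 * exp (4 * \<kappa> * H) * h\<^sup>2"
  let ?g = "\<lambda>\<omega>. exp (4 * \<kappa> * X (\<theta> h n \<omega>) \<omega>)" and ?x = "\<lambda>\<omega>. exp (\<kappa> * step h n \<omega>)"
  have gi: "integrable M ?g" by (rule integrable_exp_walk[OF h]) (use kappa_pos in simp)
  have gp: "?g \<in> borel_measurable (pre_sigma (\<theta> h n))"
    using walk_measurable[OF h, of n] by measurable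
  have gxi: "integrable M (\<lambda>\<omega>. ?g \<omega> * (?x \<omega> - 1))"
  proof (rule Bochner_Integration.integrable_bound)
    show "integrable M (\<lambda>\<omega>. (exp (\<kappa> * h) + 1) * ?g \<omega>)" using gi by simp
    show "(\<lambda>\<omega>. ?g \<omega> * (?x \<omega> - 1)) \<in> borel_measurable M"
      using walk_M[OF h, of n] step_M[OF h, of n] by measurable
    show "AE \<omega> in M. norm (?g \<omega> * (?x \<omega> - 1)) \<le> norm ((exp (\<kappa> * h) + 1) * ?g \<omega>)"
    proof (rule AE_I2)
      fix \<omega> assume \<omega>: "\<omega> \<in> space M"
      have "step h n \<omega> \<le> h" using step_abs[OF h \<omega>, of n] by linarith
      then have "?x \<omega> \<le> exp (\<kappa> * h)" using kappa_pos by simp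
      then have "\<bar>?x \<omega> - 1\<bar> \<le> exp (\<kappa> * h) + 1"
        using exp_gt_zero[of "\<kappa> * step h n \<omega>"] unfolding abs_le_iff by linarith
      then show "norm (?g \<omega> * (?x \<omega> - 1)) \<le> norm ((exp (\<kappa> * h) + 1) * ?g \<omega>)"
        by (simp add: abs_mult mult.commute add_nonneg_nonneg abs_of_nonneg)
    qed
  qed
  have z: "(\<integral>\<omega>. ?g \<omega> * (?x \<omega> - 1) \<partial>M) = 0" by (rule expectation_mult_exp_step[OF gp gxi])
  have pt: "exp (4 * \<kappa> * X (\<theta> h (Suc n) \<omega>) \<omega>) \<le> (1 + q) * ?g \<omega> + 4 * (?g \<omega> * (?x \<omega> - 1))"
    if \<omega>: "\<omega> \<in> space M" for \<omega>
  proof -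
    have s: "\<bar>\<kappa> * step h n \<omega>\<bar> = \<kappa> * h" using step_abs[OF h \<omega>, of n] kappa_pos by (simp add: abs_mult)
    have e1: "exp (\<kappa> * h) \<le> exp (\<kappa> * H)" using hH kappa_pos by simp
    have "\<kappa> * step h n \<omega> \<le> \<kappa> * h" using s by linarith
    then have "?x \<omega> \<le> exp (\<kappa> * H)" using e1 by (meson exp_le_cancel_iff order_trans)
    then have "(?x \<omega>) ^ 4 \<le> 1 + 4 * (?x \<omega> - 1) + 6 * (exp (\<kappa> * H))\<^sup>2 * (?x \<omega> - 1)\<^sup>2"
      by (intro power_four_le) (use kappa_pos h hH in auto)
    also have "(?x \<omega> - 1)\<^sup>2 \<le> (\<kappa> * h * exp (\<kappa> * H))\<^sup>2"
    proof -
      have "\<bar>?x \<omega> - 1\<bar> \<le> \<kappa> * h * exp (\<kappa> * h)" using exp_minus_one_abs_le[of "\<kappa> * step h n \<omega>"] unfolding s .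
      also have "\<dots> \<le> \<kappa> * h * exp (\<kappa> * H)" using e1 h kappa_pos by (intro mult_left_mono) auto
      finally show ?thesis using power_mono[of "\<bar>?x \<omega> - 1\<bar>" _ 2] by simp
    qed
    also have "1 + 4 * (?x \<omega> - 1) + 6 * (exp (\<kappa> * H))\<^sup>2 * (\<kappa> * h * exp (\<kappa> * H))\<^sup>2 = 1 + 4 * (?x \<omega> - 1) + q"
    proof -
      have "exp (4 * \<kappa> * H) = (exp (\<kappa> * H)) ^ 4" by (simp add: exp_of_nat_mult[of 4, symmetric] mult_ac)
      then show ?thesis by (simp add: q_def power2_eq_square power4_eq_xxxx)
    qed
    finally have "(?x \<omega>) ^ 4 \<le> 1 + 4 * (?x \<omega> - 1) + q" by simp
    then have "?g \<omega> * (?x \<omega>) ^ 4 \<le> ?g \<omega> * (1 + 4 * (?x \<omega> - 1) + q)" by (rule mult_left_mono) simp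
    moreover have "exp (4 * \<kappa> * X (\<theta> h (Suc n) \<omega>) \<omega>) = ?g \<omega> * (?x \<omega>) ^ 4"
      unfolding walk_Suc by (simp add: exp_of_nat_mult[of 4, symmetric] distrib_left mult_ac flip: exp_add)
    ultimately show ?thesis by (simp add: algebra_simps)
  qed
  have "(\<integral>\<omega>. exp (4 * \<kappa> * X (\<theta> h (Suc n) \<omega>) \<omega>) \<partial>M) \<le> (\<integral>\<omega>. (1 + q) * ?g \<omega> + 4 * (?g \<omega> * (?x \<omega> - 1)) \<partial>M)"
  proof (rule integral_mono[OF _ _ pt])
    show "integrable M (\<lambda>\<omega>. exp (4 * \<kappa> * X (\<theta> h (Suc n) \<omega>) \<omega>))"
      by (rule integrable_exp_walk[OF h]) (use kappa_pos in simp)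
    show "integrable M (\<lambda>\<omega>. (1 + q) * ?g \<omega> + 4 * (?g \<omega> * (?x \<omega> - 1)))"
      by (intro Bochner_Integration.integrable_add integrable_mult_right gi gxi)
  qed
  also have "\<dots> = (1 + q) * (\<integral>\<omega>. ?g \<omega> \<partial>M) + 4 * (\<integral>\<omega>. ?g \<omega> * (?x \<omega> - 1) \<partial>M)"
    unfolding Bochner_Integration.integral_add[OF integrable_mult_right[OF gi] integrable_mult_right[OF gxi]] by simp
  also have "\<dots> \<le> (1 + q) * (1 + q) ^ n"
    unfolding z using Suc.IH kappa_pos by (simp add: q_def mult_left_mono)
  finally show ?case by (simp add: q_def)
qed

text \<open>
  The inequality \<open>x\<^sup>2 - 1 \<ge> 2 (x - 1)\<close> for \<open>x = exp (\<kappa> \<xi>)\<close> turns the martingale \<open>exp (\<kappa> X)\<close> along the walk into the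
  submartingale \<open>exp (2 \<kappa> X)\<close>, to which Doob's inequality applies.
\<close>

lemma exp_walk_maximal:
  "(\<integral>\<omega>. (running_max (\<lambda>k \<omega>. exp (2 * \<kappa> * X (\<theta> h k \<omega>) \<omega>)) n \<omega>)\<^sup>2 \<partial>M)
    \<le> 4 * (\<integral>\<omega>. exp (4 * \<kappa> * X (\<theta> h n \<omega>) \<omega>) \<partial>M)"
proof -
  let ?Z = "\<lambda>k \<omega>. exp (2 * \<kappa> * X (\<theta> h k \<omega>) \<omega>)"
  have Z2: "(?Z k \<omega>)\<^sup>2 = exp (4 * \<kappa> * X (\<theta> h k \<omega>) \<omega>)" for k \<omega>
    by (simp flip: exp_double)
  have Zm: "?Z k \<in> borel_measurable M" for k using walk_M[OF h, of k] by measurable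
  have Zi: "integrable M (\<lambda>\<omega>. (?Z k \<omega>)\<^sup>2)" for k
    unfolding Z2 by (rule integrable_exp_walk[OF h]) (use kappa_pos in simp)
  have "(\<integral>\<omega>. (running_max ?Z n \<omega>)\<^sup>2 \<partial>M) \<le> 4 * (\<integral>\<omega>. (?Z n \<omega>)\<^sup>2 \<partial>M)"
  proof (rule discrete_doob_inequality[OF Zm Zi])
    fix k
    let ?R = "running_max ?Z k" and ?x = "\<lambda>\<omega>. exp (\<kappa> * step h k \<omega>)"
    have Rp: "?R \<in> borel_measurable (pre_sigma (\<theta> h k))"
    proof (rule measurable_running_max)
      fix j assume "j \<le> k"
      from pre_sigma_theta_mono[OF h this walk_measurable[OF h]]
      show "?Z j \<in> borel_measurable (pre_sigma (\<theta> h k))" by measurable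
    qed
    let ?g = "\<lambda>\<omega>. ?R \<omega> * ?Z k \<omega>"
    have gp: "?g \<in> borel_measurable (pre_sigma (\<theta> h k))"
      using Rp walk_measurable[OF h, of k] by measurable
    have Rb: "0 \<le> ?R \<omega> \<and> ?R \<omega> \<le> exp (2 * \<kappa> * (real k * h))" if \<omega>: "\<omega> \<in> space M" for \<omega>
    proof -
      obtain j where j: "j \<le> k" "?R \<omega> = ?Z j \<omega>" using running_max_attained[of k ?Z \<omega>] by blast
      have "2 * \<kappa> * (real j * h) \<le> 2 * \<kappa> * (real k * h)"
        using j(1) h kappa_pos by (intro mult_left_mono mult_right_mono) auto
      then have "?Z j \<omega> \<le> exp (2 * \<kappa> * (real k * h))"
        using exp_walk_bounded[OF h _ \<omega>, of "2 * \<kappa>" j] kappa_pos by (meson exp_le_cancel_iff order_trans less_imp_le mult_pos_pos zero_less_numeral)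
      then show ?thesis using j(2) by simp
    qed
    have bnd: "\<bar>?R \<omega> * ?Z k \<omega> * (?x \<omega> - 1)\<bar> \<le> exp (2 * \<kappa> * (real k * h)) * exp (2 * \<kappa> * (real k * h)) * (exp (\<kappa> * h) + 1)"
      "\<bar>?R \<omega> * (?Z (Suc k) \<omega> - ?Z k \<omega>)\<bar> \<le> exp (2 * \<kappa> * (real k * h)) * (exp (2 * \<kappa> * (real (Suc k) * h)) + exp (2 * \<kappa> * (real k * h)))"
      if \<omega>: "\<omega> \<in> space M" for \<omega>
    proof -
      have "step h k \<omega> \<le> h" using step_abs[OF h \<omega>, of k] by linarith
      then have "?x \<omega> \<le> exp (\<kappa> * h)" using kappa_pos by simp
      then have x: "\<bar>?x \<omega> - 1\<bar> \<le> exp (\<kappa> * h) + 1"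
        using exp_gt_zero[of "\<kappa> * step h k \<omega>"] unfolding abs_le_iff by linarith
      have z: "?Z i \<omega> \<le> exp (2 * \<kappa> * (real i * h))" for i
        using exp_walk_bounded[OF h _ \<omega>, of "2 * \<kappa>" i] kappa_pos by simp
      show "\<bar>?R \<omega> * ?Z k \<omega> * (?x \<omega> - 1)\<bar> \<le> exp (2 * \<kappa> * (real k * h)) * exp (2 * \<kappa> * (real k * h)) * (exp (\<kappa> * h) + 1)"
        unfolding abs_mult using Rb[OF \<omega>] z[of k] x by (intro mult_mono) auto
      have "\<bar>?Z (Suc k) \<omega> - ?Z k \<omega>\<bar> \<le> exp (2 * \<kappa> * (real (Suc k) * h)) + exp (2 * \<kappa> * (real k * h))"
        using z[of k] z[of "Suc k"] exp_gt_zero[of "2 * \<kappa> * X (\<theta> h k \<omega>) \<omega>"] exp_gt_zero[of "2 * \<kappa> * X (\<theta> h (Suc k) \<omega>) \<omega>"]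
        unfolding abs_le_iff by linarith
      then show "\<bar>?R \<omega> * (?Z (Suc k) \<omega> - ?Z k \<omega>)\<bar> \<le> exp (2 * \<kappa> * (real k * h)) * (exp (2 * \<kappa> * (real (Suc k) * h)) + exp (2 * \<kappa> * (real k * h)))"
        unfolding abs_mult[of "?R \<omega>"] using Rb[OF \<omega>] by (intro mult_mono) auto
    qed
    have RM: "?R \<in> borel_measurable M" by (rule measurable_pre_sigma_M[OF theta_stopping[OF h] Rp])
    have gi: "integrable M (\<lambda>\<omega>. ?g \<omega> * (?x \<omega> - 1))"
      by (rule integrable_const_bound[OF AE_I2])
        (use bnd(1) RM Zm[of k] step_M[OF h, of k] in \<open>simp_all\<close>)
    have i2: "integrable M (\<lambda>\<omega>. ?R \<omega> * (?Z (Suc k) \<omega> - ?Z k \<omega>))"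
      by (rule integrable_const_bound[OF AE_I2])
        (use bnd(2) RM Zm[of k] Zm[of "Suc k"] in \<open>simp_all del: of_nat_Suc\<close>)
    have "0 = (\<integral>\<omega>. 2 * (?g \<omega> * (?x \<omega> - 1)) \<partial>M)"
      using expectation_mult_exp_step[OF gp gi] by simp
    also have "\<dots> \<le> (\<integral>\<omega>. ?R \<omega> * (?Z (Suc k) \<omega> - ?Z k \<omega>) \<partial>M)"
    proof (rule integral_mono[OF integrable_mult_right[OF gi] i2])
      fix \<omega> assume \<omega>: "\<omega> \<in> space M"
      have "?Z (Suc k) \<omega> = ?Z k \<omega> * (?x \<omega>)\<^sup>2"
        unfolding walk_Suc by (simp add: distrib_left mult_ac flip: exp_double exp_add)
      then have "?Z (Suc k) \<omega> - ?Z k \<omega> = ?Z k \<omega> * ((?x \<omega>)\<^sup>2 - 1)" by (simp add: algebra_simps)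
      moreover have "2 * (?x \<omega> - 1) \<le> (?x \<omega>)\<^sup>2 - 1"
      proof -
        have "0 \<le> (?x \<omega> - 1)\<^sup>2" by simp
        then show ?thesis by (simp add: power2_eq_square algebra_simps)
      qed
      then have "?R \<omega> * (?Z k \<omega> * (2 * (?x \<omega> - 1))) \<le> ?R \<omega> * (?Z k \<omega> * ((?x \<omega>)\<^sup>2 - 1))"
        using Rb[OF \<omega>] by (intro mult_left_mono) auto
      moreover have "2 * (?g \<omega> * (?x \<omega> - 1)) = ?R \<omega> * (?Z k \<omega> * (2 * (?x \<omega> - 1)))"
        by (simp only: mult_ac)
      ultimately show "2 * (?g \<omega> * (?x \<omega> - 1)) \<le> ?R \<omega> * (?Z (Suc k) \<omega> - ?Z k \<omega>)"
        by (simp only:)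
    qed
    finally show "0 \<le> (\<integral>\<omega>. ?R \<omega> * (?Z (Suc k) \<omega> - ?Z k \<omega>) \<partial>M)" .
  qed
  then show ?thesis unfolding Z2 .
qed

end

end

context filtered_bm begin

section \<open>Moment bounds that are uniform in the number of steps\<close>

text \<open>
  The bound holds for all \<open>u\<close> at once, so that a random time may be inserted. On the dyadic range \<open>\<bar>u - T\<bar> \<le> 2\<^sup>j \<delta>\<close> the maximal fourth
  power has mean of order \<open>4\<^sup>j \<delta>\<^sup>2\<close>, while the weight is of order \<open>16\<^sup>j \<delta>\<^sup>4\<close>; the sum over \<open>j\<close> is a geometric series.
\<close>

lemma weighted_increment_bound:
  assumes T: "0 < T" and \<delta>: "0 < \<delta>"
  shows "\<exists>V. integrable M V \<and> (\<forall>\<omega>. 0 \<le> V \<omega>) \<and> (\<integral>\<omega>. V \<omega> \<partial>M) \<le> 16384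
    \<and> (AE \<omega> in M. \<forall>u\<ge>0. \<delta>\<^sup>2 * (B u \<omega> - B T \<omega>) ^ 4 \<le> V \<omega> * (\<delta> + \<bar>u - T\<bar>) ^ 4)"
proof -
  define r where "r j = 2 ^ j * \<delta>" for j :: nat
  have r: "0 < r j" for j using \<delta> by (simp add: r_def)
  define s where "s j = max 0 (T - r j)" for j
  have ex: "\<forall>j. \<exists>W. integrable M W \<and> (\<forall>\<omega>. 0 \<le> W \<omega>) \<and> (\<integral>\<omega>. W \<omega> \<partial>M) \<le> 48 * (r j)\<^sup>2
    \<and> (AE \<omega> in M. \<forall>u\<in>{s j..T + r j}. (B u \<omega> - B (s j) \<omega>) ^ 4 \<le> W \<omega>)"
  proof
    fix j
    have st: "0 \<le> s j" "s j < T + r j" using r[of j] T by (auto simp: s_def)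
    have "(T + r j - s j)\<^sup>2 \<le> (2 * r j)\<^sup>2" using r[of j] T by (intro power_mono) (auto simp: s_def)
    then have le: "12 * (T + r j - s j)\<^sup>2 \<le> 48 * (r j)\<^sup>2" by (simp add: power_mult_distrib)
    obtain W where W: "integrable M W \<and> (\<forall>\<omega>. 0 \<le> W \<omega>) \<and> (\<integral>\<omega>. W \<omega> \<partial>M) \<le> 12 * (T + r j - s j)\<^sup>2
      \<and> (AE \<omega> in M. \<forall>u\<in>{s j..T + r j}. (B u \<omega> - B (s j) \<omega>) ^ 4 \<le> W \<omega>)"
      using increment_maximal_fourth_moment[OF st] by (rule exE)
    show "\<exists>W. integrable M W \<and> (\<forall>\<omega>. 0 \<le> W \<omega>) \<and> (\<integral>\<omega>. W \<omega> \<partial>M) \<le> 48 * (r j)\<^sup>2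
      \<and> (AE \<omega> in M. \<forall>u\<in>{s j..T + r j}. (B u \<omega> - B (s j) \<omega>) ^ 4 \<le> W \<omega>)"
      by (rule exI[of _ W])
        (use W order_trans[OF conjunct1[OF conjunct2[OF conjunct2[OF W]]] le] in simp)
  qed
  obtain W where W': "\<forall>j. integrable M (W j) \<and> (\<forall>\<omega>. 0 \<le> W j \<omega>) \<and> (\<integral>\<omega>. W j \<omega> \<partial>M) \<le> 48 * (r j)\<^sup>2
    \<and> (AE \<omega> in M. \<forall>u\<in>{s j..T + r j}. (B u \<omega> - B (s j) \<omega>) ^ 4 \<le> W j \<omega>)"
    using choice[OF ex] by (rule exE)
  then have W: "integrable M (W j)" "0 \<le> W j \<omega>" "(\<integral>\<omega>. W j \<omega> \<partial>M) \<le> 48 * (r j)\<^sup>2"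
    "AE \<omega> in M. \<forall>u\<in>{s j..T + r j}. (B u \<omega> - B (s j) \<omega>) ^ 4 \<le> W j \<omega>" for j \<omega>
    by simp_all
  \<comment> \<open>The factor 256 is 16 from comparing with the left end of the range, times 16 from \<open>r j / 2 \<le> \<delta> + \<bar>u - T\<bar>\<close>.\<close>
  define c where "c j = 256 * \<delta>\<^sup>2 / (r j) ^ 4" for j
  have c0: "0 \<le> c j" for j using r[of j] by (simp add: c_def)
  define V0 where "V0 \<omega> = (\<Sum>j. ennreal (c j * W j \<omega>))" for \<omega>
  have Wm[measurable]: "W j \<in> borel_measurable M" for j using W(1) by (rule borel_measurable_integrable)
  have [measurable]: "V0 \<in> borel_measurable M" unfolding V0_def[abs_def] by measurable
  have E: "(\<integral>\<^sup>+\<omega>. ennreal (c j * W j \<omega>) \<partial>M) \<le> ennreal (12288 * (1 / 4) ^ j)" for j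
  proof -
    have "(\<integral>\<^sup>+\<omega>. ennreal (c j * W j \<omega>) \<partial>M) = ennreal (\<integral>\<omega>. c j * W j \<omega> \<partial>M)"
      by (rule nn_integral_eq_integral) (use W(1,2) c0 in auto)
    also have "(\<integral>\<omega>. c j * W j \<omega> \<partial>M) = c j * (\<integral>\<omega>. W j \<omega> \<partial>M)" by (rule integral_mult_right_zero)
    also have "\<dots> \<le> c j * (48 * (r j)\<^sup>2)" by (rule mult_left_mono[OF W(3) c0])
    also have "\<dots> = 12288 * (1 / 4) ^ j"
    proof -
      have "(r j)\<^sup>2 = 4 ^ j * \<delta>\<^sup>2"
        by (simp add: r_def power_mult_distrib power2_eq_square flip: power_mult_distrib)
      moreover have "(r j) ^ 4 = (r j)\<^sup>2 * (r j)\<^sup>2" by (simp flip: power_add)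
      ultimately show ?thesis using \<delta> by (simp add: c_def power_divide field_simps power2_eq_square)
    qed
    finally show ?thesis by (simp add: ennreal_leI)
  qed
  have "(\<integral>\<^sup>+\<omega>. V0 \<omega> \<partial>M) = (\<Sum>j. \<integral>\<^sup>+\<omega>. ennreal (c j * W j \<omega>) \<partial>M)"
    unfolding V0_def by (rule nn_integral_suminf) measurable
  also have "\<dots> \<le> (\<Sum>j. ennreal (12288 * (1 / 4) ^ j))" by (intro suminf_le E) auto
  also have "\<dots> = ennreal 16384"
  proof -
    have "(\<lambda>j. 12288 * (1 / 4 :: real) ^ j) sums (12288 * (1 / (1 - 1 / 4)))"
      by (intro sums_mult geometric_sums) simp
    then show ?thesis by (subst suminf_ennreal_eq[of _ 16384]) auto
  qed
  finally obtain V where V: "integrable M V" "\<And>\<omega>. 0 \<le> V \<omega>" "(\<integral>\<omega>. V \<omega> \<partial>M) \<le> 16384"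
    "AE \<omega> in M. V0 \<omega> = ennreal (V \<omega>)"
    using real_valued_version[of V0 16384] by auto
  have "AE \<omega> in M. \<forall>j. \<forall>u\<in>{s j..T + r j}. (B u \<omega> - B (s j) \<omega>) ^ 4 \<le> W j \<omega>"
    using W(4) by (simp add: AE_all_countable)
  with V(4) have "AE \<omega> in M. \<forall>u\<ge>0. \<delta>\<^sup>2 * (B u \<omega> - B T \<omega>) ^ 4 \<le> V \<omega> * (\<delta> + \<bar>u - T\<bar>) ^ 4"
  proof eventually_elim
    case (elim \<omega>)
    show ?case
    proof (intro allI impI)
      fix u :: real assume u: "0 \<le> u"
      have "\<exists>j. \<bar>u - T\<bar> \<le> r j"
      proof -
        obtain j where "\<bar>u - T\<bar> / \<delta> < 2 ^ j" using real_arch_pow[of 2 "\<bar>u - T\<bar> / \<delta>"] by auto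
        then have "\<bar>u - T\<bar> \<le> r j" using \<delta> by (simp add: r_def field_simps)
        then show ?thesis ..
      qed
      then obtain j where j: "\<bar>u - T\<bar> \<le> r j" "\<And>i. i < j \<Longrightarrow> \<not> \<bar>u - T\<bar> \<le> r i"
        using exists_least_iff[of "\<lambda>j. \<bar>u - T\<bar> \<le> r j"] by blast
      have half: "r j / 2 \<le> \<delta> + \<bar>u - T\<bar>"
      proof (cases j)
        case 0
        then show ?thesis using \<delta> by (simp add: r_def)
      next
        case (Suc i)
        then have "r i < \<bar>u - T\<bar>" using j(2)[of i] by simp
        then show ?thesis using \<delta> by (simp add: r_def Suc)
      qed
      have us: "u \<in> {s j..T + r j}" "T \<in> {s j..T + r j}"
        using j(1) u T r[of j] by (auto simp: s_def abs_le_iff)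
      define x y where "x = B u \<omega> - B (s j) \<omega>" and "y = B T \<omega> - B (s j) \<omega>"
      have xy: "x ^ 4 \<le> W j \<omega>" "y ^ 4 \<le> W j \<omega>"
        using bspec[OF spec[OF elim(2), of j] us(1)] bspec[OF spec[OF elim(2), of j] us(2)] by (simp_all add: x_def y_def)
      have "(x - y) ^ 4 \<le> 8 * (x ^ 4 + y ^ 4)"
      proof -
        have 1: "(x - y)\<^sup>2 \<le> 2 * (x\<^sup>2 + y\<^sup>2)"
          using zero_le_power2[of "x + y"] by (simp add: power2_eq_square algebra_simps)
        have "(x - y) ^ 4 = ((x - y)\<^sup>2)\<^sup>2" by (simp flip: power_mult)
        also have "\<dots> \<le> (2 * (x\<^sup>2 + y\<^sup>2))\<^sup>2" by (rule power_mono[OF 1]) simp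
        also have "\<dots> \<le> 8 * (x ^ 4 + y ^ 4)"
          using zero_le_power2[of "x\<^sup>2 - y\<^sup>2"] by (simp add: power2_eq_square power4_eq_xxxx algebra_simps)
        finally show ?thesis .
      qed
      then have B4: "(B u \<omega> - B T \<omega>) ^ 4 \<le> 16 * W j \<omega>" using xy by (simp add: x_def y_def)
      have "ennreal (c j * W j \<omega>) \<le> V0 \<omega>"
        unfolding V0_def using sum_le_suminf[of "\<lambda>j. ennreal (c j * W j \<omega>)" "{j}"] by simp
      then have cW: "c j * W j \<omega> \<le> V \<omega>" using elim(1) V(2) by (simp add: ennreal_le_iff)
      have "\<delta>\<^sup>2 * (B u \<omega> - B T \<omega>) ^ 4 \<le> \<delta>\<^sup>2 * (16 * W j \<omega>)"
        by (rule mult_left_mono[OF B4]) simp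
      also have "\<dots> = c j * W j \<omega> * (r j / 2) ^ 4"
        using r[of j] by (simp add: c_def power_divide)
      also have "\<dots> \<le> V \<omega> * (\<delta> + \<bar>u - T\<bar>) ^ 4"
        using half r[of j] V(2) by (intro mult_mono cW power_mono) auto
      finally show "\<delta>\<^sup>2 * (B u \<omega> - B T \<omega>) ^ 4 \<le> V \<omega> * (\<delta> + \<bar>u - T\<bar>) ^ 4" .
    qed
  qed
  then show ?thesis using V by blast
qed

text \<open>
  Up to time \<open>T\<close> the Brownian maximal inequality applies. Later times lie in an excursion, where \<open>X\<close> exceeds the
  value of the walk at its start by at most \<open>h\<close>; the moments of the walk grow by a factor \<open>1 + O(h\<^sup>2)\<close> per step, hence stay
  bounded over \<open>n\<close> steps.
\<close>

lemma exponential_path_bound: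
  assumes T: "0 < T" and H: "0 < H"
  shows "\<exists>C\<ge>0. \<forall>h n. 0 < h \<longrightarrow> h \<le> H \<longrightarrow> real n * h\<^sup>2 = T \<longrightarrow>
    (\<exists>V. integrable M V \<and> (\<forall>\<omega>. 0 \<le> V \<omega>) \<and> (\<integral>\<omega>. V \<omega> \<partial>M) \<le> C \<and>
      (AE \<omega> in M. \<forall>u. 0 \<le> u \<longrightarrow> u \<le> max T (\<theta> h n \<omega>) \<longrightarrow> exp (4 * \<kappa> * X u \<omega>) \<le> V \<omega>))"
proof -
  define a where "a = exp (4 * \<kappa> * H)"
  define C where "C = 4 * exp (2 * (2 * \<kappa>)\<^sup>2 * T) + a * (4 * exp (6 * \<kappa>\<^sup>2 * a * T))"
  obtain W where W: "integrable M W" "\<And>\<omega>. 0 \<le> W \<omega>" "(\<integral>\<omega>. W \<omega> \<partial>M) \<le> 4 * exp (2 * (2 * \<kappa>)\<^sup>2 * T)"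
    "AE \<omega> in M. \<forall>u\<in>{0..T}. exp (2 * (2 * \<kappa>) * B u \<omega>) \<le> W \<omega>"
    using exponential_maximal_moment[OF T, of "2 * \<kappa>"] by blast
  have main: "\<exists>V. integrable M V \<and> (\<forall>\<omega>. 0 \<le> V \<omega>) \<and> (\<integral>\<omega>. V \<omega> \<partial>M) \<le> C \<and>
      (AE \<omega> in M. \<forall>u. 0 \<le> u \<longrightarrow> u \<le> max T (\<theta> h n \<omega>) \<longrightarrow> exp (4 * \<kappa> * X u \<omega>) \<le> V \<omega>)"
    if h: "0 < h" and hH: "h \<le> H" and n: "real n * h\<^sup>2 = T" for h n
  proof -
    let ?Z = "\<lambda>k \<omega>. exp (2 * \<kappa> * X (\<theta> h k \<omega>) \<omega>)"
    have Z2: "(?Z k \<omega>)\<^sup>2 = exp (4 * \<kappa> * X (\<theta> h k \<omega>) \<omega>)" for k \<omega>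
      by (simp flip: exp_double)
    define R where "R \<omega> = (running_max ?Z n \<omega>)\<^sup>2" for \<omega>
    have Ri: "integrable M R"
      unfolding R_def
    proof (rule integrable_running_max_square)
      fix k show "?Z k \<in> borel_measurable M" using walk_M[OF h, of k] by measurable
      show "integrable M (\<lambda>\<omega>. (?Z k \<omega>)\<^sup>2)"
        unfolding Z2 by (rule integrable_exp_walk[OF h]) (use kappa_pos in simp)
    qed
    have "(\<integral>\<omega>. R \<omega> \<partial>M) \<le> 4 * (\<integral>\<omega>. exp (4 * \<kappa> * X (\<theta> h n \<omega>) \<omega>) \<partial>M)"
      unfolding R_def by (rule exp_walk_maximal[OF h hH])
    also have "\<dots> \<le> 4 * (1 + 6 * \<kappa>\<^sup>2 * a * h\<^sup>2) ^ n"
      unfolding a_def by (intro mult_left_mono exp_walk_moment[OF h hH]) simp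
    also have "\<dots> \<le> 4 * (exp (6 * \<kappa>\<^sup>2 * a * h\<^sup>2)) ^ n"
      by (intro mult_left_mono power_mono exp_ge_add_one_self) (auto simp: a_def)
    also have "(exp (6 * \<kappa>\<^sup>2 * a * h\<^sup>2)) ^ n = exp (6 * \<kappa>\<^sup>2 * a * T)"
      unfolding n[symmetric] by (simp add: exp_of_nat_mult[symmetric] mult_ac)
    finally have ER: "(\<integral>\<omega>. R \<omega> \<partial>M) \<le> 4 * exp (6 * \<kappa>\<^sup>2 * a * T)" .
    have R0: "0 \<le> R \<omega>" for \<omega> by (simp add: R_def)
    have Rk: "exp (4 * \<kappa> * X (\<theta> h k \<omega>) \<omega>) \<le> R \<omega>" if "k \<le> n" for k \<omega>
      unfolding R_def Z2[symmetric] using running_max_ge[OF that, of ?Z \<omega>] by (intro power_mono) auto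
    have a1: "1 \<le> a" using kappa_pos H by (simp add: a_def)
    show ?thesis
    proof (intro exI[of _ "\<lambda>\<omega>. W \<omega> + a * R \<omega>"] conjI allI)
      show "integrable M (\<lambda>\<omega>. W \<omega> + a * R \<omega>)" using W(1) Ri by simp
      show "0 \<le> W \<omega> + a * R \<omega>" for \<omega> using W(2) R0 a1 by simp
      have "(\<integral>\<omega>. W \<omega> + a * R \<omega> \<partial>M) = (\<integral>\<omega>. W \<omega> \<partial>M) + a * (\<integral>\<omega>. R \<omega> \<partial>M)" using W(1) Ri by simp
      also have "\<dots> \<le> C" unfolding C_def using ER W(3) a1 by (intro add_mono mult_left_mono) auto
      finally show "(\<integral>\<omega>. W \<omega> + a * R \<omega> \<partial>M) \<le> C" .
      show "AE \<omega> in M. \<forall>u. 0 \<le> u \<longrightarrow> u \<le> max T (\<theta> h n \<omega>) \<longrightarrow> exp (4 * \<kappa> * X u \<omega>) \<le> W \<omega> + a * R \<omega>"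
        using W(4) AE_space
      proof eventually_elim
        case (elim \<omega>)
        show ?case
        proof (intro allI impI)
          fix u assume u: "0 \<le> u" "u \<le> max T (\<theta> h n \<omega>)"
          show "exp (4 * \<kappa> * X u \<omega>) \<le> W \<omega> + a * R \<omega>"
          proof (cases "u \<le> T")
            case True
            have "4 * \<kappa> * X u \<omega> \<le> 4 * \<kappa> * B u \<omega>"
              using u kappa_pos by (intro mult_left_mono) (auto simp: drifted_def)
            then have "exp (4 * \<kappa> * X u \<omega>) \<le> exp (2 * (2 * \<kappa>) * B u \<omega>)" by simp
            also have "\<dots> \<le> W \<omega>" by (rule bspec[OF elim(1)]) (use True u in simp)
            finally show ?thesis using R0[of \<omega>] a1 by (simp add: add_increasing2)
          next
            case False
            then have un: "u \<le> \<theta> h n \<omega>" using u by simp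
            define P where "P k \<longleftrightarrow> u \<le> \<theta> h k \<omega>" for k
            obtain k where k: "P k" "\<And>i. i < k \<Longrightarrow> \<not> P i"
              using exists_least_iff[of P] un unfolding P_def by blast
            have kn: "k \<le> n" using k(2)[of n] un by (auto simp: P_def not_less[symmetric])
            have "k \<noteq> 0"
            proof
              assume "k = 0"
              then have "u \<le> 0" using k(1) by (simp add: P_def)
              then show False using False T by simp
            qed
            then obtain i where i: "k = Suc i" by (cases k) auto
            have "\<bar>X u \<omega> - X (\<theta> h i \<omega>) \<omega>\<bar> \<le> h"
              by (rule embedding_excursion[OF h elim(2)]) (use k(1) k(2)[of i] i in \<open>auto simp: P_def\<close>)
            then have "X u \<omega> \<le> H + X (\<theta> h i \<omega>) \<omega>" using hH by linarith
            from mult_left_mono[OF this, of "4 * \<kappa>"]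
            have "4 * \<kappa> * X u \<omega> \<le> 4 * \<kappa> * H + 4 * \<kappa> * X (\<theta> h i \<omega>) \<omega>"
              using kappa_pos by (simp add: distrib_left)
            then have "exp (4 * \<kappa> * X u \<omega>) \<le> a * exp (4 * \<kappa> * X (\<theta> h i \<omega>) \<omega>)"
              unfolding a_def exp_add[symmetric] by simp
            also have "\<dots> \<le> a * R \<omega>" using Rk[of i \<omega>] kn i a1 by (intro mult_left_mono) auto
            finally show ?thesis using W(2)[of \<omega>] by simp
          qed
        qed
      qed
    qed
  qed
  have "0 \<le> C" by (simp add: C_def a_def)
  then show ?thesis using main by blast
qed

end

text \<open>
  Young's inequality: products of three variables with bounded moments of orders 4, 4 and 2 are integrable.
\<close>

lemma product_le_powers:
  fixes x y d :: real
  assumes "0 \<le> x" "0 \<le> y" "0 \<le> d"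
  shows "x * y * d \<le> x ^ 4 + y ^ 4 + d\<^sup>2"
proof -
  have "x * y * d \<le> (x * y)\<^sup>2 + d\<^sup>2"
  proof -
    have "2 * (x * y) * d \<le> (x * y)\<^sup>2 + d\<^sup>2" by (rule sum_squares_bound)
    moreover have "0 \<le> x * y * d" using assms by simp
    ultimately show ?thesis by linarith
  qed
  moreover have "(x * y)\<^sup>2 \<le> x ^ 4 + y ^ 4"
  proof -
    have "2 * x\<^sup>2 * y\<^sup>2 \<le> (x\<^sup>2)\<^sup>2 + (y\<^sup>2)\<^sup>2" by (rule sum_squares_bound)
    moreover have "0 \<le> x\<^sup>2 * y\<^sup>2" by simp
    moreover have "(z\<^sup>2)\<^sup>2 = z ^ 4" for z :: real by (simp flip: power_mult)
    ultimately show ?thesis by (simp only: power_mult_distrib)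
  qed
  ultimately show ?thesis by simp
qed

lemma one_plus_power_four_le:
  fixes x :: real
  shows "(1 + x) ^ 4 \<le> 8 * (1 + x ^ 4)"
proof -
  have 1: "(1 + x)\<^sup>2 \<le> 2 * (1 + x\<^sup>2)"
    using zero_le_power2[of "1 - x"] by (simp add: power2_eq_square algebra_simps)
  have "(1 + x) ^ 4 = ((1 + x)\<^sup>2)\<^sup>2" by (simp flip: power_mult)
  also have "\<dots> \<le> (2 * (1 + x\<^sup>2))\<^sup>2" by (rule power_mono[OF 1]) simp
  also have "\<dots> \<le> 8 * (1 + x ^ 4)"
    using zero_le_power2[of "1 - x\<^sup>2"] by (simp add: power2_eq_square power4_eq_xxxx algebra_simps)
  finally show ?thesis .
qed

context filtered_bm begin

text \<open>
  The pairs of times between which a strategy is moved by the translation between the two games.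
\<close>

definition short_interval :: "real \<Rightarrow> real \<Rightarrow> nat \<Rightarrow> 'a \<Rightarrow> real \<Rightarrow> real \<Rightarrow> bool" where
  "short_interval T h n \<omega> a b \<longleftrightarrow>
     a \<le> b \<and> ((\<exists>k<n. \<theta> h k \<omega> \<le> a \<and> b \<le> \<theta> h (Suc k) \<omega>) \<or>
       (min T (\<theta> h n \<omega>) \<le> a \<and> b \<le> max T (\<theta> h n \<omega>)))"

text \<open>
  \<open>w\<close> bounds \<open>exp (\<kappa> X)\<close> up to the end of both games; up to constants, \<open>d\<close> dominates every discounted payoff and \<open>e\<close> the cost of moving a time along a short interval.
\<close>

definition path_controlled :: "real \<Rightarrow> real \<Rightarrow> nat \<Rightarrow> real \<Rightarrow> real \<Rightarrow> real \<Rightarrow> 'a \<Rightarrow> bool" where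
  "path_controlled T h n w e d \<omega> \<longleftrightarrow> 0 \<le> w \<and>
      (\<forall>u. 0 \<le> u \<longrightarrow> u \<le> max T (\<theta> h n \<omega>) \<longrightarrow> exp (\<kappa> * X u \<omega>) \<le> w) \<and>
      (1 + w) * (1 + max T (\<theta> h n \<omega>)) \<le> d \<and> 0 \<le> e \<and>
      (\<forall>a b. short_interval T h n \<omega> a b \<longrightarrow>
         (\<exists>c. (\<forall>u. a \<le> u \<longrightarrow> u \<le> b \<longrightarrow> \<bar>X u \<omega> - X a \<omega>\<bar> \<le> c) \<and> (1 + w) * ((b - a) + c) \<le> e))"

text \<open>
  With \<open>\<delta> = n powr (-1/2)\<close> the final deviation and the longest excursion are of order \<open>\<delta>\<close> in mean square; \<open>e\<close> is
  \<open>\<delta>\<close> plus their sum, so that \<open>e / \<delta>\<close> is of order one. Near \<open>T\<close> the oscillation of \<open>B\<close> is at most \<open>y e / sqrt \<delta>\<close> with \<open>y\<close> of bounded fourth moment. Both kinds of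
  intervals thus cost at most a multiple of \<open>sqrt \<delta> (1 + w) (1 + y) (e / \<delta>)\<close>, and the product of the last three factors has bounded mean.
\<close>

lemma error_control:
  assumes T: "0 < T"
  shows "\<exists>C\<ge>0. \<forall>n>0. \<exists>Err D w. integrable M Err \<and> integrable M D \<and> (\<integral>\<omega>. Err \<omega> \<partial>M) \<le> C * real n powr (- 1 / 4) \<and>
    (AE \<omega> in M. path_controlled T (sqrt (T / real n)) n (w \<omega>) (Err \<omega>) (D \<omega>) \<omega>)"
proof -
  define H where "H = sqrt T"
  have H: "0 < H" using T by (simp add: H_def)
  obtain C1 where C1: "0 \<le> C1" and path: "\<And>h n. 0 < h \<Longrightarrow> h \<le> H \<Longrightarrow> real n * h\<^sup>2 = T \<Longrightarrow>
    \<exists>V. integrable M V \<and> (\<forall>\<omega>. 0 \<le> V \<omega>) \<and> (\<integral>\<omega>. V \<omega> \<partial>M) \<le> C1 \<and>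
      (AE \<omega> in M. \<forall>u. 0 \<le> u \<longrightarrow> u \<le> max T (\<theta> h n \<omega>) \<longrightarrow> exp (4 * \<kappa> * X u \<omega>) \<le> V \<omega>)"
    using exponential_path_bound[OF T H] by auto
  define C2 where "C2 = 36 * T * exp (3 * \<kappa> * H) + 2 * T\<^sup>2 * \<kappa>\<^sup>2 * exp (2 * \<kappa> * H)"
  define C3 where "C3 = 8 * exp (3 * \<kappa> * H)"
  \<comment> \<open>Large enough for both kinds of short intervals: \<open>1 + 2 sqrt T\<close> within an excursion, \<open>3 + \<kappa>\<close> near \<open>T\<close>.\<close>
  define c where "c = 3 + \<kappa> + 2 * sqrt T"
  have c0: "0 \<le> c" using T kappa_pos by (simp add: c_def)
  define C where "C = c * (8 * (1 + C1) + 8 * (1 + 16384) + 3 * (1 + C2 * T + C3 * T\<^sup>2))"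
  have C0: "0 \<le> C" using c0 C1 T by (simp add: C_def C2_def C3_def)
  have main: "\<exists>Err D w. integrable M Err \<and> integrable M D \<and> (\<integral>\<omega>. Err \<omega> \<partial>M) \<le> C * real n powr (- 1 / 4) \<and>
    (AE \<omega> in M. path_controlled T (sqrt (T / real n)) n (w \<omega>) (Err \<omega>) (D \<omega>) \<omega>)" if n: "0 < n" for n :: nat
  proof -
    define h where "h = sqrt (T / real n)"
    \<comment> \<open>The rate to be proved; its square \<open>\<delta>\<close> is the order of the deviations in time.\<close>
    define s where "s = real n powr (- 1 / 4)"
    define \<delta> where "\<delta> = s\<^sup>2"
    have s0: "0 < s" using n by (simp add: s_def)
    have s1: "s \<le> 1"
      unfolding s_def using n powr_mono[of "- 1 / 4" 0 "real n"] by simp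
    have s4: "s ^ 4 = 1 / real n"
    proof -
      have "s ^ 4 = real n powr (- 1 / 4 * real 4)" unfolding s_def powr_powr[symmetric] using n by (subst powr_realpow) auto
      also have "\<dots> = real n powr (- 1)" by simp
      finally show ?thesis using n by (simp add: powr_minus divide_inverse)
    qed
    have \<delta>0: "0 < \<delta>" using s0 by (simp add: \<delta>_def)
    have \<delta>2: "\<delta>\<^sup>2 = 1 / real n" using s4 by (simp add: \<delta>_def flip: power_mult)
    have h0: "0 < h" using T n by (simp add: h_def)
    have h2: "h\<^sup>2 = T * \<delta>\<^sup>2" using T n by (simp add: h_def \<delta>2)
    have hd: "h = sqrt T * \<delta>"
    proof -
      have "h = sqrt (h\<^sup>2)" using h0 by simp
      also have "\<dots> = sqrt T * sqrt (\<delta>\<^sup>2)" unfolding h2 by (rule real_sqrt_mult)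
      finally show ?thesis using \<delta>0 by simp
    qed
    have hH: "h \<le> H"
    proof -
      have "\<delta> \<le> 1" using s1 s0 by (simp add: \<delta>_def power_le_one)
      then have "sqrt T * \<delta> \<le> sqrt T * 1" using T by (intro mult_left_mono) auto
      then show ?thesis by (simp add: hd H_def)
    qed
    have nh: "real n * h\<^sup>2 = T" using n by (simp add: h2 \<delta>2)
    obtain V where V: "integrable M V" "\<And>\<omega>. 0 \<le> V \<omega>" "(\<integral>\<omega>. V \<omega> \<partial>M) \<le> C1"
      "AE \<omega> in M. \<forall>u. 0 \<le> u \<longrightarrow> u \<le> max T (\<theta> h n \<omega>) \<longrightarrow> exp (4 * \<kappa> * X u \<omega>) \<le> V \<omega>"
      using path[OF h0 hH nh] by blast
    obtain U where U: "integrable M U" "\<And>\<omega>. 0 \<le> U \<omega>" "(\<integral>\<omega>. U \<omega> \<partial>M) \<le> 16384"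
      "AE \<omega> in M. \<forall>u\<ge>0. \<delta>\<^sup>2 * (B u \<omega> - B T \<omega>) ^ 4 \<le> U \<omega> * (\<delta> + \<bar>u - T\<bar>) ^ 4"
      using weighted_increment_bound[OF T \<delta>0] by blast
    define w where "w \<omega> = sqrt (sqrt (V \<omega>))" for \<omega>
    define y where "y \<omega> = sqrt (sqrt (U \<omega>))" for \<omega>
    have sq4: "(sqrt (sqrt x)) ^ 4 = x" if "0 \<le> x" for x
    proof -
      have "(sqrt (sqrt x)) ^ 4 = ((sqrt (sqrt x))\<^sup>2)\<^sup>2" by (simp flip: power_mult)
      then show ?thesis using that by simp
    qed
    have w0: "0 \<le> w \<omega>" and w4: "w \<omega> ^ 4 = V \<omega>" and y0: "0 \<le> y \<omega>" and y4: "y \<omega> ^ 4 = U \<omega>" for \<omega>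
      using V(2) U(2) sq4 by (simp_all add: w_def y_def)
    define Q where "Q \<omega> = (\<Sum>k<n. (holding h k \<omega>)\<^sup>2)" for \<omega>
    define e where "e \<omega> = \<delta> + \<bar>\<theta> h n \<omega> - T\<bar> + sqrt (Q \<omega>)" for \<omega>
    have Q0: "0 \<le> Q \<omega>" for \<omega> by (simp add: Q_def sum_nonneg)
    have e0: "\<delta> \<le> e \<omega>" "0 \<le> e \<omega>" for \<omega> using \<delta>0 Q0[of \<omega>] by (auto simp: e_def)
    note HS = holding_square[OF h0 hH, folded C3_def]
    note FT = final_time_deviation[OF h0 hH nh T, folded C2_def]
    define G where "G \<omega> = 8 * (1 + V \<omega>) + 8 * (1 + U \<omega>) + 3 * (1 + (\<theta> h n \<omega> - T)\<^sup>2 / \<delta>\<^sup>2 + Q \<omega> / \<delta>\<^sup>2)" for \<omega>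
    have Qi: "integrable M Q" unfolding Q_def by (intro Bochner_Integration.integrable_sum HS(1))
    have Gi: "integrable M G"
      unfolding G_def[abs_def]
      by (intro Bochner_Integration.integrable_add integrable_mult_right integrable_const integrable_divide V(1) U(1) FT(1) Qi)
    have EQ: "(\<integral>\<omega>. Q \<omega> \<partial>M) \<le> C3 * T\<^sup>2 * \<delta>\<^sup>2"
    proof -
      have "(\<integral>\<omega>. Q \<omega> \<partial>M) = (\<Sum>k<n. \<integral>\<omega>. (holding h k \<omega>)\<^sup>2 \<partial>M)"
        unfolding Q_def by (intro Bochner_Integration.integral_sum HS(1))
      also have "\<dots> \<le> (\<Sum>k<n. C3 * h ^ 4)" by (intro sum_mono HS(2))
      also have "\<dots> = C3 * (real n * h\<^sup>2) * h\<^sup>2" by (simp add: power2_eq_square power4_eq_xxxx)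
      also have "\<dots> = C3 * T\<^sup>2 * \<delta>\<^sup>2" unfolding nh by (simp add: h2 power2_eq_square[of T])
      finally show ?thesis .
    qed
    have EG: "(\<integral>\<omega>. G \<omega> \<partial>M) \<le> 8 * (1 + C1) + 8 * (1 + 16384) + 3 * (1 + C2 * T + C3 * T\<^sup>2)"
    proof -
      have eq: "(\<integral>\<omega>. G \<omega> \<partial>M) = 8 * (1 + (\<integral>\<omega>. V \<omega> \<partial>M)) + 8 * (1 + (\<integral>\<omega>. U \<omega> \<partial>M))
          + 3 * (1 + (\<integral>\<omega>. (\<theta> h n \<omega> - T)\<^sup>2 \<partial>M) / \<delta>\<^sup>2 + (\<integral>\<omega>. Q \<omega> \<partial>M) / \<delta>\<^sup>2)"
        unfolding G_def using V(1) U(1) FT(1) Qi by (simp add: prob_space)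
      have p: "(\<integral>\<omega>. (\<theta> h n \<omega> - T)\<^sup>2 \<partial>M) / \<delta>\<^sup>2 \<le> C2 * T"
        using FT(2) \<delta>0 unfolding h2 by (simp add: pos_divide_le_eq mult.assoc)
      have q: "(\<integral>\<omega>. Q \<omega> \<partial>M) / \<delta>\<^sup>2 \<le> C3 * T\<^sup>2"
        using EQ \<delta>0 by (simp add: pos_divide_le_eq mult.assoc)
      show ?thesis
        unfolding eq by (intro add_mono mult_left_mono V(3) U(3) p q order_refl) simp_all
    qed
    have G_bound: "(1 + w \<omega>) * (1 + y \<omega>) * (e \<omega> / \<delta>) \<le> G \<omega>" for \<omega>
    proof -
      have "(1 + w \<omega>) * (1 + y \<omega>) * (e \<omega> / \<delta>) \<le> (1 + w \<omega>) ^ 4 + (1 + y \<omega>) ^ 4 + (e \<omega> / \<delta>)\<^sup>2"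
        using w0 y0 e0 \<delta>0 by (intro product_le_powers) auto
      moreover have "(1 + w \<omega>) ^ 4 \<le> 8 * (1 + V \<omega>)" "(1 + y \<omega>) ^ 4 \<le> 8 * (1 + U \<omega>)"
        using one_plus_power_four_le[of "w \<omega>"] one_plus_power_four_le[of "y \<omega>"] by (simp_all add: w4 y4)
      moreover have "(e \<omega> / \<delta>)\<^sup>2 \<le> 3 * (1 + (\<theta> h n \<omega> - T)\<^sup>2 / \<delta>\<^sup>2 + Q \<omega> / \<delta>\<^sup>2)"
      proof -
        have three: "(p + q + r)\<^sup>2 \<le> 3 * (p\<^sup>2 + q\<^sup>2 + r\<^sup>2)" for p q r :: real
          using zero_le_power2[of "p - q"] zero_le_power2[of "p - r"] zero_le_power2[of "q - r"]
          by (simp add: power2_eq_square algebra_simps)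
        have "e \<omega> / \<delta> = 1 + \<bar>\<theta> h n \<omega> - T\<bar> / \<delta> + sqrt (Q \<omega>) / \<delta>"
          using \<delta>0 by (simp add: e_def add_divide_distrib)
        then have "(e \<omega> / \<delta>)\<^sup>2 \<le> 3 * (1\<^sup>2 + (\<bar>\<theta> h n \<omega> - T\<bar> / \<delta>)\<^sup>2 + (sqrt (Q \<omega>) / \<delta>)\<^sup>2)"
          using three by (simp only:)
        then show ?thesis using Q0[of \<omega>] by (simp add: power_divide)
      qed
      ultimately show ?thesis by (simp only: G_def)
    qed
    define Err where "Err \<omega> = c * s * G \<omega>" for \<omega>
    define D where "D \<omega> = 8 * (1 + V \<omega>) + (2 * (1 + T)\<^sup>2 + 2 * (\<theta> h n \<omega> - T)\<^sup>2)" for \<omega>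
    have "integrable M Err" unfolding Err_def[abs_def] using Gi by simp
    moreover have "integrable M D"
      unfolding D_def[abs_def]
      by (intro Bochner_Integration.integrable_add integrable_mult_right integrable_const V(1) FT(1))
    moreover have "(\<integral>\<omega>. Err \<omega> \<partial>M) \<le> C * s"
    proof -
      have "(\<integral>\<omega>. Err \<omega> \<partial>M) = c * s * (\<integral>\<omega>. G \<omega> \<partial>M)" unfolding Err_def by simp
      also have "\<dots> \<le> c * s * (8 * (1 + C1) + 8 * (1 + 16384) + 3 * (1 + C2 * T + C3 * T\<^sup>2))"
        using c0 s0 by (intro mult_left_mono EG) auto
      also have "\<dots> = C * s" by (simp add: C_def)
      finally show ?thesis .
    qed
    moreover have "AE \<omega> in M. path_controlled T h n (w \<omega>) (Err \<omega>) (D \<omega>) \<omega>"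
      using V(4) U(4) AE_space
    proof eventually_elim
      case (elim \<omega>)
      note \<omega> = elim(3)
      show ?case
        unfolding path_controlled_def
      proof (intro conjI allI impI)
        show "0 \<le> w \<omega>" by (rule w0)
        show "exp (\<kappa> * X u \<omega>) \<le> w \<omega>" if u: "0 \<le> u" "u \<le> max T (\<theta> h n \<omega>)" for u
        proof (rule power_le_imp_le_base[of _ 3])
          have "(exp (\<kappa> * X u \<omega>)) ^ Suc 3 = exp (4 * \<kappa> * X u \<omega>)"
            by (simp add: exp_of_nat_mult[of 4, symmetric] mult_ac)
          also have "\<dots> \<le> V \<omega>" using elim(1) u by blast
          also have "\<dots> = w \<omega> ^ Suc 3" using w4[of \<omega>] by simp
          finally show "(exp (\<kappa> * X u \<omega>)) ^ Suc 3 \<le> w \<omega> ^ Suc 3" .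
        qed (rule w0)
        show "(1 + w \<omega>) * (1 + max T (\<theta> h n \<omega>)) \<le> D \<omega>"
        proof -
          let ?m = "1 + max T (\<theta> h n \<omega>)"
          have m: "0 \<le> ?m" "?m \<le> (1 + T) + \<bar>\<theta> h n \<omega> - T\<bar>" using T by auto
          have "2 * (1 + w \<omega>) * ?m \<le> (1 + w \<omega>)\<^sup>2 + ?m\<^sup>2" by (rule sum_squares_bound)
          moreover have "0 \<le> (1 + w \<omega>) * ?m" using m w0[of \<omega>] by (intro mult_nonneg_nonneg) auto
          moreover have "(1 + w \<omega>)\<^sup>2 \<le> (1 + w \<omega>) ^ 4" using w0[of \<omega>] by (intro power_increasing) auto
          moreover have "(1 + w \<omega>) ^ 4 \<le> 8 * (1 + V \<omega>)"
            using one_plus_power_four_le[of "w \<omega>"] by (simp add: w4)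
          moreover have two: "(p + q)\<^sup>2 \<le> 2 * p\<^sup>2 + 2 * q\<^sup>2" for p q :: real
            using zero_le_power2[of "p - q"] by (simp add: power2_eq_square algebra_simps)
          moreover have "?m\<^sup>2 \<le> 2 * (1 + T)\<^sup>2 + 2 * (\<theta> h n \<omega> - T)\<^sup>2"
          proof -
            have "?m\<^sup>2 \<le> ((1 + T) + \<bar>\<theta> h n \<omega> - T\<bar>)\<^sup>2" by (rule power_mono[OF m(2,1)])
            also have "\<dots> \<le> 2 * (1 + T)\<^sup>2 + 2 * \<bar>\<theta> h n \<omega> - T\<bar>\<^sup>2"
              by (rule two)
            finally show ?thesis by simp
          qed
          ultimately show ?thesis unfolding D_def by linarith
        qed
        have "0 \<le> (1 + w \<omega>) * (1 + y \<omega>) * (e \<omega> / \<delta>)"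
          using w0[of \<omega>] y0[of \<omega>] e0[of \<omega>] \<delta>0 by simp
        then have G0: "0 \<le> G \<omega>" using G_bound[of \<omega>] by linarith
        then show "0 \<le> Err \<omega>" using c0 s0 by (simp add: Err_def)
        fix a b assume ab: "short_interval T h n \<omega> a b"
        have key: "(1 + w \<omega>) * ((b - a) + o') \<le> Err \<omega>"
          if "(b - a) + o' \<le> c * (e \<omega> * (1 + y \<omega>) / s)" for o'
        proof -
          have "(1 + w \<omega>) * ((b - a) + o') \<le> (1 + w \<omega>) * (c * (e \<omega> * (1 + y \<omega>) / s))"
            using that w0[of \<omega>] by (intro mult_left_mono) auto
          also have "\<dots> = c * s * ((1 + w \<omega>) * (1 + y \<omega>) * (e \<omega> / \<delta>))"
            using s0 by (simp add: \<delta>_def power2_eq_square)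
          also have "\<dots> \<le> Err \<omega>" unfolding Err_def using c0 s0 by (intro mult_left_mono G_bound) auto
          finally show ?thesis .
        qed
        have e_le: "e \<omega> \<le> e \<omega> * (1 + y \<omega>) / s"
        proof -
          have "e \<omega> * s \<le> e \<omega> * (1 + y \<omega>)" using s1 y0[of \<omega>] e0[of \<omega>] by (intro mult_left_mono) auto
          then show ?thesis using s0 by (simp add: pos_le_divide_eq)
        qed
        have ey0: "0 \<le> e \<omega> * (1 + y \<omega>) / s" using e_le e0(2)[of \<omega>] by linarith
        show "\<exists>c. (\<forall>u. a \<le> u \<longrightarrow> u \<le> b \<longrightarrow> \<bar>X u \<omega> - X a \<omega>\<bar> \<le> c) \<and> (1 + w \<omega>) * ((b - a) + c) \<le> Err \<omega>"
        proof (cases "\<exists>k<n. \<theta> h k \<omega> \<le> a \<and> b \<le> \<theta> h (Suc k) \<omega>")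
          case True
          then obtain k where k: "k < n" "\<theta> h k \<omega> \<le> a" "b \<le> \<theta> h (Suc k) \<omega>" by blast
          have osc: "\<bar>X u \<omega> - X a \<omega>\<bar> \<le> 2 * h" if "a \<le> u" "u \<le> b" for u
          proof -
            have "\<bar>X u \<omega> - X (\<theta> h k \<omega>) \<omega>\<bar> \<le> h" "\<bar>X a \<omega> - X (\<theta> h k \<omega>) \<omega>\<bar> \<le> h"
              using k that by (auto intro!: embedding_excursion[OF h0 \<omega>])
            then show ?thesis by linarith
          qed
          have "b - a \<le> holding h k \<omega>" using k by (simp add: holding_def)
          also have "\<dots> \<le> sqrt (Q \<omega>)"
          proof (rule real_le_rsqrt)
            show "(holding h k \<omega>)\<^sup>2 \<le> Q \<omega>"
              unfolding Q_def using k(1) by (intro member_le_sum[of k]) auto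
          qed
          also have "\<dots> \<le> e \<omega>" using \<delta>0 by (simp add: e_def)
          finally have 1: "b - a \<le> e \<omega>" .
          have "2 * h \<le> 2 * sqrt T * e \<omega>"
            using mult_left_mono[OF e0(1)[of \<omega>], of "2 * sqrt T"] T by (simp add: hd mult.assoc)
          with 1 have "(b - a) + 2 * h \<le> (1 + 2 * sqrt T) * e \<omega>" by (simp add: distrib_right)
          also have "\<dots> \<le> c * e \<omega>" using kappa_pos e0(2) by (intro mult_right_mono) (auto simp: c_def)
          also have "\<dots> \<le> c * (e \<omega> * (1 + y \<omega>) / s)" by (rule mult_left_mono[OF e_le c0])
          finally show ?thesis using osc key by blast
        next
          case False
          then have J: "a \<le> b" "min T (\<theta> h n \<omega>) \<le> a" "b \<le> max T (\<theta> h n \<omega>)"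
            using ab by (auto simp: short_interval_def)
          have \<theta>0: "0 \<le> \<theta> h n \<omega>" by (rule embedding_time_nonneg[OF h0 \<omega>])
          have near: "\<bar>X u \<omega> - X T \<omega>\<bar> \<le> y \<omega> * e \<omega> / s + \<kappa> / 2 * e \<omega>" if u: "a \<le> u" "u \<le> b" for u
          proof -
            have u0: "0 \<le> u" using J u T \<theta>0 by (auto simp: min_le_iff_disj)
            have ut: "\<bar>u - T\<bar> \<le> \<bar>\<theta> h n \<omega> - T\<bar>" using J u by (auto simp: min_def max_def split: if_splits)
            have ue: "\<delta> + \<bar>u - T\<bar> \<le> e \<omega>" "\<bar>u - T\<bar> \<le> e \<omega>"
              using ut Q0[of \<omega>] \<delta>0 by (auto simp: e_def add_nonneg_nonneg intro: add_increasing2)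
            have "\<bar>B u \<omega> - B T \<omega>\<bar> * s \<le> y \<omega> * e \<omega>"
            proof (rule power_le_imp_le_base[of _ 3])
              have "(\<bar>B u \<omega> - B T \<omega>\<bar> * s) ^ Suc 3 = \<delta>\<^sup>2 * (B u \<omega> - B T \<omega>) ^ 4"
                by (simp add: \<delta>_def power_mult_distrib flip: power_mult)
              also have "\<dots> \<le> U \<omega> * (\<delta> + \<bar>u - T\<bar>) ^ 4" using elim(2) u0 by blast
              also have "\<dots> \<le> U \<omega> * e \<omega> ^ 4" using ue \<delta>0 U(2) by (intro mult_left_mono power_mono) auto
              also have "\<dots> = (y \<omega> * e \<omega>) ^ Suc 3" by (simp add: power_mult_distrib flip: y4)
              finally show "(\<bar>B u \<omega> - B T \<omega>\<bar> * s) ^ Suc 3 \<le> (y \<omega> * e \<omega>) ^ Suc 3" .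
              show "0 \<le> y \<omega> * e \<omega>" using y0 e0 by simp
            qed
            then have "\<bar>B u \<omega> - B T \<omega>\<bar> \<le> y \<omega> * e \<omega> / s" using s0 by (simp add: pos_le_divide_eq)
            moreover have "\<bar>X u \<omega> - X T \<omega>\<bar> \<le> \<bar>B u \<omega> - B T \<omega>\<bar> + \<kappa> / 2 * \<bar>u - T\<bar>"
            proof -
              have "X u \<omega> - X T \<omega> = (B u \<omega> - B T \<omega>) - \<kappa> / 2 * (u - T)"
                by (simp add: drifted_def field_simps)
              then show ?thesis using abs_triangle_ineq4[of "B u \<omega> - B T \<omega>" "\<kappa> / 2 * (u - T)"] kappa_pos
                by (simp add: abs_mult)
            qed
            moreover have "\<kappa> / 2 * \<bar>u - T\<bar> \<le> \<kappa> / 2 * e \<omega>" using ue kappa_pos by (intro mult_left_mono) auto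
            ultimately show ?thesis by linarith
          qed
          define o' where "o' = 2 * (y \<omega> * e \<omega> / s + \<kappa> / 2 * e \<omega>)"
          have osc: "\<bar>X u \<omega> - X a \<omega>\<bar> \<le> o'" if "a \<le> u" "u \<le> b" for u
          proof -
            have "\<bar>x - z\<bar> \<le> 2 * q" if "\<bar>x - t\<bar> \<le> q" "\<bar>z - t\<bar> \<le> q" for x z t q :: real
              using that by linarith
            from this[OF near[OF that] near[OF order_refl J(1)]] show ?thesis unfolding o'_def .
          qed
          have "b - a \<le> \<bar>\<theta> h n \<omega> - T\<bar>" using J by (auto simp: min_def max_def split: if_splits)
          also have "\<dots> \<le> e \<omega>" using \<delta>0 Q0[of \<omega>] by (simp add: e_def)
          finally have 1: "b - a \<le> e \<omega> * (1 + y \<omega>) / s" using e_le by linarith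
          have 2: "y \<omega> * e \<omega> / s \<le> e \<omega> * (1 + y \<omega>) / s"
            using s0 e0(2)[of \<omega>] by (intro divide_right_mono) (auto simp: algebra_simps)
          have 3: "\<kappa> / 2 * e \<omega> \<le> \<kappa> / 2 * (e \<omega> * (1 + y \<omega>) / s)"
            using kappa_pos by (intro mult_left_mono e_le) auto
          have "(b - a) + o' \<le> (3 + \<kappa>) * (e \<omega> * (1 + y \<omega>) / s)"
          proof -
            have "d + 2 * (x + k) \<le> (3 + \<kappa>) * E" if "d \<le> E" "x \<le> E" "k \<le> \<kappa> / 2 * E" for d x k E :: real
            proof -
              have "2 * k \<le> \<kappa> * E" using that(3) by simp
              with that(1,2) show ?thesis by (simp add: distrib_right distrib_left)
            qed
            from this[OF 1 2 3] show ?thesis unfolding o'_def .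
          qed
          also have "\<dots> \<le> c * (e \<omega> * (1 + y \<omega>) / s)"
            using T by (intro mult_right_mono[OF _ ey0]) (simp add: c_def)
          finally show ?thesis using osc key by blast
        qed
      qed
    qed
    ultimately show ?thesis unfolding s_def h_def by blast
  qed
  show ?thesis using C0 main by blast
qed

end

section \<open>Payoffs along a path\<close>

lemma path_space_continuous: "continuous_on {0..} S \<Longrightarrow> S \<in> path_space t"
  unfolding path_space_def
  by (rule borel_measurable_continuous_on_restrict, rule continuous_on_subset[of "{0..}"]) auto

lemma exp_diff_le:
  fixes p q w :: real
  assumes "exp p \<le> w" "exp q \<le> w"
  shows "\<bar>exp p - exp q\<bar> \<le> w * \<bar>p - q\<bar>"
proof -
  have *: "exp x - exp y \<le> w * \<bar>x - y\<bar>" if "exp x \<le> w" for x y :: real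
  proof -
    have "1 + (y - x) \<le> exp (y - x)" by (rule exp_ge_add_one_self)
    then have "exp x * (1 + (y - x)) \<le> exp x * exp (y - x)" by (rule mult_left_mono) simp
    then have "exp x - exp y \<le> exp x * (x - y)" by (simp add: algebra_simps flip: exp_add)
    also have "\<dots> \<le> exp x * \<bar>x - y\<bar>" by (intro mult_left_mono) auto
    also have "\<dots> \<le> w * \<bar>x - y\<bar>" using that by (intro mult_right_mono) auto
    finally show ?thesis .
  qed
  show ?thesis using *[OF assms(1), of q] *[OF assms(2), of p] by (simp add: abs_le_iff abs_minus_commute)
qed

context payoff_functionals begin

lemma path_lipschitz_real:
  assumes s: "0 \<le> s" and path: "\<upsilon> \<in> path_space s" "\<upsilon>' \<in> path_space s"
    and d: "\<And>u. 0 \<le> u \<Longrightarrow> u \<le> s \<Longrightarrow> \<bar>\<upsilon> u - \<upsilon>' u\<bar> \<le> d"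
  shows "\<bar>F s \<upsilon> - F s \<upsilon>'\<bar> + \<bar>\<Delta> s \<upsilon> - \<Delta> s \<upsilon>'\<bar> \<le> L * (s + 1) * d"
proof -
  have "path_dist s \<upsilon> \<upsilon>' \<le> ereal d"
    unfolding path_dist_def by (rule SUP_least) (use d in auto)
  then have "ereal (L * (s + 1)) * path_dist s \<upsilon> \<upsilon>' \<le> ereal (L * (s + 1)) * ereal d"
    using s L_ge_1 by (intro ereal_mult_left_mono) auto
  then have "ereal (\<bar>F s \<upsilon> - F s \<upsilon>'\<bar> + \<bar>\<Delta> s \<upsilon> - \<Delta> s \<upsilon>'\<bar>) \<le> ereal (L * (s + 1)) * ereal d"
    using path_lipschitz[OF s order_refl path] by (rule order_trans[rotated])
  then show ?thesis by simp
qed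

lemma time_regular_real:
  assumes s: "0 \<le> s" "s \<le> t" and path: "\<upsilon> \<in> path_space t"
    and m: "\<And>u. 0 \<le> u \<Longrightarrow> u \<le> t \<Longrightarrow> \<bar>\<upsilon> u\<bar> \<le> m"
    and c: "\<And>u. s \<le> u \<Longrightarrow> u \<le> t \<Longrightarrow> \<bar>\<upsilon> u - \<upsilon> s\<bar> \<le> c"
  shows "\<bar>F t \<upsilon> - F s \<upsilon>\<bar> + \<bar>\<Delta> t \<upsilon> - \<Delta> s \<upsilon>\<bar> \<le> L * ((t - s) * (1 + m) + c)"
proof -
  have 1: "(SUP u\<in>{0..t}. ereal \<bar>\<upsilon> u\<bar>) \<le> ereal m" by (rule SUP_least) (use m in auto)
  have 2: "(SUP u\<in>{s..t}. ereal \<bar>\<upsilon> u - \<upsilon> s\<bar>) \<le> ereal c" by (rule SUP_least) (use c in auto)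
  have "ereal L * (ereal \<bar>t - s\<bar> * (1 + (SUP u\<in>{0..t}. ereal \<bar>\<upsilon> u\<bar>)) + (SUP u\<in>{s..t}. ereal \<bar>\<upsilon> u - \<upsilon> s\<bar>))
    \<le> ereal L * (ereal \<bar>t - s\<bar> * (1 + ereal m) + ereal c)"
    using 1 2 L_ge_1 by (intro ereal_mult_left_mono add_mono order_refl) auto
  also have "\<dots> = ereal (L * ((t - s) * (1 + m) + c))" using s by (simp add: one_ereal_def)
  finally have "ereal (\<bar>F t \<upsilon> - F s \<upsilon>\<bar> + \<bar>\<Delta> t \<upsilon> - \<Delta> s \<upsilon>\<bar>) \<le> ereal (L * ((t - s) * (1 + m) + c))"
    using time_regular[OF s path] by (rule order_trans[rotated])
  then show ?thesis by simp
qed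

definition exercise_payoff :: "bool \<Rightarrow> real \<Rightarrow> (real \<Rightarrow> real) \<Rightarrow> real" where
  "exercise_payoff cancel t S = F t S + (if cancel then \<Delta> t S else 0)"

lemma exercise_payoff_nonneg: "0 \<le> t \<Longrightarrow> S \<in> path_space t \<Longrightarrow> 0 \<le> exercise_payoff c t S"
  using F_nonneg Delta_nonneg by (simp add: exercise_payoff_def)

context
  fixes r \<kappa> z w :: real and x S :: "real \<Rightarrow> real"
  assumes r: "0 < r" and \<kappa>: "0 < \<kappa>" and z: "0 < z"
    and x: "continuous_on {0..} x" "x 0 = 0"
    and S_def: "\<And>u. S u = z * exp (r * u + \<kappa> * x u)"
begin

lemma S_cont: "continuous_on {0..} S"
  unfolding S_def[abs_def] by (intro continuous_intros x)

lemma S_path: "S \<in> path_space t"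
  by (rule path_space_continuous[OF S_cont])

lemma payoff_at_zero: "F 0 S = F 0 (\<lambda>_. z)" "\<Delta> 0 S = \<Delta> 0 (\<lambda>_. z)"
proof -
  have eq: "S u = z" if "0 \<le> u" "u \<le> 0" for u
  proof -
    have "u = 0" using that by simp
    then show ?thesis using x(2) by (simp add: S_def)
  qed
  have "(\<lambda>_. z) \<in> path_space 0" by (rule path_space_continuous) simp
  then show "F 0 S = F 0 (\<lambda>_. z)" "\<Delta> 0 S = \<Delta> 0 (\<lambda>_. z)"
    using payoff_cong[OF order_refl S_path _ eq] by auto
qed

lemma zero_payoff_nonneg: "0 \<le> F 0 (\<lambda>_. z)" "0 \<le> \<Delta> 0 (\<lambda>_. z)"
  using F_nonneg[of 0 S] Delta_nonneg[of 0 S] S_path payoff_at_zero by auto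

text \<open>
  The discount factor at \<open>b\<close> absorbs the growth \<open>exp (r b)\<close> of the stock up to \<open>b\<close>, so the interest rate leaves only a
  linear dependence on \<open>b\<close>.
\<close>

lemma discounted_payoff_growth:
  assumes b: "0 \<le> b" and w0: "0 \<le> w" and w: "\<And>u. 0 \<le> u \<Longrightarrow> u \<le> b \<Longrightarrow> exp (\<kappa> * x u) \<le> w"
  shows "exp (- r * b) * exercise_payoff c b S
    \<le> (1 + L) * (F 0 (\<lambda>_. z) + \<Delta> 0 (\<lambda>_. z) + z + 1) * ((1 + w) * (1 + b))"
proof -
  define A where "A = F 0 (\<lambda>_. z) + \<Delta> 0 (\<lambda>_. z) + z + 1"
  define e where "e = exp (- r * b)"
  have e: "0 < e" "e \<le> 1" using r b by (auto simp: e_def)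
  have em: "e * (z * exp (r * b) * w) = z * w" by (simp add: e_def exp_minus)
  have m: "\<bar>S u\<bar> \<le> z * exp (r * b) * w" if u: "0 \<le> u" "u \<le> b" for u
  proof -
    have "S u = z * exp (r * u) * exp (\<kappa> * x u)" by (simp add: S_def exp_add)
    also have "\<dots> \<le> z * exp (r * b) * w"
      using u z r w[OF u] by (intro mult_mono) auto
    finally show ?thesis using z by (simp add: S_def)
  qed
  have c: "\<bar>S u - S 0\<bar> \<le> z * exp (r * b) * w + z" if u: "0 \<le> u" "u \<le> b" for u
  proof -
    have "S 0 = z" using x(2) by (simp add: S_def)
    then show ?thesis using m[OF u] z by linarith
  qed
  have "\<bar>F b S - F 0 S\<bar> + \<bar>\<Delta> b S - \<Delta> 0 S\<bar>
      \<le> L * ((b - 0) * (1 + z * exp (r * b) * w) + (z * exp (r * b) * w + z))"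
    by (rule time_regular_real[OF order_refl b S_path m c])
  then have "exercise_payoff c b S \<le> A + L * (b * (1 + z * exp (r * b) * w) + (z * exp (r * b) * w + z))"
    using zero_payoff_nonneg z unfolding A_def exercise_payoff_def payoff_at_zero by auto
  then have "e * exercise_payoff c b S \<le> e * (A + L * (b * (1 + z * exp (r * b) * w) + (z * exp (r * b) * w + z)))"
    using e by (intro mult_left_mono) auto
  also have "\<dots> = e * A + L * (b * (e + e * (z * exp (r * b) * w)) + (e * (z * exp (r * b) * w) + e * z))"
    by (simp add: algebra_simps)
  also have "\<dots> = e * A + L * (b * (e + z * w) + (z * w + e * z))" unfolding em ..
  also have "\<dots> \<le> A + L * (b * (1 + z * w) + (z * w + z))"
  proof -
    have "0 \<le> A" using zero_payoff_nonneg z by (simp add: A_def)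
    then have "e * A \<le> A" "e * z \<le> z" using e z by (auto intro: mult_left_le_one_le)
    then show ?thesis using L_ge_1 b e z w0 by (intro add_mono mult_left_mono) auto
  qed
  also have "\<dots> \<le> (1 + L) * A * ((1 + w) * (1 + b))"
  proof -
    have A1: "1 + z \<le> A" using zero_payoff_nonneg by (simp add: A_def)
    have "1 * 1 \<le> (1 + w) * (1 + b)" using w0 b by (intro mult_mono) auto
    then have "A * 1 \<le> A * ((1 + w) * (1 + b))" using A1 z by (intro mult_left_mono) auto
    moreover have "b * (1 + z * w) + (z * w + z) \<le> (1 + z) * ((1 + w) * (1 + b))"
    proof -
      have "0 \<le> w + b * w + b * z" using w0 b z by simp
      then show ?thesis using w0 b z by (simp add: algebra_simps)
    qed
    moreover have "(1 + z) * ((1 + w) * (1 + b)) \<le> A * ((1 + w) * (1 + b))"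
      using A1 w0 b by (intro mult_right_mono) auto
    ultimately have "A \<le> A * ((1 + w) * (1 + b))" "L * (b * (1 + z * w) + (z * w + z)) \<le> L * (A * ((1 + w) * (1 + b)))"
      using L_ge_1 by (auto intro!: mult_left_mono)
    then show ?thesis by (simp add: distrib_right mult.assoc)
  qed
  finally show ?thesis by (simp add: e_def A_def)
qed

text \<open>
  The change splits into that of the payoff, discounted from the later time, and that of the discount factor. The
  latter multiplies the payoff at \<open>a\<close>, whose growth in \<open>a\<close> is bounded by means of \<open>a \<le> T\<close>.
\<close>

lemma discounted_payoff_increment:
  assumes a: "0 \<le> a" "a \<le> b" "a \<le> T" and w0: "0 \<le> w"
    and w: "\<And>u. 0 \<le> u \<Longrightarrow> u \<le> b \<Longrightarrow> exp (\<kappa> * x u) \<le> w"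
    and osc: "\<And>u. a \<le> u \<Longrightarrow> u \<le> b \<Longrightarrow> \<bar>x u - x a\<bar> \<le> c"
  shows "\<bar>exp (- r * b) * exercise_payoff k b S - exp (- r * a) * exercise_payoff k a S\<bar>
    \<le> (r * (1 + L) * (1 + T) + L * (1 + \<kappa> + r)) * (F 0 (\<lambda>_. z) + \<Delta> 0 (\<lambda>_. z) + z + 1)
       * ((1 + w) * ((b - a) + c))"
proof -
  define A where "A = F 0 (\<lambda>_. z) + \<Delta> 0 (\<lambda>_. z) + z + 1"
  define e where "e = exp (- r * b)"
  let ?P = "\<lambda>t. exercise_payoff k t S"
  have A1: "1 + z \<le> A" using zero_payoff_nonneg by (simp add: A_def)
  have c0: "0 \<le> c" using osc[of a] a by simp
  have b0: "0 \<le> b" using a by simp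
  have e: "0 < e" "e \<le> 1" using r b0 by (auto simp: e_def)
  have eb: "e * exp (r * b) = 1" by (simp add: e_def exp_minus)
  have m: "\<bar>S u\<bar> \<le> z * exp (r * b) * w" if u: "0 \<le> u" "u \<le> b" for u
  proof -
    have "S u = z * exp (r * u) * exp (\<kappa> * x u)" by (simp add: S_def exp_add)
    also have "\<dots> \<le> z * exp (r * b) * w"
      using u z r w[OF u] by (intro mult_mono) auto
    finally show ?thesis using z by (simp add: S_def)
  qed
  define cS where "cS = z * exp (r * b) * (\<kappa> * (w * c) + r * (b - a) * w)"
  have oscS: "\<bar>S u - S a\<bar> \<le> cS" if u: "a \<le> u" "u \<le> b" for u
  proof -
    have "S u - S a = z * exp (r * u) * (exp (\<kappa> * x u) - exp (\<kappa> * x a)) + z * (exp (r * u) - exp (r * a)) * exp (\<kappa> * x a)"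
      by (simp add: S_def exp_add algebra_simps)
    then have "\<bar>S u - S a\<bar> \<le> \<bar>z * exp (r * u) * (exp (\<kappa> * x u) - exp (\<kappa> * x a))\<bar> + \<bar>z * (exp (r * u) - exp (r * a)) * exp (\<kappa> * x a)\<bar>"
      by (simp only: abs_triangle_ineq)
    also have "\<bar>z * exp (r * u) * (exp (\<kappa> * x u) - exp (\<kappa> * x a))\<bar> \<le> z * exp (r * b) * (\<kappa> * (w * c))"
    proof -
      have "\<bar>exp (\<kappa> * x u) - exp (\<kappa> * x a)\<bar> \<le> w * \<bar>\<kappa> * x u - \<kappa> * x a\<bar>"
        by (rule exp_diff_le) (use w a u in auto)
      also have "\<bar>\<kappa> * x u - \<kappa> * x a\<bar> = \<kappa> * \<bar>x u - x a\<bar>" using \<kappa> by (simp add: abs_mult flip: right_diff_distrib)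
      also have "w * (\<kappa> * \<bar>x u - x a\<bar>) \<le> w * (\<kappa> * c)"
        using osc[OF u] \<kappa> w0 by (intro mult_left_mono) auto
      finally have 1: "\<bar>exp (\<kappa> * x u) - exp (\<kappa> * x a)\<bar> \<le> \<kappa> * (w * c)" by (simp add: mult_ac)
      have 2: "z * exp (r * u) \<le> z * exp (r * b)" using u r z by (intro mult_left_mono) auto
      have "\<bar>z * exp (r * u) * (exp (\<kappa> * x u) - exp (\<kappa> * x a))\<bar> = z * exp (r * u) * \<bar>exp (\<kappa> * x u) - exp (\<kappa> * x a)\<bar>"
        using z by (simp add: abs_mult)
      also have "\<dots> \<le> z * exp (r * b) * (\<kappa> * (w * c))" using 1 2 z by (intro mult_mono) auto
      finally show ?thesis .
    qed
    also have "\<bar>z * (exp (r * u) - exp (r * a)) * exp (\<kappa> * x a)\<bar> \<le> z * exp (r * b) * (r * (b - a) * w)"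
    proof -
      have "\<bar>exp (r * u) - exp (r * a)\<bar> \<le> exp (r * b) * \<bar>r * u - r * a\<bar>"
        using u a r by (intro exp_diff_le) auto
      also have "\<bar>r * u - r * a\<bar> = r * (u - a)" using r u by (simp add: right_diff_distrib)
      also have "exp (r * b) * (r * (u - a)) \<le> exp (r * b) * (r * (b - a))"
        using r u by (intro mult_left_mono) auto
      finally have 1: "\<bar>exp (r * u) - exp (r * a)\<bar> \<le> exp (r * b) * (r * (b - a))" .
      have "\<bar>z * (exp (r * u) - exp (r * a)) * exp (\<kappa> * x a)\<bar> = z * \<bar>exp (r * u) - exp (r * a)\<bar> * exp (\<kappa> * x a)"
        using z by (simp add: abs_mult)
      also have "\<dots> \<le> z * (exp (r * b) * (r * (b - a))) * w"
        using 1 z w[of a] a r by (intro mult_mono) auto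
      finally show ?thesis by (simp add: mult_ac)
    qed
    finally show ?thesis by (simp add: cS_def distrib_left)
  qed
  have "\<bar>F b S - F a S\<bar> + \<bar>\<Delta> b S - \<Delta> a S\<bar> \<le> L * ((b - a) * (1 + z * exp (r * b) * w) + cS)"
    by (rule time_regular_real[OF a(1,2) S_path m oscS])
  then have P: "\<bar>?P b - ?P a\<bar> \<le> L * ((b - a) * (1 + z * exp (r * b) * w) + cS)"
    unfolding exercise_payoff_def by (cases k) auto
  have "e * \<bar>?P b - ?P a\<bar> \<le> e * (L * ((b - a) * (1 + z * exp (r * b) * w) + cS))"
    by (rule mult_left_mono[OF P]) (use e in simp)
  also have "\<dots> = L * ((b - a) * (e + (e * exp (r * b)) * (z * w)) + (e * exp (r * b)) * (z * (\<kappa> * (w * c) + r * (b - a) * w)))"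
    by (simp add: cS_def algebra_simps)
  also have "\<dots> = L * ((b - a) * (e + z * w) + z * (\<kappa> * (w * c) + r * (b - a) * w))"
    unfolding eb by simp
  also have "\<dots> \<le> L * (1 + \<kappa> + r) * A * ((1 + w) * ((b - a) + c))"
  proof -
    define W where "W = A * (1 + w)"
    have "1 + z * w \<le> (1 + z) * (1 + w)" using z w0 by (simp add: algebra_simps)
    also have "\<dots> \<le> W" unfolding W_def using A1 w0 by (intro mult_right_mono) auto
    finally have W1: "1 + z * w \<le> W" .
    have zw: "z * w \<le> W" "0 \<le> z * w" using W1 z w0 by auto
    have W0: "0 \<le> W" using zw by linarith
    have "(b - a) * (e + z * w) \<le> (b - a) * W" using W1 e a by (intro mult_left_mono) auto
    moreover have "\<kappa> * c * (z * w) \<le> \<kappa> * c * W" using zw \<kappa> c0 by (intro mult_left_mono) auto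
    moreover have "r * (b - a) * (z * w) \<le> r * (b - a) * W" using zw r a by (intro mult_left_mono) auto
    moreover have "(b - a) * W + \<kappa> * c * W + r * (b - a) * W \<le> (1 + \<kappa> + r) * (W * ((b - a) + c))"
    proof -
      have "0 \<le> c * W + \<kappa> * (b - a) * W + r * c * W" using c0 W0 \<kappa> r a by simp
      then show ?thesis by (simp add: algebra_simps)
    qed
    ultimately have "(b - a) * (e + z * w) + z * (\<kappa> * (w * c) + r * (b - a) * w) \<le> (1 + \<kappa> + r) * (W * ((b - a) + c))"
      by (simp add: distrib_left mult_ac)
    then have "L * ((b - a) * (e + z * w) + z * (\<kappa> * (w * c) + r * (b - a) * w)) \<le> L * ((1 + \<kappa> + r) * (W * ((b - a) + c)))"
      using L_ge_1 by (intro mult_left_mono) auto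
    then show ?thesis by (simp add: W_def mult.assoc)
  qed
  finally have part1: "e * \<bar>?P b - ?P a\<bar> \<le> L * (1 + \<kappa> + r) * A * ((1 + w) * ((b - a) + c))" .
  have part2: "(exp (- r * a) - e) * ?P a \<le> r * (1 + L) * (1 + T) * A * ((1 + w) * ((b - a) + c))"
  proof -
    have Pa0: "0 \<le> ?P a" by (rule exercise_payoff_nonneg[OF a(1) S_path])
    have "exp (- r * a) - e = exp (- r * a) * (1 - exp (- (r * (b - a))))"
      by (simp add: e_def right_diff_distrib algebra_simps flip: exp_add)
    also have "\<dots> \<le> exp (- r * a) * (r * (b - a))"
      using exp_ge_add_one_self[of "- (r * (b - a))"] by (intro mult_left_mono) auto
    finally have "(exp (- r * a) - e) * ?P a \<le> exp (- r * a) * (r * (b - a)) * ?P a"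
      using Pa0 by (rule mult_right_mono)
    also have "\<dots> = r * (b - a) * (exp (- r * a) * ?P a)" by (simp add: mult_ac)
    also have "\<dots> \<le> r * (b - a) * ((1 + L) * A * ((1 + w) * (1 + a)))"
      unfolding A_def using r a w w0 by (intro mult_left_mono discounted_payoff_growth) auto
    also have "\<dots> = r * (1 + L) * A * (1 + w) * ((b - a) * (1 + a))" by (simp add: mult_ac)
    also have "\<dots> \<le> r * (1 + L) * A * (1 + w) * (((b - a) + c) * (1 + T))"
      using r L_ge_1 A1 z w0 a c0 by (intro mult_left_mono mult_mono) auto
    finally show ?thesis by (simp add: mult_ac)
  qed
  have "e * ?P b - exp (- r * a) * ?P a = e * (?P b - ?P a) - (exp (- r * a) - e) * ?P a"
    by (simp add: algebra_simps)
  moreover have "0 \<le> (exp (- r * a) - e) * ?P a"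
    using r a exercise_payoff_nonneg[OF a(1) S_path, of k] by (simp add: e_def)
  moreover have "\<bar>e * (?P b - ?P a)\<bar> = e * \<bar>?P b - ?P a\<bar>" using e by (simp add: abs_mult)
  ultimately have "\<bar>e * ?P b - exp (- r * a) * ?P a\<bar> \<le> e * \<bar>?P b - ?P a\<bar> + (exp (- r * a) - e) * ?P a"
    by linarith
  also have "\<dots> \<le> L * (1 + \<kappa> + r) * A * ((1 + w) * ((b - a) + c)) + r * (1 + L) * (1 + T) * A * ((1 + w) * ((b - a) + c))"
    by (rule add_mono[OF part1 part2])
  finally show ?thesis unfolding e_def A_def by (simp add: distrib_right add.commute)
qed

end

end

lemma measurable_map_upt:
  fixes f :: "nat \<Rightarrow> 'a \<Rightarrow> int"
  assumes f: "\<And>i. f i \<in> measurable M (count_space UNIV)" and N: "N \<in> measurable M (count_space UNIV)"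
  shows "(\<lambda>\<omega>. map (\<lambda>i. f i \<omega>) [0..<N \<omega>]) \<in> measurable M (count_space UNIV)"
proof (rule measurable_compose_countable[OF _ N])
  fix n
  show "(\<lambda>\<omega>. map (\<lambda>i. f i \<omega>) [0..<n]) \<in> measurable M (count_space UNIV)"
  proof (induction n)
    case (Suc n)
    have "(\<lambda>\<omega>. (\<lambda>l \<omega>. l @ [f n \<omega>]) (map (\<lambda>i. f i \<omega>) [0..<n]) \<omega>) \<in> measurable M (count_space UNIV)"
    proof (rule measurable_compose_countable[OF _ Suc])
      fix l
      show "(\<lambda>\<omega>. l @ [f n \<omega>]) \<in> measurable M (count_space UNIV)"
        by (rule measurable_compose[OF f]) simp
    qed
    then show ?case by simp
  qed simp
qed

context payoff_functionals begin

text \<open>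
  Rounding the time up to a grid and the path down to step functions with values on a grid leaves countably many cases,
  coded by integer lists, on which any functional is measurable. On a continuous path these approximations converge by the
  two regularity assumptions, the uniform continuity of the path bounding all errors.
\<close>

lemma measurable_payoff_at_random_time:
  fixes S :: "'a \<Rightarrow> real \<Rightarrow> real" and \<Phi> :: "real \<Rightarrow> (real \<Rightarrow> real) \<Rightarrow> real"
  assumes \<Phi>: "\<Phi> = F \<or> \<Phi> = \<Delta>"
    and S: "\<And>u. 0 \<le> u \<Longrightarrow> (\<lambda>\<omega>. S \<omega> u) \<in> borel_measurable M"
    and cont: "\<And>\<omega>. \<omega> \<in> space M \<Longrightarrow> continuous_on {0..} (S \<omega>)"
    and a[measurable]: "a \<in> borel_measurable M" and a0: "\<And>\<omega>. \<omega> \<in> space M \<Longrightarrow> 0 \<le> a \<omega>"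
  shows "(\<lambda>\<omega>. \<Phi> (a \<omega>) (S \<omega>)) \<in> borel_measurable M"
proof -
  have lip: "\<bar>\<Phi> s \<upsilon> - \<Phi> s \<upsilon>'\<bar> \<le> L * (s + 1) * d"
    if "0 \<le> s" "\<upsilon> \<in> path_space s" "\<upsilon>' \<in> path_space s" "\<And>u. 0 \<le> u \<Longrightarrow> u \<le> s \<Longrightarrow> \<bar>\<upsilon> u - \<upsilon>' u\<bar> \<le> d"
    for s \<upsilon> \<upsilon>' d
    using path_lipschitz_real[OF that] \<Phi> by auto
  have reg: "\<bar>\<Phi> t \<upsilon> - \<Phi> s \<upsilon>\<bar> \<le> L * ((t - s) * (1 + m) + c)"
    if "0 \<le> s" "s \<le> t" "\<upsilon> \<in> path_space t" "\<And>u. 0 \<le> u \<Longrightarrow> u \<le> t \<Longrightarrow> \<bar>\<upsilon> u\<bar> \<le> m"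
      "\<And>u. s \<le> u \<Longrightarrow> u \<le> t \<Longrightarrow> \<bar>\<upsilon> u - \<upsilon> s\<bar> \<le> c" for s t \<upsilon> m c
    using time_regular_real[OF that] \<Phi> by auto
  define d where "d m = 1 / real (Suc m)" for m
  have d: "0 < d m" "d m \<le> 1" for m by (simp_all add: d_def)
  define N where "N m \<omega> = nat \<lceil>a \<omega> / d m\<rceil>" for m \<omega>
  \<comment> \<open>The entry at index \<open>i\<close> is the rounded value at the \<open>i\<close>-th grid time; the last index encodes the rounded time.\<close>
  define code where "code m \<omega> = map (\<lambda>i. \<lfloor>S \<omega> (d m * real i) / d m\<rfloor>) [0..<Suc (N m \<omega>)]" for m \<omega>
  define pth where "pth m l u = d m * real_of_int (l ! nat \<lfloor>u / d m\<rfloor>)" for m and l :: "int list" and u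
  define G where "G m l = \<Phi> (d m * real (length l - 1)) (pth m l)" for m l
  have codem: "code m \<in> measurable M (count_space UNIV)" for m
    unfolding code_def[abs_def]
  proof (rule measurable_map_upt)
    fix i
    have [measurable]: "(\<lambda>\<omega>. S \<omega> (d m * real i)) \<in> borel_measurable M"
      using d(1)[of m] by (intro S) (simp add: less_imp_le)
    show "(\<lambda>\<omega>. \<lfloor>S \<omega> (d m * real i) / d m\<rfloor>) \<in> measurable M (count_space UNIV)" by measurable
    show "(\<lambda>\<omega>. Suc (N m \<omega>)) \<in> measurable M (count_space UNIV)" unfolding N_def by measurable
  qed
  have Gm: "(\<lambda>\<omega>. G m (code m \<omega>)) \<in> borel_measurable M" for m
    by (rule measurable_compose[OF codem]) simp
  have pth_path: "pth m l \<in> path_space t" for m l t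
  proof -
    have "pth m l \<in> borel_measurable borel" unfolding pth_def by measurable
    then show ?thesis unfolding path_space_def by (rule measurable_restrict_space1)
  qed
  show ?thesis
  proof (rule borel_measurable_LIMSEQ_real[OF _ Gm])
    fix \<omega> assume \<omega>: "\<omega> \<in> space M"
    let ?a = "a \<omega>" and ?S = "S \<omega>"
    have Sp: "?S \<in> path_space t" for t by (rule path_space_continuous[OF cont[OF \<omega>]])
    have a0': "0 \<le> ?a" by (rule a0[OF \<omega>])
    define a' where "a' m = d m * real (N m \<omega>)" for m
    have a': "?a \<le> a' m" "a' m \<le> ?a + d m" for m
      unfolding a'_def N_def using d(1)[of m] a0' by (intro grid_ceiling; simp)+
    have K: "continuous_on {0..?a + 1} ?S" by (rule continuous_on_subset[OF cont[OF \<omega>]]) auto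
    have "bounded (?S ` {0..?a + 1})"
      by (intro compact_imp_bounded compact_continuous_image K) simp
    then obtain m0 where "\<forall>y\<in>?S ` {0..?a + 1}. norm y \<le> m0"
      unfolding bounded_iff ..
    then have m0: "\<bar>?S u\<bar> \<le> m0" if "0 \<le> u" "u \<le> ?a + 1" for u
      using that by simp
    have m00: "0 \<le> m0" using m0[of 0] a0' by simp
    have unif: "uniformly_continuous_on {0..?a + 1} ?S"
      by (rule compact_uniformly_continuous[OF K]) simp
    define K0 where "K0 = L * (?a + 2) * 2 + L * (2 + m0)"
    have K0: "0 < K0" using L_ge_1 a0' m00 by (simp add: K0_def add_pos_nonneg)
    have main: "\<bar>G m (code m \<omega>) - \<Phi> ?a ?S\<bar> \<le> K0 * \<epsilon>"
      if \<epsilon>: "d m \<le> \<epsilon>" and osc: "\<And>u v. u \<in> {0..?a + 1} \<Longrightarrow> v \<in> {0..?a + 1} \<Longrightarrow> \<bar>u - v\<bar> \<le> d m \<Longrightarrow> \<bar>?S u - ?S v\<bar> \<le> \<epsilon>"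
      for m \<epsilon>
    proof -
      have \<epsilon>0: "0 < \<epsilon>" using \<epsilon> d(1)[of m] by linarith
      have a'1: "0 \<le> a' m" "a' m \<le> ?a + 1" using a'[of m] a0' d(2)[of m] by linarith+
      have "G m (code m \<omega>) = \<Phi> (a' m) (pth m (code m \<omega>))"
        by (simp add: G_def code_def a'_def)
      moreover have "\<bar>\<Phi> (a' m) (pth m (code m \<omega>)) - \<Phi> (a' m) ?S\<bar> \<le> L * (a' m + 1) * (2 * \<epsilon>)"
      proof (rule lip[OF a'1(1) pth_path Sp])
        fix u assume u: "0 \<le> u" "u \<le> a' m"
        define j where "j = nat \<lfloor>u / d m\<rfloor>"
        have ud: "0 \<le> u / d m" using u d(1)[of m] by simp
        have "u / d m \<le> real (N m \<omega>)" using u d(1)[of m] by (simp add: a'_def pos_divide_le_eq mult.commute)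
        then have j: "j \<le> N m \<omega>" unfolding j_def using ud by linarith
        have jb: "real j \<le> u / d m" "u / d m \<le> real j + 1" unfolding j_def using ud by linarith+
        have ju: "d m * real j \<le> u" "u \<le> d m * real j + d m"
          using jb d(1)[of m] by (simp_all add: pos_le_divide_eq pos_divide_le_eq algebra_simps)
        have "pth m (code m \<omega>) u = d m * real_of_int \<lfloor>?S (d m * real j) / d m\<rfloor>"
          using j by (simp add: pth_def code_def j_def[symmetric] del: upt_Suc)
        moreover have "\<bar>d m * real_of_int \<lfloor>y / d m\<rfloor> - y\<bar> \<le> d m" for y
        proof -
          have "\<bar>real_of_int \<lfloor>y / d m\<rfloor> - y / d m\<bar> \<le> 1" by linarith
          then have "d m * \<bar>real_of_int \<lfloor>y / d m\<rfloor> - y / d m\<bar> \<le> d m * 1"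
            using d(1)[of m] by (intro mult_left_mono) auto
          also have "d m * \<bar>real_of_int \<lfloor>y / d m\<rfloor> - y / d m\<bar> = \<bar>d m * (real_of_int \<lfloor>y / d m\<rfloor> - y / d m)\<bar>"
            using d(1)[of m] by (simp add: abs_mult)
          also have "d m * (real_of_int \<lfloor>y / d m\<rfloor> - y / d m) = d m * real_of_int \<lfloor>y / d m\<rfloor> - y"
            using d(1)[of m] by (simp add: right_diff_distrib)
          finally show ?thesis by simp
        qed
        ultimately have "\<bar>pth m (code m \<omega>) u - ?S (d m * real j)\<bar> \<le> d m" by simp
        moreover have "\<bar>?S (d m * real j) - ?S u\<bar> \<le> \<epsilon>"
        proof (rule osc)
          show "d m * real j \<in> {0..?a + 1}" using ju u a'1 d(1)[of m] by auto
        qed (use ju u a'1 in auto)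
        ultimately show "\<bar>pth m (code m \<omega>) u - ?S u\<bar> \<le> 2 * \<epsilon>" using \<epsilon> by linarith
      qed
      moreover have "L * (a' m + 1) * (2 * \<epsilon>) \<le> L * (?a + 2) * (2 * \<epsilon>)"
        using a'1 L_ge_1 \<epsilon>0 by (intro mult_right_mono mult_left_mono) auto
      moreover have "\<bar>\<Phi> (a' m) ?S - \<Phi> ?a ?S\<bar> \<le> L * ((a' m - ?a) * (1 + m0) + \<epsilon>)"
      proof (rule reg[OF a0' a'(1) Sp])
        show "\<bar>?S u\<bar> \<le> m0" if "0 \<le> u" "u \<le> a' m" for u using m0 that a'1 by simp
        show "\<bar>?S u - ?S ?a\<bar> \<le> \<epsilon>" if "?a \<le> u" "u \<le> a' m" for u
          by (rule osc) (use that a'1 a0' a'[of m] in auto)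
      qed
      moreover have "L * ((a' m - ?a) * (1 + m0) + \<epsilon>) \<le> L * (\<epsilon> * (1 + m0) + \<epsilon>)"
        using a'[of m] \<epsilon> m00 L_ge_1 by (intro mult_left_mono add_mono mult_right_mono) auto
      ultimately have "\<bar>G m (code m \<omega>) - \<Phi> ?a ?S\<bar> \<le> L * (?a + 2) * (2 * \<epsilon>) + L * (\<epsilon> * (1 + m0) + \<epsilon>)"
        by linarith
      also have "\<dots> = K0 * \<epsilon>" by (simp add: K0_def algebra_simps)
      finally show ?thesis .
    qed
    show "(\<lambda>m. G m (code m \<omega>)) \<longlonglongrightarrow> \<Phi> ?a ?S"
    proof (rule LIMSEQ_I)
      fix e :: real assume e: "0 < e"
      define \<epsilon> where "\<epsilon> = e / (2 * K0)"
      have \<epsilon>: "0 < \<epsilon>" using e K0 by (simp add: \<epsilon>_def)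
      obtain \<delta> where \<delta>: "0 < \<delta>" "\<And>u v. u \<in> {0..?a + 1} \<Longrightarrow> v \<in> {0..?a + 1} \<Longrightarrow> dist u v < \<delta> \<Longrightarrow> dist (?S u) (?S v) < \<epsilon>"
        using unif \<epsilon> unfolding uniformly_continuous_on_def by blast
      obtain m1 where m1: "1 / real (Suc m1) < min \<delta> \<epsilon>"
        using nat_approx_posE[of "min \<delta> \<epsilon>"] \<delta>(1) \<epsilon> by auto
      show "\<exists>no. \<forall>n\<ge>no. norm (G n (code n \<omega>) - \<Phi> ?a ?S) < e"
      proof (intro exI allI impI)
        fix n assume n: "m1 \<le> n"
        have "d n \<le> 1 / real (Suc m1)" unfolding d_def using n by (intro divide_left_mono) auto
        then have dn: "d n < \<delta>" "d n \<le> \<epsilon>" using m1 by auto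
        have "\<bar>G n (code n \<omega>) - \<Phi> ?a ?S\<bar> \<le> K0 * \<epsilon>"
        proof (rule main[OF dn(2)])
          fix u v assume "u \<in> {0..?a + 1}" "v \<in> {0..?a + 1}" "\<bar>u - v\<bar> \<le> d n"
          then show "\<bar>?S u - ?S v\<bar> \<le> \<epsilon>" using \<delta>(2)[of u v] dn(1) by (auto simp: dist_real_def)
        qed
        also have "\<dots> < e" using e K0 by (simp add: \<epsilon>_def)
        finally show "norm (G n (code n \<omega>) - \<Phi> ?a ?S) < e" by simp
      qed
    qed
  qed
qed

end

section \<open>Comparison of the two games\<close>

text \<open>
  If every minimizing strategy of the second game has a counterpart in the first game such that every reply to the
  counterpart is matched by a reply in the second game, up to \<open>\<epsilon>\<close>, then the values compare up to \<open>\<epsilon>\<close>.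
\<close>

lemma inf_sup_le:
  fixes q :: "'a \<Rightarrow> 'b \<Rightarrow> real" and q' :: "'c \<Rightarrow> 'd \<Rightarrow> real"
  assumes ne: "I \<noteq> {}" "J \<noteq> {}" "I' \<noteq> {}" "J' \<noteq> {}"
    and b: "\<And>x y. x \<in> I \<Longrightarrow> y \<in> J \<Longrightarrow> 0 \<le> q x y \<and> q x y \<le> K"
    and b': "\<And>x y. x \<in> I' \<Longrightarrow> y \<in> J' \<Longrightarrow> 0 \<le> q' x y \<and> q' x y \<le> K'"
    and dom: "\<And>x'. x' \<in> I' \<Longrightarrow> \<exists>x\<in>I. \<forall>y\<in>J. \<exists>y'\<in>J'. q x y \<le> q' x' y' + \<epsilon>"
  shows "(INF x\<in>I. SUP y\<in>J. q x y) \<le> (INF x\<in>I'. SUP y\<in>J'. q' x y) + \<epsilon>"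
proof -
  have "(INF x\<in>I. SUP y\<in>J. q x y) - \<epsilon> \<le> (INF x\<in>I'. SUP y\<in>J'. q' x y)"
  proof (rule cINF_greatest[OF ne(3)])
    fix x' assume x': "x' \<in> I'"
    obtain x where x: "x \<in> I" "\<forall>y\<in>J. \<exists>y'\<in>J'. q x y \<le> q' x' y' + \<epsilon>" using dom[OF x'] ..
    have bdd: "bdd_above (q x ` J)" if "x \<in> I" for x using b[OF that] by (intro bdd_aboveI2[of _ _ K]) auto
    have bdd': "bdd_above (q' x' ` J')" using b'[OF x'] by (intro bdd_aboveI2[of _ _ K']) auto
    obtain y0 where y0: "y0 \<in> J" using ne(2) by blast
    have "bdd_below ((\<lambda>x. SUP y\<in>J. q x y) ` I)"
    proof (rule bdd_belowI2[of _ 0])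
      fix x assume x: "x \<in> I"
      have "0 \<le> q x y0" using b[OF x y0] by simp
      also have "\<dots> \<le> (SUP y\<in>J. q x y)" by (rule cSUP_upper[OF y0 bdd[OF x]])
      finally show "0 \<le> (SUP y\<in>J. q x y)" .
    qed
    then have "(INF x\<in>I. SUP y\<in>J. q x y) \<le> (SUP y\<in>J. q x y)" by (rule cINF_lower[OF _ x(1)])
    also have "\<dots> \<le> (SUP y\<in>J'. q' x' y) + \<epsilon>"
    proof (rule cSUP_least[OF ne(2)])
      fix y assume "y \<in> J"
      then obtain y' where y': "y' \<in> J'" "q x y \<le> q' x' y' + \<epsilon>" using x(2) by blast
      then show "q x y \<le> (SUP y\<in>J'. q' x' y) + \<epsilon>"
        using cSUP_upper[OF y'(1) bdd'] by linarith
    qed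
    finally show "(INF x\<in>I. SUP y\<in>J. q x y) - \<epsilon> \<le> (SUP y\<in>J'. q' x' y)" by linarith
  qed
  then show ?thesis by linarith
qed

context filtered_bm begin

definition market_times :: "real \<Rightarrow> ('a \<Rightarrow> real) set" where
  "market_times T = {\<tau>. stopping_time F \<tau> \<and> (\<forall>\<omega>\<in>space M. \<tau> \<omega> \<in> {0..T})}"

definition walk_times :: "real \<Rightarrow> nat \<Rightarrow> ('a \<Rightarrow> nat) set" where
  "walk_times h n = {\<zeta>. stopping_time (\<lambda>k. pre_sigma (\<theta> h k)) \<zeta> \<and> (\<forall>\<omega>\<in>space M. \<zeta> \<omega> \<in> {0..n})}"

definition round_up :: "real \<Rightarrow> nat \<Rightarrow> ('a \<Rightarrow> real) \<Rightarrow> 'a \<Rightarrow> nat" where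
  "round_up h n \<tau> \<omega> = (LEAST k. n \<le> k \<or> \<tau> \<omega> \<le> \<theta> h k \<omega>)"

lemma round_up_le: "round_up h n \<tau> \<omega> \<le> n"
  unfolding round_up_def by (rule Least_le) simp

lemma less_round_up: "k < round_up h n \<tau> \<omega> \<Longrightarrow> \<theta> h k \<omega> < \<tau> \<omega>"
  unfolding round_up_def by (drule not_less_Least) simp

lemma le_round_up: "round_up h n \<tau> \<omega> < n \<Longrightarrow> \<tau> \<omega> \<le> \<theta> h (round_up h n \<tau> \<omega>) \<omega>"
  using LeastI[of "\<lambda>k. n \<le> k \<or> \<tau> \<omega> \<le> \<theta> h k \<omega>" n] by (auto simp: round_up_def)

lemma round_up_le_iff:
  assumes h: "0 < h" and \<omega>: "\<omega> \<in> space M" and k: "k < n"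
  shows "round_up h n \<tau> \<omega> \<le> k \<longleftrightarrow> \<tau> \<omega> \<le> \<theta> h k \<omega>"
proof
  assume le: "round_up h n \<tau> \<omega> \<le> k"
  then have "\<tau> \<omega> \<le> \<theta> h (round_up h n \<tau> \<omega>) \<omega>" using k by (intro le_round_up) simp
  also have "\<dots> \<le> \<theta> h k \<omega>" by (rule embedding_time_le[OF h \<omega> le])
  finally show "\<tau> \<omega> \<le> \<theta> h k \<omega>" .
next
  assume "\<tau> \<omega> \<le> \<theta> h k \<omega>"
  then show "round_up h n \<tau> \<omega> \<le> k" unfolding round_up_def by (intro Least_le) simp
qed

lemma round_up_walk_time:
  assumes h: "0 < h" and \<tau>: "\<tau> \<in> market_times T"
  shows "round_up h n \<tau> \<in> walk_times h n"
proof -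
  have st: "stopping_time F \<tau>" using \<tau> by (simp add: market_times_def)
  have "stopping_time (\<lambda>k. pre_sigma (\<theta> h k)) (round_up h n \<tau>)"
  proof (rule stopping_timeI)
    fix k
    show "Measurable.pred (pre_sigma (\<theta> h k)) (\<lambda>\<omega>. round_up h n \<tau> \<omega> \<le> k)"
    proof (cases "k < n")
      case False
      then have "round_up h n \<tau> \<omega> \<le> k" for \<omega> using round_up_le[of h n \<tau> \<omega>] by simp
      then show ?thesis by simp
    next
      case True
      note stopping_time_less[OF theta_stopping[OF h] st, of k, measurable]
      have "Measurable.pred (pre_sigma (\<theta> h k)) (\<lambda>\<omega>. \<not> \<theta> h k \<omega> < \<tau> \<omega>)" by measurable
      then show ?thesis
        by (rule measurable_cong[THEN iffD2, rotated])
          (simp add: round_up_le_iff[OF h _ True] space_pre_sigma not_less)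
    qed
  qed
  then show ?thesis by (simp add: walk_times_def round_up_le)
qed

text \<open>
  A seller who waits until \<open>T\<close> in the market waits until the last step of the walk: cancelling at an embedding time before
  \<open>T\<close> would cost the penalty.
\<close>

lemma early_round_up_walk_time:
  assumes h: "0 < h" and \<sigma>: "\<sigma> \<in> market_times T"
  shows "(\<lambda>\<omega>. if \<sigma> \<omega> < T then round_up h n \<sigma> \<omega> else n) \<in> walk_times h n"
proof -
  have st: "stopping_time F \<sigma>" using \<sigma> by (simp add: market_times_def)
  let ?\<zeta> = "\<lambda>\<omega>. if \<sigma> \<omega> < T then round_up h n \<sigma> \<omega> else n"
  have "stopping_time (\<lambda>k. pre_sigma (\<theta> h k)) ?\<zeta>"
  proof (rule stopping_timeI)
    fix k
    show "Measurable.pred (pre_sigma (\<theta> h k)) (\<lambda>\<omega>. ?\<zeta> \<omega> \<le> k)"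
    proof (cases "k < n")
      case False
      then have "?\<zeta> \<omega> \<le> k" for \<omega> using round_up_le[of h n \<sigma> \<omega>] by simp
      then show ?thesis by simp
    next
      case True
      have "Measurable.pred (pre_sigma (\<theta> h k)) (\<lambda>\<omega>. \<sigma> \<omega> \<le> \<theta> h k \<omega> \<and> \<sigma> \<omega> < T)"
      proof (rule pred_pre_sigmaI[OF theta_stopping[OF h]])
        fix t
        have [measurable]: "Measurable.pred (F t) (\<lambda>\<omega>. \<sigma> \<omega> \<le> \<theta> h k \<omega> \<and> \<theta> h k \<omega> \<le> t)"
        proof -
          note stopping_time_less[OF theta_stopping[OF h] st, of k, measurable]
          have "Measurable.pred (pre_sigma (\<theta> h k)) (\<lambda>\<omega>. \<not> \<theta> h k \<omega> < \<sigma> \<omega>)" by measurable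
          then have "{\<omega> \<in> space M. \<sigma> \<omega> \<le> \<theta> h k \<omega>} \<in> sets (pre_sigma (\<theta> h k))"
            by (simp add: pred_def space_pre_sigma not_less)
          from sets_pre_sigmaD[OF theta_stopping[OF h] this, of t]
          show ?thesis by (simp add: pred_def space_F conj_ac)
        qed
        show "Measurable.pred (F t) (\<lambda>\<omega>. (\<sigma> \<omega> \<le> \<theta> h k \<omega> \<and> \<sigma> \<omega> < T) \<and> \<theta> h k \<omega> \<le> t)"
        proof (cases "t < T")
          case tT: True
          have "Measurable.pred (F t) (\<lambda>\<omega>. \<sigma> \<omega> \<le> \<theta> h k \<omega> \<and> \<theta> h k \<omega> \<le> t)" by measurable
          then show ?thesis
            by (rule measurable_cong[THEN iffD2, rotated]) (use tT in auto)
        next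
          case tT: False
          have [measurable]: "Measurable.pred (F t) (\<lambda>\<omega>. \<sigma> \<omega> < T)"
            using stopping_time_less_const[OF st, of T] sets_F_mono[of T t] tT by (auto simp: pred_def space_F)
          have "Measurable.pred (F t) (\<lambda>\<omega>. (\<sigma> \<omega> \<le> \<theta> h k \<omega> \<and> \<theta> h k \<omega> \<le> t) \<and> \<sigma> \<omega> < T)" by measurable
          then show ?thesis by (rule measurable_cong[THEN iffD2, rotated]) auto
        qed
      qed
      then show ?thesis
        by (rule measurable_cong[THEN iffD2, rotated])
          (use True in \<open>auto simp: round_up_le_iff[OF h _ True] space_pre_sigma\<close>)
    qed
  qed
  then show ?thesis by (simp add: walk_times_def round_up_le)
qed

lemma walk_time_measurable:
  assumes h: "0 < h" and \<zeta>: "\<zeta> \<in> walk_times h n"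
  shows "Measurable.pred (F t) (\<lambda>\<omega>. \<zeta> \<omega> = k \<and> \<theta> h k \<omega> \<le> t)"
proof -
  have st: "stopping_time (\<lambda>k. pre_sigma (\<theta> h k)) \<zeta>" using \<zeta> by (simp add: walk_times_def)
  have le: "{\<omega> \<in> space M. \<zeta> \<omega> \<le> j} \<in> sets (pre_sigma (\<theta> h k))" if "j \<le> k" for j
  proof -
    have "{\<omega> \<in> space M. \<zeta> \<omega> \<le> j} \<in> sets (pre_sigma (\<theta> h j))"
      using stopping_timeD[OF st, of j] by (simp add: pred_def space_pre_sigma)
    then show ?thesis
      using mono_pre_sigma[OF theta_stopping[OF h] theta_stopping[OF h] embedding_time_le[OF h _ that]] by blast
  qed
  have "{\<omega> \<in> space M. \<zeta> \<omega> = k} \<in> sets (pre_sigma (\<theta> h k))"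
  proof (cases k)
    case 0
    then show ?thesis using le[of 0] by simp
  next
    case (Suc j)
    have "{\<omega> \<in> space M. \<zeta> \<omega> = k} = {\<omega> \<in> space M. \<zeta> \<omega> \<le> k} - {\<omega> \<in> space M. \<zeta> \<omega> \<le> j}"
      by (auto simp: Suc)
    then show ?thesis using sets.Diff[OF le[of k] le[of j]] by (simp add: Suc)
  qed
  from sets_pre_sigmaD[OF theta_stopping[OF h] this, of t]
  show ?thesis by (simp add: pred_def space_F conj_ac)
qed

text \<open>
  Two uses: with \<open>m = n\<close> a walk time equal to \<open>n\<close> is sent to \<open>T\<close>, with \<open>m = n + 1\<close> every walk time is truncated at \<open>T\<close>.
\<close>

lemma truncated_walk_time:
  assumes h: "0 < h" and T: "0 \<le> T" and \<zeta>: "\<zeta> \<in> walk_times h n" and mn: "m \<le> Suc n"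
  shows "(\<lambda>\<omega>. if \<zeta> \<omega> < m then min (\<theta> h (\<zeta> \<omega>) \<omega>) T else T) \<in> market_times T"
proof -
  let ?\<tau> = "\<lambda>\<omega>. if \<zeta> \<omega> < m then min (\<theta> h (\<zeta> \<omega>) \<omega>) T else T"
  have "stopping_time F ?\<tau>"
  proof (rule stopping_timeI)
    fix t
    show "Measurable.pred (F t) (\<lambda>\<omega>. ?\<tau> \<omega> \<le> t)"
    proof (cases "T \<le> t")
      case True
      then have "?\<tau> \<omega> \<le> t" for \<omega> by (simp add: min_le_iff_disj)
      then show ?thesis by simp
    next
      case False
      have "Measurable.pred (F t) (\<lambda>\<omega>. \<exists>k\<in>{..<m}. \<zeta> \<omega> = k \<and> \<theta> h k \<omega> \<le> t)"
        by (intro pred_intros_finite walk_time_measurable[OF h \<zeta>]) simp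
      then show ?thesis
        by (rule measurable_cong[THEN iffD2, rotated]) (use False in \<open>auto simp: min_le_iff_disj\<close>)
    qed
  qed
  then show ?thesis using T embedding_time_nonneg[OF h] by (simp add: market_times_def)
qed

lemma walk_time_M:
  assumes h: "0 < h" and \<zeta>: "\<zeta> \<in> walk_times h n"
  shows "(\<lambda>\<omega>. \<theta> h (\<zeta> \<omega>) \<omega>) \<in> borel_measurable M"
proof -
  have [measurable]: "\<zeta> \<in> measurable M (count_space UNIV)"
    unfolding measurable_count_space_eq2_countable
  proof (intro conjI ballI)
    fix k :: nat
    have st: "stopping_time (\<lambda>k. pre_sigma (\<theta> h k)) \<zeta>" using \<zeta> by (simp add: walk_times_def)
    have le: "{\<omega> \<in> space M. \<zeta> \<omega> \<le> j} \<in> sets M" for j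
      using stopping_timeD[OF st, of j] pre_sigma_subset_M[OF theta_stopping[OF h], of j]
      by (auto simp: pred_def space_pre_sigma)
    show "\<zeta> -` {k} \<inter> space M \<in> sets M"
    proof (cases k)
      case 0
      then have "\<zeta> -` {k} \<inter> space M = {\<omega> \<in> space M. \<zeta> \<omega> \<le> 0}" by auto
      then show ?thesis using le[of 0] by (simp only:)
    next
      case (Suc j)
      then have "\<zeta> -` {k} \<inter> space M = {\<omega> \<in> space M. \<zeta> \<omega> \<le> Suc j} - {\<omega> \<in> space M. \<zeta> \<omega> \<le> j}" by auto
      then show ?thesis using sets.Diff[OF le[of "Suc j"] le[of j]] by (simp only:)
    qed
  qed simp
  show ?thesis
    by (rule measurable_compose_countable[OF theta_M[OF h]]) measurable
qed

end

locale embedded_market = filtered_bm M F B \<kappa> + pay: payoff_functionals Fp \<Delta> L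
  for M :: "'a measure" and F B \<kappa> Fp \<Delta> L +
  fixes r T :: real
  assumes r_pos: "0 < r" and T_pos: "0 < T"
begin

definition discounted_value :: "real \<Rightarrow> bool \<Rightarrow> real \<Rightarrow> 'a \<Rightarrow> real" where
  "discounted_value z c t \<omega> = exp (- r * t) * pay.exercise_payoff c t (stock r \<kappa> B z \<omega>)"

abbreviation Q :: "real \<Rightarrow> 'a \<Rightarrow> real \<Rightarrow> real \<Rightarrow> real" where
  "Q z \<omega> s t \<equiv> discounted_payoff Fp \<Delta> r \<kappa> B z \<omega> s t"

abbreviation size :: "real \<Rightarrow> real" where
  "size z \<equiv> Fp 0 (\<lambda>_. z) + \<Delta> 0 (\<lambda>_. z) + z + 1"

lemma Q_eq: "Q z \<omega> s t = (if s < t then discounted_value z True s \<omega> else discounted_value z False t \<omega>)"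
  by (simp add: discounted_payoff_def payoff_def discounted_value_def pay.exercise_payoff_def min_def)

lemma stock_path: "\<omega> \<in> space M \<Longrightarrow> continuous_on {0..} (stock r \<kappa> B z \<omega>)"
  unfolding stock_def[abs_def] by (intro continuous_intros continuous_X)

lemma stock_M: "0 \<le> u \<Longrightarrow> (\<lambda>\<omega>. stock r \<kappa> B z \<omega> u) \<in> borel_measurable M"
  using measurable_F_M[OF adapted_X, of u] unfolding stock_def by measurable

lemma discounted_value_M:
  assumes [measurable]: "a \<in> borel_measurable M" and a0: "\<And>\<omega>. \<omega> \<in> space M \<Longrightarrow> 0 \<le> a \<omega>"
  shows "(\<lambda>\<omega>. discounted_value z c (a \<omega>) \<omega>) \<in> borel_measurable M"
proof -
  have [measurable]: "(\<lambda>\<omega>. Fp (a \<omega>) (stock r \<kappa> B z \<omega>)) \<in> borel_measurable M"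
    "(\<lambda>\<omega>. \<Delta> (a \<omega>) (stock r \<kappa> B z \<omega>)) \<in> borel_measurable M"
    using pay.measurable_payoff_at_random_time[of Fp "stock r \<kappa> B z" M a]
      pay.measurable_payoff_at_random_time[of \<Delta> "stock r \<kappa> B z" M a] stock_M stock_path assms by simp_all
  show ?thesis unfolding discounted_value_def pay.exercise_payoff_def by (cases c) simp_all
qed

lemma Q_M:
  assumes [measurable]: "a \<in> borel_measurable M" "b \<in> borel_measurable M"
    and "\<And>\<omega>. \<omega> \<in> space M \<Longrightarrow> 0 \<le> a \<omega>" "\<And>\<omega>. \<omega> \<in> space M \<Longrightarrow> 0 \<le> b \<omega>"
  shows "(\<lambda>\<omega>. Q z \<omega> (a \<omega>) (b \<omega>)) \<in> borel_measurable M"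
proof -
  have [measurable]: "(\<lambda>\<omega>. discounted_value z True (a \<omega>) \<omega>) \<in> borel_measurable M"
    "(\<lambda>\<omega>. discounted_value z False (b \<omega>) \<omega>) \<in> borel_measurable M"
    using assms by (auto intro!: discounted_value_M)
  show ?thesis unfolding Q_eq by measurable
qed

lemma discounted_value_nonneg: "\<omega> \<in> space M \<Longrightarrow> 0 \<le> t \<Longrightarrow> 0 \<le> discounted_value z c t \<omega>"
  unfolding discounted_value_def
  by (intro mult_nonneg_nonneg pay.exercise_payoff_nonneg path_space_continuous stock_path) auto

lemma discounted_value_cancel:
  assumes "\<omega> \<in> space M" "0 \<le> t"
  shows "discounted_value z False t \<omega> \<le> discounted_value z True t \<omega>"
proof -
  have "0 \<le> \<Delta> t (stock r \<kappa> B z \<omega>)"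
    using assms by (intro pay.Delta_nonneg path_space_continuous stock_path)
  then show ?thesis unfolding discounted_value_def pay.exercise_payoff_def by (intro mult_left_mono) auto
qed

lemma Q_nonneg: "\<omega> \<in> space M \<Longrightarrow> 0 \<le> s \<Longrightarrow> 0 \<le> t \<Longrightarrow> 0 \<le> Q z \<omega> s t"
  unfolding Q_eq using discounted_value_nonneg by simp

lemma size_ge_1:
  assumes "0 < z" shows "1 \<le> size z"
proof -
  have "(\<lambda>_. z) \<in> path_space 0" by (rule path_space_continuous) simp
  then show ?thesis using pay.F_nonneg[of 0] pay.Delta_nonneg[of 0] assms by (simp add: add_nonneg_nonneg)
qed

text \<open>
  The consequences of \<open>path_controlled\<close> for the payoffs started at \<open>z\<close>.
\<close>

definition controlled :: "real \<Rightarrow> nat \<Rightarrow> real \<Rightarrow> real \<Rightarrow> real \<Rightarrow> 'a \<Rightarrow> bool" where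
  "controlled z n h e d \<omega> \<longleftrightarrow> 0 \<le> e \<and>
     (\<forall>a b c. short_interval T h n \<omega> a b \<longrightarrow> 0 \<le> a \<longrightarrow> a \<le> T \<longrightarrow>
        \<bar>discounted_value z c b \<omega> - discounted_value z c a \<omega>\<bar> \<le> e) \<and>
     (\<forall>b c. 0 \<le> b \<longrightarrow> b \<le> max T (\<theta> h n \<omega>) \<longrightarrow> discounted_value z c b \<omega> \<le> d)"

lemma controlled_exists:
  "\<exists>C\<ge>0. \<forall>z>0. \<forall>n>0. \<exists>E D. integrable M E \<and> integrable M D \<and>
     (\<integral>\<omega>. E \<omega> \<partial>M) \<le> C * size z * real n powr (- 1 / 4) \<and>
     (AE \<omega> in M. controlled z n (sqrt (T / real n)) (E \<omega>) (D \<omega>) \<omega>)"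
proof -
  obtain C where C: "0 \<le> C" and EC: "\<forall>n>0. \<exists>Err D w. integrable M Err \<and> integrable M D \<and> (\<integral>\<omega>. Err \<omega> \<partial>M) \<le> C * real n powr (- 1 / 4) \<and>
    (AE \<omega> in M. path_controlled T (sqrt (T / real n)) n (w \<omega>) (Err \<omega>) (D \<omega>) \<omega>)"
    using error_control[OF T_pos] by blast
  define K where "K = r * (1 + L) * (1 + T) + L * (1 + \<kappa> + r)"
  have L: "1 \<le> L" by (rule pay.L_ge_1)
  have K0: "0 \<le> K" using r_pos T_pos kappa_pos L by (simp add: K_def)
  show ?thesis
  proof (rule exI[of _ "K * C"], intro conjI allI impI)
    show "0 \<le> K * C" using K0 C by simp
    fix z :: real and n :: nat
    assume z: "0 < z" and n: "0 < n"
    define h where "h = sqrt (T / real n)"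
    have h: "0 < h" using T_pos n by (simp add: h_def)
    have A0: "0 \<le> size z" using size_ge_1[OF z] by linarith
    obtain Err D w where Err: "integrable M Err" "integrable M D" "(\<integral>\<omega>. Err \<omega> \<partial>M) \<le> C * real n powr (- 1 / 4)"
      and ae: "AE \<omega> in M. path_controlled T h n (w \<omega>) (Err \<omega>) (D \<omega>) \<omega>"
      using EC[rule_format, OF n] unfolding h_def by blast
    have "AE \<omega> in M. controlled z n h (K * size z * Err \<omega>) ((1 + L) * size z * D \<omega>) \<omega>"
      using ae AE_space
    proof eventually_elim
      case (elim \<omega>)
      note \<omega> = elim(2)
      have w0: "0 \<le> w \<omega>" and wb: "\<And>u. 0 \<le> u \<Longrightarrow> u \<le> max T (\<theta> h n \<omega>) \<Longrightarrow> exp (\<kappa> * X u \<omega>) \<le> w \<omega>"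
        and wD: "(1 + w \<omega>) * (1 + max T (\<theta> h n \<omega>)) \<le> D \<omega>" and E0: "0 \<le> Err \<omega>"
        and sh: "\<And>a b. short_interval T h n \<omega> a b \<Longrightarrow>
         \<exists>c. (\<forall>u. a \<le> u \<longrightarrow> u \<le> b \<longrightarrow> \<bar>X u \<omega> - X a \<omega>\<bar> \<le> c) \<and> (1 + w \<omega>) * ((b - a) + c) \<le> Err \<omega>"
        using elim(1) unfolding path_controlled_def by blast+
      have S: "stock r \<kappa> B z \<omega> u = z * exp (r * u + \<kappa> * X u \<omega>)" for u by (simp add: stock_def)
      note path = r_pos kappa_pos z continuous_X[OF \<omega>] X_zero[OF \<omega>] S
      show ?case
        unfolding controlled_def
      proof (intro conjI allI impI)
        show "0 \<le> K * size z * Err \<omega>" using K0 A0 E0 by simp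
        fix a b c assume ab: "short_interval T h n \<omega> a b" and a: "0 \<le> a" "a \<le> T"
        obtain c' where c': "\<And>u. a \<le> u \<Longrightarrow> u \<le> b \<Longrightarrow> \<bar>X u \<omega> - X a \<omega>\<bar> \<le> c'" "(1 + w \<omega>) * ((b - a) + c') \<le> Err \<omega>"
          using sh[OF ab] by blast
        have le: "a \<le> b" using ab by (simp add: short_interval_def)
        have bm: "b \<le> max T (\<theta> h n \<omega>)"
        proof -
          have "\<theta> h (Suc k) \<omega> \<le> \<theta> h n \<omega>" if "k < n" for k
            by (rule embedding_time_le[OF h \<omega>]) (use that in simp)
          then show ?thesis using ab unfolding short_interval_def by force
        qed
        have "\<bar>discounted_value z c b \<omega> - discounted_value z c a \<omega>\<bar> \<le> K * size z * ((1 + w \<omega>) * ((b - a) + c'))"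
          unfolding discounted_value_def K_def
          by (rule pay.discounted_payoff_increment[OF path a(1) le a(2) w0 _ c'(1)]) (use wb bm in auto)
        also have "\<dots> \<le> K * size z * Err \<omega>" using K0 A0 by (intro mult_left_mono c'(2)) auto
        finally show "\<bar>discounted_value z c b \<omega> - discounted_value z c a \<omega>\<bar> \<le> K * size z * Err \<omega>" .
      next
        fix b c assume b: "0 \<le> b" "b \<le> max T (\<theta> h n \<omega>)"
        have "discounted_value z c b \<omega> \<le> (1 + L) * size z * ((1 + w \<omega>) * (1 + b))"
          unfolding discounted_value_def
          by (rule pay.discounted_payoff_growth[OF path b(1) w0]) (use wb b in auto)
        also have "\<dots> \<le> (1 + L) * size z * D \<omega>"
        proof (intro mult_left_mono)
          have "(1 + w \<omega>) * (1 + b) \<le> (1 + w \<omega>) * (1 + max T (\<theta> h n \<omega>))"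
            using w0 b by (intro mult_left_mono) auto
          then show "(1 + w \<omega>) * (1 + b) \<le> D \<omega>" using wD by linarith
        qed (use L A0 in auto)
        finally show "discounted_value z c b \<omega> \<le> (1 + L) * size z * D \<omega>" .
      qed
    qed
    moreover have "integrable M (\<lambda>\<omega>. K * size z * Err \<omega>)" "integrable M (\<lambda>\<omega>. (1 + L) * size z * D \<omega>)"
      using Err by (intro integrable_mult_right; simp)+
    moreover have "(\<integral>\<omega>. K * size z * Err \<omega> \<partial>M) \<le> K * C * size z * real n powr (- 1 / 4)"
    proof -
      have "(\<integral>\<omega>. K * size z * Err \<omega> \<partial>M) = K * size z * (\<integral>\<omega>. Err \<omega> \<partial>M)" by (rule integral_mult_right_zero)
      also have "\<dots> \<le> K * size z * (C * real n powr (- 1 / 4))"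
        using K0 A0 by (intro mult_left_mono Err(3)) auto
      finally show ?thesis by (simp only: mult_ac)
    qed
    ultimately show "\<exists>E D. integrable M E \<and> integrable M D \<and>
     (\<integral>\<omega>. E \<omega> \<partial>M) \<le> K * C * size z * real n powr (- 1 / 4) \<and>
     (AE \<omega> in M. controlled z n (sqrt (T / real n)) (E \<omega>) (D \<omega>) \<omega>)"
      unfolding h_def by blast
  qed
qed

context
  fixes z e d h :: real and n :: nat and \<omega> :: 'a
  assumes \<omega>: "\<omega> \<in> space M" and h: "0 < h" and n: "0 < n"
    and ctl: "controlled z n h e d \<omega>"
begin

lemma controlledD:
  "0 \<le> e"
  "short_interval T h n \<omega> a b \<Longrightarrow> 0 \<le> a \<Longrightarrow> a \<le> T \<Longrightarrow> \<bar>discounted_value z c b \<omega> - discounted_value z c a \<omega>\<bar> \<le> e"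
  using ctl unfolding controlled_def by blast+

text \<open>
  Rounding up moves a time within one excursion, except for times beyond the last embedding time, which are moved
  back to it.
\<close>

lemma round_up_error:
  assumes \<tau>: "0 \<le> \<tau> \<omega>" "\<tau> \<omega> \<le> T"
  shows "\<bar>discounted_value z c (\<theta> h (round_up h n \<tau> \<omega>) \<omega>) \<omega> - discounted_value z c (\<tau> \<omega>) \<omega>\<bar> \<le> e"
proof -
  let ?\<nu> = "round_up h n \<tau> \<omega>"
  have \<theta>0: "0 \<le> \<theta> h k \<omega>" for k by (rule embedding_time_nonneg[OF h \<omega>])
  show ?thesis
  proof (cases "\<tau> \<omega> \<le> \<theta> h ?\<nu> \<omega>")
    case True
    have "short_interval T h n \<omega> (\<tau> \<omega>) (\<theta> h ?\<nu> \<omega>)"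
    proof (cases ?\<nu>)
      case 0
      then have "\<tau> \<omega> = 0" using True \<tau> by simp
      then show ?thesis unfolding short_interval_def 0 using n \<theta>0[of "Suc 0"] by auto
    next
      case (Suc i)
      have "i < n" using round_up_le[of h n \<tau> \<omega>] Suc by simp
      moreover have "\<theta> h i \<omega> \<le> \<tau> \<omega>" using less_round_up[of i h n \<tau> \<omega>] Suc by simp
      ultimately show ?thesis unfolding short_interval_def Suc using True[unfolded Suc] by blast
    qed
    from controlledD(2)[OF this \<tau>] show ?thesis .
  next
    case False
    then have "?\<nu> = n" using le_round_up[of h n \<tau> \<omega>] round_up_le[of h n \<tau> \<omega>] by fastforce
    then have "short_interval T h n \<omega> (\<theta> h ?\<nu> \<omega>) (\<tau> \<omega>)"
      using False \<tau> by (auto simp: short_interval_def)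
    from controlledD(2)[OF this \<theta>0, of c] False \<tau> show ?thesis by (simp add: abs_minus_commute)
  qed
qed

lemma truncation_error:
  assumes k: "k \<le> n"
  shows "\<bar>discounted_value z c (\<theta> h k \<omega>) \<omega> - discounted_value z c (min (\<theta> h k \<omega>) T) \<omega>\<bar> \<le> e"
proof (cases "\<theta> h k \<omega> \<le> T")
  case True
  then show ?thesis using controlledD(1) by (simp add: min_def)
next
  case False
  have "\<theta> h k \<omega> \<le> \<theta> h n \<omega>" by (rule embedding_time_le[OF h \<omega> k])
  then have "short_interval T h n \<omega> T (\<theta> h k \<omega>)" using False by (auto simp: short_interval_def)
  from controlledD(2)[OF this, of c] False T_pos show ?thesis by (simp add: min_def)
qed

text \<open>
  The seller of the market copies \<open>\<zeta>\<close>, but never acts before \<open>T\<close> if \<open>\<zeta> = n\<close>; a buyer stopping at \<open>\<tau>\<close> is matched by the buyer of the walk who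
  rounds \<open>\<tau>\<close> up. If the seller acts first in the market, then at an embedding time strictly before \<open>\<tau>\<close>, and the payoffs of both games
  agree. Otherwise the rounded buyer also acts no later than the seller, and only the rounding of \<open>\<tau>\<close> costs.
\<close>

lemma seller_comparison:
  assumes \<zeta>: "\<zeta> \<le> n" and \<tau>: "0 \<le> \<tau> \<omega>" "\<tau> \<omega> \<le> T"
  shows "Q z \<omega> (if \<zeta> < n then min (\<theta> h \<zeta> \<omega>) T else T) (\<tau> \<omega>)
    \<le> Q z \<omega> (\<theta> h \<zeta> \<omega>) (\<theta> h (round_up h n \<tau> \<omega>) \<omega>) + e"
proof -
  let ?\<nu> = "round_up h n \<tau> \<omega>"
  have \<nu>n: "?\<nu> \<le> n" by (rule round_up_le)
  have err: "discounted_value z False (\<tau> \<omega>) \<omega> \<le> discounted_value z False (\<theta> h ?\<nu> \<omega>) \<omega> + e"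
    using round_up_error[where \<tau> = \<tau> and c = False, OF \<tau>] by linarith
  show ?thesis
  proof (cases "\<zeta> < n")
    case False
    then have "\<zeta> = n" using \<zeta> by simp
    then have "\<not> \<theta> h \<zeta> \<omega> < \<theta> h ?\<nu> \<omega>" using embedding_time_less_iff[OF h \<omega>, of \<zeta> ?\<nu>] \<nu>n by simp
    then show ?thesis using err False \<tau> by (simp add: Q_eq)
  next
    case True
    show ?thesis
    proof (cases "min (\<theta> h \<zeta> \<omega>) T < \<tau> \<omega>")
      case less: True
      then have m: "min (\<theta> h \<zeta> \<omega>) T = \<theta> h \<zeta> \<omega>" "\<theta> h \<zeta> \<omega> < \<tau> \<omega>" using \<tau> by auto
      have "\<not> ?\<nu> \<le> \<zeta>" using round_up_le_iff[OF h \<omega> True, of \<tau>] m by simp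
      then have "\<theta> h \<zeta> \<omega> < \<theta> h ?\<nu> \<omega>" using embedding_time_less_iff[OF h \<omega>, of \<zeta> ?\<nu>] by simp
      then show ?thesis using m True controlledD(1) by (simp add: Q_eq)
    next
      case False
      then have "?\<nu> \<le> \<zeta>" using round_up_le_iff[OF h \<omega> True, of \<tau>] by auto
      then have "\<not> \<theta> h \<zeta> \<omega> < \<theta> h ?\<nu> \<omega>" using embedding_time_less_iff[OF h \<omega>, of \<zeta> ?\<nu>] by simp
      then show ?thesis using err False True by (simp add: Q_eq)
    qed
  qed
qed

text \<open>
  The seller of the walk rounds \<open>\<sigma>\<close> up; a buyer at \<open>\<eta>\<close> is matched by truncating the embedding time at \<open>T\<close>. The order of play can only
  differ when \<open>\<eta>\<close> is the rounding of \<open>\<sigma>\<close>: then the buyer acts first on the walk, the seller in the market, and the market pays the larger amount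
  because the penalty is nonnegative.
\<close>

lemma buyer_comparison:
  assumes \<eta>: "\<eta> \<le> n" and \<sigma>: "0 \<le> \<sigma> \<omega>" "\<sigma> \<omega> \<le> T"
  defines "\<zeta> \<equiv> if \<sigma> \<omega> < T then round_up h n \<sigma> \<omega> else n"
  shows "Q z \<omega> (\<theta> h \<zeta> \<omega>) (\<theta> h \<eta> \<omega>) \<le> Q z \<omega> (\<sigma> \<omega>) (min (\<theta> h \<eta> \<omega>) T) + e"
proof -
  let ?\<nu> = "round_up h n \<sigma> \<omega>" and ?V = "\<lambda>c t. discounted_value z c t \<omega>"
  have trunc: "?V False (\<theta> h \<eta> \<omega>) \<le> ?V False (min (\<theta> h \<eta> \<omega>) T) + e"
    using truncation_error[OF \<eta>, of False] by linarith
  have rnd: "?V c (\<theta> h ?\<nu> \<omega>) \<le> ?V c (\<sigma> \<omega>) + e" for c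
    using round_up_error[where \<tau> = \<sigma> and c = c, OF \<sigma>] by linarith
  show ?thesis
  proof (cases "\<sigma> \<omega> < T")
    case False
    then have "\<sigma> \<omega> = T" "\<zeta> = n" using \<sigma> by (auto simp: \<zeta>_def)
    moreover have "\<not> \<theta> h n \<omega> < \<theta> h \<eta> \<omega>" using embedding_time_less_iff[OF h \<omega>, of n \<eta>] \<eta> by simp
    ultimately show ?thesis using trunc by (simp add: Q_eq)
  next
    case True
    then have \<zeta>: "\<zeta> = ?\<nu>" by (simp add: \<zeta>_def)
    show ?thesis
    proof (cases "?\<nu> < \<eta>")
      case less: True
      then have lt: "\<theta> h ?\<nu> \<omega> < \<theta> h \<eta> \<omega>" using embedding_time_less_iff[OF h \<omega>, of ?\<nu> \<eta>] by simp
      have "\<sigma> \<omega> \<le> \<theta> h ?\<nu> \<omega>" using less \<eta> by (intro le_round_up) simp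
      then have "\<sigma> \<omega> < min (\<theta> h \<eta> \<omega>) T" using lt True by simp
      then show ?thesis using rnd[of True] lt by (simp add: Q_eq \<zeta>)
    next
      case False
      then have nl: "\<not> \<theta> h ?\<nu> \<omega> < \<theta> h \<eta> \<omega>" using embedding_time_less_iff[OF h \<omega>, of ?\<nu> \<eta>] by simp
      show ?thesis
      proof (cases "\<sigma> \<omega> < min (\<theta> h \<eta> \<omega>) T")
        case sl: True
        have "\<not> \<eta> < ?\<nu>" using less_round_up[of \<eta> h n \<sigma> \<omega>] sl by auto
        then have "\<eta> = ?\<nu>" using False by simp
        then have "?V False (\<theta> h \<eta> \<omega>) \<le> ?V True (\<sigma> \<omega>) + e"
          using rnd[of False] discounted_value_cancel[OF \<omega> \<sigma>(1), of z] by simp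
        then show ?thesis using sl nl by (simp add: Q_eq \<zeta>)
      next
        case sl: False
        then show ?thesis using trunc nl by (simp only: Q_eq \<zeta> if_False)
      qed
    qed
  qed
qed

end

theorem embedded_game_error:
  "\<exists>C>0. \<forall>z>0. \<forall>n>0.
    \<bar>(INF \<sigma>\<in>market_times T. SUP \<tau>\<in>market_times T. \<integral>\<omega>. Q z \<omega> (\<sigma> \<omega>) (\<tau> \<omega>) \<partial>M)
     - (INF \<zeta>\<in>walk_times (sqrt (T / real n)) n. SUP \<eta>\<in>walk_times (sqrt (T / real n)) n.
          \<integral>\<omega>. Q z \<omega> (\<theta> (sqrt (T / real n)) (\<zeta> \<omega>) \<omega>) (\<theta> (sqrt (T / real n)) (\<eta> \<omega>) \<omega>) \<partial>M)\<bar>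
    \<le> C * size z * real n powr (- 1 / 4)"
proof -
  obtain C where C: "0 \<le> C" and ctl: "\<forall>z>0. \<forall>n>0. \<exists>E D. integrable M E \<and> integrable M D \<and>
     (\<integral>\<omega>. E \<omega> \<partial>M) \<le> C * size z * real n powr (- 1 / 4) \<and>
     (AE \<omega> in M. controlled z n (sqrt (T / real n)) (E \<omega>) (D \<omega>) \<omega>)"
    using controlled_exists by blast
  show ?thesis
  proof (rule exI[of _ "C + 1"], intro conjI allI impI)
    show "0 < C + 1" using C by simp
    fix z :: real and n :: nat
    assume z: "0 < z" and n: "0 < n"
    define h where "h = sqrt (T / real n)"
    have h: "0 < h" using T_pos n by (simp add: h_def)
    obtain E D where E: "integrable M E" and D: "integrable M D"
      and EE: "(\<integral>\<omega>. E \<omega> \<partial>M) \<le> C * size z * real n powr (- 1 / 4)"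
      and ae: "AE \<omega> in M. controlled z n h (E \<omega>) (D \<omega>) \<omega>"
      using ctl[rule_format, OF z n] unfolding h_def by blast
    define \<epsilon> where "\<epsilon> = (\<integral>\<omega>. E \<omega> \<partial>M)"
    let ?J = "\<lambda>\<sigma> \<tau>. \<integral>\<omega>. Q z \<omega> (\<sigma> \<omega>) (\<tau> \<omega>) \<partial>M"
    let ?I = "market_times T" and ?W = "walk_times h n"
    let ?J' = "\<lambda>\<zeta> \<eta>. ?J (\<lambda>\<omega>. \<theta> h (\<zeta> \<omega>) \<omega>) (\<lambda>\<omega>. \<theta> h (\<eta> \<omega>) \<omega>)"
    define adm where "adm a \<longleftrightarrow> a \<in> borel_measurable M \<and> (\<forall>\<omega>\<in>space M. 0 \<le> a \<omega> \<and> a \<omega> \<le> max T (\<theta> h n \<omega>))" for a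
    have admI: "adm \<sigma>" if "\<sigma> \<in> ?I" for \<sigma>
      using that stopping_time_M[of \<sigma>] unfolding adm_def market_times_def by (auto simp: le_max_iff_disj)
    have admW: "adm (\<lambda>\<omega>. \<theta> h (\<zeta> \<omega>) \<omega>)" if "\<zeta> \<in> ?W" for \<zeta>
      unfolding adm_def
    proof (intro conjI ballI)
      show "(\<lambda>\<omega>. \<theta> h (\<zeta> \<omega>) \<omega>) \<in> borel_measurable M" by (rule walk_time_M[OF h that])
      fix \<omega> assume \<omega>: "\<omega> \<in> space M"
      show "0 \<le> \<theta> h (\<zeta> \<omega>) \<omega>" by (rule embedding_time_nonneg[OF h \<omega>])
      have "\<zeta> \<omega> \<le> n" using that \<omega> by (simp add: walk_times_def)
      from embedding_time_le[OF h \<omega> this] show "\<theta> h (\<zeta> \<omega>) \<omega> \<le> max T (\<theta> h n \<omega>)" by simp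
    qed
    have Qi: "integrable M (\<lambda>\<omega>. Q z \<omega> (a \<omega>) (b \<omega>))" and Qb: "0 \<le> ?J a b \<and> ?J a b \<le> (\<integral>\<omega>. D \<omega> \<partial>M)"
      if a: "adm a" and b: "adm b" for a b
    proof -
      have m: "(\<lambda>\<omega>. Q z \<omega> (a \<omega>) (b \<omega>)) \<in> borel_measurable M"
        using a b by (intro Q_M) (auto simp: adm_def)
      have bd: "AE \<omega> in M. 0 \<le> Q z \<omega> (a \<omega>) (b \<omega>) \<and> Q z \<omega> (a \<omega>) (b \<omega>) \<le> D \<omega>"
        using ae AE_space
      proof eventually_elim
        case (elim \<omega>)
        have ab: "0 \<le> a \<omega>" "a \<omega> \<le> max T (\<theta> h n \<omega>)" "0 \<le> b \<omega>" "b \<omega> \<le> max T (\<theta> h n \<omega>)"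
          using a b elim(2) by (auto simp: adm_def)
        have "discounted_value z c t \<omega> \<le> D \<omega>" if "0 \<le> t" "t \<le> max T (\<theta> h n \<omega>)" for c t
          using elim(1) that unfolding controlled_def by blast
        then show ?case using Q_nonneg[OF elim(2) ab(1,3), of z] ab by (simp add: Q_eq)
      qed
      show i: "integrable M (\<lambda>\<omega>. Q z \<omega> (a \<omega>) (b \<omega>))"
        by (rule Bochner_Integration.integrable_bound[OF D m]) (use bd in \<open>eventually_elim, simp\<close>)
      have "0 \<le> ?J a b" by (rule integral_nonneg_AE) (use bd in \<open>eventually_elim, simp\<close>)
      moreover have "?J a b \<le> (\<integral>\<omega>. D \<omega> \<partial>M)"
        by (rule integral_mono_AE[OF i D]) (use bd in \<open>eventually_elim, simp\<close>)
      ultimately show "0 \<le> ?J a b \<and> ?J a b \<le> (\<integral>\<omega>. D \<omega> \<partial>M)" by simp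
    qed
    have cmp: "?J a b \<le> ?J a' b' + \<epsilon>"
      if "adm a" "adm b" "adm a'" "adm b'"
        and le: "\<And>\<omega>. \<omega> \<in> space M \<Longrightarrow> controlled z n h (E \<omega>) (D \<omega>) \<omega> \<Longrightarrow>
          Q z \<omega> (a \<omega>) (b \<omega>) \<le> Q z \<omega> (a' \<omega>) (b' \<omega>) + E \<omega>" for a b a' b'
    proof -
      have "?J a b \<le> (\<integral>\<omega>. Q z \<omega> (a' \<omega>) (b' \<omega>) + E \<omega> \<partial>M)"
      proof (rule integral_mono_AE)
        show "AE \<omega> in M. Q z \<omega> (a \<omega>) (b \<omega>) \<le> Q z \<omega> (a' \<omega>) (b' \<omega>) + E \<omega>"
          using ae AE_space by eventually_elim (rule le)
      qed (use Qi that(1-4) E in \<open>auto intro!: Bochner_Integration.integrable_add\<close>)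
      also have "\<dots> = ?J a' b' + \<epsilon>"
        unfolding \<epsilon>_def by (rule Bochner_Integration.integral_add[OF Qi[OF that(3,4)] E])
      finally show ?thesis .
    qed
    have Ine: "?I \<noteq> {}"
    proof -
      have "(\<lambda>_. 0) \<in> ?I" using T_pos by (simp add: market_times_def stopping_time_const)
      then show ?thesis by blast
    qed
    have Wne: "?W \<noteq> {}" using Ine round_up_walk_time[OF h] by blast
    have range: "0 \<le> \<tau> \<omega>" "\<tau> \<omega> \<le> T" if "\<tau> \<in> ?I" "\<omega> \<in> space M" for \<tau> \<omega>
      using that by (auto simp: market_times_def)
    have rangeW: "\<zeta> \<omega> \<le> n" if "\<zeta> \<in> ?W" "\<omega> \<in> space M" for \<zeta> \<omega>
      using that by (auto simp: walk_times_def)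
    have up: "(INF \<sigma>\<in>?I. SUP \<tau>\<in>?I. ?J \<sigma> \<tau>) \<le> (INF \<zeta>\<in>?W. SUP \<eta>\<in>?W. ?J' \<zeta> \<eta>) + \<epsilon>"
    proof (rule inf_sup_le[OF Ine Ine Wne Wne Qb[OF admI admI] Qb[OF admW admW]])
      fix \<zeta> assume \<zeta>: "\<zeta> \<in> ?W"
      define \<sigma> where "\<sigma> \<omega> = (if \<zeta> \<omega> < n then min (\<theta> h (\<zeta> \<omega>) \<omega>) T else T)" for \<omega>
      have \<sigma>: "\<sigma> \<in> ?I" unfolding \<sigma>_def using truncated_walk_time[OF h _ \<zeta>, of T n] T_pos by simp
      show "\<exists>\<sigma>\<in>?I. \<forall>\<tau>\<in>?I. \<exists>\<eta>\<in>?W. ?J \<sigma> \<tau> \<le> ?J' \<zeta> \<eta> + \<epsilon>"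
      proof (rule bexI[OF _ \<sigma>], rule ballI)
        fix \<tau> assume \<tau>: "\<tau> \<in> ?I"
        have \<eta>: "round_up h n \<tau> \<in> ?W" by (rule round_up_walk_time[OF h \<tau>])
        have "?J \<sigma> \<tau> \<le> ?J' \<zeta> (round_up h n \<tau>) + \<epsilon>"
          unfolding \<sigma>_def
          by (rule cmp[OF admI[OF \<sigma>[unfolded \<sigma>_def]] admI[OF \<tau>] admW[OF \<zeta>] admW[OF \<eta>]])
            (rule seller_comparison[OF _ h n]; use rangeW[OF \<zeta>] range[OF \<tau>] in simp)
        then show "\<exists>\<eta>\<in>?W. ?J \<sigma> \<tau> \<le> ?J' \<zeta> \<eta> + \<epsilon>" using \<eta> by blast
      qed
    qed
    have down: "(INF \<zeta>\<in>?W. SUP \<eta>\<in>?W. ?J' \<zeta> \<eta>) \<le> (INF \<sigma>\<in>?I. SUP \<tau>\<in>?I. ?J \<sigma> \<tau>) + \<epsilon>"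
    proof (rule inf_sup_le[OF Wne Wne Ine Ine Qb[OF admW admW] Qb[OF admI admI]])
      fix \<sigma> assume \<sigma>: "\<sigma> \<in> ?I"
      define \<zeta> where "\<zeta> \<omega> = (if \<sigma> \<omega> < T then round_up h n \<sigma> \<omega> else n)" for \<omega>
      have \<zeta>: "\<zeta> \<in> ?W" unfolding \<zeta>_def by (rule early_round_up_walk_time[OF h \<sigma>])
      show "\<exists>\<zeta>\<in>?W. \<forall>\<eta>\<in>?W. \<exists>\<tau>\<in>?I. ?J' \<zeta> \<eta> \<le> ?J \<sigma> \<tau> + \<epsilon>"
      proof (rule bexI[OF _ \<zeta>], rule ballI)
        fix \<eta> assume \<eta>: "\<eta> \<in> ?W"
        define \<tau> where "\<tau> \<omega> = (if \<eta> \<omega> < Suc n then min (\<theta> h (\<eta> \<omega>) \<omega>) T else T)" for \<omega>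
        have \<tau>: "\<tau> \<in> ?I" unfolding \<tau>_def using truncated_walk_time[OF h _ \<eta>, of T "Suc n"] T_pos by simp
        have "?J' \<zeta> \<eta> \<le> ?J \<sigma> \<tau> + \<epsilon>"
        proof (rule cmp[OF admW[OF \<zeta>] admW[OF \<eta>] admI[OF \<sigma>] admI[OF \<tau>]])
          fix \<omega> assume \<omega>: "\<omega> \<in> space M" and c: "controlled z n h (E \<omega>) (D \<omega>) \<omega>"
          have "\<tau> \<omega> = min (\<theta> h (\<eta> \<omega>) \<omega>) T" using rangeW[OF \<eta> \<omega>] by (simp add: \<tau>_def less_Suc_eq_le)
          then show "Q z \<omega> (\<theta> h (\<zeta> \<omega>) \<omega>) (\<theta> h (\<eta> \<omega>) \<omega>) \<le> Q z \<omega> (\<sigma> \<omega>) (\<tau> \<omega>) + E \<omega>"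
            unfolding \<zeta>_def using buyer_comparison[where \<sigma> = \<sigma>, OF \<omega> h n c rangeW[OF \<eta> \<omega>] range[OF \<sigma> \<omega>]] by simp
        qed
        then show "\<exists>\<tau>\<in>?I. ?J' \<zeta> \<eta> \<le> ?J \<sigma> \<tau> + \<epsilon>" using \<tau> by blast
      qed
    qed
    have "C * size z * real n powr (- 1 / 4) \<le> (C + 1) * size z * real n powr (- 1 / 4)"
      using size_ge_1[OF z] by (intro mult_right_mono) auto
    with EE have "\<epsilon> \<le> (C + 1) * size z * real n powr (- 1 / 4)" unfolding \<epsilon>_def by linarith
    with up down have "\<bar>(INF \<sigma>\<in>?I. SUP \<tau>\<in>?I. ?J \<sigma> \<tau>) - (INF \<zeta>\<in>?W. SUP \<eta>\<in>?W. ?J' \<zeta> \<eta>)\<bar>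
      \<le> (C + 1) * size z * real n powr (- 1 / 4)" by linarith
    then show "\<bar>(INF \<sigma>\<in>market_times T. SUP \<tau>\<in>market_times T. \<integral>\<omega>. Q z \<omega> (\<sigma> \<omega>) (\<tau> \<omega>) \<partial>M)
     - (INF \<zeta>\<in>walk_times (sqrt (T / real n)) n. SUP \<eta>\<in>walk_times (sqrt (T / real n)) n.
          \<integral>\<omega>. Q z \<omega> (\<theta> (sqrt (T / real n)) (\<zeta> \<omega>) \<omega>) (\<theta> (sqrt (T / real n)) (\<eta> \<omega>) \<omega>) \<partial>M)\<bar>
    \<le> (C + 1) * size z * real n powr (- 1 / 4)"
      unfolding h_def .
  qed
qed

end

section \<open>A version of the Brownian motion with good paths\<close>

context standard_brownian_motion begin

abbreviation increment :: "real \<Rightarrow> real \<Rightarrow> 'a \<Rightarrow> real" where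
  "increment s t \<omega> \<equiv> B t \<omega> - B s \<omega>"

lemma increment_M: "0 \<le> s \<Longrightarrow> 0 \<le> t \<Longrightarrow> increment s t \<in> borel_measurable M"
  using measurable_B[of s] measurable_B[of t] by measurable

lemma sets_bm_filtration:
  "sets (bm_filtration M B t) = sigma_sets (space M)
    ({B s -` A \<inter> space M | s A. 0 \<le> s \<and> s \<le> t \<and> A \<in> sets borel} \<union> null_sets M)"
  unfolding bm_filtration_def by (rule sets_measure_of) (use sets.sets_into_space in auto)

lemma space_bm_filtration: "space (bm_filtration M B t) = space M"
  using filtration_bm_filtration by (rule filtration.space_F)

lemma null_set_bm_filtration: "N \<in> null_sets M \<Longrightarrow> N \<in> sets (bm_filtration M B t)"
  unfolding sets_bm_filtration by (intro sigma_sets.Basic) simp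

lemma bm_filtration_subset: "sets (bm_filtration M B t) \<subseteq> sets M"
  unfolding sets_bm_filtration
  by (rule sets.sigma_sets_subset) (use measurable_sets[OF measurable_B] in auto)

lemma adapted_bm: "0 \<le> t \<Longrightarrow> B t \<in> borel_measurable (bm_filtration M B t)"
proof (rule measurableI)
  fix A :: "real set" assume "0 \<le> t" "A \<in> sets borel"
  then show "B t -` A \<inter> space (bm_filtration M B t) \<in> sets (bm_filtration M B t)"
    unfolding space_bm_filtration sets_bm_filtration by (intro sigma_sets.Basic) auto
qed simp

definition cylinder :: "real set \<Rightarrow> (real \<Rightarrow> real set) \<Rightarrow> 'a set" where
  "cylinder U A = {\<omega> \<in> space M. \<forall>u\<in>U. B u \<omega> \<in> A u}"

lemma cylinder_M:
  assumes "finite U" "U \<subseteq> {0..}" "\<And>u. A u \<in> sets borel"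
  shows "cylinder U A \<in> sets M"
  unfolding cylinder_def
proof (rule sets.sets_Collect_finite_All[OF _ assms(1)])
  fix u assume "u \<in> U"
  then have "B u -` A u \<inter> space M \<in> sets M" using assms by (intro measurable_sets[OF measurable_B]) auto
  then show "{\<omega> \<in> space M. B u \<omega> \<in> A u} \<in> sets M" by (simp add: vimage_def Int_def conj_commute)
qed

text \<open>
  The increments over the points of \<open>U\<close>, over the gap up to \<open>s\<close> and over \<open>[s, t]\<close> are consecutive increments of one monotone
  sequence of times; up to a null set, where the motion does not start at zero, the cylinder is an event about the former ones.
\<close>

lemma cylinder_independent:
  assumes U: "finite U" "U \<subseteq> {0..s}" and A: "\<And>u. A u \<in> sets borel" and s: "0 \<le> s" "s < t"
    and D: "D \<in> sets borel"
  shows "prob (cylinder U A \<inter> (increment s t -` D \<inter> space M)) = prob (cylinder U A) * prob (increment s t -` D \<inter> space M)"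
proof -
  define us where "us = sorted_list_of_set U"
  define m where "m = length us"
  have us: "set us = U" "sorted us" using U by (simp_all add: us_def)
  \<comment> \<open>Time \<open>0\<close>, the points of \<open>U\<close> in increasing order, then \<open>s\<close>, and \<open>t\<close> from then on.\<close>
  define \<tau> where "\<tau> i = (if i = 0 then 0 else if i \<le> m then us ! (i - 1) else if i = Suc m then s else t)" for i
  have usb: "us ! i \<in> {0..s}" if "i < m" for i using us(1) U(2) nth_mem[of i us] that unfolding m_def by blast
  have mono\<tau>: "mono \<tau>"
  proof (rule mono_iff_le_Suc[THEN iffD2], rule allI)
    fix i
    consider "i = 0" | "0 < i" "i < m" | "0 < i" "i = m" | "i = Suc m" | "Suc m < i" by linarith
    then show "\<tau> i \<le> \<tau> (Suc i)"
    proof cases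
      case 1
      then show ?thesis using usb[of 0] s by (auto simp: \<tau>_def)
    next
      case 2
      then show ?thesis using us(2) by (auto simp: \<tau>_def m_def intro!: sorted_nth_mono)
    next
      case 3
      then show ?thesis using usb[of "m - 1"] by (auto simp: \<tau>_def)
    qed (use s in \<open>auto simp: \<tau>_def\<close>)
  qed
  define I where "I i = increment (\<tau> i) (\<tau> (Suc i))" for i
  have \<tau>0: "\<tau> 0 = 0" by (simp add: \<tau>_def)
  have \<tau>nn: "0 \<le> \<tau> i" for i using monoD[OF mono\<tau>, of 0 i] by (simp add: \<tau>0)
  have IM: "I i \<in> borel_measurable M" for i unfolding I_def by (intro increment_M \<tau>nn)
  have ind: "indep_vars (\<lambda>_. borel) I {..<m + 2}"
    unfolding I_def using indep_increments[OF _ mono\<tau>, of "m + 2"] by (simp add: \<tau>0)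
  have last: "I (Suc m) = increment s t" unfolding I_def by (simp add: \<tau>_def)
  let ?R = "\<lambda>J \<omega>. restrict (\<lambda>i. I i \<omega>) J"
  have ivar: "indep_var (PiM {..m} (\<lambda>_. borel)) (?R {..m}) (PiM {Suc m} (\<lambda>_. borel)) (?R {Suc m})"
    by (rule indep_var_restrict[OF ind]) auto
  define Xa where "Xa = {f \<in> space (PiM {..m} (\<lambda>_. borel :: real measure)). \<forall>i\<in>{..<m}. (\<Sum>j\<le>i. f j) \<in> A (us ! i)}"
  define Xb where "Xb = {f \<in> space (PiM {Suc m} (\<lambda>_. borel :: real measure)). f (Suc m) \<in> D}"
  have Xa: "Xa \<in> sets (PiM {..m} (\<lambda>_. borel))"
    unfolding Xa_def
  proof (rule sets.sets_Collect_finite_All)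
    fix i assume "i \<in> {..<m}"
    then have "(\<lambda>f. \<Sum>j\<le>i. f j) \<in> borel_measurable (PiM {..m} (\<lambda>_. borel :: real measure))"
      by (intro borel_measurable_sum measurable_component_singleton) auto
    from measurable_sets[OF this A[of "us ! i"]]
    show "{f \<in> space (PiM {..m} (\<lambda>_. borel :: real measure)). (\<Sum>j\<le>i. f j) \<in> A (us ! i)} \<in> sets (PiM {..m} (\<lambda>_. borel))"
      by (simp add: vimage_def Int_def conj_commute)
  qed simp
  have Xb: "Xb \<in> sets (PiM {Suc m} (\<lambda>_. borel))"
  proof -
    have "(\<lambda>f. f (Suc m)) \<in> borel_measurable (PiM {Suc m} (\<lambda>_. borel :: real measure))"
      by (intro measurable_component_singleton) simp
    from measurable_sets[OF this D] show ?thesis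
      unfolding Xb_def by (simp add: vimage_def Int_def conj_commute)
  qed
  have part: "(\<Sum>j\<le>i. I j \<omega>) = B (us ! i) \<omega> - B 0 \<omega>" if "i < m" for i \<omega>
  proof -
    have "(\<Sum>j\<le>i. I j \<omega>) = B (\<tau> (Suc i)) \<omega> - B (\<tau> 0) \<omega>"
      unfolding I_def by (induction i) simp_all
    then show ?thesis using that by (simp add: \<tau>_def)
  qed
  have inXa: "?R {..m} \<omega> \<in> Xa \<longleftrightarrow> (\<forall>i<m. B (us ! i) \<omega> - B 0 \<omega> \<in> A (us ! i))" for \<omega>
    unfolding Xa_def using part[of _ \<omega>] by (auto simp: space_PiM)
  have inXb: "?R {Suc m} \<omega> \<in> Xb \<longleftrightarrow> increment s t \<omega> \<in> D" for \<omega>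
    unfolding Xb_def by (simp add: space_PiM last)
  have aeA: "AE \<omega> in M. \<omega> \<in> cylinder U A \<longleftrightarrow> \<omega> \<in> ?R {..m} -` Xa \<inter> space M"
    using start_zero AE_space
  proof eventually_elim
    case (elim \<omega>)
    have "(\<forall>u\<in>U. B u \<omega> \<in> A u) \<longleftrightarrow> (\<forall>i<m. B (us ! i) \<omega> \<in> A (us ! i))"
      unfolding us(1)[symmetric] m_def by (rule all_set_conv_all_nth)
    then show ?case using elim by (simp add: cylinder_def inXa)
  qed
  have RaM: "?R {..m} -` Xa \<inter> space M \<in> sets M"
    by (rule measurable_sets[OF indep_var_rv1[OF ivar] Xa])
  have cM: "cylinder U A \<in> sets M" using U A by (intro cylinder_M) auto
  have YD: "increment s t -` D \<inter> space M \<in> sets M"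
    using s by (intro measurable_sets[OF increment_M D]) auto
  have "prob (cylinder U A \<inter> (increment s t -` D \<inter> space M))
      = prob ((?R {..m} -` Xa \<inter> space M) \<inter> (increment s t -` D \<inter> space M))"
    by (rule measure_eq_AE) (use aeA cM RaM YD in \<open>auto elim: eventually_mono\<close>)
  also have "(?R {..m} -` Xa \<inter> space M) \<inter> (increment s t -` D \<inter> space M)
      = (\<lambda>\<omega>. (?R {..m} \<omega>, ?R {Suc m} \<omega>)) -` (Xa \<times> Xb) \<inter> space M"
    by (auto simp: inXb)
  also have "prob \<dots> = prob (?R {..m} -` Xa \<inter> space M) * prob (?R {Suc m} -` Xb \<inter> space M)"
    by (rule indep_varD[OF ivar Xa Xb])
  also have "prob (?R {..m} -` Xa \<inter> space M) = prob (cylinder U A)"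
    by (rule measure_eq_AE[symmetric, OF aeA cM RaM])
  also have "?R {Suc m} -` Xb \<inter> space M = increment s t -` D \<inter> space M"
    by (auto simp: inXb)
  finally show ?thesis .
qed

text \<open>
  Cylinders together with the null sets are stable under intersection and generate the completed filtration.
\<close>

lemma increment_independent:
  assumes s: "0 \<le> s" "s < t" and A: "A \<in> sets (bm_filtration M B s)" and D: "D \<in> sets borel"
  shows "prob (A \<inter> (increment s t -` D \<inter> space M)) = prob A * prob (increment s t -` D \<inter> space M)"
proof -
  define \<C> where "\<C> = {cylinder U A | U A. finite U \<and> U \<subseteq> {0..s} \<and> (\<forall>u. A u \<in> sets borel)}"
  let ?P = "\<C> \<union> null_sets M"
  let ?Y = "increment s t -` D \<inter> space M"
  have Y: "?Y \<in> sets M" using s by (intro measurable_sets[OF increment_M D]) auto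
  have CM: "\<C> \<subseteq> sets M" unfolding \<C>_def by (auto intro!: cylinder_M)
  have null: "prob (N \<inter> E) = prob N * prob E" if "N \<in> null_sets M" "E \<in> sets M" for N E
  proof -
    have "N \<inter> E \<in> null_sets M" using that by (rule null_set_Int2)
    then show ?thesis using that(1) by (simp add: measure_eq_0_null_sets)
  qed
  have "indep_set ?P {?Y}"
  proof (rule indep_setI)
    show "?P \<subseteq> events" using CM by auto
    show "{?Y} \<subseteq> events" using Y by simp
    fix a b assume "a \<in> ?P" "b \<in> {?Y}"
    then consider U A where "a = cylinder U A" "finite U" "U \<subseteq> {0..s}" "\<And>u. A u \<in> sets borel" "b = ?Y"
      | "a \<in> null_sets M" "b = ?Y"
      unfolding \<C>_def by blast
    then show "prob (a \<inter> b) = prob a * prob b"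
    proof cases
      case 1
      then show ?thesis using cylinder_independent[OF 1(2,3,4) s D] by simp
    next
      case 2
      then show ?thesis using null Y by simp
    qed
  qed
  moreover have "Int_stable ?P"
  proof (rule Int_stableI)
    fix a b assume ab: "a \<in> ?P" "b \<in> ?P"
    show "a \<inter> b \<in> ?P"
    proof (cases "a \<in> \<C> \<and> b \<in> \<C>")
      case True
      then obtain U A V C where a: "a = cylinder U A" "finite U" "U \<subseteq> {0..s}" "\<And>u. A u \<in> sets borel"
        and b: "b = cylinder V C" "finite V" "V \<subseteq> {0..s}" "\<And>u. C u \<in> sets borel"
        unfolding \<C>_def by blast
      define E where "E u = (if u \<in> U then A u else UNIV) \<inter> (if u \<in> V then C u else UNIV)" for u
      have "a \<inter> b = cylinder (U \<union> V) E" unfolding a b cylinder_def E_def by auto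
      moreover have "E u \<in> sets borel" for u using a(4) b(4) by (simp add: E_def)
      ultimately show ?thesis using a(2,3) b(2,3) unfolding \<C>_def by blast
    next
      case False
      then have "a \<inter> b \<in> null_sets M"
      proof (cases "a \<in> null_sets M")
        case True
        then show ?thesis using ab CM by (intro null_set_Int2[of a]) auto
      next
        case False
        then have "b \<in> null_sets M" using ab \<open>\<not> (a \<in> \<C> \<and> b \<in> \<C>)\<close> by auto
        then show ?thesis using ab CM by (intro null_set_Int1[of b]) auto
      qed
      then show ?thesis by simp
    qed
  qed
  moreover have "Int_stable {?Y}" by (simp add: Int_stable_def)
  ultimately have ind: "indep_set (sigma_sets (space M) ?P) (sigma_sets (space M) {?Y})"
    by (rule indep_set_sigma_sets)
  have "A \<in> sigma_sets (space M) ?P"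
  proof -
    have "{B u -` E \<inter> space M | u E. 0 \<le> u \<and> u \<le> s \<and> E \<in> sets borel} \<subseteq> \<C>"
    proof
      fix a assume "a \<in> {B u -` E \<inter> space M | u E. 0 \<le> u \<and> u \<le> s \<and> E \<in> sets borel}"
      then obtain u E where "a = B u -` E \<inter> space M" "0 \<le> u" "u \<le> s" "E \<in> sets borel" by blast
      then show "a \<in> \<C>"
        unfolding \<C>_def by (intro CollectI exI[of _ "{u}"] exI[of _ "\<lambda>_. E"]) (auto simp: cylinder_def)
    qed
    then have "{B u -` E \<inter> space M | u E. 0 \<le> u \<and> u \<le> s \<and> E \<in> sets borel} \<union> null_sets M \<subseteq> ?P"
      by (rule Un_mono) simp
    from subsetD[OF sigma_sets_mono'[OF this] A[unfolded sets_bm_filtration]] show ?thesis .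
  qed
  then show ?thesis by (intro indep_setD[OF ind]) auto
qed

text \<open>
  The density of \<open>B t\<close> is at most \<open>1 / sqrt t\<close>, so \<open>X t\<close> lies in a fixed bounded interval with a probability that vanishes as \<open>t\<close> grows.
\<close>

lemma drifted_unbounded:
  "AE \<omega> in M. \<forall>a. \<exists>t\<ge>0. a < \<bar>drifted \<kappa> B t \<omega>\<bar>"
proof -
  have zero: "AE \<omega> in M. \<not> (\<forall>k. \<bar>increment 0 (real (Suc k)) \<omega> - \<kappa> / 2 * real (Suc k)\<bar> \<le> real a)" for a :: nat
  proof -
    let ?U = "{\<omega> \<in> space M. \<forall>k. \<bar>increment 0 (real (Suc k)) \<omega> - \<kappa> / 2 * real (Suc k)\<bar> \<le> real a}"
    have UM: "?U \<in> sets M"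
    proof (rule sets.sets_Collect_countable_All)
      fix k
      have [measurable]: "increment 0 (real (Suc k)) \<in> borel_measurable M" by (rule increment_M) simp_all
      show "{\<omega> \<in> space M. \<bar>increment 0 (real (Suc k)) \<omega> - \<kappa> / 2 * real (Suc k)\<bar> \<le> real a} \<in> sets M" by measurable
    qed
    have bound: "emeasure M ?U \<le> ennreal (2 * real a * (1 / sqrt (real (Suc k))))" for k
    proof -
      let ?t = "real (Suc k)"
      define c where "c = \<kappa> / 2 * ?t"
      have [measurable]: "increment 0 ?t \<in> borel_measurable M" by (rule increment_M) simp_all
      have dist: "distributed M lborel (increment 0 ?t) (\<lambda>x. ennreal (normal_density 0 (sqrt ?t) x))"
        using normal_increments[of 0 ?t] by simp
      have "emeasure M ?U \<le> emeasure M (increment 0 ?t -` {c - real a..c + real a} \<inter> space M)"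
      proof (rule emeasure_mono)
        show "?U \<subseteq> increment 0 ?t -` {c - real a..c + real a} \<inter> space M"
        proof
          fix \<omega> assume "\<omega> \<in> ?U"
          then have "\<omega> \<in> space M" "\<bar>increment 0 ?t \<omega> - c\<bar> \<le> real a" unfolding c_def by blast+
          then show "\<omega> \<in> increment 0 ?t -` {c - real a..c + real a} \<inter> space M" by (auto simp: abs_le_iff)
        qed
      qed measurable
      also have "\<dots> = (\<integral>\<^sup>+x. ennreal (normal_density 0 (sqrt ?t) x) * indicator {c - real a..c + real a} x \<partial>lborel)"
        by (rule distributed_emeasure[OF dist]) simp
      also have "\<dots> \<le> (\<integral>\<^sup>+x. ennreal (1 / sqrt ?t) * indicator {c - real a..c + real a} x \<partial>lborel)"
      proof (rule nn_integral_mono, rule mult_right_mono, rule ennreal_leI)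
        fix x :: real
        have "normal_density 0 (sqrt ?t) x = 1 / sqrt (2 * pi * ?t) * exp (- (x\<^sup>2) / (2 * ?t))"
          by (simp add: normal_density_def)
        also have "\<dots> \<le> 1 / sqrt ?t * 1"
        proof (intro mult_mono divide_left_mono)
          have "1 * ?t \<le> 2 * pi * ?t" using pi_gt3 by (intro mult_right_mono) auto
          then show "sqrt ?t \<le> sqrt (2 * pi * ?t)" by (simp only: real_sqrt_le_iff mult_1)
        qed (auto intro!: divide_nonpos_nonneg)
        finally show "normal_density 0 (sqrt ?t) x \<le> 1 / sqrt ?t" by simp
      qed simp
      also have "\<dots> = ennreal (1 / sqrt ?t) * ennreal (2 * real a)"
        by (subst nn_integral_cmult_indicator) simp_all
      also have "\<dots> = ennreal (2 * real a * (1 / sqrt ?t))"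
        by (subst ennreal_mult'[symmetric]) (simp_all add: mult.commute)
      finally show ?thesis .
    qed
    have lim: "(\<lambda>k. ennreal (2 * real a * (1 / sqrt (real (Suc k))))) \<longlonglongrightarrow> ennreal (2 * real a * 0)"
    proof (intro tendsto_ennrealI tendsto_mult tendsto_const)
      have "filterlim (\<lambda>k. sqrt (real (Suc k))) at_top sequentially"
        by (intro filterlim_compose[OF sqrt_at_top] filterlim_compose[OF filterlim_real_sequentially] filterlim_Suc)
      then show "(\<lambda>k. 1 / sqrt (real (Suc k))) \<longlonglongrightarrow> 0"
        unfolding divide_inverse mult_1 by (rule filterlim_compose[OF tendsto_inverse_0_at_top[OF filterlim_ident]])
    qed
    have "emeasure M ?U \<le> ennreal (2 * real a * 0)"
      by (rule LIMSEQ_le_const[OF lim]) (use bound in auto)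
    then have "?U \<in> null_sets M" using UM by (simp add: null_sets_def)
    then show ?thesis by (rule AE_I') blast
  qed
  have "AE \<omega> in M. \<forall>a. \<not> (\<forall>k. \<bar>increment 0 (real (Suc k)) \<omega> - \<kappa> / 2 * real (Suc k)\<bar> \<le> real a)"
    using zero by (simp only: AE_all_countable) blast
  with start_zero show ?thesis
  proof eventually_elim
    case (elim \<omega>)
    show ?case
    proof
      fix a :: real
      obtain a' :: nat where a': "a \<le> real a'" using real_arch_simple by blast
      obtain k where "\<not> \<bar>increment 0 (real (Suc k)) \<omega> - \<kappa> / 2 * real (Suc k)\<bar> \<le> real a'"
        using elim(2) by blast
      then have "a < \<bar>drifted \<kappa> B (real (Suc k)) \<omega>\<bar>" using a' elim(1) by (simp add: drifted_def)
      then show "\<exists>t\<ge>0. a < \<bar>drifted \<kappa> B t \<omega>\<bar>" by (intro exI[of _ "real (Suc k)"]) simp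
    qed
  qed
qed

end

locale complete_bm = standard_brownian_motion M B + complete_measure M
  for M :: "'a measure" and B :: "real \<Rightarrow> 'a \<Rightarrow> real" +
  fixes \<kappa> :: real
  assumes kappa_pos: "0 < \<kappa>"
begin

text \<open>
  The exceptional paths, on which the motion is replaced by one whose drifted path is \<open>t\<close>.
\<close>

definition bad :: "'a set" where
  "bad = {\<omega> \<in> space M. \<not> (B 0 \<omega> = 0 \<and> continuous_on {0..} (\<lambda>t. B t \<omega>) \<and>
     (\<forall>a. \<exists>t\<ge>0. a < \<bar>drifted \<kappa> B t \<omega>\<bar>))}"

definition good_B :: "real \<Rightarrow> 'a \<Rightarrow> real" where
  "good_B t \<omega> = (if \<omega> \<in> bad then (1 + \<kappa> / 2) * t else B t \<omega>)"

lemma bad_null: "bad \<in> null_sets M"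
proof -
  have "AE \<omega> in M. B 0 \<omega> = 0 \<and> continuous_on {0..} (\<lambda>t. B t \<omega>) \<and> (\<forall>a. \<exists>t\<ge>0. a < \<bar>drifted \<kappa> B t \<omega>\<bar>)"
    using start_zero continuous_paths drifted_unbounded[of \<kappa>] by eventually_elim blast
  then obtain N where N: "bad \<subseteq> N" "N \<in> null_sets M"
    unfolding bad_def by (rule AE_E) (auto simp: null_sets_def)
  then have "bad \<in> sets M" by (rule complete)
  then show ?thesis using N null_sets_subset by blast
qed

lemma AE_good: "AE \<omega> in M. \<omega> \<notin> bad"
  by (rule AE_not_in[OF bad_null])

lemma good_B_eq: "\<omega> \<notin> bad \<Longrightarrow> good_B t \<omega> = B t \<omega>"
  by (simp add: good_B_def)

lemma subset_bad_null: "A \<subseteq> bad \<Longrightarrow> A \<in> null_sets M"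
  using complete[OF _ bad_null] null_sets_subset[OF bad_null] by blast

lemma measurable_off_bad:
  fixes f g :: "'a \<Rightarrow> real"
  assumes f: "f \<in> borel_measurable M" and eq: "\<And>\<omega>. \<omega> \<in> space M \<Longrightarrow> \<omega> \<notin> bad \<Longrightarrow> f \<omega> = g \<omega>"
  shows "g \<in> borel_measurable M"
proof (rule measurableI)
  fix A :: "real set" assume "A \<in> sets borel"
  then have 1: "f -` A \<inter> space M - bad \<in> sets M" using measurable_sets[OF f] bad_null by auto
  have 2: "g -` A \<inter> space M \<inter> bad \<in> sets M" using subset_bad_null[of "g -` A \<inter> space M \<inter> bad"] by auto
  have "g -` A \<inter> space M = (f -` A \<inter> space M - bad) \<union> (g -` A \<inter> space M \<inter> bad)"
    using eq by auto
  then show "g -` A \<inter> space M \<in> sets M" using sets.Un[OF 1 2] by simp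
qed simp

lemma integral_off_bad:
  assumes f: "f \<in> borel_measurable M" and eq: "\<And>\<omega>. \<omega> \<in> space M \<Longrightarrow> \<omega> \<notin> bad \<Longrightarrow> f \<omega> = (g \<omega> :: real)"
  shows "(\<integral>\<omega>. f \<omega> \<partial>M) = (\<integral>\<omega>. g \<omega> \<partial>M)"
proof (rule integral_cong_AE[OF f measurable_off_bad[OF f eq]])
  show "AE \<omega> in M. f \<omega> = g \<omega>" using AE_good AE_space by eventually_elim (rule eq)
qed

lemma good_drifted: "\<omega> \<in> bad \<Longrightarrow> drifted \<kappa> good_B t \<omega> = t"
  by (simp add: drifted_def good_B_def algebra_simps)

lemma good_filtered_bm: "filtered_bm M (bm_filtration M B) good_B \<kappa>"
proof -
  interpret filtration "space M" "bm_filtration M B" by (rule filtration_bm_filtration)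
  have adapted: "good_B t \<in> borel_measurable (bm_filtration M B t)" if t: "0 \<le> t" for t
  proof -
    have [measurable]: "bad \<in> sets (bm_filtration M B t)" by (rule null_set_bm_filtration[OF bad_null])
    note adapted_bm[OF t, measurable]
    show ?thesis unfolding good_B_def[abs_def] by measurable
  qed
  have good_M: "good_B t \<in> borel_measurable M" if "0 \<le> t" for t
    by (rule measurable_off_bad[OF measurable_B[OF that]]) (simp add: good_B_eq)
  have inc_M: "(\<lambda>\<omega>. good_B t \<omega> - good_B s \<omega>) \<in> borel_measurable M" if "0 \<le> s" "s < t" for s t
    using good_M[of s] good_M[of t] that by simp
  show ?thesis
  proof unfold_locales
    show "sets (bm_filtration M B t) \<subseteq> sets M" for t by (rule bm_filtration_subset)
    show "0 < \<kappa>" by (rule kappa_pos)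
    show "good_B t \<in> borel_measurable (bm_filtration M B t)" if "0 \<le> t" for t by (rule adapted[OF that])
    show "good_B 0 \<omega> = 0" if "\<omega> \<in> space M" for \<omega>
      using that by (simp add: good_B_def bad_def)
    show "continuous_on {0..} (\<lambda>t. good_B t \<omega>)" if "\<omega> \<in> space M" for \<omega>
    proof (cases "\<omega> \<in> bad")
      case True
      then show ?thesis unfolding good_B_def by (simp add: continuous_intros)
    next
      case False
      then have "continuous_on {0..} (\<lambda>t. B t \<omega>)" using that by (simp add: bad_def)
      then show ?thesis by (simp add: good_B_eq[OF False])
    qed
    show "\<exists>t\<ge>0. a < \<bar>drifted \<kappa> good_B t \<omega>\<bar>" if "\<omega> \<in> space M" for \<omega> a
    proof (cases "\<omega> \<in> bad")
      case True
      then show ?thesis by (intro exI[of _ "\<bar>a\<bar> + 1"]) (simp add: good_drifted)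
    next
      case False
      then have "\<exists>t\<ge>0. a < \<bar>drifted \<kappa> B t \<omega>\<bar>" using that by (simp add: bad_def)
      then show ?thesis unfolding drifted_def good_B_eq[OF False] .
    qed
    show "distributed M lborel (\<lambda>\<omega>. good_B t \<omega> - good_B s \<omega>) (\<lambda>x. ennreal (normal_density 0 (sqrt (t - s)) x))"
      if st: "0 \<le> s" "s < t" for s t
    proof -
      have D: "distributed M lborel (increment s t) (\<lambda>x. ennreal (normal_density 0 (sqrt (t - s)) x))"
        by (rule normal_increments[OF st])
      have "distr M lborel (\<lambda>\<omega>. good_B t \<omega> - good_B s \<omega>) = distr M lborel (increment s t)"
      proof (rule distr_cong_AE)
        show "AE \<omega> in M. good_B t \<omega> - good_B s \<omega> = increment s t \<omega>"
          using AE_good by eventually_elim (simp add: good_B_eq)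
        show "(\<lambda>\<omega>. good_B t \<omega> - good_B s \<omega>) \<in> measurable M lborel" using inc_M[OF st] by simp
        show "increment s t \<in> measurable M lborel" using increment_M[of s t] st by simp
      qed simp_all
      then show ?thesis using D inc_M[OF st] unfolding distributed_def by simp
    qed
    show "prob (A \<inter> ((\<lambda>\<omega>. good_B t \<omega> - good_B s \<omega>) -` D \<inter> space M))
        = prob A * prob ((\<lambda>\<omega>. good_B t \<omega> - good_B s \<omega>) -` D \<inter> space M)"
      if st: "0 \<le> s" "s < t" and A: "A \<in> sets (bm_filtration M B s)" and D: "D \<in> sets borel" for s t A D
    proof -
      have AM: "A \<in> sets M" using A bm_filtration_subset by blast
      have Y: "increment s t -` D \<inter> space M \<in> sets M"
        using increment_M[of s t] st D by (intro measurable_sets) auto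
      have Y': "(\<lambda>\<omega>. good_B t \<omega> - good_B s \<omega>) -` D \<inter> space M \<in> sets M"
        by (rule measurable_sets[OF inc_M[OF st] D])
      have ae: "AE \<omega> in M. \<omega> \<in> (\<lambda>\<omega>. good_B t \<omega> - good_B s \<omega>) -` D \<inter> space M \<longleftrightarrow> \<omega> \<in> increment s t -` D \<inter> space M"
        using AE_good by eventually_elim (simp add: good_B_eq)
      have "prob ((\<lambda>\<omega>. good_B t \<omega> - good_B s \<omega>) -` D \<inter> space M) = prob (increment s t -` D \<inter> space M)"
        by (rule measure_eq_AE[OF ae Y' Y])
      moreover have "prob (A \<inter> ((\<lambda>\<omega>. good_B t \<omega> - good_B s \<omega>) -` D \<inter> space M)) = prob (A \<inter> (increment s t -` D \<inter> space M))"
      proof (rule measure_eq_AE)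
        show "AE \<omega> in M. \<omega> \<in> A \<inter> ((\<lambda>\<omega>. good_B t \<omega> - good_B s \<omega>) -` D \<inter> space M) \<longleftrightarrow> \<omega> \<in> A \<inter> (increment s t -` D \<inter> space M)"
          using ae by eventually_elim blast
      qed (use AM Y Y' in auto)
      ultimately show ?thesis using increment_independent[OF st A D] by simp
    qed
  qed
qed

lemma good_embedding_time: "\<omega> \<notin> bad \<Longrightarrow> embedding_time \<kappa> good_B h k \<omega> = embedding_time \<kappa> B h k \<omega>"
proof (induction k)
  case (Suc k)
  have "drifted \<kappa> good_B t \<omega> = drifted \<kappa> B t \<omega>" for t
    using Suc.prems by (simp add: drifted_def good_B_eq)
  then show ?case using Suc.IH[OF Suc.prems] by (simp only: embedding_time.simps)
qed simp

text \<open>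
  The defining events of the two \<open>\<sigma>\<close>-algebras differ by subsets of a null set, which belong to the filtration at every time.
\<close>

lemma embedded_filtration_good:
  "embedded_filtration M B \<kappa> h k
    = filtration.pre_sigma (space M) (bm_filtration M B) (embedding_time \<kappa> good_B h k)"
proof -
  interpret filtration "space M" "bm_filtration M B" by (rule filtration_bm_filtration)
  have *: "{\<omega> \<in> A. f \<omega> \<le> t} \<in> sets (bm_filtration M B t)"
    if A: "{\<omega> \<in> A. g \<omega> \<le> t} \<in> sets (bm_filtration M B t)" and eq: "\<And>\<omega>. \<omega> \<notin> bad \<Longrightarrow> f \<omega> = g \<omega>"
    for f g :: "'a \<Rightarrow> real" and A t
  proof -
    have "bad \<in> sets (bm_filtration M B t)" by (rule null_set_bm_filtration[OF bad_null])
    then have 1: "{\<omega> \<in> A. g \<omega> \<le> t} - bad \<in> sets (bm_filtration M B t)" using A by auto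
    have "{\<omega> \<in> A. f \<omega> \<le> t} \<inter> bad \<in> null_sets M" by (rule subset_bad_null) auto
    from sets.Un[OF 1 null_set_bm_filtration[OF this]]
    have "({\<omega> \<in> A. g \<omega> \<le> t} - bad) \<union> ({\<omega> \<in> A. f \<omega> \<le> t} \<inter> bad) \<in> sets (bm_filtration M B t)" .
    also have "({\<omega> \<in> A. g \<omega> \<le> t} - bad) \<union> ({\<omega> \<in> A. f \<omega> \<le> t} \<inter> bad) = {\<omega> \<in> A. f \<omega> \<le> t}"
      using eq by auto
    finally show ?thesis .
  qed
  have "{\<omega> \<in> A. embedding_time \<kappa> B h k \<omega> \<le> t} \<in> sets (bm_filtration M B t)
    \<longleftrightarrow> {\<omega> \<in> A. embedding_time \<kappa> good_B h k \<omega> \<le> t} \<in> sets (bm_filtration M B t)" for A t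
  proof
    assume "{\<omega> \<in> A. embedding_time \<kappa> B h k \<omega> \<le> t} \<in> sets (bm_filtration M B t)"
    then show "{\<omega> \<in> A. embedding_time \<kappa> good_B h k \<omega> \<le> t} \<in> sets (bm_filtration M B t)"
      by (rule *[OF _ good_embedding_time])
  next
    assume "{\<omega> \<in> A. embedding_time \<kappa> good_B h k \<omega> \<le> t} \<in> sets (bm_filtration M B t)"
    then show "{\<omega> \<in> A. embedding_time \<kappa> B h k \<omega> \<le> t} \<in> sets (bm_filtration M B t)"
      by (rule *[OF _ good_embedding_time[symmetric]])
  qed
  then show ?thesis unfolding embedded_filtration_def pre_sigma_def by (simp only:)
qed

lemma good_discounted_payoff:
  assumes "\<omega> \<notin> bad"
  shows "discounted_payoff F \<Delta> r \<kappa> good_B z \<omega> = discounted_payoff F \<Delta> r \<kappa> B z \<omega>"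
proof -
  have "stock r \<kappa> good_B z \<omega> = stock r \<kappa> B z \<omega>"
    by (rule ext) (simp add: stock_def drifted_def good_B_eq[OF assms])
  then show ?thesis unfolding discounted_payoff_def by (simp only:)
qed

end

section \<open>The error estimate for the given motion\<close>

theorem lemma1:
  fixes M :: "'a measure" and B :: "real \<Rightarrow> 'a \<Rightarrow> real"
    and F \<Delta> :: "real \<Rightarrow> (real \<Rightarrow> real) \<Rightarrow> real" and L T r \<kappa> :: real
  assumes "0 < T" and "0 < r" and "0 < \<kappa>"
    and "payoff_functionals F \<Delta> L"
    and "complete_measure M"
    and "standard_brownian_motion M B"
  shows "\<exists>C>0. \<forall>z>0. \<forall>n::nat. n > 0 \<longrightarrow>
    \<bar>game_value M B F \<Delta> r \<kappa> T z - embedded_game_value M B F \<Delta> r \<kappa> T n z\<bar>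
      \<le> C * (F 0 (\<lambda>_. z) + \<Delta> 0 (\<lambda>_. z) + z + 1) * real n powr (- 1 / 4)"
proof -
  interpret bm: complete_bm M B \<kappa>
    using assms by (intro complete_bm.intro complete_bm_axioms.intro)
  interpret G: filtered_bm M "bm_filtration M B" bm.good_B \<kappa> by (rule bm.good_filtered_bm)
  interpret G: embedded_market M "bm_filtration M B" bm.good_B \<kappa> F \<Delta> L r T
    using assms by (intro embedded_market.intro embedded_market_axioms.intro G.filtered_bm_axioms)
  have val: "game_value M B F \<Delta> r \<kappa> T z
      = (INF \<sigma>\<in>G.market_times T. SUP \<tau>\<in>G.market_times T. \<integral>\<omega>. G.Q z \<omega> (\<sigma> \<omega>) (\<tau> \<omega>) \<partial>M)" for z
  proof -
    have I: "stopping_times_upto M B T = G.market_times T"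
      by (simp add: stopping_times_upto_def G.market_times_def)
    have "(\<integral>\<omega>. G.Q z \<omega> (\<sigma> \<omega>) (\<tau> \<omega>) \<partial>M) = (\<integral>\<omega>. discounted_payoff F \<Delta> r \<kappa> B z \<omega> (\<sigma> \<omega>) (\<tau> \<omega>) \<partial>M)"
      if "\<sigma> \<in> G.market_times T" "\<tau> \<in> G.market_times T" for \<sigma> \<tau>
    proof (rule bm.integral_off_bad)
      show "(\<lambda>\<omega>. G.Q z \<omega> (\<sigma> \<omega>) (\<tau> \<omega>)) \<in> borel_measurable M"
        using that by (intro G.Q_M G.stopping_time_M) (auto simp: G.market_times_def)
    qed (simp add: bm.good_discounted_payoff)
    then show ?thesis unfolding game_value_def I by (simp cong: INF_cong SUP_cong)
  qed
  have val': "embedded_game_value M B F \<Delta> r \<kappa> T n z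
      = (INF \<zeta>\<in>G.walk_times (sqrt (T / real n)) n. SUP \<eta>\<in>G.walk_times (sqrt (T / real n)) n.
          \<integral>\<omega>. G.Q z \<omega> (G.\<theta> (sqrt (T / real n)) (\<zeta> \<omega>) \<omega>) (G.\<theta> (sqrt (T / real n)) (\<eta> \<omega>) \<omega>) \<partial>M)"
    if n: "0 < n" for n z
  proof -
    define h where "h = sqrt (T / real n)"
    have h: "0 < h" using assms(1) n by (simp add: h_def)
    have I: "embedded_stopping_times M B \<kappa> h n = G.walk_times h n"
      by (simp add: embedded_stopping_times_def G.walk_times_def bm.embedded_filtration_good[abs_def])
    have "(\<integral>\<omega>. G.Q z \<omega> (G.\<theta> h (\<zeta> \<omega>) \<omega>) (G.\<theta> h (\<eta> \<omega>) \<omega>) \<partial>M)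
        = (\<integral>\<omega>. discounted_payoff F \<Delta> r \<kappa> B z \<omega> (embedding_time \<kappa> B h (\<zeta> \<omega>) \<omega>) (embedding_time \<kappa> B h (\<eta> \<omega>) \<omega>) \<partial>M)"
      if "\<zeta> \<in> G.walk_times h n" "\<eta> \<in> G.walk_times h n" for \<zeta> \<eta>
    proof (rule bm.integral_off_bad)
      show "(\<lambda>\<omega>. G.Q z \<omega> (G.\<theta> h (\<zeta> \<omega>) \<omega>) (G.\<theta> h (\<eta> \<omega>) \<omega>)) \<in> borel_measurable M"
        by (intro G.Q_M G.walk_time_M[OF h that(1)] G.walk_time_M[OF h that(2)] G.embedding_time_nonneg[OF h])
    qed (simp add: bm.good_discounted_payoff bm.good_embedding_time)
    then show ?thesis unfolding embedded_game_value_def Let_def h_def[symmetric] I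
      by (simp cong: INF_cong SUP_cong)
  qed
  obtain C where C: "0 < C" and bound: "\<forall>z>0. \<forall>n>0.
    \<bar>(INF \<sigma>\<in>G.market_times T. SUP \<tau>\<in>G.market_times T. \<integral>\<omega>. G.Q z \<omega> (\<sigma> \<omega>) (\<tau> \<omega>) \<partial>M)
     - (INF \<zeta>\<in>G.walk_times (sqrt (T / real n)) n. SUP \<eta>\<in>G.walk_times (sqrt (T / real n)) n.
          \<integral>\<omega>. G.Q z \<omega> (G.\<theta> (sqrt (T / real n)) (\<zeta> \<omega>) \<omega>) (G.\<theta> (sqrt (T / real n)) (\<eta> \<omega>) \<omega>) \<partial>M)\<bar>
    \<le> C * G.size z * real n powr (- 1 / 4)"
    using G.embedded_game_error by blast
  show ?thesis
  proof (intro exI[of _ C] conjI allI impI C)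
    fix z :: real and n :: nat assume "0 < z" "0 < n"
    with bound show "\<bar>game_value M B F \<Delta> r \<kappa> T z - embedded_game_value M B F \<Delta> r \<kappa> T n z\<bar>
      \<le> C * (F 0 (\<lambda>_. z) + \<Delta> 0 (\<lambda>_. z) + z + 1) * real n powr (- 1 / 4)"
      unfolding val val'[OF \<open>0 < n\<close>] by blast
  qed
qed

end
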